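(* Let $p \in \{a,e\}^*$ be a pattern. (1) If $p \preceq e^*a$ or $p \preceq ae$, then $\mathrm{p\text{-}FD}_{\mathrm{basic}}(E_1^{\ge}p) \subseteq \mathrm{para\text{-}AC}^0$. (2) If $aa \preceq p$, $eae \preceq p$, or $aee \preceq p$, then $\mathrm{p\text{-}FD}_{\mathrm{basic}}(E_1^{\ge}p)$ contains a $\mathrm{W}[1]$-hard problem.
   Context: A basic graph is a finite undirected graph without self-loops, represented as a structure over the vocabulary $\{\sim\}$ ($\sim$ binary, symmetric, irreflexive). A pattern is a word $p\in\{a,e\}^*$. A formula with pattern $E_1^{\ge}p$ is a sentence $\exists^{\ge}X\,\varphi(X)$ over $\{\sim\}$ where $X$ is a unary second-order variable and $\varphi(X)$ is first-order (with equality) in prenex form with quantifier prefix $p$ ($a$ = $\forall$, $e$ = $\exists$). For a graph $\mathcal G$ with vertex set $V$ and $k\in\mathbb N$, $(\mathcal G,k)\models\exists^{\ge}X\,\varphi(X)$ iff there is $C\subseteq V$ with $|C|\ge k$ and $\mathcal G\models\varphi(C)$. $\mathrm{p\text{-}FD}_{\mathrm{basic}}(E_1^{\ge}p)$ is the class of parameterized problems $\{(\mathcal G,k)\mid \mathcal G \text{ basic}, (\mathcal G,k)\models\psi\}$ (parameter $k$) for $\psi$ of pattern $E_1^{\ge}p$. $p\preceq q$: $p$ is a subsequence of $q$; "$p\preceq e^*a$": $p\preceq e^ma$ for some $m$. $\mathrm{para\text{-}AC}^0$: parameterized problems decided by constant-depth unbounded fan-in circuit families of size $f(k)n^{O(1)}$,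 $f$ computable. *)

theory Defs
  imports Main "HOL-Library.Sublist"
begin

section \<open>First-order logic with one free relation variable\<close>

text \<open>A relational vocabulary is the list of arities of its symbols; symbol number \<open>i\<close> is
  \<open>Rel i\<close>. \<open>Mem\<close> is the atom for the free relation variable \<open>X\<close>. The constant
  \<open>Bot\<close> makes quantifier-free sentences available for the empty pattern.\<close>

type_synonym vocabulary = "nat list"

datatype fo =
    Bot
  | Eq nat nat
  | Rel nat "nat list"
  | Mem "nat list"
  | Neg fo
  | Conj fo fo
  | Disj fo fo
  | Forall nat fo
  | Exists nat fo

record 'a struct =
  univ :: "'a set"
  rel :: "nat \<Rightarrow> 'a list set"

definition tuples :: "'a set \<Rightarrow> nat \<Rightarrow> 'a list set" where
  "tuples U r = {xs. set xs \<subseteq> U \<and> length xs = r}"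

definition finite_struct :: "vocabulary \<Rightarrow> 'a struct \<Rightarrow> bool" where
  "finite_struct \<tau> A \<longleftrightarrow>
     finite (univ A) \<and> (\<forall>i < length \<tau>. rel A i \<subseteq> tuples (univ A) (\<tau> ! i))"

text \<open>\<open>fo_over \<tau> s \<phi>\<close>: \<open>\<phi>\<close> is a formula over \<open>\<tau>\<close>, with \<open>X\<close> of arity \<open>s\<close>.\<close>

fun fo_over :: "vocabulary \<Rightarrow> nat \<Rightarrow> fo \<Rightarrow> bool" where
  "fo_over \<tau> s Bot \<longleftrightarrow> True"
| "fo_over \<tau> s (Eq x y) \<longleftrightarrow> True"
| "fo_over \<tau> s (Rel i xs) \<longleftrightarrow> i < length \<tau> \<and> length xs = \<tau> ! i"
| "fo_over \<tau> s (Mem xs) \<longleftrightarrow> length xs = s"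
| "fo_over \<tau> s (Neg \<phi>) \<longleftrightarrow> fo_over \<tau> s \<phi>"
| "fo_over \<tau> s (Conj \<phi> \<psi>) \<longleftrightarrow> fo_over \<tau> s \<phi> \<and> fo_over \<tau> s \<psi>"
| "fo_over \<tau> s (Disj \<phi> \<psi>) \<longleftrightarrow> fo_over \<tau> s \<phi> \<and> fo_over \<tau> s \<psi>"
| "fo_over \<tau> s (Forall x \<phi>) \<longleftrightarrow> fo_over \<tau> s \<phi>"
| "fo_over \<tau> s (Exists x \<phi>) \<longleftrightarrow> fo_over \<tau> s \<phi>"

fun free_vars :: "fo \<Rightarrow> nat set" where
  "free_vars Bot = {}"
| "free_vars (Eq x y) = {x, y}"
| "free_vars (Rel i xs) = set xs"
| "free_vars (Mem xs) = set xs"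
| "free_vars (Neg \<phi>) = free_vars \<phi>"
| "free_vars (Conj \<phi> \<psi>) = free_vars \<phi> \<union> free_vars \<psi>"
| "free_vars (Disj \<phi> \<psi>) = free_vars \<phi> \<union> free_vars \<psi>"
| "free_vars (Forall x \<phi>) = free_vars \<phi> - {x}"
| "free_vars (Exists x \<phi>) = free_vars \<phi> - {x}"

fun sat :: "'a struct \<Rightarrow> 'a list set \<Rightarrow> (nat \<Rightarrow> 'a) \<Rightarrow> fo \<Rightarrow> bool" where
  "sat A X v Bot \<longleftrightarrow> False"
| "sat A X v (Eq x y) \<longleftrightarrow> v x = v y"
| "sat A X v (Rel i xs) \<longleftrightarrow> map v xs \<in> rel A i"
| "sat A X v (Mem xs) \<longleftrightarrow> map v xs \<in> X"
| "sat A X v (Neg \<phi>) \<longleftrightarrow> \<not> sat A X v \<phi>"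
| "sat A X v (Conj \<phi> \<psi>) \<longleftrightarrow> sat A X v \<phi> \<and> sat A X v \<psi>"
| "sat A X v (Disj \<phi> \<psi>) \<longleftrightarrow> sat A X v \<phi> \<or> sat A X v \<psi>"
| "sat A X v (Forall x \<phi>) \<longleftrightarrow> (\<forall>a \<in> univ A. sat A X (v(x := a)) \<phi>)"
| "sat A X v (Exists x \<phi>) \<longleftrightarrow> (\<exists>a \<in> univ A. sat A X (v(x := a)) \<phi>)"

text \<open>Truth of a sentence; the assignment is irrelevant when \<open>free_vars \<phi> = {}\<close>.\<close>

definition models :: "'a struct \<Rightarrow> 'a list set \<Rightarrow> fo \<Rightarrow> bool" where
  "models A X \<phi> \<longleftrightarrow> (\<forall>v. sat A X v \<phi>)"

fun quantifier_free :: "fo \<Rightarrow> bool" where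
  "quantifier_free (Neg \<phi>) \<longleftrightarrow> quantifier_free \<phi>"
| "quantifier_free (Conj \<phi> \<psi>) \<longleftrightarrow> quantifier_free \<phi> \<and> quantifier_free \<psi>"
| "quantifier_free (Disj \<phi> \<psi>) \<longleftrightarrow> quantifier_free \<phi> \<and> quantifier_free \<psi>"
| "quantifier_free (Forall x \<phi>) \<longleftrightarrow> False"
| "quantifier_free (Exists x \<phi>) \<longleftrightarrow> False"
| "quantifier_free _ \<longleftrightarrow> True"

datatype quant = QA | QE

type_synonym pattern = "quant list"

fun prenex :: "pattern \<Rightarrow> fo \<Rightarrow> bool" where
  "prenex [] \<phi> \<longleftrightarrow> quantifier_free \<phi>"
| "prenex (QA # p) (Forall x \<phi>) \<longleftrightarrow> prenex p \<phi>"
| "prenex (QE # p) (Exists x \<phi>) \<longleftrightarrow> prenex p \<phi>"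
| "prenex _ _ \<longleftrightarrow> False"


section \<open>Parameterized problems over finite structures\<close>

text \<open>Instances are pairs of a word and a parameter. A structure with universe \<open>{..<n}\<close> is
  encoded by \<open>1\<^sup>n0\<close>, followed by the characteristic table of each relation; the table
  of a binary relation is its adjacency matrix.\<close>

type_synonym word = "bool list"
type_synonym param_problem = "(word \<times> nat) set"

definition encode :: "vocabulary \<Rightarrow> nat struct \<Rightarrow> word" where
  "encode \<tau> A = (let n = card (univ A) in
     replicate n True @ [False] @
     concat (map (\<lambda>i. map (\<lambda>xs. xs \<in> rel A i) (List.n_lists (\<tau> ! i) [0..<n])) [0..<length \<tau>]))"

abbreviation graph_vocabulary :: vocabulary where
  "graph_vocabulary \<equiv> [2]"

definition basic_graph :: "'a struct \<Rightarrow> bool" where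
  "basic_graph G \<longleftrightarrow> finite_struct graph_vocabulary G \<and>
     (\<forall>u v. [u, v] \<in> rel G 0 \<longrightarrow> [v, u] \<in> rel G 0) \<and> (\<forall>v. [v, v] \<notin> rel G 0)"

text \<open>\<open>(G, k) \<Turnstile> \<exists>\<^sup>\<ge>X \<phi>(X)\<close> for unary \<open>X\<close>; a set \<open>C\<close> of vertices is passed
  to the semantics as a set of 1-tuples.\<close>

definition models_ge :: "'a struct \<Rightarrow> nat \<Rightarrow> fo \<Rightarrow> bool" where
  "models_ge G k \<phi> \<longleftrightarrow> (\<exists>C \<subseteq> univ G. k \<le> card C \<and> models G ((\<lambda>v. [v]) ` C) \<phi>)"

definition fd_problem :: "fo \<Rightarrow> param_problem" where
  "fd_problem \<phi> = {(encode graph_vocabulary G, k) | G k.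
     basic_graph G \<and> (\<exists>n. univ G = {..<n}) \<and> models_ge G k \<phi>}"

definition p_FD_basic :: "pattern \<Rightarrow> param_problem set" where
  "p_FD_basic p =
     {fd_problem \<phi> | \<phi>. fo_over graph_vocabulary 1 \<phi> \<and> free_vars \<phi> = {} \<and> prenex p \<phi>}"


section \<open>Computation\<close>

text \<open>While programs over finitely many stacks of bits, with unit cost per basic step. Two stacks
  simulate a Turing machine tape and conversely, so this model is equivalent to multi-tape Turing
  machines up to a constant factor in the running time.\<close>

datatype test = Nonempty nat | Top nat

datatype prog =
    Push nat bool
  | Pop nat
  | Seq prog prog
  | Cond test prog prog
  | Loop test prog

type_synonym store = "nat \<Rightarrow> word"

fun holds :: "test \<Rightarrow> store \<Rightarrow> bool" where
  "holds (Nonempty r) s \<longleftrightarrow> s r \<noteq> []"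
| "holds (Top r) s \<longleftrightarrow> s r \<noteq> [] \<and> hd (s r)"

text \<open>\<open>exec P s t s'\<close>: started in \<open>s\<close>, \<open>P\<close> halts after \<open>t\<close> steps in \<open>s'\<close>.\<close>

inductive exec :: "prog \<Rightarrow> store \<Rightarrow> nat \<Rightarrow> store \<Rightarrow> bool" where
  Push: "exec (Push r b) s 1 (s(r := b # s r))"
| Pop: "exec (Pop r) s 1 (s(r := tl (s r)))"
| Seq: "exec P s t s' \<Longrightarrow> exec Q s' t' s'' \<Longrightarrow> exec (Seq P Q) s (t + t') s''"
| Cond_True: "holds b s \<Longrightarrow> exec P s t s' \<Longrightarrow> exec (Cond b P Q) s (t + 1) s'"
| Cond_False: "\<not> holds b s \<Longrightarrow> exec Q s t s' \<Longrightarrow> exec (Cond b P Q) s (t + 1) s'"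
| Loop_True: "holds b s \<Longrightarrow> exec P s t s' \<Longrightarrow> exec (Loop b P) s' t' s'' \<Longrightarrow>
    exec (Loop b P) s (t + t' + 1) s''"
| Loop_False: "\<not> holds b s \<Longrightarrow> exec (Loop b P) s 1 s"

text \<open>Words are read from and left on stack 0 (first symbol on top), parameters on stack 1 in
  unary.\<close>

definition start :: "word \<Rightarrow> nat \<Rightarrow> store" where
  "start w k = (\<lambda>_. [])(0 := w, 1 := replicate k True)"

definition computable :: "(nat \<Rightarrow> nat) \<Rightarrow> bool" where
  "computable f \<longleftrightarrow> (\<exists>P. \<forall>k. \<exists>t s. exec P (start [] k) t s \<and> s 1 = replicate (f k) True)"


section \<open>The class para-AC0\<close>

text \<open>A circuit lists its gates in topological order; a gate refers to its predecessors by
  position, and the last gate is the output. \<open>AndG []\<close> and \<open>OrG []\<close> are the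
  constants.\<close>

datatype gate = Input nat | NotG nat | AndG "nat list" | OrG "nat list"

type_synonym circuit = "gate list"

fun wf_gate :: "nat \<Rightarrow> nat \<Rightarrow> gate \<Rightarrow> bool" where
  "wf_gate n m (Input i) \<longleftrightarrow> i < n"
| "wf_gate n m (NotG j) \<longleftrightarrow> j < m"
| "wf_gate n m (AndG js) \<longleftrightarrow> (\<forall>j \<in> set js. j < m)"
| "wf_gate n m (OrG js) \<longleftrightarrow> (\<forall>j \<in> set js. j < m)"

definition wf_circuit :: "nat \<Rightarrow> circuit \<Rightarrow> bool" where
  "wf_circuit n gs \<longleftrightarrow> gs \<noteq> [] \<and> (\<forall>m < length gs. wf_gate n m (gs ! m))"

fun gate_val :: "word \<Rightarrow> bool list \<Rightarrow> gate \<Rightarrow> bool" where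
  "gate_val w vs (Input i) \<longleftrightarrow> w ! i"
| "gate_val w vs (NotG j) \<longleftrightarrow> \<not> vs ! j"
| "gate_val w vs (AndG js) \<longleftrightarrow> (\<forall>j \<in> set js. vs ! j)"
| "gate_val w vs (OrG js) \<longleftrightarrow> (\<exists>j \<in> set js. vs ! j)"

definition accepts :: "circuit \<Rightarrow> word \<Rightarrow> bool" where
  "accepts gs w \<longleftrightarrow> last (foldl (\<lambda>vs g. vs @ [gate_val w vs g]) [] gs)"

fun gate_depth :: "nat list \<Rightarrow> gate \<Rightarrow> nat" where
  "gate_depth ds (Input i) = 0"
| "gate_depth ds (NotG j) = Suc (ds ! j)"
| "gate_depth ds (AndG js) = Suc (Max (insert 0 ((!) ds ` set js)))"
| "gate_depth ds (OrG js) = Suc (Max (insert 0 ((!) ds ` set js)))"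

definition depth :: "circuit \<Rightarrow> nat" where
  "depth gs = last (foldl (\<lambda>ds g. ds @ [gate_depth ds g]) [] gs)"

text \<open>The base \<open>n + 1\<close> in the polynomial bounds here and below only serves to admit inputs
  of length 0.\<close>

definition para_AC0 :: "param_problem set" where
  "para_AC0 = {Q. \<exists>f c d C. computable f \<and>
     (\<forall>n k. wf_circuit n (C n k) \<and> length (C n k) \<le> f k * (n + 1) ^ c \<and> depth (C n k) \<le> d \<and>
        (\<forall>w. length w = n \<longrightarrow> (accepts (C n k) w \<longleftrightarrow> (w, k) \<in> Q)))}"


section \<open>W[1]-hardness\<close>

text \<open>Many-one fpt-reductions: computable in time \<open>f(k) \<cdot> |w|\<^sup>O\<^sup>(\<^sup>1\<^sup>)\<close>, with
  the new parameter bounded by a computable function of the old one.\<close>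

definition fpt_reducible :: "param_problem \<Rightarrow> param_problem \<Rightarrow> bool" where
  "fpt_reducible Q Q' \<longleftrightarrow> (\<exists>P f g c. computable f \<and> computable g \<and>
     (\<forall>w k. \<exists>t s k'. exec P (start w k) t s \<and> t \<le> f k * (length w + 1) ^ c \<and>
        s 1 = replicate k' True \<and> k' \<le> g k \<and> ((w, k) \<in> Q \<longleftrightarrow> (s 0, k') \<in> Q')))"

text \<open>The definition of W[1] due to Flum and Grohe: the closure under fpt-reductions of the
  weighted Fagin-definable problems p-WD of universal sentences \<open>\<phi>(X)\<close> over arbitrary
  vocabularies, with \<open>X\<close> of arbitrary arity: is there a relation \<open>S\<close> with
  exactly \<open>k\<close> tuples such that \<open>\<phi>(S)\<close> holds?\<close>

definition wd_problem :: "vocabulary \<Rightarrow> nat \<Rightarrow> fo \<Rightarrow> param_problem" where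
  "wd_problem \<tau> s \<phi> = {(encode \<tau> A, k) | A k.
     finite_struct \<tau> A \<and> (\<exists>n. univ A = {..<n}) \<and>
     (\<exists>S \<subseteq> tuples (univ A) s. card S = k \<and> models A S \<phi>)}"

definition W1 :: "param_problem set" where
  "W1 = {Q. \<exists>\<tau> s \<phi> m. 0 \<notin> set \<tau> \<and> 0 < s \<and> fo_over \<tau> s \<phi> \<and> free_vars \<phi> = {} \<and>
     prenex (replicate m QA) \<phi> \<and> fpt_reducible Q (wd_problem \<tau> s \<phi>)}"

definition W1_hard :: "param_problem \<Rightarrow> bool" where
  "W1_hard Q \<longleftrightarrow> (\<forall>Q' \<in> W1. fpt_reducible Q' Q)"

end

theory Submission imports Defs begin

text \<open>For a pattern below e*a, guess the values of the existentially quantified variables and which of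
  them lie in \<open>C\<close>. Whether another vertex may be added to \<open>C\<close> then only depends on that vertex, so there
  is a largest solution, and it is first-order definable.

  For ae, every vertex needs a partner of a certain kind, as in dominating sets, and the problem has
  a first-order definable kernel: a set \<open>S\<close> of vertices and a sentence \<open>Y\<close> such that there is a
  solution with \<open>k\<close> elements if \<open>Y\<close> holds and \<open>S\<close> has at least \<open>256 \<cdot> 4\<^sup>k\<close> elements. Otherwise some
  solution of maximal size misses at most four vertices, is equal to \<open>S\<close>, or is a subset of the
  small set \<open>S\<close>. Circuits of constant depth count up to \<open>k\<close>, and run through the subsets of a small
  set, with a hash family: projections to few bit positions separate a small set of numbers.

  For hardness, a weighted Fagin problem is turned into the search for \<open>(k + 2)\<^sup>Q\<close> pairwise compatible
  local pieces of a solution, that is, for an independent set. This is of the form aa. A gadget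
  graph in which a vertex of \<open>C\<close> needs a triangle outside of \<open>C\<close> expresses it in the forms eae and
  aee.\<close>

section \<open>Programs\<close>

text \<open>Circuits and reductions have to be exhibited in concrete machine models, so each side
  gets an intermediate language: formula trees that are flattened into circuits, and a loop language
  whose loop bounds are polynomial terms, so that all its programs run in polynomial time. For ae
  the recurring argument starts from a largest solution \<open>C\<close> with fewer than
  \<open>k\<close> elements. A vertex that cannot be moved into \<open>C\<close> is either the
  chosen support of an element of \<open>C\<close>, of which there are few, or part of a rigid local
  pattern. A large graph repeats such a pattern, and the copies together give a solution with
  \<open>k\<close> elements. Only one case needs an exponential threshold: inside vertices need a
  neighbour outside, outside vertices a non-neighbour inside. Nonempty solutions then exist exactly
  for graphs with an alternating 4-cycle, that is, graphs that are not threshold graphs, and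
  vertices are classified by their neighbourhood within \<open>C\<close>. In the hardness proof,
  pairwise compatible pieces are determined by \<open>Q\<close> interval indices below
  \<open>k + 2\<close>. Hence at most \<open>(k + 2) ^ Q\<close> of them fit together, and asking
  for that many forces every index vector to occur.\<close>

definition runs :: "prog \<Rightarrow> store \<Rightarrow> store \<Rightarrow> nat \<Rightarrow> bool" where
  "runs P s s' T \<longleftrightarrow> (\<exists>t\<le>T. exec P s t s')"

lemma runs_mono: "runs P s s' T \<Longrightarrow> T \<le> T' \<Longrightarrow> runs P s s' T'"
  unfolding runs_def by (meson le_trans)

lemma runs_Push: "runs (Push r b) s (s(r := b # s r)) 1"
  unfolding runs_def using exec.Push by blast

lemma runs_Pop: "runs (Pop r) s (s(r := tl (s r))) 1"
  unfolding runs_def using exec.Pop by blast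

lemma runs_Seq: "runs P s s' T \<Longrightarrow> runs Q s' s'' T' \<Longrightarrow> runs (Seq P Q) s s'' (T + T')"
  unfolding runs_def by (meson exec.Seq add_mono)

lemma runs_PushI: "s' = s(r := b # s r) \<Longrightarrow> runs (Push r b) s s' 1"
  using runs_Push by simp

lemma runs_PopI: "s' = s(r := tl (s r)) \<Longrightarrow> runs (Pop r) s s' 1"
  using runs_Pop by simp

lemma runs_SeqI:
  "runs P s s' T \<Longrightarrow> runs Q s' s'' T' \<Longrightarrow> T + T' \<le> U \<Longrightarrow> runs (Seq P Q) s s'' U"
  using runs_Seq runs_mono by blast

lemma runs_Cond:
  assumes "holds b s \<Longrightarrow> runs P s s' T" "\<not> holds b s \<Longrightarrow> runs Q s s' T"
  shows "runs (Cond b P Q) s s' (T + 1)"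
proof (cases "holds b s")
  case True
  with assms(1) obtain t where "t \<le> T" "exec P s t s'" unfolding runs_def by blast
  with True show ?thesis unfolding runs_def by (intro exI[of _ "t + 1"]) (auto intro: exec.Cond_True[unfolded Suc_eq_plus1[symmetric]])
next
  case False
  with assms(2) obtain t where "t \<le> T" "exec Q s t s'" unfolding runs_def by blast
  with False show ?thesis unfolding runs_def by (intro exI[of _ "t + 1"]) (auto intro: exec.Cond_False[unfolded Suc_eq_plus1[symmetric]])
qed

text \<open>The stores at the loop head are given in advance as a sequence \<open>S\<close>, so a
  loop is verified by naming its invariant as a function of the round number. Each round costs the
  body and one test.\<close>

lemma runs_Loop:
  assumes "\<And>i. i < m \<Longrightarrow> holds b (S i)" "\<And>i. i < m \<Longrightarrow> runs P (S i) (S (Suc i)) T" "\<not> holds b (S m)"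
  shows "runs (Loop b P) (S 0) (S m) (m * (T + 1) + 1)"
  using assms
proof (induction m arbitrary: S)
  case 0
  then show ?case unfolding runs_def using exec.Loop_False by fastforce
next
  case (Suc m)
  have 1: "runs (Loop b P) (S (Suc 0)) (S (Suc m)) (m * (T + 1) + 1)"
    using Suc.IH[of "\<lambda>i. S (Suc i)"] Suc.prems by simp
  obtain t where t: "t \<le> m * (T + 1) + 1" "exec (Loop b P) (S (Suc 0)) t (S (Suc m))"
    using 1 unfolding runs_def by blast
  obtain t0 where t0: "t0 \<le> T" "exec P (S 0) t0 (S (Suc 0))"
    using Suc.prems(2)[of 0] unfolding runs_def by blast
  have "exec (Loop b P) (S 0) (t0 + t + 1) (S (Suc m))"
    using exec.Loop_True[OF _ t0(2) t(2)] Suc.prems(1)[of 0] by simp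
  moreover have "t0 + t + 1 \<le> Suc m * (T + 1) + 1" using t0 t by simp
  ultimately show ?case unfolding runs_def by blast
qed

lemma runs_Loop':
  assumes "\<And>i. i < m \<Longrightarrow> holds b (S i)" "\<And>i. i < m \<Longrightarrow> runs P (S i) (S (Suc i)) T" "\<not> holds b (S m)"
    "S 0 = s" "S m = s'"
  shows "runs (Loop b P) s s' (m * (T + 1) + 1)"
  using runs_Loop[of m b S P T] assms by blast

section \<open>Moving and copying unary numbers and words between stacks\<close>

definition clr :: "nat \<Rightarrow> prog" where "clr a = Loop (Nonempty a) (Pop a)"
definition mv :: "nat \<Rightarrow> nat \<Rightarrow> prog" where
  "mv a b = Loop (Nonempty a) (Seq (Pop a) (Push b True))"
definition mv2 :: "nat \<Rightarrow> nat \<Rightarrow> nat \<Rightarrow> prog" where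
  "mv2 a b c = Loop (Nonempty a) (Seq (Pop a) (Seq (Push b True) (Push c True)))"
definition mvbit :: "nat \<Rightarrow> nat \<Rightarrow> prog" where
  "mvbit a b = Seq (Cond (Top a) (Push b True) (Push b False)) (Pop a)"
definition mvw :: "nat \<Rightarrow> nat \<Rightarrow> prog" where
  "mvw a b = Loop (Nonempty a) (mvbit a b)"

lemma runs_clr: "runs (clr a) s (s(a := [])) (2 * length (s a) + 1)"
proof -
  have "runs (clr a) s (s(a := [])) (length (s a) * (1 + 1) + 1)"
    unfolding clr_def
  proof (rule runs_Loop'[where S = "\<lambda>i. s(a := drop i (s a))"])
    fix i assume "i < length (s a)"
    show "runs (Pop a) (s(a := drop i (s a))) (s(a := drop (Suc i) (s a))) 1"
      by (rule runs_PopI) (simp add: drop_Suc tl_drop)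
  qed auto
  then show ?thesis by (rule runs_mono) simp
qed

text \<open>The program language has no skip; clearing an empty register takes its place in branches
  that should do nothing.\<close>

lemma runs_skip: "s a = [] \<Longrightarrow> runs (clr a) s s 1"
  using runs_clr[of a s] by (simp add: fun_upd_idem)

lemma runs_mv:
  assumes "s a = replicate m True" "a \<noteq> b"
  shows "runs (mv a b) s (s(a := [], b := replicate m True @ s b)) (3 * m + 1)"
proof -
  let ?S = "\<lambda>i. s(a := replicate (m - i) True, b := replicate i True @ s b)"
  have "runs (mv a b) s (s(a := [], b := replicate m True @ s b)) (m * (2 + 1) + 1)"
    unfolding mv_def
  proof (rule runs_Loop'[where S = ?S])
    fix i assume i: "i < m"
    then obtain d where d: "m - i = Suc d" "m - Suc i = d" by (metis Suc_diff_Suc)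
    have "runs (Pop a) (?S i) ((?S i)(a := replicate (m - Suc i) True)) 1"
      by (rule runs_PopI) (use assms d in \<open>auto simp: fun_eq_iff\<close>)
    moreover have "runs (Push b True) ((?S i)(a := replicate (m - Suc i) True)) (?S (Suc i)) 1"
      by (rule runs_PushI) (use assms d in \<open>auto simp: fun_eq_iff\<close>)
    ultimately show "runs (Seq (Pop a) (Push b True)) (?S i) (?S (Suc i)) 2"
      by (rule runs_SeqI) simp
  qed (use assms in auto)
  then show ?thesis by (rule runs_mono) simp
qed

lemma runs_mv2:
  assumes "s a = replicate m True" "a \<noteq> b" "a \<noteq> c" "b \<noteq> c"
  shows "runs (mv2 a b c) s (s(a := [], b := replicate m True @ s b, c := replicate m True @ s c)) (4 * m + 1)"
proof -
  let ?S = "\<lambda>i. s(a := replicate (m - i) True, b := replicate i True @ s b, c := replicate i True @ s c)"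
  have "runs (mv2 a b c) s (s(a := [], b := replicate m True @ s b, c := replicate m True @ s c)) (m * (3 + 1) + 1)"
    unfolding mv2_def
  proof (rule runs_Loop'[where S = ?S])
    fix i assume i: "i < m"
    then obtain d where d: "m - i = Suc d" "m - Suc i = d" by (metis Suc_diff_Suc)
    have 1: "runs (Pop a) (?S i) ((?S i)(a := replicate (m - Suc i) True)) 1"
      by (rule runs_PopI) (use assms d in \<open>auto simp: fun_eq_iff\<close>)
    have 2: "runs (Push b True) ((?S i)(a := replicate (m - Suc i) True))
       ((?S i)(a := replicate (m - Suc i) True, b := replicate (Suc i) True @ s b)) 1"
      by (rule runs_PushI) (use assms d in \<open>auto simp: fun_eq_iff\<close>)
    have 3: "runs (Push c True) ((?S i)(a := replicate (m - Suc i) True, b := replicate (Suc i) True @ s b))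
       (?S (Suc i)) 1"
      by (rule runs_PushI) (use assms d in \<open>auto simp: fun_eq_iff\<close>)
    show "runs (Seq (Pop a) (Seq (Push b True) (Push c True))) (?S i) (?S (Suc i)) 3"
      by (rule runs_SeqI[OF 1 runs_Seq[OF 2 3]]) simp
  qed (use assms in auto)
  then show ?thesis by (rule runs_mono) simp
qed

lemma runs_mvbit:
  assumes "a \<noteq> b" "s a \<noteq> []"
  shows "runs (mvbit a b) s (s(a := tl (s a), b := hd (s a) # s b)) 3"
  unfolding mvbit_def
proof (rule runs_SeqI)
  show "runs (Cond (Top a) (Push b True) (Push b False)) s (s(b := hd (s a) # s b)) (1 + 1)"
    by (rule runs_Cond; rule runs_PushI) (use assms in auto)
  show "runs (Pop a) (s(b := hd (s a) # s b)) (s(a := tl (s a), b := hd (s a) # s b)) 1"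
    by (rule runs_PopI) (use assms in \<open>auto simp: fun_eq_iff\<close>)
qed simp

text \<open>Moving a word to another stack reverses it. This restores an input that was shifted away
  for reading, and it turns round an output that was pushed back to front.\<close>

lemma runs_mvw:
  assumes "a \<noteq> b"
  shows "runs (mvw a b) s (s(a := [], b := rev (s a) @ s b)) (4 * length (s a) + 1)"
proof -
  let ?S = "\<lambda>i. s(a := drop i (s a), b := rev (take i (s a)) @ s b)"
  have "runs (mvw a b) s (s(a := [], b := rev (s a) @ s b)) (length (s a) * (3 + 1) + 1)"
    unfolding mvw_def
  proof (rule runs_Loop'[where S = ?S])
    fix i assume i: "i < length (s a)"
    have "runs (mvbit a b) (?S i) ((?S i)(a := tl (?S i a), b := hd (?S i a) # ?S i b)) 3"
      by (rule runs_mvbit) (use assms i in auto)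
    moreover have "(?S i)(a := tl (?S i a), b := hd (?S i a) # ?S i b) = ?S (Suc i)"
      using assms i by (auto simp: fun_eq_iff drop_Suc tl_drop take_Suc_conv_app_nth hd_drop_conv_nth)
    ultimately show "runs (mvbit a b) (?S i) (?S (Suc i)) 3" by simp
  qed (use assms in auto)
  then show ?thesis by (rule runs_mono) simp
qed


section \<open>Polynomial bounds\<close>

text \<open>The base is at least 2, so constants and constant factors are absorbed by the exponent
  and no coefficient has to be carried along.\<close>

definition polyb :: "(nat \<Rightarrow> nat) \<Rightarrow> bool" where
  "polyb f \<longleftrightarrow> (\<exists>c. \<forall>N. f N \<le> (N + 2) ^ c)"

lemma polyb_const: "polyb (\<lambda>_. c)"
proof -
  have "c \<le> (N + 2) ^ c" for N :: nat
    using less_exp[of c] power_mono[of 2 "N + 2" c] by linarith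
  then show ?thesis unfolding polyb_def by blast
qed

lemma polyb_id: "polyb (\<lambda>N. N)"
  unfolding polyb_def by (rule exI[of _ 1]) simp

lemma polyb_mult: "polyb f \<Longrightarrow> polyb g \<Longrightarrow> polyb (\<lambda>N. f N * g N)"
  unfolding polyb_def by (metis mult_le_mono power_add)

lemma polyb_mono: "polyb f \<Longrightarrow> (\<And>N. g N \<le> f N) \<Longrightarrow> polyb g"
  unfolding polyb_def by (meson le_trans)

lemma polyb_add:
  assumes "polyb f" "polyb g" shows "polyb (\<lambda>N. f N + g N)"
proof -
  have "polyb (\<lambda>N. (f N + 1) ^ 1)" if p: "polyb f" for f
  proof -
    obtain c where c: "\<And>N. f N \<le> (N + 2) ^ c" using p unfolding polyb_def by blast
    have "f N + 1 \<le> (N + 2) ^ (c + 1)" for N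
    proof -
      have "1 \<le> (N + 2) ^ c" by simp
      then have "f N + 1 \<le> 2 * (N + 2) ^ c" using c[of N] by linarith
      also have "\<dots> \<le> (N + 2) ^ (c + 1)" by simp
      finally show ?thesis .
    qed
    then show ?thesis unfolding polyb_def power_one_right by blast
  qed
  \<comment> \<open>A sum is at most the product of \<open>f N + 1\<close> and
    \<open>g N + 1\<close>.\<close>
  from polyb_mult[OF this[OF assms(1)] this[OF assms(2)]] show ?thesis
    by (rule polyb_mono) simp
qed

lemma polyb_comp: "polyb f \<Longrightarrow> polyb g \<Longrightarrow> polyb (\<lambda>N. f (g N))"
proof -
  assume f: "polyb f" and g: "polyb g"
  obtain c where c: "\<And>N. f N \<le> (N + 2) ^ c" using f unfolding polyb_def by blast
  have "polyb (\<lambda>N. g N + 2)" using g polyb_add polyb_const by blast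
  then obtain d where d: "\<And>N. g N + 2 \<le> (N + 2) ^ d" unfolding polyb_def by blast
  have "f (g N) \<le> (N + 2) ^ (d * c)" for N
    using order_trans[OF c[of "g N"] power_mono[OF d[of N], of c]] by (simp add: power_mult)
  then show ?thesis unfolding polyb_def by blast
qed

lemma polyb_power: "polyb f \<Longrightarrow> polyb (\<lambda>N. f N ^ c)"
  by (induction c) (auto intro: polyb_const polyb_mult)

lemmas polyb_intros = polyb_const polyb_id polyb_add polyb_mult polyb_power

section \<open>A loop language\<close>

datatype tm = TV nat | TC nat | TAdd tm tm | TMul tm tm

fun tval :: "(nat \<Rightarrow> nat) \<Rightarrow> tm \<Rightarrow> nat" where
  "tval e (TV x) = e x"
| "tval e (TC c) = c"
| "tval e (TAdd a b) = tval e a + tval e b"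
| "tval e (TMul a b) = tval e a * tval e b"

text \<open>Quantifiers, like the loops of \<open>cmd\<close>, range below the value of a polynomial
  term; evaluation of a fixed expression therefore takes polynomial time.\<close>

datatype bx = BLess tm tm | BBit tm | BNot bx | BAnd bx bx | BEx nat tm bx

fun bval :: "word \<Rightarrow> (nat \<Rightarrow> nat) \<Rightarrow> bx \<Rightarrow> bool" where
  "bval w e (BLess a b) \<longleftrightarrow> tval e a < tval e b"
| "bval w e (BBit a) \<longleftrightarrow> tval e a < length w \<and> w ! tval e a"
| "bval w e (BNot b) \<longleftrightarrow> \<not> bval w e b"
| "bval w e (BAnd a b) \<longleftrightarrow> bval w e a \<and> bval w e b"
| "bval w e (BEx x t b) \<longleftrightarrow> (\<exists>a < tval e t. bval w (e(x := a)) b)"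

datatype cmd = Emit bx | CSeq cmd cmd | CFor nat tm cmd

fun cval :: "word \<Rightarrow> (nat \<Rightarrow> nat) \<Rightarrow> cmd \<Rightarrow> word" where
  "cval w e (Emit b) = [bval w e b]"
| "cval w e (CSeq c d) = cval w e c @ cval w e d"
| "cval w e (CFor x t c) = concat (map (\<lambda>a. cval w (e(x := a)) c) [0..<tval e t])"

text \<open>Register layout: the input word in 0, the output in 2, the variables in the odd registers
  (so variable 0 is the parameter), temporaries in the remaining even ones.\<close>

definition vr :: "nat \<Rightarrow> nat" where "vr x = 2 * x + 1"
definition tr :: "nat \<Rightarrow> nat" where "tr j = 2 * j + 4"

lemma vr_tr [simp]:
  "vr x = vr y \<longleftrightarrow> x = y" "tr i = tr j \<longleftrightarrow> i = j" "vr x \<noteq> tr i" "tr i \<noteq> vr x"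
  "vr x \<noteq> 0" "vr x \<noteq> 2" "tr i \<noteq> 0" "tr i \<noteq> 2" "0 \<noteq> vr x" "2 \<noteq> vr x" "0 \<noteq> tr i" "2 \<noteq> tr i"
  "0 < vr x" "0 < tr i"
  unfolding vr_def tr_def by presburger+

text \<open>Temporaries from index \<open>f\<close> on are free. Compiled code receives a first free
  index and passes a larger one to its subexpressions, and a target \<open>r\<close> with
  \<open>tgt r f\<close> is a register about which \<open>rep\<close> says nothing, so that writing
  to it preserves \<open>rep\<close>.\<close>

definition rep :: "(nat \<Rightarrow> nat) \<Rightarrow> word \<Rightarrow> nat \<Rightarrow> store \<Rightarrow> bool" where
  "rep e w f s \<longleftrightarrow> s 0 = w \<and> (\<forall>x. s (vr x) = replicate (e x) True) \<and> (\<forall>j\<ge>f. s (tr j) = [])"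

definition tgt :: "nat \<Rightarrow> nat \<Rightarrow> bool" where
  "tgt r f \<longleftrightarrow> r \<noteq> 0 \<and> (\<forall>x. r \<noteq> vr x) \<and> (\<forall>j\<ge>f. r \<noteq> tr j)"

lemma tgt_tr [simp]: "tgt (tr j) f \<longleftrightarrow> j < f"
  unfolding tgt_def by (auto simp: not_le[symmetric])

lemma tgt_2 [simp]: "tgt 2 f" unfolding tgt_def by auto

lemma tgtD: "tgt r f \<Longrightarrow> r \<noteq> 0" "tgt r f \<Longrightarrow> r \<noteq> vr x" "tgt r f \<Longrightarrow> f \<le> j \<Longrightarrow> r \<noteq> tr j"
  "tgt r f \<Longrightarrow> vr x \<noteq> r" "tgt r f \<Longrightarrow> f \<le> j \<Longrightarrow> tr j \<noteq> r" "tgt r f \<Longrightarrow> f \<le> g \<Longrightarrow> tgt r g"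
  unfolding tgt_def by auto

lemma repD: "rep e w f s \<Longrightarrow> s 0 = w" "rep e w f s \<Longrightarrow> s (vr x) = replicate (e x) True"
  "rep e w f s \<Longrightarrow> f \<le> j \<Longrightarrow> s (tr j) = []"
  unfolding rep_def by auto

lemma rep_upd: "rep e w f s \<Longrightarrow> tgt r g \<Longrightarrow> f \<le> g \<Longrightarrow> rep e w g (s(r := l))"
  unfolding rep_def tgt_def by auto

section \<open>Compiling terms, tests and commands into stack programs\<close>

fun pushes :: "nat \<Rightarrow> nat \<Rightarrow> nat \<Rightarrow> prog" where
  "pushes 0 r f = clr (tr f)"
| "pushes (Suc c) r f = Seq (Push r True) (pushes c r f)"

text \<open>Reading a register empties it, so a variable is moved to a temporary and to the target
  at the same time and then moved back. Results are pushed on top of what the target holds, which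
  makes addition a sequential composition and multiplication a loop.\<close>

fun compT :: "tm \<Rightarrow> nat \<Rightarrow> nat \<Rightarrow> prog" where
  "compT (TV x) r f = Seq (mv2 (vr x) (tr f) r) (mv (tr f) (vr x))"
| "compT (TC c) r f = pushes c r f"
| "compT (TAdd a b) r f = Seq (compT a r f) (compT b r f)"
| "compT (TMul a b) r f = Seq (compT a (tr f) (Suc f))
     (Loop (Nonempty (tr f)) (Seq (Pop (tr f)) (compT b r (Suc f))))"

text \<open>One number bounds all variables and the input length, so that every time bound is a
  function of one argument.\<close>

definition bnd :: "nat \<Rightarrow> (nat \<Rightarrow> nat) \<Rightarrow> word \<Rightarrow> bool" where
  "bnd N e w \<longleftrightarrow> (\<forall>x. e x \<le> N) \<and> length w \<le> N"

lemma tval_bound: "\<exists>B. polyb B \<and> (\<forall>N e w. bnd N e w \<longrightarrow> tval e t \<le> B N)"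
proof (induction t)
  case (TV x)
  show ?case by (rule exI[of _ "\<lambda>N. N"]) (auto simp: bnd_def polyb_id)
next
  case (TC c)
  show ?case by (rule exI[of _ "\<lambda>N. c"]) (auto simp: polyb_const)
next
  case (TAdd a b)
  then obtain A B where "polyb A" "polyb B" "\<forall>N e w. bnd N e w \<longrightarrow> tval e a \<le> A N"
    "\<forall>N e w. bnd N e w \<longrightarrow> tval e b \<le> B N" by blast
  then show ?case by (intro exI[of _ "\<lambda>N. A N + B N"]) (auto intro: polyb_add simp: add_mono)
next
  case (TMul a b)
  then obtain A B where "polyb A" "polyb B" "\<forall>N e w. bnd N e w \<longrightarrow> tval e a \<le> A N"
    "\<forall>N e w. bnd N e w \<longrightarrow> tval e b \<le> B N" by blast
  then show ?case by (intro exI[of _ "\<lambda>N. A N * B N"]) (auto intro: polyb_mult simp: mult_mono)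
qed

lemma runs_pushes:
  "s (tr f) = [] \<Longrightarrow> r \<noteq> tr f \<Longrightarrow> runs (pushes c r f) s (s(r := replicate c True @ s r)) (c + 1)"
proof (induction c arbitrary: s)
  case 0
  then show ?case using runs_skip[of s "tr f"] by simp
next
  case (Suc c)
  have 1: "runs (Push r True) s (s(r := True # s r)) 1" by (rule runs_Push)
  let ?s = "s(r := True # s r)"
  have e: "?s(r := replicate c True @ ?s r) = s(r := replicate (Suc c) True @ s r)"
    by (simp add: fun_eq_iff replicate_app_Cons_same)
  have "runs (pushes c r f) ?s (?s(r := replicate c True @ ?s r)) (c + 1)"
    by (rule Suc.IH) (use Suc.prems in auto)
  from runs_Seq[OF 1 this] show ?case unfolding e pushes.simps by (rule runs_mono) simp
qed

lemma runs_compT: "\<exists>T. polyb T \<and> (\<forall>N e w s r f. bnd N e w \<longrightarrow> rep e w f s \<longrightarrow> tgt r f \<longrightarrow>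
   runs (compT t r f) s (s(r := replicate (tval e t) True @ s r)) (T N))"
proof (induction t)
  case (TV x)
  have "runs (compT (TV x) r f) s (s(r := replicate (tval e (TV x)) True @ s r)) (7 * N + 2)"
    if a: "bnd N e w" "rep e w f s" "tgt r f" for N e w s r f
  proof -
    let ?s = "s(vr x := [], tr f := replicate (e x) True @ s (tr f), r := replicate (e x) True @ s r)"
    have 1: "runs (mv2 (vr x) (tr f) r) s ?s (4 * e x + 1)"
      by (rule runs_mv2) (use a repD tgtD in auto)
    have "runs (mv (tr f) (vr x)) ?s (?s(tr f := [], vr x := replicate (e x) True @ ?s (vr x))) (3 * e x + 1)"
      by (rule runs_mv) (use repD[OF a(2)] tgtD[OF a(3)] in auto)
    moreover have "?s(tr f := [], vr x := replicate (e x) True @ ?s (vr x)) = s(r := replicate (tval e (TV x)) True @ s r)"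
      using repD[OF a(2)] tgtD[OF a(3)] by (auto simp: fun_eq_iff)
    moreover have "e x \<le> N" using a unfolding bnd_def by blast
    ultimately show ?thesis by (auto intro: runs_SeqI[OF 1])
  qed
  moreover have "polyb (\<lambda>N. 7 * N + 2)" by (intro polyb_intros)
  ultimately show ?case by blast
next
  case (TC c)
  have "runs (compT (TC c) r f) s (s(r := replicate (tval e (TC c)) True @ s r)) (c + 1)"
    if "rep e w f s" "tgt r f" for e w s r f
    using runs_pushes[of s f r c] repD(3)[OF that(1), of f] tgtD(3)[OF that(2), of f] by simp
  then show ?case by (intro exI[of _ "\<lambda>N. c + 1"] conjI polyb_const) blast
next
  case (TAdd a b)
  obtain A where A: "polyb A" "\<And>N e w s r f. bnd N e w \<Longrightarrow> rep e w f s \<Longrightarrow> tgt r f \<Longrightarrow>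
   runs (compT a r f) s (s(r := replicate (tval e a) True @ s r)) (A N)" using TAdd.IH(1) by blast
  obtain B where B: "polyb B" "\<And>N e w s r f. bnd N e w \<Longrightarrow> rep e w f s \<Longrightarrow> tgt r f \<Longrightarrow>
   runs (compT b r f) s (s(r := replicate (tval e b) True @ s r)) (B N)" using TAdd.IH(2) by blast
  have "runs (compT (TAdd a b) r f) s (s(r := replicate (tval e (TAdd a b)) True @ s r)) (A N + B N)"
    if h: "bnd N e w" "rep e w f s" "tgt r f" for N e w s r f
  proof -
    let ?s = "s(r := replicate (tval e a) True @ s r)"
    have "runs (compT b r f) ?s (?s(r := replicate (tval e b) True @ ?s r)) (B N)"
      by (rule B(2)[OF h(1) rep_upd[OF h(2,3)] h(3)]) simp
    also have "?s(r := replicate (tval e b) True @ ?s r) = s(r := replicate (tval e (TAdd a b)) True @ s r)"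
      by (simp flip: append_assoc replicate_add add: add.commute)
    finally show ?thesis unfolding compT.simps by (rule runs_Seq[OF A(2)[OF h]])
  qed
  moreover have "polyb (\<lambda>N. A N + B N)" by (intro polyb_intros A B)
  ultimately show ?case by (intro exI[of _ "\<lambda>N. A N + B N"]) blast
next
  case (TMul a b)
  obtain A where A: "polyb A" "\<And>N e w s r f. bnd N e w \<Longrightarrow> rep e w f s \<Longrightarrow> tgt r f \<Longrightarrow>
   runs (compT a r f) s (s(r := replicate (tval e a) True @ s r)) (A N)" using TMul.IH(1) by blast
  obtain B where B: "polyb B" "\<And>N e w s r f. bnd N e w \<Longrightarrow> rep e w f s \<Longrightarrow> tgt r f \<Longrightarrow>
   runs (compT b r f) s (s(r := replicate (tval e b) True @ s r)) (B N)" using TMul.IH(2) by blast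
  obtain V where V: "polyb V" "\<And>N e w. bnd N e w \<Longrightarrow> tval e a \<le> V N" using tval_bound by blast
  have "runs (compT (TMul a b) r f) s (s(r := replicate (tval e (TMul a b)) True @ s r))
      (A N + (V N * (1 + B N + 1) + 1))"
    if h: "bnd N e w" "rep e w f s" "tgt r f" for N e w s r f
  proof -
    let ?m = "tval e a"
    let ?S = "\<lambda>i. s(tr f := replicate (?m - i) True, r := replicate (i * tval e b) True @ s r)"
    have "runs (compT a (tr f) (Suc f)) s (s(tr f := replicate ?m True @ s (tr f))) (A N)"
      by (rule A(2)[OF h(1)]) (use h in \<open>auto simp: rep_def\<close>)
    also have "s(tr f := replicate ?m True @ s (tr f)) = ?S 0"
      using repD(3)[OF h(2), of f] tgtD[OF h(3)] by (auto simp: fun_eq_iff)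
    finally have 1: "runs (compT a (tr f) (Suc f)) s (?S 0) (A N)" .
    have 2: "runs (Loop (Nonempty (tr f)) (Seq (Pop (tr f)) (compT b r (Suc f)))) (?S 0)
      (s(r := replicate (tval e (TMul a b)) True @ s r)) (?m * (1 + B N + 1) + 1)"
    proof (rule runs_Loop'[where S = ?S])
      fix i assume i: "i < ?m"
      show "holds (Nonempty (tr f)) (?S i)" using i tgtD[OF h(3)] by auto
      let ?s = "(?S i)(tr f := replicate (?m - Suc i) True)"
      have p: "runs (Pop (tr f)) (?S i) ?s 1"
        by (rule runs_PopI) (use i tgtD[OF h(3)] in \<open>auto simp: fun_eq_iff\<close>)
      have "runs (compT b r (Suc f)) ?s (?s(r := replicate (tval e b) True @ ?s r)) (B N)"
        by (rule B(2)[OF h(1)]) (use h(2) tgtD[OF h(3)] in \<open>simp_all add: rep_def\<close>)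
      also have "?s(r := replicate (tval e b) True @ ?s r) = ?S (Suc i)"
        using tgtD[OF h(3)] by (auto simp: fun_eq_iff replicate_add)
      finally show "runs (Seq (Pop (tr f)) (compT b r (Suc f))) (?S i) (?S (Suc i)) (1 + B N)"
        by (rule runs_SeqI[OF p]) simp
    next
      show "?S ?m = s(r := replicate (tval e (TMul a b)) True @ s r)"
        using tgtD[OF h(3)] repD(3)[OF h(2), of f] by (simp add: fun_eq_iff)
    qed (use tgtD[OF h(3)] in simp_all)
    have "?m * (1 + B N + 1) \<le> V N * (1 + B N + 1)" by (rule mult_le_mono1) (rule V(2)[OF h(1)])
    then show ?thesis unfolding compT.simps by (intro runs_SeqI[OF 1 2] add_mono) simp_all
  qed
  moreover have "polyb (\<lambda>N. A N + (V N * (1 + B N + 1) + 1))" by (intro polyb_intros A B V)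
  ultimately show ?case by (intro exI[of _ "\<lambda>N. A N + (V N * (1 + B N + 1) + 1)"]) blast
qed

text \<open>Truth is a single \<open>True\<close> on an otherwise empty target. \<open>BLess\<close>
  decrements both numbers together and looks at what is left of the second. \<open>BBit\<close>
  shifts a prefix of the input away, tests the top and puts the prefix back. \<open>BEx\<close>
  saves the variable, lets it count up itself, and restores it.\<close>

fun compB :: "bx \<Rightarrow> nat \<Rightarrow> nat \<Rightarrow> prog" where
  "compB (BLess a b) r f = Seq (compT a (tr f) (Suc f)) (Seq (compT b (tr (Suc f)) (Suc (Suc f)))
     (Seq (Loop (Nonempty (tr f)) (Seq (Pop (tr f)) (Pop (tr (Suc f)))))
     (Seq (Cond (Nonempty (tr (Suc f))) (Push r True) (clr (tr f))) (clr (tr (Suc f))))))"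
| "compB (BBit a) r f = Seq (compT a (tr f) (Suc f))
     (Seq (Loop (Nonempty (tr f)) (Seq (Pop (tr f)) (Cond (Nonempty 0) (mvbit 0 (tr (Suc f))) (clr 0))))
     (Seq (Cond (Top 0) (Push r True) (clr (tr f))) (mvw (tr (Suc f)) 0)))"
| "compB (BNot b) r f = Seq (compB b (tr f) (Suc f)) (Cond (Nonempty (tr f)) (Pop (tr f)) (Push r True))"
| "compB (BAnd a b) r f = Seq (compB a (tr f) (Suc f))
     (Cond (Nonempty (tr f)) (Seq (Pop (tr f)) (compB b r f)) (clr (tr f)))"
| "compB (BEx x t b) r f = Seq (compT t (tr f) (Suc f)) (Seq (mv (vr x) (tr (Suc f)))
     (Seq (Loop (Nonempty (tr f)) (Seq (Pop (tr f)) (Seq (compB b (tr (f + 2)) (f + 3))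
        (Seq (Cond (Nonempty (tr (f + 2))) (Seq (Pop (tr (f + 2))) (Seq (clr r) (Push r True))) (clr (tr (f + 2))))
             (Push (vr x) True)))))
     (Seq (clr (vr x)) (mv (tr (Suc f)) (vr x)))))"

definition bl :: "bool \<Rightarrow> word" where "bl b = (if b then [True] else [])"

lemma runs_compT_tr:
  assumes "\<And>N e w s r f. bnd N e w \<Longrightarrow> rep e w f s \<Longrightarrow> tgt r f \<Longrightarrow>
      runs (compT t r f) s (s(r := replicate (tval e t) True @ s r)) (A N)"
    and "bnd N e w" "rep e w f s"
  shows "runs (compT t (tr f) (Suc f)) s (s(tr f := replicate (tval e t) True)) (A N)"
proof -
  have "rep e w (Suc f) s" "tgt (tr f) (Suc f)" "s (tr f) = []" using assms(3) by (auto simp: rep_def)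
  then show ?thesis using assms(1)[OF assms(2)] by fastforce
qed

lemma runs_compB: "\<exists>T. polyb T \<and> (\<forall>N e w s r f. bnd N e w \<longrightarrow> rep e w f s \<longrightarrow> tgt r f \<longrightarrow> s r = [] \<longrightarrow>
   runs (compB b r f) s (s(r := bl (bval w e b))) (T N))"
proof (induction b)
  case (BLess a b)
  obtain A where A: "polyb A" "\<And>N e w s r f. bnd N e w \<Longrightarrow> rep e w f s \<Longrightarrow> tgt r f \<Longrightarrow>
   runs (compT a r f) s (s(r := replicate (tval e a) True @ s r)) (A N)" using runs_compT by blast
  obtain B where B: "polyb B" "\<And>N e w s r f. bnd N e w \<Longrightarrow> rep e w f s \<Longrightarrow> tgt r f \<Longrightarrow>
   runs (compT b r f) s (s(r := replicate (tval e b) True @ s r)) (B N)" using runs_compT by blast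
  obtain U where U: "polyb U" "\<And>N e w. bnd N e w \<Longrightarrow> tval e a \<le> U N" using tval_bound by blast
  obtain V where V: "polyb V" "\<And>N e w. bnd N e w \<Longrightarrow> tval e b \<le> V N" using tval_bound by blast
  let ?T = "\<lambda>N. A N + (B N + ((U N * 3 + 1) + (2 + (2 * V N + 1))))"
  have "runs (compB (BLess a b) r f) s (s(r := bl (bval w e (BLess a b)))) (?T N)"
    if h: "bnd N e w" "rep e w f s" "tgt r f" "s r = []" for N e w s r f
  proof -
    let ?m = "tval e a" and ?k = "tval e b"
    let ?S = "\<lambda>i. s(tr f := replicate (?m - i) True, tr (Suc f) := replicate (?k - i) True)"
    let ?s1 = "s(tr f := replicate ?m True)"
    note D = repD[OF h(2)] tgtD[OF h(3)]
    have 1: "runs (compT a (tr f) (Suc f)) s ?s1 (A N)"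
      by (rule runs_compT_tr[OF A(2) h(1,2)])
    have 2: "runs (compT b (tr (Suc f)) (Suc (Suc f))) ?s1 (?S 0) (B N)"
    proof -
      have "rep e w (Suc f) ?s1" by (rule rep_upd[OF h(2)]) auto
      from runs_compT_tr[OF B(2) h(1) this] show ?thesis by simp
    qed
    have 3: "runs (Loop (Nonempty (tr f)) (Seq (Pop (tr f)) (Pop (tr (Suc f))))) (?S 0) (?S ?m) (?m * (2 + 1) + 1)"
    proof (rule runs_Loop)
      fix i assume "i < ?m"
      then have e: "?m - i = Suc (?m - Suc i)" by simp
      show "runs (Seq (Pop (tr f)) (Pop (tr (Suc f)))) (?S i) (?S (Suc i)) 2"
        by (rule runs_SeqI[where s'="(?S i)(tr f := replicate (?m - Suc i) True)" and T=1 and T'=1]; (rule runs_PopI)?)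
          (auto simp: fun_eq_iff e tl_replicate)
    qed auto
    let ?s4 = "s(tr (Suc f) := replicate (?k - ?m) True, r := bl (?m < ?k))"
    have 4: "runs (Cond (Nonempty (tr (Suc f))) (Push r True) (clr (tr f))) (?S ?m) ?s4 (1 + 1)"
    proof (rule runs_Cond)
      assume "holds (Nonempty (tr (Suc f))) (?S ?m)"
      then have l: "?m < ?k" by simp
      show "runs (Push r True) (?S ?m) ?s4 1"
        by (rule runs_PushI) (use D l h(4) in \<open>auto simp: fun_eq_iff bl_def\<close>)
    next
      assume "\<not> holds (Nonempty (tr (Suc f))) (?S ?m)"
      then have l: "\<not> ?m < ?k" by simp
      have "?s4 = ?S ?m" using D l h(4) by (auto simp: fun_eq_iff bl_def)
      then show "runs (clr (tr f)) (?S ?m) ?s4 1" using runs_skip[of "?S ?m" "tr f"] by simp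
    qed
    have 5: "runs (clr (tr (Suc f))) ?s4 (s(r := bl (?m < ?k))) (2 * ?k + 1)"
    proof -
      have "?s4(tr (Suc f) := []) = s(r := bl (?m < ?k))" using D by (auto simp: fun_eq_iff)
      then show ?thesis using runs_mono[OF runs_clr[of "tr (Suc f)" ?s4], of "2 * ?k + 1"] D by simp
    qed
    from runs_Seq[OF 1 runs_Seq[OF 2 runs_Seq[OF 3 runs_Seq[OF 4 5]]]]
    have "runs (compB (BLess a b) r f) s (s(r := bl (?m < ?k)))
      (A N + (B N + (?m * (2 + 1) + 1 + (1 + 1 + (2 * ?k + 1)))))" by simp
    then show ?thesis by simp (rule runs_mono, assumption, use U(2)[OF h(1)] V(2)[OF h(1)] in simp)
  qed
  moreover have "polyb ?T" by (intro polyb_intros A B U V)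
  ultimately show ?case by (intro exI[of _ ?T]) blast
next
  case (BBit a)
  obtain A where A: "polyb A" "\<And>N e w s r f. bnd N e w \<Longrightarrow> rep e w f s \<Longrightarrow> tgt r f \<Longrightarrow>
   runs (compT a r f) s (s(r := replicate (tval e a) True @ s r)) (A N)" using runs_compT by blast
  obtain U where U: "polyb U" "\<And>N e w. bnd N e w \<Longrightarrow> tval e a \<le> U N" using tval_bound by blast
  let ?T = "\<lambda>N. A N + ((U N * 6 + 1) + (2 + (4 * N + 1)))"
  have "runs (compB (BBit a) r f) s (s(r := bl (bval w e (BBit a)))) (?T N)"
    if h: "bnd N e w" "rep e w f s" "tgt r f" "s r = []" for N e w s r f
  proof -
    let ?m = "tval e a" 
    let ?S = "\<lambda>i. s(tr f := replicate (?m - i) True, 0 := drop i w, tr (Suc f) := rev (take i w))"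
    note D = repD[OF h(2)] tgtD[OF h(3)]
    have "?S 0 = s(tr f := replicate ?m True)" using D by (auto simp: fun_eq_iff)
    then have 1: "runs (compT a (tr f) (Suc f)) s (?S 0) (A N)"
      using runs_compT_tr[OF A(2) h(1,2)] by simp
    have 2: "runs (Loop (Nonempty (tr f)) (Seq (Pop (tr f)) (Cond (Nonempty 0) (mvbit 0 (tr (Suc f))) (clr 0)))) (?S 0) (?S ?m) (?m * (5 + 1) + 1)"
    proof (rule runs_Loop)
      fix i assume i: "i < ?m"
      let ?s = "(?S i)(tr f := replicate (?m - Suc i) True)"
      have p: "runs (Pop (tr f)) (?S i) ?s 1"
        by (rule runs_PopI) (use i in \<open>auto simp: fun_eq_iff\<close>)
      have c: "runs (Cond (Nonempty 0) (mvbit 0 (tr (Suc f))) (clr 0)) ?s (?S (Suc i)) (3 + 1)"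
      proof (rule runs_Cond)
        assume "holds (Nonempty 0) ?s"
        then have l: "i < length w" by simp
        have "runs (mvbit 0 (tr (Suc f))) ?s (?s(0 := tl (?s 0), tr (Suc f) := hd (?s 0) # ?s (tr (Suc f)))) 3"
          by (rule runs_mvbit) (use l in auto)
        also have "?s(0 := tl (?s 0), tr (Suc f) := hd (?s 0) # ?s (tr (Suc f))) = ?S (Suc i)"
          using l by (auto simp: fun_eq_iff drop_Suc tl_drop take_Suc_conv_app_nth hd_drop_conv_nth)
        finally show "runs (mvbit 0 (tr (Suc f))) ?s (?S (Suc i)) 3" .
      next
        assume "\<not> holds (Nonempty 0) ?s"
        then have "?S (Suc i) = ?s" by (auto simp: fun_eq_iff)
        then show "runs (clr 0) ?s (?S (Suc i)) 3"
          using runs_mono[OF runs_skip[of ?s 0], of 3] \<open>\<not> holds (Nonempty 0) ?s\<close> by simp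
      qed
      show "runs (Seq (Pop (tr f)) (Cond (Nonempty 0) (mvbit 0 (tr (Suc f))) (clr 0))) (?S i) (?S (Suc i)) 5"
        by (rule runs_SeqI[OF p c]) simp
    qed auto
    let ?b = "?m < length w \<and> w ! ?m"
    let ?s3 = "(?S ?m)(r := bl ?b)"
    have 3: "runs (Cond (Top 0) (Push r True) (clr (tr f))) (?S ?m) ?s3 (1 + 1)"
    proof (rule runs_Cond)
      assume "holds (Top 0) (?S ?m)"
      then have l: "?b" by (auto simp: hd_drop_conv_nth)
      show "runs (Push r True) (?S ?m) ?s3 1"
        by (rule runs_PushI) (use D l h(4) in \<open>auto simp: fun_eq_iff bl_def\<close>)
    next
      assume "\<not> holds (Top 0) (?S ?m)"
      then have l: "\<not> ?b" by (auto simp: hd_drop_conv_nth)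
      have "?s3 = ?S ?m" using D l h(4) by (auto simp: fun_eq_iff bl_def)
      then show "runs (clr (tr f)) (?S ?m) ?s3 1" using runs_skip[of "?S ?m" "tr f"] by simp
    qed
    have "runs (mvw (tr (Suc f)) 0) ?s3 (?s3(tr (Suc f) := [], 0 := rev (?s3 (tr (Suc f))) @ ?s3 0)) (4 * length (?s3 (tr (Suc f))) + 1)"
      by (rule runs_mvw) simp
    moreover have "?s3(tr (Suc f) := [], 0 := rev (?s3 (tr (Suc f))) @ ?s3 0) = s(r := bl ?b)"
      using D by (auto simp: fun_eq_iff)
    moreover have "length (?s3 (tr (Suc f))) \<le> N" using D h(1) by (simp add: bnd_def min.coboundedI1)
    ultimately have 4: "runs (mvw (tr (Suc f)) 0) ?s3 (s(r := bl ?b)) (4 * N + 1)"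
      by (auto intro: runs_mono)
    from runs_Seq[OF 1 runs_Seq[OF 2 runs_Seq[OF 3 4]]]
    have "runs (compB (BBit a) r f) s (s(r := bl ?b)) (A N + (?m * (5 + 1) + 1 + (1 + 1 + (4 * N + 1))))"
      by simp
    then show ?thesis by simp (rule runs_mono, assumption, use U(2)[OF h(1)] in simp)
  qed
  moreover have "polyb ?T" by (intro polyb_intros A U)
  ultimately show ?case by (intro exI[of _ ?T]) blast
next
  case (BNot b)
  obtain B where B: "polyb B" "\<And>N e w s r f. bnd N e w \<Longrightarrow> rep e w f s \<Longrightarrow> tgt r f \<Longrightarrow> s r = [] \<Longrightarrow>
   runs (compB b r f) s (s(r := bl (bval w e b))) (B N)" using BNot.IH by blast
  have "runs (compB (BNot b) r f) s (s(r := bl (bval w e (BNot b)))) (B N + 2)"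
    if h: "bnd N e w" "rep e w f s" "tgt r f" "s r = []" for N e w s r f
  proof -
    note D = repD[OF h(2)] tgtD[OF h(3)]
    let ?v = "bval w e b"
    let ?s = "s(tr f := bl ?v)"
    have 1: "runs (compB b (tr f) (Suc f)) s ?s (B N)"
      by (rule B(2)[OF h(1)]) (use h(2) D in \<open>auto simp: rep_def\<close>)
    have 2: "runs (Cond (Nonempty (tr f)) (Pop (tr f)) (Push r True)) ?s (s(r := bl (\<not> ?v))) (1 + 1)"
      by (rule runs_Cond; (rule runs_PopI | rule runs_PushI)) (use D h(4) in \<open>auto simp: fun_eq_iff bl_def split: if_splits\<close>)
    show ?thesis using runs_Seq[OF 1 2] by simp
  qed
  moreover have "polyb (\<lambda>N. B N + 2)" by (intro polyb_intros B)
  ultimately show ?case by (intro exI[of _ "\<lambda>N. B N + 2"]) blast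
next
  case (BAnd a b)
  obtain A where A: "polyb A" "\<And>N e w s r f. bnd N e w \<Longrightarrow> rep e w f s \<Longrightarrow> tgt r f \<Longrightarrow> s r = [] \<Longrightarrow>
   runs (compB a r f) s (s(r := bl (bval w e a))) (A N)" using BAnd.IH(1) by blast
  obtain B where B: "polyb B" "\<And>N e w s r f. bnd N e w \<Longrightarrow> rep e w f s \<Longrightarrow> tgt r f \<Longrightarrow> s r = [] \<Longrightarrow>
   runs (compB b r f) s (s(r := bl (bval w e b))) (B N)" using BAnd.IH(2) by blast
  have "runs (compB (BAnd a b) r f) s (s(r := bl (bval w e (BAnd a b)))) (A N + (B N + 2))"
    if h: "bnd N e w" "rep e w f s" "tgt r f" "s r = []" for N e w s r f
  proof -
    note D = repD[OF h(2)] tgtD[OF h(3)]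
    let ?v = "bval w e a" and ?u = "bval w e b"
    let ?s = "s(tr f := bl ?v)"
    have 1: "runs (compB a (tr f) (Suc f)) s ?s (A N)"
      by (rule A(2)[OF h(1)]) (use h(2) D in \<open>auto simp: rep_def\<close>)
    have 2: "runs (Cond (Nonempty (tr f)) (Seq (Pop (tr f)) (compB b r f)) (clr (tr f))) ?s (s(r := bl (?v \<and> ?u))) (1 + B N + 1)"
    proof (rule runs_Cond)
      assume "holds (Nonempty (tr f)) ?s"
      then have v: ?v by (auto simp: bl_def split: if_splits)
      have "runs (Pop (tr f)) ?s s 1"
        by (rule runs_PopI) (use v D in \<open>auto simp: fun_eq_iff bl_def\<close>)
      from runs_Seq[OF this B(2)[OF h]] v
      show "runs (Seq (Pop (tr f)) (compB b r f)) ?s (s(r := bl (?v \<and> ?u))) (1 + B N)" by simp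
    next
      assume "\<not> holds (Nonempty (tr f)) ?s"
      then have v: "\<not> ?v" by (auto simp: bl_def split: if_splits)
      then have "?s = s" "s(r := bl (?v \<and> ?u)) = s" using D h(4) by (auto simp: fun_eq_iff bl_def)
      then show "runs (clr (tr f)) ?s (s(r := bl (?v \<and> ?u))) (1 + B N)"
        using runs_mono[OF runs_skip[of s "tr f"], of "1 + B N"] D by simp
    qed
    show ?thesis using runs_Seq[OF 1 2] by simp
  qed
  moreover have "polyb (\<lambda>N. A N + (B N + 2))" by (intro polyb_intros A B)
  ultimately show ?case by (intro exI[of _ "\<lambda>N. A N + (B N + 2)"]) blast
next
  case (BEx x t b)
  obtain A where A: "polyb A" "\<And>N e w s r f. bnd N e w \<Longrightarrow> rep e w f s \<Longrightarrow> tgt r f \<Longrightarrow>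
   runs (compT t r f) s (s(r := replicate (tval e t) True @ s r)) (A N)" using runs_compT by blast
  obtain U where U: "polyb U" "\<And>N e w. bnd N e w \<Longrightarrow> tval e t \<le> U N" using tval_bound by blast
  obtain B where B: "polyb B" "\<And>N e w s r f. bnd N e w \<Longrightarrow> rep e w f s \<Longrightarrow> tgt r f \<Longrightarrow> s r = [] \<Longrightarrow>
   runs (compB b r f) s (s(r := bl (bval w e b))) (B N)" using BEx.IH by blast
  \<comment> \<open>The body is entered with values of the quantified variable up to
    \<open>U N\<close>, so its time is taken at \<open>N + U N\<close>; \<open>polyb_comp\<close>
    keeps this polynomial.\<close>
  let ?T = "\<lambda>N. A N + ((3 * N + 1) + ((U N * (B (N + U N) + 9) + 1) + ((2 * U N + 1) + (3 * N + 1))))"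
  have "runs (compB (BEx x t b) r f) s (s(r := bl (bval w e (BEx x t b)))) (?T N)"
    if h: "bnd N e w" "rep e w f s" "tgt r f" "s r = []" for N e w s r f
  proof -
    note D = repD[OF h(2)] tgtD[OF h(3)]
    let ?m = "tval e t" 
    let ?E = "\<lambda>i. \<exists>a<i. bval w (e(x := a)) b"
    let ?S = "\<lambda>i. s(tr f := replicate (?m - i) True, tr (Suc f) := replicate (e x) True,
      vr x := replicate i True, r := bl (?E i))"
    let ?s1 = "s(tr f := replicate ?m True)"
    have ex: "e x \<le> N" using h(1) by (simp add: bnd_def)
    have 1: "runs (compT t (tr f) (Suc f)) s ?s1 (A N)"
      by (rule runs_compT_tr[OF A(2) h(1,2)])
    have "runs (mv (vr x) (tr (Suc f))) ?s1 (?s1(vr x := [], tr (Suc f) := replicate (e x) True @ ?s1 (tr (Suc f)))) (3 * e x + 1)"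
      by (rule runs_mv) (use D in auto)
    also have "?s1(vr x := [], tr (Suc f) := replicate (e x) True @ ?s1 (tr (Suc f))) = ?S 0"
      using D h(4) by (auto simp: fun_eq_iff bl_def)
    finally have 2: "runs (mv (vr x) (tr (Suc f))) ?s1 (?S 0) (3 * e x + 1)" .
    have 3: "runs (Loop (Nonempty (tr f)) (Seq (Pop (tr f)) (Seq (compB b (tr (f + 2)) (f + 3))
        (Seq (Cond (Nonempty (tr (f + 2))) (Seq (Pop (tr (f + 2))) (Seq (clr r) (Push r True))) (clr (tr (f + 2))))
             (Push (vr x) True))))) (?S 0) (?S ?m) (?m * ((1 + (B (N + U N) + (6 + 1))) + 1) + 1)"
    proof (rule runs_Loop)
      fix i assume i: "i < ?m"
      show "holds (Nonempty (tr f)) (?S i)" using i D by auto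
      let ?s = "(?S i)(tr f := replicate (?m - Suc i) True)"
      let ?v = "bval w (e(x := i)) b"
      let ?s2 = "?s(tr (f + 2) := bl ?v)"
      let ?s3 = "?s(r := bl (?E (Suc i)))"
      have p: "runs (Pop (tr f)) (?S i) ?s 1"
        by (rule runs_PopI) (use i D in \<open>auto simp: fun_eq_iff\<close>)
      have iU: "i \<le> U N" using i U(2)[OF h(1)] by linarith
      have q: "runs (compB b (tr (f + 2)) (f + 3)) ?s ?s2 (B (N + U N))"
        by (rule B(2)[where e="e(x := i)" and w=w])
          (use h D iU in \<open>auto simp: rep_def bnd_def tgt_def trans_le_add1 add.commute\<close>)
      have E: "?E (Suc i) \<longleftrightarrow> ?E i \<or> ?v" by (auto simp: less_Suc_eq)
      have c: "runs (Cond (Nonempty (tr (f + 2))) (Seq (Pop (tr (f + 2))) (Seq (clr r) (Push r True))) (clr (tr (f + 2)))) ?s2 ?s3 (5 + 1)"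
      proof (rule runs_Cond)
        assume "holds (Nonempty (tr (f + 2))) ?s2"
        then have v: ?v by (auto simp: bl_def split: if_splits)
        have c1: "runs (Pop (tr (f + 2))) ?s2 ?s 1"
          by (rule runs_PopI) (use v D in \<open>auto simp: fun_eq_iff bl_def\<close>)
        have c2: "runs (clr r) ?s (?s(r := [])) 3"
          by (rule runs_mono[OF runs_clr]) (use D in \<open>auto simp: bl_def\<close>)
        have c3: "runs (Push r True) (?s(r := [])) ?s3 1"
          by (rule runs_PushI) (use v E in \<open>auto simp: fun_eq_iff bl_def\<close>)
        show "runs (Seq (Pop (tr (f + 2))) (Seq (clr r) (Push r True))) ?s2 ?s3 5"
          by (rule runs_SeqI[OF c1 runs_Seq[OF c2 c3]]) simp
      next
        assume "\<not> holds (Nonempty (tr (f + 2))) ?s2"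
        then have v: "\<not> ?v" by (auto simp: bl_def split: if_splits)
        then have e: "?s2 = ?s3" using D E by (auto simp: fun_eq_iff bl_def)
        show "runs (clr (tr (f + 2))) ?s2 ?s3 5"
          unfolding e[symmetric] by (rule runs_mono[OF runs_skip]) (use v in \<open>auto simp: bl_def\<close>)
      qed
      have pu: "runs (Push (vr x) True) ?s3 (?S (Suc i)) 1"
        by (rule runs_PushI) (use D in \<open>auto simp: fun_eq_iff\<close>)
      show "runs (Seq (Pop (tr f)) (Seq (compB b (tr (f + 2)) (f + 3))
        (Seq (Cond (Nonempty (tr (f + 2))) (Seq (Pop (tr (f + 2))) (Seq (clr r) (Push r True))) (clr (tr (f + 2))))
             (Push (vr x) True)))) (?S i) (?S (Suc i)) (1 + (B (N + U N) + (6 + 1)))"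
        by (rule runs_SeqI[OF p runs_Seq[OF q runs_Seq[OF c pu]]]) simp
    qed (use D in auto)
    let ?s5 = "(?S ?m)(vr x := [])"
    have 4: "runs (clr (vr x)) (?S ?m) ?s5 (2 * ?m + 1)"
      by (rule runs_mono[OF runs_clr]) (use D in auto)
    have "runs (mv (tr (Suc f)) (vr x)) ?s5 (?s5(tr (Suc f) := [], vr x := replicate (e x) True @ ?s5 (vr x))) (3 * e x + 1)"
      by (rule runs_mv) (use D in auto)
    also have "?s5(tr (Suc f) := [], vr x := replicate (e x) True @ ?s5 (vr x)) = s(r := bl (bval w e (BEx x t b)))"
      using D by (auto simp: fun_eq_iff)
    finally have 5: "runs (mv (tr (Suc f)) (vr x)) ?s5 (s(r := bl (bval w e (BEx x t b)))) (3 * e x + 1)" .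
    have "?m * ((1 + (B (N + U N) + (6 + 1))) + 1) \<le> U N * (B (N + U N) + 9)"
      by (rule mult_mono) (use U(2)[OF h(1)] in auto)
    then show ?thesis using ex U(2)[OF h(1)]
      by (simp only: compB.simps) (rule runs_mono[OF runs_Seq[OF 1 runs_Seq[OF 2 runs_Seq[OF 3 runs_Seq[OF 4 5]]]]], linarith)
  qed
  moreover have "polyb ?T" by (intro polyb_intros A U polyb_comp[OF B(1)])
  ultimately show ?case by (intro exI[of _ ?T]) blast
qed

text \<open>The output grows on register 2 with its last symbol on top; it is reversed only once, at
  the very end.\<close>

fun compC :: "cmd \<Rightarrow> nat \<Rightarrow> prog" where
  "compC (Emit b) f = Seq (compB b (tr f) (Suc f))
     (Cond (Nonempty (tr f)) (Seq (Pop (tr f)) (Push 2 True)) (Push 2 False))"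
| "compC (CSeq c d) f = Seq (compC c f) (compC d f)"
| "compC (CFor x t c) f = Seq (compT t (tr f) (Suc f)) (Seq (mv (vr x) (tr (Suc f)))
     (Seq (Loop (Nonempty (tr f)) (Seq (Pop (tr f)) (Seq (compC c (f + 2)) (Push (vr x) True))))
     (Seq (clr (vr x)) (mv (tr (Suc f)) (vr x)))))"

lemma runs_compC: "\<exists>T. polyb T \<and> (\<forall>N e w s f. bnd N e w \<longrightarrow> rep e w f s \<longrightarrow>
   runs (compC c f) s (s(2 := rev (cval w e c) @ s 2)) (T N))"
proof (induction c)
  case (Emit b)
  obtain B where B: "polyb B" "\<And>N e w s r f. bnd N e w \<Longrightarrow> rep e w f s \<Longrightarrow> tgt r f \<Longrightarrow> s r = [] \<Longrightarrow>
   runs (compB b r f) s (s(r := bl (bval w e b))) (B N)" using runs_compB by blast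
  have "runs (compC (Emit b) f) s (s(2 := rev (cval w e (Emit b)) @ s 2)) (B N + 3)"
    if h: "bnd N e w" "rep e w f s" for N e w s f
  proof -
    note D = repD[OF h(2)]
    let ?v = "bval w e b"
    let ?s = "s(tr f := bl ?v)"
    have 1: "runs (compB b (tr f) (Suc f)) s ?s (B N)"
      by (rule B(2)[OF h(1)]) (use h(2) D in \<open>auto simp: rep_def\<close>)
    have 2: "runs (Cond (Nonempty (tr f)) (Seq (Pop (tr f)) (Push 2 True)) (Push 2 False)) ?s (s(2 := ?v # s 2)) (2 + 1)"
    proof (rule runs_Cond)
      assume "holds (Nonempty (tr f)) ?s"
      then have v: ?v by (auto simp: bl_def split: if_splits)
      have p: "runs (Pop (tr f)) ?s s 1"
        by (rule runs_PopI) (use v D in \<open>auto simp: fun_eq_iff bl_def\<close>)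
      have q: "runs (Push 2 True) s (s(2 := ?v # s 2)) 1"
        by (rule runs_PushI) (use v in simp)
      show "runs (Seq (Pop (tr f)) (Push 2 True)) ?s (s(2 := ?v # s 2)) 2"
        by (rule runs_SeqI[OF p q]) simp
    next
      assume "\<not> holds (Nonempty (tr f)) ?s"
      then have v: "\<not> ?v" by (auto simp: bl_def split: if_splits)
      have "runs (Push 2 False) ?s (s(2 := ?v # s 2)) 1"
        by (rule runs_PushI) (use v D in \<open>auto simp: fun_eq_iff bl_def\<close>)
      then show "runs (Push 2 False) ?s (s(2 := ?v # s 2)) 2" by (rule runs_mono) simp
    qed
    have "s(2 := ?v # s 2) = s(2 := rev (cval w e (Emit b)) @ s 2)" by simp
    then show ?thesis using runs_Seq[OF 1 2] by (simp del: fun_upd_apply)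
  qed
  moreover have "polyb (\<lambda>N. B N + 3)" by (intro polyb_intros B)
  ultimately show ?case by (intro exI[of _ "\<lambda>N. B N + 3"]) blast
next
  case (CSeq c d)
  obtain A where A: "polyb A" "\<And>N e w s f. bnd N e w \<Longrightarrow> rep e w f s \<Longrightarrow>
   runs (compC c f) s (s(2 := rev (cval w e c) @ s 2)) (A N)" using CSeq.IH(1) by blast
  obtain B where B: "polyb B" "\<And>N e w s f. bnd N e w \<Longrightarrow> rep e w f s \<Longrightarrow>
   runs (compC d f) s (s(2 := rev (cval w e d) @ s 2)) (B N)" using CSeq.IH(2) by blast
  have "runs (compC (CSeq c d) f) s (s(2 := rev (cval w e (CSeq c d)) @ s 2)) (A N + B N)"
    if h: "bnd N e w" "rep e w f s" for N e w s f
  proof -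
    let ?s = "s(2 := rev (cval w e c) @ s 2)"
    have "rep e w f ?s" by (rule rep_upd[OF h(2)]) auto
    from runs_Seq[OF A(2)[OF h] B(2)[OF h(1) this]]
    show ?thesis unfolding compC.simps by (rule back_subst[where P="\<lambda>x. runs _ _ x _"]) simp
  qed
  moreover have "polyb (\<lambda>N. A N + B N)" by (intro polyb_intros A B)
  ultimately show ?case by (intro exI[of _ "\<lambda>N. A N + B N"]) blast
next
  case (CFor x t c)
  obtain A where A: "polyb A" "\<And>N e w s r f. bnd N e w \<Longrightarrow> rep e w f s \<Longrightarrow> tgt r f \<Longrightarrow>
   runs (compT t r f) s (s(r := replicate (tval e t) True @ s r)) (A N)" using runs_compT by blast
  obtain U where U: "polyb U" "\<And>N e w. bnd N e w \<Longrightarrow> tval e t \<le> U N" using tval_bound by blast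
  obtain B where B: "polyb B" "\<And>N e w s f. bnd N e w \<Longrightarrow> rep e w f s \<Longrightarrow>
   runs (compC c f) s (s(2 := rev (cval w e c) @ s 2)) (B N)" using CFor.IH by blast
  let ?T = "\<lambda>N. A N + ((3 * N + 1) + ((U N * (B (N + U N) + 3) + 1) + ((2 * U N + 1) + (3 * N + 1))))"
  have "runs (compC (CFor x t c) f) s (s(2 := rev (cval w e (CFor x t c)) @ s 2)) (?T N)"
    if h: "bnd N e w" "rep e w f s" for N e w s f
  proof -
    note D = repD[OF h(2)]
    let ?m = "tval e t" 
    let ?E = "\<lambda>i. rev (concat (map (\<lambda>a. cval w (e(x := a)) c) [0..<i])) @ s 2"
    let ?S = "\<lambda>i. s(tr f := replicate (?m - i) True, tr (Suc f) := replicate (e x) True,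
      vr x := replicate i True, 2 := ?E i)"
    let ?s1 = "s(tr f := replicate ?m True)"
    have ex: "e x \<le> N" using h(1) by (simp add: bnd_def)
    have 1: "runs (compT t (tr f) (Suc f)) s ?s1 (A N)"
      by (rule runs_compT_tr[OF A(2) h(1,2)])
    have "runs (mv (vr x) (tr (Suc f))) ?s1 (?s1(vr x := [], tr (Suc f) := replicate (e x) True @ ?s1 (tr (Suc f)))) (3 * e x + 1)"
      by (rule runs_mv) (use D in auto)
    also have "?s1(vr x := [], tr (Suc f) := replicate (e x) True @ ?s1 (tr (Suc f))) = ?S 0"
      using D by (auto simp: fun_eq_iff)
    finally have 2: "runs (mv (vr x) (tr (Suc f))) ?s1 (?S 0) (3 * e x + 1)" .
    have 3: "runs (Loop (Nonempty (tr f)) (Seq (Pop (tr f)) (Seq (compC c (f + 2)) (Push (vr x) True)))) (?S 0) (?S ?m) (?m * ((1 + (B (N + U N) + 1)) + 1) + 1)"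
    proof (rule runs_Loop)
      fix i assume i: "i < ?m"
      show "holds (Nonempty (tr f)) (?S i)" using i D by auto
      let ?s = "(?S i)(tr f := replicate (?m - Suc i) True)"
      let ?s3 = "?s(2 := ?E (Suc i))"
      have p: "runs (Pop (tr f)) (?S i) ?s 1"
        by (rule runs_PopI) (use i D in \<open>auto simp: fun_eq_iff\<close>)
      have iU: "i \<le> U N" using i U(2)[OF h(1)] by linarith
      have "runs (compC c (f + 2)) ?s (?s(2 := rev (cval w (e(x := i)) c) @ ?s 2)) (B (N + U N))"
        by (rule B(2))
          (use h D iU in \<open>auto simp: rep_def bnd_def trans_le_add1 add.commute\<close>)
      also have "?s(2 := rev (cval w (e(x := i)) c) @ ?s 2) = ?s3" by (auto simp: fun_eq_iff)
      finally have q: "runs (compC c (f + 2)) ?s ?s3 (B (N + U N))" .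
      have pu: "runs (Push (vr x) True) ?s3 (?S (Suc i)) 1"
        by (rule runs_PushI) (use D in \<open>auto simp: fun_eq_iff\<close>)
      show "runs (Seq (Pop (tr f)) (Seq (compC c (f + 2)) (Push (vr x) True))) (?S i) (?S (Suc i)) (1 + (B (N + U N) + 1))"
        by (rule runs_SeqI[OF p runs_Seq[OF q pu]]) simp
    qed (use D in auto)
    let ?s5 = "(?S ?m)(vr x := [])"
    have 4: "runs (clr (vr x)) (?S ?m) ?s5 (2 * ?m + 1)"
      by (rule runs_mono[OF runs_clr]) (use D in auto)
    have "runs (mv (tr (Suc f)) (vr x)) ?s5 (?s5(tr (Suc f) := [], vr x := replicate (e x) True @ ?s5 (vr x))) (3 * e x + 1)"
      by (rule runs_mv) (use D in auto)
    also have "?s5(tr (Suc f) := [], vr x := replicate (e x) True @ ?s5 (vr x)) = s(2 := rev (cval w e (CFor x t c)) @ s 2)"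
      using D by (auto simp: fun_eq_iff)
    finally have 5: "runs (mv (tr (Suc f)) (vr x)) ?s5 (s(2 := rev (cval w e (CFor x t c)) @ s 2)) (3 * e x + 1)" .
    have "?m * ((1 + (B (N + U N) + 1)) + 1) \<le> U N * (B (N + U N) + 3)"
      by (rule mult_mono) (use U(2)[OF h(1)] in auto)
    then show ?thesis using ex U(2)[OF h(1)]
      by (simp only: compC.simps) (rule runs_mono[OF runs_Seq[OF 1 runs_Seq[OF 2 runs_Seq[OF 3 runs_Seq[OF 4 5]]]]], linarith)
  qed
  moreover have "polyb ?T" by (intro polyb_intros A U polyb_comp[OF B(1)])
  ultimately show ?case by (intro exI[of _ ?T]) blast
qed

definition len_prog :: "nat \<Rightarrow> prog" where
  "len_prog x = Seq (Loop (Nonempty 0) (Seq (mvbit 0 (tr 0)) (Push (vr x) True))) (mvw (tr 0) 0)"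

definition lead_prog :: "nat \<Rightarrow> prog" where
  "lead_prog x = Seq (Loop (Top 0) (Seq (Pop 0) (Seq (Push (tr 0) True) (Push (vr x) True)))) (mv (tr 0) 0)"

lemma runs_len_prog:
  assumes "rep e w 0 s"
  shows "runs (len_prog x) s (s(vr x := replicate (length w) True @ s (vr x))) (9 * length w + 2)"
proof -
  note D = repD[OF assms]
  let ?S = "\<lambda>i. s(0 := drop i w, tr 0 := rev (take i w), vr x := replicate i True @ s (vr x))"
  have 1: "runs (Loop (Nonempty 0) (Seq (mvbit 0 (tr 0)) (Push (vr x) True))) s (?S (length w)) (length w * (4 + 1) + 1)"
  proof (rule runs_Loop'[where S = ?S])
    fix i assume i: "i < length w"
    let ?s = "(?S i)(0 := tl (?S i 0), tr 0 := hd (?S i 0) # ?S i (tr 0))"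
    have p: "runs (mvbit 0 (tr 0)) (?S i) ?s 3"
      by (rule runs_mvbit) (use i in auto)
    have q: "runs (Push (vr x) True) ?s (?S (Suc i)) 1"
      by (rule runs_PushI)
        (use i in \<open>auto simp: fun_eq_iff drop_Suc tl_drop take_Suc_conv_app_nth hd_drop_conv_nth\<close>)
    show "runs (Seq (mvbit 0 (tr 0)) (Push (vr x) True)) (?S i) (?S (Suc i)) 4"
      by (rule runs_SeqI[OF p q]) simp
  qed (use D in \<open>auto simp: fun_eq_iff\<close>)
  let ?s = "?S (length w)"
  have "runs (mvw (tr 0) 0) ?s (?s(tr 0 := [], 0 := rev (?s (tr 0)) @ ?s 0)) (4 * length (?s (tr 0)) + 1)"
    by (rule runs_mvw) simp
  also have "?s(tr 0 := [], 0 := rev (?s (tr 0)) @ ?s 0) = s(vr x := replicate (length w) True @ s (vr x))"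
    using D by (auto simp: fun_eq_iff)
  finally have 2: "runs (mvw (tr 0) 0) ?s (s(vr x := replicate (length w) True @ s (vr x))) (4 * length w + 1)"
    by (rule runs_mono) simp
  show ?thesis unfolding len_prog_def by (rule runs_SeqI[OF 1 2]) simp
qed

text \<open>For the encoding of a structure this is the size of its universe.\<close>

definition lead :: "word \<Rightarrow> nat" where "lead w = length (takeWhile (\<lambda>b. b) w)"

lemma lead_le: "lead w \<le> length w" unfolding lead_def by (rule length_takeWhile_le)

lemma runs_lead_prog:
  assumes "rep e w 0 s"
  shows "runs (lead_prog x) s (s(vr x := replicate (lead w) True @ s (vr x))) (7 * length w + 2)"
proof -
  note D = repD[OF assms]
  have wi: "w ! i" if "i < lead w" for i
    using that nth_mem[of i "takeWhile (\<lambda>b. b) w"] set_takeWhileD[of "w ! i" "\<lambda>b. b" w]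
    by (auto simp: lead_def takeWhile_nth)
  let ?S = "\<lambda>i. s(0 := drop i w, tr 0 := replicate i True, vr x := replicate i True @ s (vr x))"
  have 1: "runs (Loop (Top 0) (Seq (Pop 0) (Seq (Push (tr 0) True) (Push (vr x) True)))) s (?S (lead w)) (lead w * (3 + 1) + 1)"
  proof (rule runs_Loop'[where S = ?S])
    fix i assume i: "i < lead w"
    then have il: "i < length w" using lead_le[of w] by simp
    show "holds (Top 0) (?S i)" using wi[OF i] il by (simp add: hd_drop_conv_nth)
    let ?s = "(?S i)(0 := drop (Suc i) w)"
    let ?s' = "?s(tr 0 := replicate (Suc i) True)"
    have p: "runs (Pop 0) (?S i) ?s 1"
      by (rule runs_PopI) (use il in \<open>auto simp: fun_eq_iff drop_Suc tl_drop\<close>)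
    have q: "runs (Push (tr 0) True) ?s ?s' 1"
      by (rule runs_PushI) (auto simp: fun_eq_iff)
    have r: "runs (Push (vr x) True) ?s' (?S (Suc i)) 1"
      by (rule runs_PushI) (auto simp: fun_eq_iff)
    show "runs (Seq (Pop 0) (Seq (Push (tr 0) True) (Push (vr x) True))) (?S i) (?S (Suc i)) 3"
      by (rule runs_SeqI[OF p runs_Seq[OF q r]]) simp
  next
    show "\<not> holds (Top 0) (?S (lead w))"
    proof (cases "lead w < length w")
      case True
      then have "\<not> w ! lead w" unfolding lead_def by (rule nth_length_takeWhile)
      then show ?thesis using True by (simp add: hd_drop_conv_nth)
    qed auto
  qed (use D in \<open>auto simp: fun_eq_iff\<close>)
  have tk: "replicate (lead w) True @ drop (lead w) w = w"
  proof -
    have "takeWhile (\<lambda>b. b) w = replicate (lead w) True"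
      unfolding lead_def by (rule replicate_eqI[symmetric, symmetric]) (auto dest: set_takeWhileD)
    moreover have "drop (lead w) w = dropWhile (\<lambda>b. b) w"
      unfolding lead_def by (rule dropWhile_eq_drop[symmetric])
    ultimately show ?thesis by (metis takeWhile_dropWhile_id)
  qed
  let ?s = "?S (lead w)"
  have "runs (mv (tr 0) 0) ?s (?s(tr 0 := [], 0 := replicate (lead w) True @ ?s 0)) (3 * lead w + 1)"
    by (rule runs_mv) auto
  also have "?s(tr 0 := [], 0 := replicate (lead w) True @ ?s 0) = s(vr x := replicate (lead w) True @ s (vr x))"
    using D tk by (auto simp: fun_eq_iff)
  finally have 2: "runs (mv (tr 0) 0) ?s (s(vr x := replicate (lead w) True @ s (vr x))) (3 * lead w + 1)" .
  show ?thesis unfolding lead_prog_def by (rule runs_SeqI[OF 1 2]) (use lead_le[of w] in simp)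
qed

definition env0 :: "word \<Rightarrow> nat \<Rightarrow> nat \<Rightarrow> nat" where
  "env0 w k = (\<lambda>_. 0)(0 := k, 1 := length w, 2 := lead w)"

text \<open>Every reduction of the hardness proof is obtained from here: the output is described by
  a command and the new parameter by a term, over the variables 0 (parameter), 1 (length) and 2
  (universe size).\<close>

theorem loop_program:
  "\<exists>P c. \<forall>w k. \<exists>s. runs P (start w k) s ((length w + k + 2) ^ c) \<and>
     s 0 = cval w (env0 w k) cm \<and> s 1 = replicate (tval (env0 w k) K) True"
proof -
  obtain A where A: "polyb A" "\<And>N e w s f. bnd N e w \<Longrightarrow> rep e w f s \<Longrightarrow>
   runs (compC cm f) s (s(2 := rev (cval w e cm) @ s 2)) (A N)" using runs_compC by blast
  obtain B where B: "polyb B" "\<And>N e w s r f. bnd N e w \<Longrightarrow> rep e w f s \<Longrightarrow> tgt r f \<Longrightarrow>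
   runs (compT K r f) s (s(r := replicate (tval e K) True @ s r)) (B N)" using runs_compT by blast
  obtain U where U: "polyb U" "\<And>N e w. bnd N e w \<Longrightarrow> tval e K \<le> U N" using tval_bound by blast
  \<comment> \<open>The length of the output is needed because reversing it into register 0 takes
    time proportional to it.\<close>
  have lenC: "\<exists>V. polyb V \<and> (\<forall>N e w. bnd N e w \<longrightarrow> length (cval w e c) \<le> V N)" for c
  proof (induction c)
    case (Emit b)
    show ?case by (intro exI[of _ "\<lambda>_. 1"]) (auto intro: polyb_const)
  next
    case (CSeq c d)
    obtain V where V: "polyb V" "\<forall>N e w. bnd N e w \<longrightarrow> length (cval w e c) \<le> V N" using CSeq.IH(1) by blast
    obtain W where W: "polyb W" "\<forall>N e w. bnd N e w \<longrightarrow> length (cval w e d) \<le> W N" using CSeq.IH(2) by blast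
    show ?case by (intro exI[of _ "\<lambda>N. V N + W N"]) (use V W in \<open>auto intro: polyb_add simp: add_mono\<close>)
  next
    case (CFor x t c)
    obtain V where V: "polyb V" "\<forall>N e w. bnd N e w \<longrightarrow> length (cval w e c) \<le> V N" using CFor.IH by blast
    obtain U where U: "polyb U" "\<And>N e w. bnd N e w \<Longrightarrow> tval e t \<le> U N" using tval_bound by blast
    have "length (cval w e (CFor x t c)) \<le> U N * V (N + U N)" if h: "bnd N e w" for N e w
    proof -
      have "length (cval w (e(x := a)) c) \<le> V (N + U N)" if "a < tval e t" for a
      proof -
        have "a \<le> U N" using that U(2)[OF h] by linarith
        then have "bnd (N + U N) (e(x := a)) w" using h by (auto simp: bnd_def trans_le_add1)
        then show ?thesis using V(2) by blast
      qed
      then have "length (cval w e (CFor x t c)) \<le> (\<Sum>a\<leftarrow>[0..<tval e t]. V (N + U N))"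
        unfolding cval.simps length_concat map_map comp_def by (intro sum_list_mono) auto
      also have "\<dots> = tval e t * V (N + U N)" by (simp add: sum_list_triv)
      also have "\<dots> \<le> U N * V (N + U N)" using U(2)[OF h] by simp
      finally show ?thesis .
    qed
    moreover have "polyb (\<lambda>N. U N * V (N + U N))" by (intro polyb_intros U polyb_comp[OF V(1)])
    ultimately show ?case by (intro exI[of _ "\<lambda>N. U N * V (N + U N)"]) blast
  qed
  obtain V where V: "polyb V" "\<And>N e w. bnd N e w \<Longrightarrow> length (cval w e cm) \<le> V N" using lenC by blast
  define P where "P = Seq (len_prog 1) (Seq (lead_prog 2) (Seq (compC cm 0) (Seq (compT K (tr 0) 1)
     (Seq (clr 0) (Seq (mvw 2 0) (Seq (clr (vr 0)) (mv (tr 0) (vr 0))))))))"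
  let ?T = "\<lambda>N. (9 * N + 2) + ((7 * N + 2) + (A N + (B N + ((2 * N + 1) + ((4 * V N + 1) + ((2 * N + 1) + (3 * U N + 1)))))))"
  have "polyb ?T" by (intro polyb_intros A B U V)
  then obtain c where c: "\<And>N. ?T N \<le> (N + 2) ^ c" unfolding polyb_def by blast
  have "\<exists>s. runs P (start w k) s ((length w + k + 2) ^ c) \<and>
     s 0 = cval w (env0 w k) cm \<and> s 1 = replicate (tval (env0 w k) K) True" for w k
  proof -
    let ?N = "length w + k" and ?e = "env0 w k"
    let ?s0 = "start w k"
    have vr0: "vr 0 = 1" by (simp add: vr_def)
    have s0: "?s0 0 = w" "?s0 (vr 0) = replicate k True" "\<And>x. ?s0 (tr x) = []" "?s0 2 = []"
      "\<And>x. x \<noteq> 0 \<Longrightarrow> ?s0 (vr x) = []"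
      by (auto simp: start_def vr_def tr_def)
    let ?s1 = "?s0(vr 1 := replicate (length w) True)"
    let ?s2 = "?s1(vr 2 := replicate (lead w) True)"
    have r0: "rep ((\<lambda>_. 0)(0 := k)) w 0 ?s0" unfolding rep_def using s0 by auto
    have 1: "runs (len_prog 1) ?s0 ?s1 (9 * length w + 2)"
      using runs_len_prog[OF r0, of 1] s0 by simp
    have r1: "rep ((\<lambda>_. 0)(0 := k, 1 := length w)) w 0 ?s1" unfolding rep_def using s0 by auto
    have 2: "runs (lead_prog 2) ?s1 ?s2 (7 * length w + 2)"
      using runs_lead_prog[OF r1, of 2] s0 by simp
    have r2: "rep ?e w 0 ?s2" unfolding rep_def env0_def using s0 by auto
    have b: "bnd ?N ?e w" unfolding bnd_def env0_def using lead_le[of w] by auto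
    let ?cv = "cval w ?e cm"
    let ?s3 = "?s2(2 := rev ?cv)"
    have 3: "runs (compC cm 0) ?s2 ?s3 (A ?N)" using A(2)[OF b r2] s0 by simp
    let ?s4 = "?s3(tr 0 := replicate (tval ?e K) True)"
    have "rep ?e w 0 ?s3" by (rule rep_upd[OF r2]) auto
    from runs_compT_tr[OF B(2) b this] have 4: "runs (compT K (tr 0) 1) ?s3 ?s4 (B ?N)" by simp
    let ?s5 = "?s4(0 := [])"
    have 5: "runs (clr 0) ?s4 ?s5 (2 * ?N + 1)"
      by (rule runs_mono[OF runs_clr]) (use s0 in auto)
    let ?s6 = "?s5(2 := [], 0 := ?cv)"
    have 6: "runs (mvw 2 0) ?s5 ?s6 (4 * V ?N + 1)"
    proof -
      have "runs (mvw 2 0) ?s5 (?s5(2 := [], 0 := rev (?s5 2) @ ?s5 0)) (4 * length (?s5 2) + 1)"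
        by (rule runs_mvw) simp
      then show ?thesis using V(2)[OF b] by (auto elim!: runs_mono)
    qed
    let ?s7 = "?s6(vr 0 := [])"
    have 7: "runs (clr (vr 0)) ?s6 ?s7 (2 * ?N + 1)"
      by (rule runs_mono[OF runs_clr]) (use s0 in auto)
    let ?s8 = "?s7(tr 0 := [], vr 0 := replicate (tval ?e K) True @ ?s7 (vr 0))"
    have 8: "runs (mv (tr 0) (vr 0)) ?s7 ?s8 (3 * tval ?e K + 1)"
      by (rule runs_mv) auto
    have "runs P ?s0 ?s8 ((9 * length w + 2) + ((7 * length w + 2) + (A ?N + (B ?N + ((2 * ?N + 1) + ((4 * V ?N + 1) + ((2 * ?N + 1) + (3 * tval ?e K + 1))))))))"
      unfolding P_def by (intro runs_Seq) (fact 1 2 3 4 5 6 7 8)+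
    moreover have "(9 * length w + 2) + ((7 * length w + 2) + (A ?N + (B ?N + ((2 * ?N + 1) + ((4 * V ?N + 1) + ((2 * ?N + 1) + (3 * tval ?e K + 1))))))) \<le> ?T ?N"
      using U(2)[OF b] by (intro add_mono mult_le_mono2) auto
    ultimately have "runs P ?s0 ?s8 ((?N + 2) ^ c)" using c[of ?N] runs_mono le_trans by blast
    moreover have "?s8 0 = ?cv" by simp
    moreover have "?s8 1 = replicate (tval ?e K) True" unfolding vr0[symmetric] by simp
    ultimately show ?thesis by blast
  qed
  then show ?thesis by blast
qed

section \<open>Renaming registers and composing reductions\<close>

fun ren_test :: "(nat \<Rightarrow> nat) \<Rightarrow> test \<Rightarrow> test" where
  "ren_test \<rho> (Nonempty r) = Nonempty (\<rho> r)"
| "ren_test \<rho> (Top r) = Top (\<rho> r)"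

fun ren :: "(nat \<Rightarrow> nat) \<Rightarrow> prog \<Rightarrow> prog" where
  "ren \<rho> (Push r b) = Push (\<rho> r) b"
| "ren \<rho> (Pop r) = Pop (\<rho> r)"
| "ren \<rho> (Seq P Q) = Seq (ren \<rho> P) (ren \<rho> Q)"
| "ren \<rho> (Cond b P Q) = Cond (ren_test \<rho> b) (ren \<rho> P) (ren \<rho> Q)"
| "ren \<rho> (Loop b P) = Loop (ren_test \<rho> b) (ren \<rho> P)"

lemma holds_ren: "(\<And>r. \<sigma> (\<rho> r) = s r) \<Longrightarrow> holds (ren_test \<rho> b) \<sigma> = holds b s"
  by (cases b) auto

text \<open>An injective renaming confines a program to part of the store, so that several programs
  can run one after the other without disturbing each other's data.\<close>

lemma exec_ren:
  assumes "exec P s t s'" "inj \<rho>" "\<And>r. \<sigma> (\<rho> r) = s r"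
  shows "\<exists>\<sigma>'. exec (ren \<rho> P) \<sigma> t \<sigma>' \<and> (\<forall>r. \<sigma>' (\<rho> r) = s' r) \<and> (\<forall>r. r \<notin> range \<rho> \<longrightarrow> \<sigma>' r = \<sigma> r)"
  using assms(1,3)
proof (induction arbitrary: \<sigma> rule: exec.induct)
  case (Push r b s)
  let ?t = "\<sigma>(\<rho> r := b # \<sigma> (\<rho> r))"
  have "exec (prog.Push (\<rho> r) b) \<sigma> 1 ?t" by (rule exec.Push)
  moreover have "\<forall>x. ?t (\<rho> x) = (s(r := b # s r)) x" using Push assms(2) by (auto simp: inj_eq)
  moreover have "\<forall>x. x \<notin> range \<rho> \<longrightarrow> ?t x = \<sigma> x" by auto
  ultimately show ?case unfolding ren.simps by blast
next
  case (Pop r s)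
  let ?t = "\<sigma>(\<rho> r := tl (\<sigma> (\<rho> r)))"
  have "exec (prog.Pop (\<rho> r)) \<sigma> 1 ?t" by (rule exec.Pop)
  moreover have "\<forall>x. ?t (\<rho> x) = (s(r := tl (s r))) x" using Pop assms(2) by (auto simp: inj_eq)
  moreover have "\<forall>x. x \<notin> range \<rho> \<longrightarrow> ?t x = \<sigma> x" by auto
  ultimately show ?case unfolding ren.simps by blast
next
  case (Seq P s t s' Q t' s'')
  obtain \<sigma>1 where 1: "exec (ren \<rho> P) \<sigma> t \<sigma>1" "\<And>r. \<sigma>1 (\<rho> r) = s' r" "\<And>r. r \<notin> range \<rho> \<Longrightarrow> \<sigma>1 r = \<sigma> r"
    using Seq.IH(1)[OF Seq.prems] by blast
  obtain \<sigma>2 where 2: "exec (ren \<rho> Q) \<sigma>1 t' \<sigma>2" "\<And>r. \<sigma>2 (\<rho> r) = s'' r" "\<And>r. r \<notin> range \<rho> \<Longrightarrow> \<sigma>2 r = \<sigma>1 r"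
    using Seq.IH(2)[of \<sigma>1, OF 1(2)] by blast
  show ?case by (rule exI[of _ \<sigma>2]) (use 1 2 in \<open>auto intro: exec.Seq\<close>)
next
  case (Cond_True b s P t s' Q)
  obtain \<sigma>1 where 1: "exec (ren \<rho> P) \<sigma> t \<sigma>1" "\<And>r. \<sigma>1 (\<rho> r) = s' r" "\<And>r. r \<notin> range \<rho> \<Longrightarrow> \<sigma>1 r = \<sigma> r"
    using Cond_True.IH[OF Cond_True.prems] by blast
  have "holds (ren_test \<rho> b) \<sigma>" using Cond_True.hyps(1) holds_ren[of \<sigma> \<rho> s b, OF Cond_True.prems] by simp
  from exec.Cond_True[OF this 1(1)] show ?case using 1(2,3) by auto
next
  case (Cond_False b s Q t s' P)
  obtain \<sigma>1 where 1: "exec (ren \<rho> Q) \<sigma> t \<sigma>1" "\<And>r. \<sigma>1 (\<rho> r) = s' r" "\<And>r. r \<notin> range \<rho> \<Longrightarrow> \<sigma>1 r = \<sigma> r"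
    using Cond_False.IH[OF Cond_False.prems] by blast
  have "\<not> holds (ren_test \<rho> b) \<sigma>" using Cond_False.hyps(1) holds_ren[of \<sigma> \<rho> s b, OF Cond_False.prems] by simp
  from exec.Cond_False[OF this 1(1)] show ?case using 1(2,3) by auto
next
  case (Loop_True b s P t s' t' s'')
  obtain \<sigma>1 where 1: "exec (ren \<rho> P) \<sigma> t \<sigma>1" "\<And>r. \<sigma>1 (\<rho> r) = s' r" "\<And>r. r \<notin> range \<rho> \<Longrightarrow> \<sigma>1 r = \<sigma> r"
    using Loop_True.IH(1)[OF Loop_True.prems] by blast
  obtain \<sigma>2 where 2: "exec (ren \<rho> (Loop b P)) \<sigma>1 t' \<sigma>2" "\<And>r. \<sigma>2 (\<rho> r) = s'' r" "\<And>r. r \<notin> range \<rho> \<Longrightarrow> \<sigma>2 r = \<sigma>1 r"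
    using Loop_True.IH(2)[of \<sigma>1, OF 1(2)] by blast
  have "holds (ren_test \<rho> b) \<sigma>" using Loop_True.hyps(1) holds_ren[of \<sigma> \<rho> s b, OF Loop_True.prems] by simp
  from exec.Loop_True[OF this 1(1)] 2(1) have "exec (ren \<rho> (Loop b P)) \<sigma> (t + t' + 1) \<sigma>2" by auto
  then show ?case using 1(3) 2(2,3) by auto
next
  case (Loop_False b s P)
  have "\<not> holds (ren_test \<rho> b) \<sigma>" using Loop_False.hyps(1) holds_ren[of \<sigma> \<rho> s b, OF Loop_False.prems] by simp
  from exec.Loop_False[OF this] show ?case using Loop_False.prems by auto
qed

lemma runs_ren:
  assumes "runs P s s' T" "inj \<rho>" "\<And>r. \<sigma> (\<rho> r) = s r"
  obtains \<sigma>' where "runs (ren \<rho> P) \<sigma> \<sigma>' T" "\<And>r. \<sigma>' (\<rho> r) = s' r" "\<And>r. r \<notin> range \<rho> \<Longrightarrow> \<sigma>' r = \<sigma> r"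
proof -
  obtain t where t: "t \<le> T" "exec P s t s'" using assms(1) unfolding runs_def by blast
  from exec_ren[OF t(2) assms(2), of \<sigma>, OF assms(3)] obtain \<sigma>' where
    "exec (ren \<rho> P) \<sigma> t \<sigma>'" "\<forall>r. \<sigma>' (\<rho> r) = s' r" "\<forall>r. r \<notin> range \<rho> \<longrightarrow> \<sigma>' r = \<sigma> r" by blast
  then show ?thesis using t(1) that[of \<sigma>'] unfolding runs_def by blast
qed

fun regs :: "prog \<Rightarrow> nat set" where
  "regs (Push r b) = {r}"
| "regs (Pop r) = {r}"
| "regs (Seq P Q) = regs P \<union> regs Q"
| "regs (Cond b P Q) = regs P \<union> regs Q"
| "regs (Loop b P) = regs P"

lemma finite_regs: "finite (regs P)"
  by (induction P) auto

lemma exec_frame: "exec P s t s' \<Longrightarrow> r \<notin> regs P \<Longrightarrow> s' r = s r"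
  by (induction rule: exec.induct) auto

text \<open>Bounds the size of an intermediate instance by the time spent on writing it.\<close>

lemma exec_length: "exec P s t s' \<Longrightarrow> length (s' r) \<le> length (s r) + t"
proof (induction rule: exec.induct)
  case (Pop r' s)
  then show ?case by (auto intro: le_SucI)
qed auto

text \<open>A polynomial-time reduction with polynomially bounded new parameter. It involves no
  computable functions of its own and can be appended to any fpt-reduction.\<close>

definition polyred :: "param_problem \<Rightarrow> param_problem \<Rightarrow> bool" where
  "polyred Q Q' \<longleftrightarrow> (\<exists>P c. \<forall>w k. \<exists>s k'. runs P (start w k) s ((length w + k + 2) ^ c) \<and>
     s 1 = replicate k' True \<and> k' \<le> (k + 2) ^ c \<and> ((w, k) \<in> Q \<longleftrightarrow> (s 0, k') \<in> Q'))"

section \<open>Closure properties of computable functions, and composition of reductions\<close>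

lemma computableI:
  assumes "\<And>k. \<exists>s T. runs P (start [] k) s T \<and> s 1 = replicate (f k) True"
  shows "computable f"
  using assms unfolding computable_def runs_def by meson

lemma computableE:
  assumes "computable f"
  obtains P where "\<And>k. \<exists>s T. runs P (start [] k) s T \<and> s 1 = replicate (f k) True"
proof -
  obtain P where "\<And>k. \<exists>t s. exec P (start [] k) t s \<and> s 1 = replicate (f k) True"
    using assms unfolding computable_def by blast
  then have "\<And>k. \<exists>s T. runs P (start [] k) s T \<and> s 1 = replicate (f k) True"
    unfolding runs_def by blast
  then show ?thesis by (rule that)
qed

fun tpow :: "tm \<Rightarrow> nat \<Rightarrow> tm" where
  "tpow t 0 = TC 1"
| "tpow t (Suc c) = TMul t (tpow t c)"

lemma tval_tpow [simp]: "tval e (tpow t c) = tval e t ^ c"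
  by (induction c) auto

lemma inj_lin: "inj (\<lambda>r::nat. 3 * r + c)"
  by (auto simp: inj_def)

text \<open>One shape that majorises sums, products and powers of \<open>f\<close> and
  \<open>g\<close>; all parameter bounds below are brought into it.\<close>

lemma computable_pow:
  assumes "computable f" "computable g"
  shows "computable (\<lambda>k. (f k + g k + 3) ^ c)"
proof -
  obtain Pf where Pf: "\<And>k. \<exists>s T. runs Pf (start [] k) s T \<and> s 1 = replicate (f k) True"
    using computableE[OF assms(1)] by blast
  obtain Pg where Pg: "\<And>k. \<exists>s T. runs Pg (start [] k) s T \<and> s 1 = replicate (g k) True"
    using computableE[OF assms(2)] by blast
  \<comment> \<open>Three disjoint sets of registers, one per residue class modulo 3 and all
    starting at 3, for the programs of \<open>f\<close> and \<open>g\<close> and for the evaluation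
    of the power. Register 1 stays free for argument and result.\<close>
  define A where "A = (\<lambda>r::nat. 3 * r + 3)"
  define B where "B = (\<lambda>r::nat. 3 * r + 4)"
  define C where "C = (\<lambda>r::nat. 3 * r + 5)"
  have inj: "inj A" "inj B" "inj C" unfolding A_def B_def C_def by (rule inj_lin)+
  have ne [simp]: "A r \<noteq> B r'" "A r \<noteq> C r'" "B r \<noteq> C r'" "B r \<noteq> A r'" "C r \<noteq> A r'" "C r \<noteq> B r'"
    "A r \<noteq> 1" "B r \<noteq> 1" "C r \<noteq> 1" "1 \<noteq> A r" "1 \<noteq> B r" "1 \<noteq> C r" 
    "A r \<noteq> Suc 0" "B r \<noteq> Suc 0" "C r \<noteq> Suc 0" "Suc 0 \<noteq> A r" "Suc 0 \<noteq> B r" "Suc 0 \<noteq> C r" for r r'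
    unfolding A_def B_def C_def by presburger+
  have eq [simp]: "A r = A r' \<longleftrightarrow> r = r'" "B r = B r' \<longleftrightarrow> r = r'" "C r = C r' \<longleftrightarrow> r = r'" for r r'
    unfolding A_def B_def C_def by auto
  have rg: "B r \<notin> range A" "C r \<notin> range A" "1 \<notin> range A" "A r \<notin> range B" "C r \<notin> range B" "1 \<notin> range B"
    "A r \<notin> range C" "B r \<notin> range C" "1 \<notin> range C" for r
    by (auto simp: image_iff simp del: One_nat_def)
  let ?K = "tpow (TAdd (TAdd (TV 0) (TV 1)) (TC 3)) c"
  define P where "P = Seq (mv2 1 (A 1) (B 1)) (Seq (ren A Pf) (Seq (ren B Pg)
     (Seq (mv (A 1) (C (vr 0))) (Seq (mv (B 1) (C (vr 1))) (Seq (ren C (compT ?K (tr 0) 1)) (mv (C (tr 0)) 1))))))"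
  obtain K where K: "\<And>N e w s r f. bnd N e w \<Longrightarrow> rep e w f s \<Longrightarrow> tgt r f \<Longrightarrow>
   runs (compT ?K r f) s (s(r := replicate (tval e ?K) True @ s r)) (K N)" using runs_compT by blast
  have "\<exists>s T. runs P (start [] k) s T \<and> s 1 = replicate ((f k + g k + 3) ^ c) True" for k
  proof -
    let ?s0 = "start [] k"
    let ?s1 = "(\<lambda>_. [])(A 1 := replicate k True, B 1 := replicate k True)"
    have e1: "?s0(1 := [], A 1 := replicate k True @ ?s0 (A 1), B 1 := replicate k True @ ?s0 (B 1)) = ?s1"
      by (auto simp: fun_eq_iff start_def A_def B_def)
    have "runs (mv2 1 (A 1) (B 1)) ?s0 (?s0(1 := [], A 1 := replicate k True @ ?s0 (A 1), B 1 := replicate k True @ ?s0 (B 1))) (4 * k + 1)"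
      by (rule runs_mv2) (auto simp: start_def)
    then have 1: "runs (mv2 1 (A 1) (B 1)) ?s0 ?s1 (4 * k + 1)" unfolding e1 .
    obtain sf Tf where sf: "runs Pf (start [] k) sf Tf" "sf 1 = replicate (f k) True" using Pf by blast
    have a: "?s1 (A r) = start [] k r" for r by (auto simp: start_def)
    obtain s2 where 2: "runs (ren A Pf) ?s1 s2 Tf" "\<And>r. s2 (A r) = sf r" "\<And>r. r \<notin> range A \<Longrightarrow> s2 r = ?s1 r"
      using runs_ren[OF sf(1) inj(1), of ?s1, OF a] by blast
    obtain sg Tg where sg: "runs Pg (start [] k) sg Tg" "sg 1 = replicate (g k) True" using Pg by blast
    have b: "s2 (B r) = start [] k r" for r by (subst 2(3)) (auto simp: rg start_def)
    obtain s3 where 3: "runs (ren B Pg) s2 s3 Tg" "\<And>r. s3 (B r) = sg r" "\<And>r. r \<notin> range B \<Longrightarrow> s3 r = s2 r"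
      using runs_ren[OF sg(1) inj(2), of s2, OF b] by blast
    have s3: "s3 (A 1) = replicate (f k) True" "s3 (B 1) = replicate (g k) True" "s3 (C r) = []" "s3 1 = []" for r
      using 2 3 sf(2) sg(2) rg by (simp_all del: One_nat_def)
    let ?s4 = "s3(A 1 := [], C (vr 0) := replicate (f k) True @ s3 (C (vr 0)))"
    have 4: "runs (mv (A 1) (C (vr 0))) s3 ?s4 (3 * f k + 1)"
      by (rule runs_mv) (use s3 in auto)
    let ?s5 = "?s4(B 1 := [], C (vr 1) := replicate (g k) True @ ?s4 (C (vr 1)))"
    have 5: "runs (mv (B 1) (C (vr 1))) ?s4 ?s5 (3 * g k + 1)"
      by (rule runs_mv) (use s3 in auto)
    let ?e = "(\<lambda>_. 0)(0 := f k, 1 := g k)"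
    let ?t = "(\<lambda>_. [])(vr 0 := replicate (f k) True, vr 1 := replicate (g k) True)"
    have r: "rep ?e [] 0 ?t" unfolding rep_def by auto
    have b: "bnd (f k + g k) ?e []" unfolding bnd_def by auto
    have "runs (compT ?K (tr 0) (Suc 0)) ?t (?t(tr 0 := replicate (tval ?e ?K) True)) (K (f k + g k))"
      by (rule runs_compT_tr[OF _ b r]) (rule K)
    then have t: "runs (compT ?K (tr 0) 1) ?t (?t(tr 0 := replicate (tval ?e ?K) True)) (K (f k + g k))" by simp
    have c: "?s5 (C r) = ?t r" for r by (auto simp: s3)
    obtain s6 where 6: "runs (ren C (compT ?K (tr 0) 1)) ?s5 s6 (K (f k + g k))"
      "\<And>r. s6 (C r) = (?t(tr 0 := replicate (tval ?e ?K) True)) r" "\<And>r. r \<notin> range C \<Longrightarrow> s6 r = ?s5 r"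
      using runs_ren[OF t inj(3), of ?s5, OF c] by blast
    have s6: "s6 (C (tr 0)) = replicate (tval ?e ?K) True" "s6 1 = []"
      using 6(2)[of "tr 0"] 6(3)[of 1] rg s3 by (auto simp del: One_nat_def)
    let ?s7 = "s6(C (tr 0) := [], 1 := replicate (tval ?e ?K) True @ s6 1)"
    have 7: "runs (mv (C (tr 0)) 1) s6 ?s7 (3 * tval ?e ?K + 1)"
      by (rule runs_mv) (use s6 in auto)
    have "\<exists>T. runs P ?s0 ?s7 T" unfolding P_def
      using runs_Seq[OF 1 runs_Seq[OF 2(1) runs_Seq[OF 3(1) runs_Seq[OF 4 runs_Seq[OF 5 runs_Seq[OF 6(1) 7]]]]]] by blast
    moreover have "?s7 1 = replicate ((f k + g k + 3) ^ c) True" using s6(2) by (simp del: One_nat_def)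
    ultimately show ?thesis by blast
  qed
  then show ?thesis by (rule computableI)
qed

lemma computable_id: "computable (\<lambda>k. k)"
proof (rule computableI)
  fix k
  have "runs (clr 0) (start [] k) (start [] k) 1" by (rule runs_skip) (simp add: start_def)
  then show "\<exists>s T. runs (clr 0) (start [] k) s T \<and> s 1 = replicate k True"
    by (auto simp: start_def)
qed

text \<open>Starting from one symbol, the content of register 2 is doubled \<open>f k\<close> times,
  by copying it to two registers and moving both back.\<close>

lemma computable_exp:
  assumes "computable f"
  shows "computable (\<lambda>k. 2 ^ f k)"
proof -
  obtain Pf where Pf: "\<And>k. \<exists>s T. runs Pf (start [] k) s T \<and> s 1 = replicate (f k) True"
    using computableE[OF assms(1)] by blast
  define A where "A = (\<lambda>r::nat. 3 * r + 3)"
  have inj: "inj A" unfolding A_def by (rule inj_lin)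
  have ne: "A r \<noteq> 1" "A r \<noteq> 2" "A r \<noteq> 4" "A r \<noteq> 5" for r unfolding A_def by presburger+
  have A1: "A 1 = 6" unfolding A_def by simp
  have rg: "1 \<notin> range A" "2 \<notin> range A" "4 \<notin> range A" "5 \<notin> range A"
    using ne by (metis imageE)+
  let ?body = "Seq (Pop 6) (Seq (mv2 2 4 5) (Seq (mv 4 2) (mv 5 2)))"
  define P where "P = Seq (mv 1 6) (Seq (ren A Pf) (Seq (Push 2 True) (Seq (Loop (Nonempty 6) ?body) (mv 2 1))))"
  have "\<exists>s T. runs P (start [] k) s T \<and> s 1 = replicate (2 ^ f k) True" for k
  proof -
    let ?s0 = "start [] k"
    let ?s1 = "(\<lambda>_. [])(6 := replicate k True)"
    have e1: "?s0(1 := [], 6 := replicate k True @ ?s0 6) = ?s1"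
      by (auto simp: fun_eq_iff start_def)
    have "runs (mv 1 6) ?s0 (?s0(1 := [], 6 := replicate k True @ ?s0 6)) (3 * k + 1)"
      by (rule runs_mv) (auto simp: start_def)
    then have 1: "runs (mv 1 6) ?s0 ?s1 (3 * k + 1)" unfolding e1 .
    obtain sf Tf where sf: "runs Pf (start [] k) sf Tf" "sf 1 = replicate (f k) True" using Pf by blast
    have a: "?s1 (A r) = start [] k r" for r by (auto simp: start_def A_def)
    obtain s2 where 2: "runs (ren A Pf) ?s1 s2 Tf" "\<And>r. s2 (A r) = sf r" "\<And>r. r \<notin> range A \<Longrightarrow> s2 r = ?s1 r"
      using runs_ren[OF sf(1) inj, of ?s1, OF a] by blast
    have s2: "s2 6 = replicate (f k) True" "s2 1 = []" "s2 2 = []" "s2 4 = []" "s2 5 = []"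
      using 2(2)[of 1] 2(3) rg sf(2) A1 by (simp_all del: One_nat_def)
    let ?S = "\<lambda>i. s2(6 := replicate (f k - i) True, 2 := replicate (2 ^ i) True)"
    have 3: "runs (Push 2 True) s2 (?S 0) 1"
      by (rule runs_PushI) (use s2 in \<open>auto simp: fun_eq_iff\<close>)
    let ?T = "1 + ((4 * 2 ^ f k + 1) + ((3 * 2 ^ f k + 1) + (3 * 2 ^ f k + 1)))"
    have 4: "runs (Loop (Nonempty 6) ?body) (?S 0) (?S (f k)) (f k * (?T + 1) + 1)"
    proof (rule runs_Loop)
      fix i assume i: "i < f k"
      let ?m = "2 ^ i :: nat"
      have m: "?m \<le> 2 ^ f k" using i by (intro power_increasing) auto
      let ?r = "replicate ?m True"
      let ?a = "(?S i)(6 := replicate (f k - Suc i) True)"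
      have p: "runs (Pop 6) (?S i) ?a 1"
        by (rule runs_PopI) (use i in \<open>auto simp: fun_eq_iff\<close>)
      let ?b = "?a(2 := [], 4 := ?r @ ?a 4, 5 := ?r @ ?a 5)"
      have q: "runs (mv2 2 4 5) ?a ?b (4 * ?m + 1)" by (rule runs_mv2) auto
      let ?c = "?b(4 := [], 2 := ?r @ ?b 2)"
      have r: "runs (mv 4 2) ?b ?c (3 * ?m + 1)" by (rule runs_mv) (use s2 in auto)
      let ?d = "?c(5 := [], 2 := ?r @ ?c 2)"
      have t: "runs (mv 5 2) ?c ?d (3 * ?m + 1)" by (rule runs_mv) (use s2 in auto)
      have "?d = ?S (Suc i)" using s2 by (auto simp: fun_eq_iff mult_2 replicate_add)
      then have "runs ?body (?S i) (?S (Suc i)) (1 + ((4 * ?m + 1) + ((3 * ?m + 1) + (3 * ?m + 1))))"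
        using runs_Seq[OF p runs_Seq[OF q runs_Seq[OF r t]]] by (simp only:)
      then show "runs ?body (?S i) (?S (Suc i)) ?T"
        by (rule runs_mono) (intro add_mono mult_le_mono2 m order_refl)
    qed auto
    let ?s5 = "(?S (f k))(2 := [], 1 := replicate (2 ^ f k) True @ ?S (f k) 1)"
    have 5: "runs (mv 2 1) (?S (f k)) ?s5 (3 * 2 ^ f k + 1)" by (rule runs_mv) auto
    have "\<exists>T. runs P ?s0 ?s5 T" unfolding P_def
      using runs_Seq[OF 1 runs_Seq[OF 2(1) runs_Seq[OF 3 runs_Seq[OF 4 5]]]] by blast
    moreover have "?s5 1 = replicate (2 ^ f k) True" using s2 by simp
    ultimately show ?thesis by blast
  qed
  then show ?thesis by (rule computableI)
qed

theorem fpt_reducible_polyred: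
  assumes "fpt_reducible Q Q1" "polyred Q1 Q2"
  shows "fpt_reducible Q Q2"
proof -
  obtain P f g c where fg: "computable f" "computable g" and P: "\<And>w k. \<exists>t s k'. exec P (start w k) t s \<and>
      t \<le> f k * (length w + 1) ^ c \<and> s 1 = replicate k' True \<and> k' \<le> g k \<and> ((w, k) \<in> Q \<longleftrightarrow> (s 0, k') \<in> Q1)"
    using assms(1) unfolding fpt_reducible_def by blast
  obtain R d where R: "\<And>w k. \<exists>s k'. runs R (start w k) s ((length w + k + 2) ^ d) \<and>
     s 1 = replicate k' True \<and> k' \<le> (k + 2) ^ d \<and> ((w, k) \<in> Q1 \<longleftrightarrow> (s 0, k') \<in> Q2)"
    using assms(2) unfolding polyred_def by blast
  obtain p where p: "\<And>r. r \<in> regs P \<Longrightarrow> r < p" using finite_regs[of P] unfolding finite_nat_set_iff_bounded by auto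
  \<comment> \<open>Registers 0 and 1 hand over word and parameter. All others are shifted past the
    registers of \<open>P\<close>, so they are still empty when the second program starts.\<close>
  define \<rho> where "\<rho> = (\<lambda>r. if r < 2 then r else r + p)"
  have inj: "inj \<rho>" unfolding \<rho>_def inj_def by auto
  \<comment> \<open>With \<open>X\<close> bounding both the first running time and the size of the
    intermediate instance, the second program takes at most \<open>X ^ d\<close> steps. The total is
    below \<open>2 * X ^ (d + 1)\<close>, hence below \<open>X ^ (d + 2)\<close>.\<close>
  define F where "F = (\<lambda>k. (f k + g k + 3) ^ (d + 2))"
  have F: "computable F" unfolding F_def by (rule computable_pow[OF fg])
  have "\<exists>t s k'. exec (Seq P (ren \<rho> R)) (start w k) t s \<and> t \<le> F k * (length w + 1) ^ ((c + 1) * (d + 2)) \<and>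
      s 1 = replicate k' True \<and> k' \<le> F k \<and> ((w, k) \<in> Q \<longleftrightarrow> (s 0, k') \<in> Q2)" for w k
  proof -
    let ?n = "length w"
    obtain t1 s1 k1 where 1: "exec P (start w k) t1 s1" "t1 \<le> f k * (?n + 1) ^ c"
      "s1 1 = replicate k1 True" "k1 \<le> g k" "(w, k) \<in> Q \<longleftrightarrow> (s1 0, k1) \<in> Q1" using P[of w k] by blast
    obtain s2 k2 where 2: "runs R (start (s1 0) k1) s2 ((length (s1 0) + k1 + 2) ^ d)"
      "s2 1 = replicate k2 True" "k2 \<le> (k1 + 2) ^ d" "(s1 0, k1) \<in> Q1 \<longleftrightarrow> (s2 0, k2) \<in> Q2" using R[of "s1 0" k1] by blast
    have "s1 (\<rho> r) = start (s1 0) k1 r" for r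
    proof (cases "r < 2")
      case True
      then have "r = 0 \<or> r = 1" by auto
      then show ?thesis using 1(3) by (auto simp: \<rho>_def start_def)
    next
      case False
      then have "\<rho> r \<notin> regs P" using p by (force simp: \<rho>_def)
      then have "s1 (\<rho> r) = start w k (\<rho> r)" using exec_frame[OF 1(1)] by blast
      then show ?thesis using False by (simp add: \<rho>_def start_def)
    qed
    then obtain s3 where 3: "runs (ren \<rho> R) s1 s3 ((length (s1 0) + k1 + 2) ^ d)" "\<And>r. s3 (\<rho> r) = s2 r"
      using runs_ren[OF 2(1) inj, of s1] by blast
    obtain t2 where t2: "exec (ren \<rho> R) s1 t2 s3" "t2 \<le> (length (s1 0) + k1 + 2) ^ d"
      using 3(1) unfolding runs_def by blast
    have s3: "s3 0 = s2 0" "s3 1 = s2 1" using 3(2)[of 0] 3(2)[of 1] by (auto simp: \<rho>_def)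
    let ?G = "f k + g k + 3"
    define E where "E = (?n + 1) ^ (c + 1)"
    define X where "X = ?G * E"
    have E1: "1 \<le> E" unfolding E_def by (rule one_le_power) simp
    have E2: "?n \<le> E" using self_le_power[of "?n + 1" "c + 1"] unfolding E_def by linarith
    have E3: "(?n + 1) ^ c \<le> E" unfolding E_def by (rule power_increasing) simp_all
    have t1: "t1 \<le> f k * E"
      by (rule order_trans[OF 1(2)]) (rule mult_le_mono2[OF E3])
    have "length (s1 0) \<le> ?n + t1" using exec_length[OF 1(1), of 0] by (simp add: start_def)
    moreover have "g k + 2 \<le> (g k + 2) * E"
      using mult_le_mono2[OF E1, of "g k + 2"] by simp
    ultimately have "length (s1 0) + k1 + 2 \<le> 1 * E + f k * E + (g k + 2) * E"
      using t1 1(4) E2 by linarith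
    also have "\<dots> = X" by (simp add: X_def algebra_simps)
    finally have X: "length (s1 0) + k1 + 2 \<le> X" .
    have G: "3 \<le> X" using mult_le_mono[of 3 ?G 1 E] E1 unfolding X_def by linarith
    have "t1 \<le> X" unfolding X_def by (rule order_trans[OF t1]) (rule mult_le_mono1, simp)
    moreover have "X \<le> X ^ (d + 1)" by (rule self_le_power) (use G in linarith, simp)
    moreover have "t2 \<le> X ^ d" using t2(2) power_mono[OF X, of d] by linarith
    moreover have "X ^ d \<le> X ^ (d + 1)" by (rule power_increasing) (simp, use G in linarith)
    ultimately have "t1 + t2 \<le> 2 * X ^ (d + 1)" by linarith
    also have "\<dots> \<le> X * X ^ (d + 1)" by (rule mult_le_mono1) (use G in linarith)
    also have "\<dots> = F k * (?n + 1) ^ ((c + 1) * (d + 2))"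
    proof -
      have "X * X ^ (d + 1) = X ^ (d + 2)" by simp
      then show ?thesis by (simp only: F_def X_def E_def power_mult power_mult_distrib)
    qed
    finally have t: "t1 + t2 \<le> F k * (?n + 1) ^ ((c + 1) * (d + 2))" .
    have "k2 \<le> ?G ^ d" using 2(3) power_mono[of "k1 + 2" ?G d] 1(4) by linarith
    also have "\<dots> \<le> F k" unfolding F_def by (rule power_increasing) auto
    finally have k2: "k2 \<le> F k" .
    show ?thesis
      by (rule exI[of _ "t1 + t2"], rule exI[of _ s3], rule exI[of _ k2], intro conjI exec.Seq[OF 1(1) t2(1)] t k2)
        (simp_all only: s3 2(2,4) 1(5))
  qed
  then have "computable F \<and> computable F \<and> (\<forall>w k. \<exists>t s k'. exec (Seq P (ren \<rho> R)) (start w k) t s \<and>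
      t \<le> F k * (length w + 1) ^ ((c + 1) * (d + 2)) \<and>
      s 1 = replicate k' True \<and> k' \<le> F k \<and> ((w, k) \<in> Q \<longleftrightarrow> (s 0, k') \<in> Q2))"
    using F by simp
  then show ?thesis unfolding fpt_reducible_def by - (rule exI, rule exI, rule exI, rule exI)
qed

section \<open>Solutions of the pattern ae on a graph\<close>

lemma pigeonhole_many:
  assumes "finite A" "finite B" "\<And>a. a \<in> A \<Longrightarrow> f a \<in> B" "card B * m < card A"
  obtains b where "b \<in> B" "m < card {a \<in> A. f a = b}"
proof -
  have "\<exists>b\<in>B. m < card {a \<in> A. f a = b}"
  proof (rule ccontr)
    assume "\<not> ?thesis"
    then have *: "\<And>b. b \<in> B \<Longrightarrow> card {a \<in> A. f a = b} \<le> m" by (auto simp: not_less)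
    have "card A \<le> card (\<Union>b\<in>B. {a \<in> A. f a = b})"
      by (rule card_mono) (use assms in auto)
    also have "\<dots> \<le> (\<Sum>b\<in>B. card {a \<in> A. f a = b})" by (rule card_UN_le[OF assms(2)])
    also have "\<dots> \<le> (\<Sum>b\<in>B. m)" by (rule sum_mono) (rule *)
    finally show False using assms(4) by simp
  qed
  then show ?thesis using that by blast
qed

lemma max_card_set:
  assumes "P C0" "finite V" "\<And>C. P C \<Longrightarrow> C \<subseteq> V"
  shows "\<exists>C. P C \<and> (\<forall>C'. P C' \<longrightarrow> card C' \<le> card C)"
proof -
  have "\<forall>C. P C \<longrightarrow> card C < Suc (card V)"
    using assms card_mono by (metis less_Suc_eq_le)
  from ex_has_greatest_nat[of P C0 card, OF assms(1) this] show ?thesis .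
qed

section \<open>Red and blue neighbours: domination arguments\<close>

locale grph =
  fixes V :: "nat set" and R :: "nat \<Rightarrow> nat \<Rightarrow> bool"
  assumes fin [simp]: "finite V" and sym: "R x y \<Longrightarrow> R y x" and irr [simp]: "\<not> R x x"
begin

lemma finS: "A \<subseteq> V \<Longrightarrow> finite A" by (rule finite_subset[OF _ fin])

text \<open>Adjacent pairs are thought of as red and non-adjacent ones as blue; exchanging the
  colours is complementation.\<close>

definition B :: "nat \<Rightarrow> nat \<Rightarrow> bool" where "B x y \<longleftrightarrow> x \<noteq> y \<and> \<not> R x y"

lemma B_sym: "B x y \<Longrightarrow> B y x" using sym by (auto simp: B_def)

text \<open>Take a largest \<open>C\<close> all of whose vertices have a neighbour in
  \<open>W - C\<close>. A vertex outside without a neighbour in \<open>C\<close> could be added, so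
  both parts dominate each other and the larger one may be taken.\<close>

lemma dominating_partition:
  assumes "W \<subseteq> V" "\<And>w. w \<in> W \<Longrightarrow> \<exists>y\<in>W. R w y"
  obtains C where "C \<subseteq> W" "card W \<le> 2 * card C" "\<And>c. c \<in> C \<Longrightarrow> \<exists>d\<in>W - C. R c d"
    "\<And>d. d \<in> W - C \<Longrightarrow> \<exists>c\<in>C. R d c"
proof -
  have fW: "finite W" using assms(1) finS by auto
  let ?P = "\<lambda>C. C \<subseteq> W \<and> (\<forall>c\<in>C. \<exists>d\<in>W - C. R c d)"
  have P0: "?P {}" and sub: "\<And>C. ?P C \<Longrightarrow> C \<subseteq> W" by auto
  obtain C where CM: "?P C \<and> (\<forall>C'. ?P C' \<longrightarrow> card C' \<le> card C)"
    using max_card_set[of ?P, OF P0 fW sub] by (rule exE)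
  note C = CM[THEN conjunct1] and mx = CM[THEN conjunct2, THEN spec, THEN mp]
  have d: "\<exists>c\<in>C. R d c" if dW: "d \<in> W - C" for d
  proof (rule ccontr)
    assume n: "\<not> ?thesis"
    obtain y where y: "y \<in> W" "R d y" using assms(2) dW by auto
    have "?P (insert d C)"
    proof (intro conjI ballI)
      show "insert d C \<subseteq> W" using dW C by auto
      fix c assume "c \<in> insert d C"
      then show "\<exists>x\<in>W - insert d C. R c x"
      proof
        assume "c = d" then show ?thesis using y n irr by (metis DiffI insertE)
      next
        assume "c \<in> C"
        then obtain x where "x \<in> W - C" "R c x" using C by auto
        moreover have "x \<noteq> d" using n \<open>c \<in> C\<close> \<open>R c x\<close> sym by blast
        ultimately show ?thesis by auto
      qed
    qed
    from mx[OF this] have "card (insert d C) \<le> card C" .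
    moreover have "finite C" "d \<notin> C" using C fW finite_subset dW by auto
    ultimately show False by simp
  qed
  show ?thesis
  proof (cases "card W \<le> 2 * card C")
    case True
    show ?thesis by (rule that[of C]) (use True C d in auto)
  next
    case False
    have "card (W - C) = card W - card C" by (rule card_Diff_subset) (use C fW finite_subset in auto)
    moreover have "card C \<le> card W" using C fW card_mono by auto
    ultimately have "card W \<le> 2 * card (W - C)" using False by linarith
    moreover have "W - (W - C) = C" using C by auto
    ultimately show ?thesis by (intro that[of "W - C"]) (use C d in auto)
  qed
qed

text \<open>Every vertex keeps a neighbour outside of \<open>C\<close>. A maximal \<open>C\<close> that is small leaves almost only
  pairs of mutually private neighbours; two such pairs hanging on the same \<open>c \<in> C\<close> allow to trade
  \<open>c\<close> for one vertex of each pair.\<close>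

lemma total_dominating:
  assumes "\<And>v. v \<in> V \<Longrightarrow> \<exists>y\<in>V. R v y"
    and noK2: "\<And>u v. u \<in> V \<Longrightarrow> v \<in> V \<Longrightarrow> R u v \<Longrightarrow> \<exists>y\<in>V. (R u y \<and> y \<noteq> v) \<or> (R v y \<and> y \<noteq> u)"
    and "5 * k + 3 \<le> card V"
  obtains C where "C \<subseteq> V" "k \<le> card C" "\<And>v. v \<in> V \<Longrightarrow> \<exists>y\<in>V - C. R v y"
proof -
  let ?P = "\<lambda>C. C \<subseteq> V \<and> (\<forall>v\<in>V. \<exists>y\<in>V - C. R v y)"
  have P0: "?P {}" and sub: "\<And>C. ?P C \<Longrightarrow> C \<subseteq> V" using assms(1) by auto
  obtain C where CM: "?P C \<and> (\<forall>C'. ?P C' \<longrightarrow> card C' \<le> card C)"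
    using max_card_set[of ?P, OF P0 fin sub] by (rule exE)
  note C = CM[THEN conjunct1] and mx = CM[THEN conjunct2, THEN spec, THEN mp]
  show ?thesis
  proof (cases "k \<le> card C")
    case True
    show ?thesis by (rule that[of C]) (use True C in auto)
  next
    case False
    define D where "D = V - C"
    have fC: "finite C" and fD: "finite D" using C finS by (auto simp: D_def)
    have VCD: "V = C \<union> D" "C \<inter> D = {}" using C by (auto simp: D_def)
    have cardD: "card V = card C + card D" unfolding VCD(1) by (rule card_Un_disjoint) (use fC fD VCD in auto)
    have "\<forall>x\<in>V. \<exists>y. y \<in> D \<and> R x y" using C by (auto simp: D_def)
    then obtain r where r: "\<And>x. x \<in> V \<Longrightarrow> r x \<in> D \<and> R x (r x)" by metis
    \<comment> \<open>The vertices of \<open>D\<close> chosen as supports for elements of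
      \<open>C\<close>. Adding any other \<open>y\<close> to \<open>C\<close> can only hurt a vertex
      of \<open>D\<close> that has \<open>y\<close> as its only neighbour in
      \<open>D\<close>.\<close>
    define crit where "crit = r ` C"
    have crit: "finite crit" "card crit \<le> card C" unfolding crit_def using fC card_image_le by auto
    have "\<exists>v. v \<in> D \<and> (\<forall>z\<in>D. R v z \<longleftrightarrow> z = y)" if y: "y \<in> D - crit" for y
    proof (rule ccontr)
      assume n: "\<not> ?thesis"
      have "?P (insert y C)"
      proof (intro conjI ballI)
        show "insert y C \<subseteq> V" using y C by (auto simp: D_def)
        fix v assume v: "v \<in> V"
        show "\<exists>x\<in>V - insert y C. R v x"
        proof (cases "v \<in> C")
          case True
          then have "r v \<in> crit" by (auto simp: crit_def)
          then show ?thesis using r[OF v] y by (auto simp: D_def)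
        next
          case False
          then have "v \<in> D" using v by (auto simp: D_def)
          then have "\<not> (\<forall>z\<in>D. R v z \<longleftrightarrow> z = y)" using n by auto
          then have "\<exists>z\<in>D. R v z \<and> z \<noteq> y" using r[OF v] by metis
          then show ?thesis by (auto simp: D_def)
        qed
      qed
      from mx[OF this] have "card (insert y C) \<le> card C" .
      moreover have "y \<notin> C" using y by (auto simp: D_def)
      ultimately show False using fC by simp
    qed
    then obtain p where p: "\<And>y. y \<in> D - crit \<Longrightarrow> p y \<in> D \<and> (\<forall>z\<in>D. R (p y) z \<longleftrightarrow> z = y)" by metis
    have injp: "inj_on p (D - crit)"
    proof (rule inj_onI)
      fix a b assume ab: "a \<in> D - crit" "b \<in> D - crit" "p a = p b"
      have "R (p a) a" using p[OF ab(1)] ab(1) by auto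
      then show "a = b" using p[OF ab(2)] ab by auto
    qed
    \<comment> \<open>On \<open>P\<close> the map \<open>p\<close> is an involution:
      \<open>y\<close> and \<open>p y\<close> are each other's only neighbour in \<open>D\<close>.
      Of the \<open>5 * k + 3\<close> vertices fewer than \<open>3 * k\<close> are lost on the way,
      to \<open>C\<close> and twice to \<open>crit\<close>.\<close>
    define P where "P = {y \<in> D - crit. p y \<notin> crit}"
    have fP: "finite P" using fD by (auto simp: P_def)
    have "card (D - crit) \<le> card P + card crit"
    proof -
      have "card (D - crit) \<le> card (P \<union> {y \<in> D - crit. p y \<in> crit})" by (rule card_mono) (use fD in \<open>auto simp: P_def\<close>)
      also have "\<dots> \<le> card P + card {y \<in> D - crit. p y \<in> crit}" by (rule card_Un_le)
      also have "card {y \<in> D - crit. p y \<in> crit} \<le> card crit"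
        by (rule card_inj_on_le[of p]) (use injp crit in \<open>auto intro: inj_on_subset\<close>)
      finally show ?thesis by simp
    qed
    moreover have "card D \<le> card (D - crit) + card crit"
      using card_Un_le[of "D - crit" crit] card_mono[of "(D - crit) \<union> crit" D] fD crit by fastforce
    ultimately have cP: "2 * k + 3 \<le> card P" using cardD assms(3) crit(2) False by linarith
    have pP: "p y \<in> P \<and> p (p y) = y \<and> (\<forall>z\<in>D. R y z \<longleftrightarrow> z = p y)" if "y \<in> P" for y
    proof -
      have y: "y \<in> D - crit" "p y \<notin> crit" using that by (auto simp: P_def)
      have 1: "p y \<in> D - crit" using p[OF y(1)] y(2) by auto
      have "R (p (p y)) (p y)" using p[OF 1] 1 by blast
      then have "R (p y) (p (p y))" by (rule sym)
      then have "p (p y) = y" using p[OF y(1)] p[OF 1] by auto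
      then show ?thesis using p[OF 1] 1 y by (auto simp: P_def)
    qed
    define N where "N = {y \<in> P. \<exists>c\<in>C. R y c}"
    \<comment> \<open>One vertex with a neighbour in \<open>C\<close> from each pair;
      \<open>noK2\<close> says that there is one, since the pair is not a component by itself. There
      are more pairs than elements of \<open>C\<close>, so two vertices of \<open>A0\<close> hang on
      the same \<open>c\<close>.\<close>
    define A0 where "A0 = {y \<in> N. p y \<in> N \<longrightarrow> y < p y}"
    have fA0: "finite A0" using fP by (auto simp: A0_def N_def)
    have neq: "p y \<noteq> y" if "y \<in> P" for y using pP[OF that] that irr by (auto simp: P_def)
    have A0P: "A0 \<subseteq> P" by (auto simp: A0_def N_def)
    have disj: "p y \<notin> A0" if "y \<in> A0" for y
      using that pP A0P by (auto simp: A0_def N_def)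
    have "P \<subseteq> A0 \<union> p ` A0"
    proof
      fix y assume y: "y \<in> P"
      have yV: "y \<in> V" "p y \<in> V" using y pP[OF y] by (auto simp: P_def D_def)
      have "R y (p y)" using pP[OF y] y p by (auto simp: P_def)
      from noK2[OF yV this] obtain z where z: "z \<in> V" "R y z \<and> z \<noteq> p y \<or> R (p y) z \<and> z \<noteq> y" by blast
      have "z \<in> C"
      proof (rule ccontr)
        assume "z \<notin> C" then have "z \<in> D" using z by (auto simp: D_def)
        then show False using z(2) pP[OF y] pP[of "p y"] by metis
      qed
      then have N: "y \<in> N \<or> p y \<in> N" using z(2) pP[OF y] y by (auto simp: N_def)
      have pp: "p (p y) = y" using pP[OF y] by simp
      have ii: "y \<in> p ` A0" if "p y \<in> A0" using that pp by (metis imageI)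
      show "y \<in> A0 \<union> p ` A0"
        using N neq[OF y] pp ii unfolding A0_def by (cases "y < p y") auto
    qed
    then have "card P \<le> card (A0 \<union> p ` A0)" by (rule card_mono[rotated]) (use fA0 in auto)
    also have "\<dots> \<le> card A0 + card A0"
      using card_Un_le[of A0 "p ` A0"] card_image_le[OF fA0, of p] by linarith
    finally have "card C * 1 < card A0" using cP False by linarith
    moreover have "\<forall>y\<in>A0. \<exists>c. c \<in> C \<and> R y c" by (auto simp: A0_def N_def)
    then obtain \<kappa> where \<kappa>: "\<And>y. y \<in> A0 \<Longrightarrow> \<kappa> y \<in> C \<and> R y (\<kappa> y)" by metis
    ultimately obtain c where c: "c \<in> C" "1 < card {y \<in> A0. \<kappa> y = c}"
      using pigeonhole_many[OF fA0 fC, of \<kappa> 1] by blast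
    define A where "A = {y \<in> A0. \<kappa> y = c}"
    have A: "A \<subseteq> A0" "\<And>y. y \<in> A \<Longrightarrow> R y c" "1 < card A" using c \<kappa> by (auto simp: A_def)
    have fA: "finite A" using A(1) fA0 finite_subset by auto
    have pA: "p ` A \<subseteq> D - crit" using A(1) A0P pP by (fastforce simp: P_def)
    have cc: "c \<notin> p ` A" using pA c by (auto simp: D_def)
    \<comment> \<open>The trade: \<open>c\<close> leaves and the partners of \<open>A\<close> enter.
      Now \<open>c\<close> supports \<open>A\<close>, and each vertex of \<open>A\<close> supports
      its partner. The gain is at least one, as \<open>A\<close> has two elements or more.\<close>
    let ?C = "(C - {c}) \<union> p ` A"
    have "?P ?C"
    proof (intro conjI ballI)
      show "?C \<subseteq> V" using C pA by (auto simp: D_def)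
      fix v assume v: "v \<in> V"
      consider "v \<in> C" | "v \<in> A" | y where "y \<in> A" "v = p y" | "v \<in> D" "v \<notin> A" "v \<notin> p ` A"
        using v VCD by auto
      then show "\<exists>y\<in>V - ?C. R v y"
      proof cases
        case 1
        then have "r v \<in> crit" by (auto simp: crit_def)
        then have "r v \<notin> ?C" using pA r[OF v] by (auto simp: D_def)
        then show ?thesis using r[OF v] by (auto simp: D_def)
      next
        case 2
        then show ?thesis using A(2) cc c C by blast
      next
        case (3 y)
        have yP: "y \<in> P" using 3 A A0P by auto
        have "y \<notin> p ` A" using disj A(1) pP A0P 3(1) by (metis imageE subsetD)
        moreover have "y \<in> D" using yP by (auto simp: P_def)
        moreover have "R v y" using p[of y] yP 3 by (auto simp: P_def)
        ultimately show ?thesis by (auto simp: D_def)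
      next
        case 4
        have "r v \<notin> p ` A"
        proof
          assume "r v \<in> p ` A"
          then obtain y where y: "y \<in> A" "r v = p y" by auto
          then have "R (p y) v" using r[OF v] sym by auto
          then have "v = y" using p[of y] y A A0P 4 by (auto simp: P_def)
          then show False using 4 y by auto
        qed
        then show ?thesis using r[OF v] by (auto simp: D_def)
      qed
    qed
    from mx[OF this] have "card ?C \<le> card C" .
    moreover have "card ?C = card (C - {c}) + card (p ` A)"
      by (rule card_Un_disjoint) (use fC fA pA in \<open>auto simp: D_def\<close>)
    moreover have "card (p ` A) = card A"
      by (rule card_image) (rule inj_on_subset[OF injp], use A A0P in \<open>auto simp: P_def\<close>)
    moreover have "card (C - {c}) = card C - 1" "card C > 0" using c fC by (auto simp: card_gt_0_iff)
    ultimately show ?thesis using A(3) by linarith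
  qed
qed

text \<open>A largest \<open>C\<close> that is small leaves, apart from few exceptions, vertices
  that are blue to all the rest of \<open>D\<close>. Their red neighbours lie in \<open>C\<close>,
  so more than \<open>2 * k + 1\<close> of them share one red neighbour \<open>c\<close>, and these,
  without at most \<open>k + 1\<close> of them, form a solution from scratch.\<close>

lemma blue_total_dominating:
  assumes red: "\<And>v. v \<in> V \<Longrightarrow> \<exists>y\<in>V. R v y" and blue: "\<And>v. v \<in> V \<Longrightarrow> \<exists>y\<in>V. B v y"
    and card: "2 * k * k + 5 * k + 5 \<le> card V"
  obtains C where "C \<subseteq> V" "k \<le> card C" "\<And>c. c \<in> C \<Longrightarrow> \<exists>d\<in>V - C. R c d"
    "\<And>d. d \<in> V - C \<Longrightarrow> \<exists>y\<in>V - C. B d y"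
proof -
  let ?P = "\<lambda>C. C \<subseteq> V \<and> (\<forall>c\<in>C. \<exists>d\<in>V - C. R c d) \<and> (\<forall>d\<in>V - C. \<exists>y\<in>V - C. B d y)"
  have P0: "?P {}" and sub: "\<And>C. ?P C \<Longrightarrow> C \<subseteq> V" using blue by auto
  obtain C where CM: "?P C \<and> (\<forall>C'. ?P C' \<longrightarrow> card C' \<le> card C)"
    using max_card_set[of ?P, OF P0 fin sub] by (rule exE)
  note C = CM[THEN conjunct1] and mx = CM[THEN conjunct2, THEN spec, THEN mp]
  show ?thesis
  proof (cases "k \<le> card C")
    case True
    show ?thesis by (rule that[of C]) (use True C in auto)
  next
    case False
    define D where "D = V - C"
    have fC: "finite C" and fD: "finite D" using C finS by (auto simp: D_def)
    have VCD: "V = C \<union> D" "C \<inter> D = {}" using C by (auto simp: D_def)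
    have cardD: "card V = card C + card D" unfolding VCD(1) by (rule card_Un_disjoint) (use fC fD VCD in auto)
    have "\<forall>x\<in>C. \<exists>y. y \<in> D \<and> R x y" using C by (auto simp: D_def)
    then obtain r where r: "\<And>x. x \<in> C \<Longrightarrow> r x \<in> D \<and> R x (r x)" by metis
    have dB: "\<exists>y\<in>D. B d y" if "d \<in> D" for d using C that by (auto simp: D_def)
    define crit where "crit = r ` C"
    have crit: "finite crit" "card crit \<le> card C" unfolding crit_def using fC card_image_le by auto
    \<comment> \<open>No nonempty set of non-critical vertices can be moved to \<open>C\<close> as a
      whole without breaking a condition.\<close>
    have grow: False if M: "M \<subseteq> D - crit" "M \<noteq> {}" "\<And>m. m \<in> M \<Longrightarrow> \<exists>d\<in>D - M. R m d"
      "\<And>d. d \<in> D - M \<Longrightarrow> \<exists>y\<in>D - M. B d y" for M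
    proof -
      have e: "V - (C \<union> M) = D - M" by (auto simp: D_def)
      have "?P (C \<union> M)" unfolding e
      proof (intro conjI ballI)
        show "C \<union> M \<subseteq> V" using C M(1) by (auto simp: D_def)
        fix c assume "c \<in> C \<union> M"
        then show "\<exists>d\<in>D - M. R c d"
        proof
          assume "c \<in> C"
          then have "r c \<in> crit" by (auto simp: crit_def)
          then show ?thesis using r[OF \<open>c \<in> C\<close>] M(1) by blast
        qed (rule M(3))
      qed (rule M(4))
      from mx[OF this] have "card (C \<union> M) \<le> card C" .
      moreover have "card (C \<union> M) = card C + card M"
        by (rule card_Un_disjoint) (use fC finite_subset[OF M(1)] fD M(1) in \<open>auto simp: D_def\<close>)
      moreover have "card M \<noteq> 0" using M(1,2) fD finite_subset by (metis card_0_eq finite_Diff)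
      ultimately show False by simp
    qed
    have D5: "4 < card D" using cardD card False by linarith
    have ex3: "\<exists>z\<in>D. z \<noteq> a \<and> z \<noteq> b" for a b
    proof (rule ccontr)
      assume "\<not> ?thesis" then have "D \<subseteq> {a, b}" by auto
      then have "card D \<le> card {a, b}" by (rule card_mono[rotated]) simp
      also have "\<dots> \<le> 2" by (simp add: card_insert_if)
      finally show False using D5 by simp
    qed
    \<comment> \<open>A non-critical \<open>d\<close> whose only blue neighbour in \<open>D\<close>
      is a non-critical \<open>y\<close> could be moved to \<open>C\<close>: alone if
      \<open>y\<close> has a further blue neighbour, and otherwise together with \<open>y\<close>.
      Since \<open>D\<close> has more than four vertices, some third vertex supports them by red
      edges.\<close>
    have priv: False if y: "y \<in> D - crit" and d: "d \<in> D - crit" and yd: "\<And>z. z \<in> D \<Longrightarrow> B d z \<longleftrightarrow> z = y" for y d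
    proof (cases "\<exists>e\<in>D. e \<noteq> d \<and> B y e")
      case True
      then obtain e where e: "e \<in> D" "e \<noteq> d" "B y e" by auto
      show False
      proof (rule grow[of "{d}"])
        fix m assume "m \<in> {d}"
        obtain z where "z \<in> D" "z \<noteq> y" "z \<noteq> d" using ex3 by blast
        then show "\<exists>x\<in>D - {d}. R m x" using yd[of z] \<open>m \<in> {d}\<close> by (auto simp: B_def)
      next
        fix x assume x: "x \<in> D - {d}"
        show "\<exists>z\<in>D - {d}. B x z"
        proof (cases "x = y")
          case True then show ?thesis using e by auto
        next
          case False
          then have "\<not> B x d" using yd[of x] x B_sym[of x d] by auto
          then show ?thesis using dB[of x] x by blast
        qed
      qed (use d in auto)
    next
      case False
      have dy: "d \<noteq> y" "B d y" using yd[of y] y by (auto simp: B_def)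
      have By: "B y z \<longleftrightarrow> z = d" if "z \<in> D" for z using False B_sym[OF dy(2)] that by auto
      show False
      proof (rule grow[of "{d, y}"])
        fix m assume m: "m \<in> {d, y}"
        obtain z where "z \<in> D" "z \<noteq> y" "z \<noteq> d" using ex3 by blast
        then show "\<exists>x\<in>D - {d, y}. R m x" using yd[of z] By[of z] m by (auto simp: B_def)
      next
        fix x assume x: "x \<in> D - {d, y}"
        then have "\<not> B x d" "\<not> B x y" using yd[of x] By[of x] B_sym[of x d] B_sym[of x y] by auto
        then show "\<exists>z\<in>D - {d, y}. B x z" using dB[of x] x by blast
      qed (use d y in auto)
    qed
    \<comment> \<open>A vertex of \<open>D1\<close> has a red support in \<open>D\<close>; it can
      only be kept out of \<open>C\<close> by being the only blue neighbour of some vertex, which is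
      critical by \<open>priv\<close>. Distinct vertices block distinct critical ones, so
      \<open>D1\<close> is no larger than \<open>crit\<close>.\<close>
    define D1 where "D1 = {y \<in> D - crit. \<exists>d\<in>D. R y d}"
    have "\<exists>d. d \<in> crit \<and> d \<in> D \<and> (\<forall>z\<in>D. B d z \<longleftrightarrow> z = y)" if y: "y \<in> D1" for y
    proof (rule ccontr)
      assume n: "\<not> ?thesis"
      obtain w where w: "w \<in> D" "R y w" using y by (auto simp: D1_def)
      show False
      proof (rule grow[of "{y}"])
        fix m assume "m \<in> {y}" then show "\<exists>d\<in>D - {y}. R m d" using w by (metis DiffI irr singletonD)
      next
        fix d assume d: "d \<in> D - {y}"
        show "\<exists>z\<in>D - {y}. B d z"
        proof (rule ccontr)
          assume "\<not> ?thesis"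
          then have "\<And>z. z \<in> D \<Longrightarrow> B d z \<longleftrightarrow> z = y" using dB[of d] d by blast
          then show False using n priv[of y d] d y by (auto simp: D1_def)
        qed
      qed (use y in \<open>auto simp: D1_def\<close>)
    qed
    then obtain q where q: "\<And>y. y \<in> D1 \<Longrightarrow> q y \<in> crit \<and> q y \<in> D \<and> (\<forall>z\<in>D. B (q y) z \<longleftrightarrow> z = y)" by metis
    have "inj_on q D1"
    proof (rule inj_onI)
      fix a b assume ab: "a \<in> D1" "b \<in> D1" "q a = q b"
      have "B (q a) a" using q[OF ab(1)] ab(1) by (auto simp: D1_def)
      then show "a = b" using q[OF ab(2)] ab by (auto simp: D1_def)
    qed
    then have cD1: "card D1 \<le> card crit" by (rule card_inj_on_le) (use q crit in auto)
    define D2 where "D2 = {y \<in> D - crit. \<forall>d\<in>D. \<not> R y d}"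
    have fD2: "finite D2" using fD by (auto simp: D2_def)
    have "D = D1 \<union> D2 \<union> (crit \<inter> D)" by (auto simp: D1_def D2_def)
    then have "card D \<le> card (D1 \<union> D2) + card (crit \<inter> D)" using card_Un_le by metis
    also have "\<dots> \<le> card D1 + card D2 + card crit"
      using card_Un_le[of D1 D2] card_mono[of crit "crit \<inter> D"] crit(1) by auto
    finally have "card D \<le> 2 * card C + card D2" using cD1 crit by linarith
    then have "2 * k * k + 2 * k \<le> card D2" using card cardD False by linarith
    moreover have "card C * (2 * k + 1) < 2 * k * k + 2 * k"
    proof -
      have "card C * (2 * k + 1) \<le> (k - 1) * (2 * k + 1)" by (rule mult_le_mono1) (use False in linarith)
      also have "\<dots> < 2 * k * k + 2 * k" using False by (cases k) (auto simp: algebra_simps)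
      finally show ?thesis .
    qed
    ultimately have big: "card C * (2 * k + 1) < card D2" by linarith
    have "\<forall>y\<in>D2. \<exists>c. c \<in> C \<and> R y c"
    proof
      fix y assume y: "y \<in> D2"
      then obtain x where "x \<in> V" "R y x" using red[of y] by (auto simp: D2_def D_def)
      then show "\<exists>c. c \<in> C \<and> R y c" using y VCD by (auto simp: D2_def)
    qed
    then obtain \<kappa> where \<kappa>: "\<And>y. y \<in> D2 \<Longrightarrow> \<kappa> y \<in> C \<and> R y (\<kappa> y)" by metis
    obtain c where c: "c \<in> C" "2 * k + 1 < card {y \<in> D2. \<kappa> y = c}"
      using pigeonhole_many[OF fD2 fC _ big, of \<kappa>] \<kappa> by blast
    define L where "L = {y \<in> D2. \<kappa> y = c}"
    have L: "L \<subseteq> D2" "\<And>y. y \<in> L \<Longrightarrow> R y c" "2 * k + 1 < card L" using c \<kappa> by (auto simp: L_def)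
    have fL: "finite L" using L(1) fD2 finite_subset by auto
    obtain b where b: "\<And>v. v \<in> V \<Longrightarrow> b v \<in> V \<and> B v (b v)" using blue by metis
    have "\<exists>l0 l1. l0 \<in> L \<and> l1 \<in> L \<and> l0 \<noteq> l1"
    proof (rule ccontr)
      assume n: "\<not> ?thesis"
      then obtain l where "L \<subseteq> {l}" by blast
      then have "card L \<le> card {l}" by (rule card_mono[rotated]) simp
      then show False using L(3) by simp
    qed
    then obtain l0 l1 where l: "l0 \<in> L" "l1 \<in> L" "l0 \<noteq> l1" by blast
    \<comment> \<open>Kept outside are blue partners for the old \<open>C\<close>, and
      \<open>l0\<close> and \<open>l1\<close>, which are red to nothing in \<open>D\<close>: every
      vertex of \<open>D\<close> differs from one of the two and is blue to it.\<close>
    let ?C = "L - (b ` C \<union> {l0, l1})"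
    have LD: "L \<subseteq> D" using L(1) by (auto simp: D2_def)
    have cV: "c \<in> V - ?C" using c C LD VCD by blast
    have P: "?P ?C"
    proof (intro conjI ballI)
      show "?C \<subseteq> V" using LD by (auto simp: D_def)
    next
      fix x assume "x \<in> ?C"
      then have "R x c" using L(2) by auto
      then show "\<exists>d\<in>V - ?C. R x d" using cV by blast
    next
      fix d assume d: "d \<in> V - ?C"
      show "\<exists>y\<in>V - ?C. B d y"
      proof (cases "d \<in> C")
        case True
        then show ?thesis using b[of d] d by blast
      next
        case False
        then have dD: "d \<in> D" using d by (auto simp: D_def)
        have "B d l0 \<or> B d l1"
        proof -
          have "\<not> R d l0" "\<not> R d l1" using l L(1) dD sym[of d] unfolding D2_def by blast+
          then show ?thesis using l(3) unfolding B_def by auto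
        qed
        then show ?thesis using l LD by (auto simp: D_def)
      qed
    qed
    have "card (b ` C \<union> {l0, l1}) \<le> card (b ` C) + card {l0, l1}" by (rule card_Un_le)
    also have "\<dots> \<le> card C + 2" using card_image_le[OF fC, of b] by (simp add: card_insert_if)
    finally have "card L \<le> card ?C + (card C + 2)"
      using diff_card_le_card_Diff[of "b ` C \<union> {l0, l1}" L] fC by simp
    then have "k \<le> card ?C" using L(3) False by linarith
    then show ?thesis by (intro that[of ?C]) (use P in auto)
  qed
qed

subsection \<open>Self-supporting pairs\<close>

text \<open>A solution on part of the vertices, for the case in which the inside needs a red
  neighbour outside and the outside a blue neighbour inside.\<close>

definition sp :: "nat set \<Rightarrow> nat set \<Rightarrow> bool" where
  "sp C D \<longleftrightarrow> C \<subseteq> V \<and> D \<subseteq> V \<and> C \<inter> D = {} \<and> (\<forall>c\<in>C. \<exists>d\<in>D. R c d) \<and> (\<forall>d\<in>D. \<exists>c\<in>C. B d c)"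

lemma spI:
  assumes "C \<subseteq> V" "D \<subseteq> V" "C \<inter> D = {}" "\<And>c. c \<in> C \<Longrightarrow> \<exists>d\<in>D. R c d" "\<And>d. d \<in> D \<Longrightarrow> \<exists>c\<in>C. B d c"
  shows "sp C D"
  unfolding sp_def using assms by auto

text \<open>A smallest nonempty subset closed under the map is mapped onto itself, since its image
  is closed too.\<close>

lemma closed_subset:
  assumes "finite C" "C \<noteq> {}" "\<And>x. x \<in> C \<Longrightarrow> \<phi> x \<in> C"
  obtains A where "A \<subseteq> C" "A \<noteq> {}" "\<phi> ` A = A"
proof -
  let ?P = "\<lambda>A. A \<subseteq> C \<and> A \<noteq> {} \<and> \<phi> ` A \<subseteq> A"
  have P0: "?P C" using assms by auto
  obtain A where AM: "?P A \<and> (\<forall>A'. ?P A' \<longrightarrow> card A \<le> card A')"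
    using ex_has_least_nat[of ?P C card, OF P0] by (rule exE)
  note A = AM[THEN conjunct1] AM[THEN conjunct2, THEN spec, THEN mp]
  have "?P (\<phi> ` A)" using A(1) by (auto simp: image_mono)
  from A(2)[OF this] have "card A \<le> card (\<phi> ` A)" .
  moreover have "finite A" using A(1) assms(1) finite_subset by auto
  ultimately have "\<phi> ` A = A" using A(1) by (intro card_seteq) auto
  then show ?thesis using A(1) by (intro that[of A]) auto
qed

text \<open>A stuck vertex \<open>t\<close> is red to all of \<open>C\<close> and blue to all of \<open>D\<close>. If some \<open>x \<in> C\<close> is blue to another
  vertex of \<open>C\<close>, then \<open>t\<close> replaces \<open>x\<close>, which moves to \<open>D\<close>. Otherwise \<open>C\<close> is a red clique, and
  reversing an alternating cycle makes room for \<open>t\<close>.\<close>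

lemma sp_extend:
  assumes "sp C0 D0" "C0 \<noteq> {}"
  obtains C where "sp C (V - C)" "card C0 \<le> card C"
proof -
  let ?Q = "\<lambda>(C, D). sp C D \<and> card C0 \<le> card C"
  have "\<forall>X. ?Q X \<longrightarrow> card (fst X \<union> snd X) < Suc (card V)"
    by (auto simp: sp_def less_Suc_eq_le intro!: card_mono)
  moreover have "?Q (C0, D0)" using assms by simp
  ultimately obtain X where X: "?Q X" "\<And>Y. ?Q Y \<Longrightarrow> card (fst Y \<union> snd Y) \<le> card (fst X \<union> snd X)"
    using ex_has_greatest_nat[of ?Q "(C0, D0)" "\<lambda>X. card (fst X \<union> snd X)"] by blast
  obtain C D where CD: "X = (C, D)" by (cases X)
  have S: "sp C D" and k: "card C0 \<le> card C" using X(1) CD by auto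
  have mx: False if "sp C' D'" "card C \<le> card C'" "card (C \<union> D) < card (C' \<union> D')" for C' D'
    using X(2)[of "(C', D')"] that k CD by auto
  have sD: "C \<subseteq> V" "D \<subseteq> V" "C \<inter> D = {}" and cR: "\<And>c. c \<in> C \<Longrightarrow> \<exists>d\<in>D. R c d" and dB: "\<And>d. d \<in> D \<Longrightarrow> \<exists>c\<in>C. B d c"
    using S by (auto simp: sp_def)
  have fC: "finite C" and fD: "finite D" using sD finS by auto
  have C0ne: "C \<noteq> {}" using k assms(2) S assms(1) finS by (auto simp: sp_def)
  have "t \<in> C \<union> D" if tV: "t \<in> V" for t
  proof (rule ccontr)
    assume t: "t \<notin> C \<union> D"
    have grow: False if "sp C' D'" "card C \<le> card C'" "C' \<union> D' = insert t (C \<union> D)" for C' D'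
      using mx[OF that(1,2)] that(3) t fC fD by (simp add: card_insert_if)
    have tD: "B t d" if d: "d \<in> D" for d
    proof (rule ccontr)
      assume "\<not> B t d"
      then have "R t d" using t d by (auto simp: B_def)
      then have "sp (insert t C) D" using S t tV d unfolding sp_def by auto
      then show False by (rule grow) (use fC in \<open>auto intro: card_insert_le\<close>)
    qed
    have tC: "R t c" if c: "c \<in> C" for c
    proof (rule ccontr)
      assume "\<not> R t c"
      then have "B t c" using t c by (auto simp: B_def)
      then have "sp C (insert t D)" using S t tV c unfolding sp_def by auto
      then show False by (rule grow) auto
    qed
    have clique: "R x x'" if x: "x \<in> C" "x' \<in> C" "x \<noteq> x'" for x x'
    proof (rule ccontr)
      assume "\<not> R x x'"
      then have b: "B x x'" using x by (auto simp: B_def)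
      have "sp (insert t (C - {x})) (insert x D)"
      proof (rule spI)
        fix c assume "c \<in> insert t (C - {x})"
        then show "\<exists>d\<in>insert x D. R c d" using tC[OF x(1)] cR by auto
      next
        fix d assume "d \<in> insert x D"
        then show "\<exists>c\<in>insert t (C - {x}). B d c" using b x tD B_sym by auto
      qed (use sD tV x t in auto)
      moreover have "card C \<le> card (insert t (C - {x}))" using fC t x by (auto simp: card_Suc_Diff1)
      ultimately show False by (rule grow) (use x in auto)
    qed
    obtain f where f: "\<And>c. c \<in> C \<Longrightarrow> f c \<in> D \<and> R c (f c)" using cR by metis
    obtain h where h: "\<And>d. d \<in> D \<Longrightarrow> h d \<in> C \<and> B d (h d)" using dB by metis
    \<comment> \<open>\<open>f\<close> goes along red edges to \<open>D\<close> and \<open>h\<close>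
      back along blue ones. On \<open>A\<close> the composition is a permutation, so
      \<open>A\<close> has as many elements as its image \<open>E\<close> under \<open>f\<close>,
      and exchanging the two does not change the size of \<open>C\<close>.\<close>
    obtain A where A: "A \<subseteq> C" "A \<noteq> {}" "(\<lambda>c. h (f c)) ` A = A"
      by (rule closed_subset[OF fC C0ne, of "\<lambda>c. h (f c)"]) (use f h in auto)
    have fA: "finite A" using A fC finite_subset by auto
    define E where "E = f ` A"
    have ED: "E \<subseteq> D" using f A by (auto simp: E_def)
    have "inj_on (\<lambda>c. h (f c)) A" by (rule eq_card_imp_inj_on[OF fA]) (simp add: A(3))
    then have "inj_on f A" by (auto simp: inj_on_def)
    then have cE: "card E = card A" unfolding E_def by (rule card_image)
    obtain a where a: "a \<in> A" using A(2) by auto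
    have "sp (insert t ((C - A) \<union> E)) ((D - E) \<union> A)"
    proof (rule spI)
      fix c assume "c \<in> insert t ((C - A) \<union> E)"
      then consider "c = t" | "c \<in> C - A" | x where "x \<in> A" "c = f x" by (auto simp: E_def)
      then show "\<exists>d\<in>(D - E) \<union> A. R c d"
      proof cases
        case 1 then show ?thesis using tC a A by auto
      next
        case 2 then show ?thesis using clique[of c a] a A by auto
      next
        case 3
        then have "R c x" using f[of x] A sym by blast
        then show ?thesis using 3 by auto
      qed
    next
      fix d assume "d \<in> (D - E) \<union> A"
      then show "\<exists>c\<in>insert t ((C - A) \<union> E). B d c"
      proof
        assume "d \<in> D - E" then show ?thesis using tD B_sym by auto
      next
        assume "d \<in> A"
        then obtain x where "x \<in> A" "d = h (f x)" using A(3) by auto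
        moreover have "B (h (f x)) (f x)" if "x \<in> A" for x
          by (rule B_sym) (use h[of "f x"] f[of x] A(1) that in auto)
        ultimately show ?thesis by (auto simp: E_def)
      qed
    qed (use sD tV t ED A in auto)
    moreover have "card C \<le> card (insert t ((C - A) \<union> E))"
    proof -
      have "card ((C - A) \<union> E) = card (C - A) + card E"
        by (rule card_Un_disjoint) (use fC fD ED sD finite_subset in auto)
      also have "\<dots> = card C" using cE card_Diff_subset[OF fA A(1)] card_mono[OF fC A(1)] by simp
      finally show ?thesis using card_insert_le[of "(C - A) \<union> E" t] by simp
    qed
    ultimately show False by (rule grow) (use ED A in auto)
  qed
  then have "V - C = D" using sD by auto
  then show ?thesis using that[of C] S k by simp
qed

text \<open>An alternating 4-cycle; the graphs without one are the threshold graphs.\<close>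

definition alt4 :: bool where
  "alt4 \<longleftrightarrow> (\<exists>a\<in>V. \<exists>b\<in>V. \<exists>c\<in>V. \<exists>d\<in>V. R a b \<and> B b c \<and> R c d \<and> B d a)"

lemma alt4_sp:
  assumes alt4
  obtains C D where "sp C D" "C \<noteq> {}"
proof -
  obtain a b c d where "a \<in> V" "b \<in> V" "c \<in> V" "d \<in> V" "R a b" "B b c" "R c d" "B d a"
    using assms unfolding alt4_def by blast
  then have "sp {a, c} {b, d}" unfolding sp_def using sym by (auto simp: B_def)
  then show ?thesis using that by blast
qed

text \<open>Choose \<open>d\<close> in \<open>D\<close> with the largest set of red neighbours in
  \<open>C\<close>, then \<open>c'\<close> blue to \<open>d\<close> and \<open>d'\<close> red to
  \<open>c'\<close>. By maximality \<open>d'\<close> misses some red neighbour \<open>c\<close> of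
  \<open>d\<close>, which closes the cycle.\<close>

lemma sp_alt4:
  assumes "sp C D" "C \<noteq> {}"
  shows alt4
proof -
  have sD: "C \<subseteq> V" "D \<subseteq> V" "C \<inter> D = {}" and cR: "\<And>c. c \<in> C \<Longrightarrow> \<exists>d\<in>D. R c d" and dB: "\<And>d. d \<in> D \<Longrightarrow> \<exists>c\<in>C. B d c"
    using assms by (auto simp: sp_def)
  have fC: "finite C" and fD: "finite D" using sD finS by auto
  define N where "N = (\<lambda>d. {c \<in> C. R c d})"
  obtain d0 where d0: "d0 \<in> D" using cR assms(2) by auto
  have b: "\<forall>d. d \<in> D \<longrightarrow> card (N d) < Suc (card C)" using card_mono[OF fC] by (auto simp: N_def less_Suc_eq_le)
  obtain d where d: "d \<in> D" "\<And>d'. d' \<in> D \<Longrightarrow> card (N d') \<le> card (N d)"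
    using ex_has_greatest_nat[of "\<lambda>d. d \<in> D" d0 "\<lambda>d. card (N d)", OF d0 b] by blast
  obtain c' where c': "c' \<in> C" "B d c'" using dB[OF d(1)] by auto
  obtain d' where d': "d' \<in> D" "R c' d'" using cR[OF c'(1)] by auto
  have "\<not> N d \<subseteq> N d'"
  proof
    assume s: "N d \<subseteq> N d'"
    moreover have "c' \<in> N d'" "c' \<notin> N d" using c' d' sym by (auto simp: N_def B_def)
    ultimately have "N d \<subset> N d'" by auto
    moreover have "finite (N d')" using fC by (auto simp: N_def)
    ultimately have "card (N d) < card (N d')" by (simp add: psubset_card_mono)
    then show False using d(2)[OF d'(1)] by simp
  qed
  then obtain c where "c \<in> N d" "c \<notin> N d'" by auto
  then have "R c d" "B d' c" "c \<in> C" using d' sD sym by (auto simp: N_def B_def)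
  then show ?thesis unfolding alt4_def using sD c' d d' by blast
qed

definition nb :: "nat \<Rightarrow> nat set" where "nb x = {y \<in> V. R x y}"

text \<open>In terms of the peeling process of threshold graphs (remove isolated and dominating vertices
  repeatedly), these are the vertices that are removed as isolated ones.\<close>

definition peeled :: "nat \<Rightarrow> bool" where
  "peeled j \<longleftrightarrow> j \<in> V \<and> (\<forall>a\<in>nb j. \<forall>v\<in>V. B v a \<longrightarrow> nb v \<subseteq> nb j) \<and>
     (\<forall>v\<in>V. \<forall>v'\<in>V. nb v \<subseteq> nb j \<longrightarrow> nb v' \<subseteq> nb j \<longrightarrow> nb v \<subseteq> nb v' \<or> nb v' \<subseteq> nb v)"

text \<open>If a neighbour \<open>a\<close> of \<open>j\<close> stayed outside, its blue support
  \<open>v\<close> in \<open>C\<close> would be peeled as well, with a strictly smaller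
  neighbourhood; by induction \<open>v\<close> would be outside. Once all neighbours of
  \<open>j\<close> are in \<open>C\<close>, nothing outside can support \<open>j\<close>.\<close>

lemma peeled_out:
  assumes "sp C (V - C)" "peeled j"
  shows "j \<notin> C \<and> nb j \<subseteq> C"
  using assms(2)
proof (induction "card (nb j)" arbitrary: j rule: less_induct)
  case less
  note pj = less.prems
  have "nb j \<subseteq> C"
  proof
    fix a assume a: "a \<in> nb j"
    show "a \<in> C"
    proof (rule ccontr)
      assume "a \<notin> C"
      then have "a \<in> V - C" using a by (auto simp: nb_def)
      then obtain v where v: "v \<in> C" "B a v" using assms(1) unfolding sp_def by blast
      have vV: "v \<in> V" using v assms(1) by (auto simp: sp_def)
      have pj1: "\<And>a v. a \<in> nb j \<Longrightarrow> v \<in> V \<Longrightarrow> B v a \<Longrightarrow> nb v \<subseteq> nb j"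
        and pj2: "\<And>v v'. v \<in> V \<Longrightarrow> v' \<in> V \<Longrightarrow> nb v \<subseteq> nb j \<Longrightarrow> nb v' \<subseteq> nb j \<Longrightarrow> nb v \<subseteq> nb v' \<or> nb v' \<subseteq> nb v"
        using pj unfolding peeled_def by simp_all
      have vj: "nb v \<subseteq> nb j" by (rule pj1[OF a vV B_sym[OF v(2)]])
      have "a \<notin> nb v" using v sym by (auto simp: nb_def B_def)
      then have "nb v \<subset> nb j" using vj a by auto
      then have lt: "card (nb v) < card (nb j)" by (rule psubset_card_mono[rotated]) (simp add: nb_def)
      have "peeled v" unfolding peeled_def
      proof (intro conjI ballI impI vV)
        fix a' v' assume a': "a' \<in> nb v" and v': "v' \<in> V" "B v' a'"
        have 1: "nb v' \<subseteq> nb j" using pj1[OF _ v'] a' vj by auto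
        have "a' \<notin> nb v'" using v' by (auto simp: nb_def B_def)
        then show "nb v' \<subseteq> nb v" using pj2[OF vV v'(1) vj 1] a' by auto
      next
        fix x x' assume "x \<in> V" "x' \<in> V" "nb x \<subseteq> nb v" "nb x' \<subseteq> nb v"
        then show "nb x \<subseteq> nb x' \<or> nb x' \<subseteq> nb x" using pj2[of x x'] vj by auto
      qed
      from less.hyps[OF lt this] v show False by auto
    qed
  qed
  moreover have "j \<notin> C"
  proof
    assume "j \<in> C"
    then obtain d where "d \<in> V - C" "R j d" using assms(1) unfolding sp_def by blast
    then show False using \<open>nb j \<subseteq> C\<close> by (auto simp: nb_def)
  qed
  ultimately show ?case by simp
qed

text \<open>\<open>alt4\<close> provides some solution, hence a largest one. If it is small, more
  than \<open>2 ^ k * (k + 1)\<close> unpeeled vertices remain whose neighbourhoods lie in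
  \<open>C\<close>, so more than \<open>k + 1\<close> of them, \<open>L\<close>, share a
  neighbourhood \<open>N0\<close>. The reason why these are not peeled supplies the few vertices
  that turn \<open>L\<close> into the main part of a self-supporting pair.\<close>

lemma unpeeled_many:
  assumes alt4 "2 * k + 2 ^ k * (k + 1) < card {v \<in> V. \<not> peeled v}"
  obtains C where "sp C (V - C)" "k \<le> card C"
proof -
  note result = that
  let ?P = "\<lambda>C. sp C (V - C)"
  obtain C1 D1 where S1: "sp C1 D1" "C1 \<noteq> {}" by (rule alt4_sp[OF assms(1)]) (rule that)
  obtain C2 where P0: "?P C2" by (rule sp_extend[OF S1]) (rule that)
  have sub: "\<And>C. ?P C \<Longrightarrow> C \<subseteq> V" by (auto simp: sp_def)
  obtain C where CM: "?P C \<and> (\<forall>C'. ?P C' \<longrightarrow> card C' \<le> card C)"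
    using max_card_set[of ?P, OF P0 fin sub] by (rule exE)
  note C = CM[THEN conjunct1] and mx = CM[THEN conjunct2, THEN spec, THEN mp]
  show ?thesis
  proof (cases "k \<le> card C")
    case True
    show ?thesis by (rule result[OF C True])
  next
    case False
    define D where "D = V - C"
    have CV: "C \<subseteq> V" using C by (auto simp: sp_def)
    have fC: "finite C" and fD: "finite D" using CV finS by (auto simp: D_def)
    have VCD: "V = C \<union> D" "C \<inter> D = {}" using CV by (auto simp: D_def)
    have "\<forall>x\<in>C. \<exists>y. y \<in> D \<and> R x y" using C unfolding sp_def D_def by blast
    then obtain r where r: "\<And>x. x \<in> C \<Longrightarrow> r x \<in> D \<and> R x (r x)" by metis
    define crit where "crit = r ` C"
    have crit: "finite crit" "card crit \<le> card C" unfolding crit_def using fC card_image_le by auto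
    \<comment> \<open>A red neighbour in \<open>D\<close> would support \<open>y\<close> inside, and
      blue supports of the outside are never lost when \<open>C\<close> grows; so \<open>y\<close>
      could be added to \<open>C\<close>.\<close>
    have nR: "\<not> R y d" if y: "y \<in> D - crit" and d: "d \<in> D" for y d
    proof
      assume Ryd: "R y d"
      have "?P (insert y C)"
      proof (rule spI)
        fix c assume "c \<in> insert y C"
        then show "\<exists>d\<in>V - insert y C. R c d"
        proof
          assume c: "c = y"
          have "d \<noteq> y" using Ryd by auto
          then show ?thesis using Ryd d c by (auto simp: D_def)
        next
          assume c: "c \<in> C"
          then have "r c \<noteq> y" using y by (auto simp: crit_def)
          then show ?thesis using r[OF c] by (auto simp: D_def)
        qed
      next
        fix x assume "x \<in> V - insert y C"
        then show "\<exists>c\<in>insert y C. B x c" using C by (auto simp: sp_def)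
      qed (use y CV in \<open>auto simp: D_def\<close>)
      from mx[OF this] show False using y fC by (auto simp: D_def)
    qed
    define Bad where "Bad = {y \<in> D - crit. \<not> peeled y}"
    have fBad: "finite Bad" using fD by (auto simp: Bad_def)
    have "{v \<in> V. \<not> peeled v} \<subseteq> C \<union> crit \<union> Bad" using VCD by (auto simp: Bad_def)
    then have "card {v \<in> V. \<not> peeled v} \<le> card (C \<union> crit \<union> Bad)"
      by (rule card_mono[rotated]) (use fC crit fBad in auto)
    also have "\<dots> \<le> card C + card crit + card Bad"
      using card_Un_le[of "C \<union> crit" Bad] card_Un_le[of C crit] by linarith
    finally have "2 ^ k * (k + 1) < card Bad" using assms(2) crit False by linarith
    moreover have "card (Pow C) * (k + 1) \<le> 2 ^ k * (k + 1)"
      unfolding card_Pow[OF fC] by (rule mult_le_mono1, rule power_increasing) (use False in auto)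
    ultimately have big: "card (Pow C) * (k + 1) < card Bad" by linarith
    have nbC: "nb y \<subseteq> C" if "y \<in> D - crit" for y using nR[OF that] by (auto simp: nb_def D_def)
    obtain N0 where N0: "N0 \<in> Pow C" "k + 1 < card {y \<in> Bad. nb y = N0}"
      using pigeonhole_many[OF fBad _ _ big, of nb] fC nbC by (auto simp: Bad_def)
    define L where "L = {y \<in> Bad. nb y = N0}"
    have fL: "finite L" using fBad by (auto simp: L_def)
    have kL: "k + 1 < card L" using N0 by (simp add: L_def)
    have LD: "L \<subseteq> D" "L \<subseteq> V" by (auto simp: L_def Bad_def D_def)
    have LR: "R l v \<longleftrightarrow> v \<in> N0" if "l \<in> L" "v \<in> V" for l v using that by (auto simp: L_def nb_def)
    have N0L: "N0 \<inter> L = {}" "N0 \<subseteq> V" using N0 LD VCD by auto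
    have fin_by: thesis if S: "sp C' D'" "card C' \<ge> k" "C' \<noteq> {}" for C' D'
    proof -
      obtain C'' where "sp C'' (V - C'')" "card C' \<le> card C''" by (rule sp_extend[OF S(1,3)])
      then show thesis using result[of C''] S(2) by auto
    qed
    obtain l0 where l0: "l0 \<in> L" using kL by fastforce
    have "\<not> peeled l0" "nb l0 = N0" "l0 \<in> V" using l0 LD by (auto simp: L_def Bad_def)
    then have "(\<exists>a\<in>N0. \<exists>v\<in>V. B v a \<and> \<not> nb v \<subseteq> N0) \<or>
      (\<exists>v\<in>V. \<exists>v'\<in>V. nb v \<subseteq> N0 \<and> nb v' \<subseteq> N0 \<and> \<not> nb v \<subseteq> nb v' \<and> \<not> nb v' \<subseteq> nb v)"
      unfolding peeled_def by auto
    then show ?thesis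
    proof
      assume "\<exists>a\<in>N0. \<exists>v\<in>V. B v a \<and> \<not> nb v \<subseteq> N0"
      \<comment> \<open>Outside go \<open>a\<close>, which is red to all of \<open>L\<close>, and
        \<open>z\<close>, which is red to \<open>v\<close>. In return \<open>v\<close> is blue to
        \<open>a\<close>, and a vertex of \<open>L\<close> other than \<open>z\<close> is blue to
        \<open>z\<close>.\<close>
      then obtain a v z where *: "a \<in> N0" "v \<in> V" "B v a" "z \<in> V" "R v z" "z \<notin> N0" by (auto simp: nb_def)
      have aL: "R l a" if "l \<in> L" for l using LR[OF that] * N0L by auto
      have ne: "v \<notin> L" using * aL by (auto simp: B_def)
      have zl: "\<not> R z l" "\<not> R l z" if "l \<in> L" for l using LR[OF that *(4)] * sym by auto
      have aN: "a \<notin> L" "a \<in> V" using *(1) N0L by auto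
      have vz: "v \<noteq> a" "v \<noteq> z" using *(3,5) by (auto simp: B_def)
      show thesis
      proof (cases "z \<in> L")
        case True
        obtain l where l: "l \<in> L" "l \<noteq> z"
        proof -
          have "L \<noteq> {z}" using kL by auto
          then show thesis using that True by blast
        qed
        have "sp (insert v (L - {z})) {a, z}"
        proof (rule spI)
          fix c assume "c \<in> insert v (L - {z})"
          then show "\<exists>d\<in>{a, z}. R c d" using aL * by auto
        next
          fix d assume "d \<in> {a, z}"
          then show "\<exists>c\<in>insert v (L - {z}). B d c"
            using B_sym[OF *(3)] l zl[OF l(1)] by (auto simp: B_def)
        qed (use aN vz ne LD *(2,4) in auto)
        moreover have "k \<le> card (insert v (L - {z}))" using kL fL ne True by auto
        ultimately show thesis by (rule fin_by) auto
      next
        case False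
        have "sp (insert v L) {a, z}"
        proof (rule spI)
          fix c assume "c \<in> insert v L"
          then show "\<exists>d\<in>{a, z}. R c d" using aL * by auto
        next
          fix d assume "d \<in> {a, z}"
          then show "\<exists>c\<in>insert v L. B d c"
            using B_sym[OF *(3)] l0 zl[OF l0] False by (auto simp: B_def)
        qed (use aN vz ne LD *(2,4) False in auto)
        moreover have "k \<le> card (insert v L)" using kL fL ne by auto
        ultimately show thesis by (rule fin_by) auto
      qed
    next
      assume "\<exists>v\<in>V. \<exists>v'\<in>V. nb v \<subseteq> N0 \<and> nb v' \<subseteq> N0 \<and> \<not> nb v \<subseteq> nb v' \<and> \<not> nb v' \<subseteq> nb v"
      \<comment> \<open>Incomparable neighbourhoods form an alternating 4-cycle. Its inside vertices
        \<open>v\<close> and \<open>v'\<close> are joined by all of \<open>L\<close>, which is red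
        to both \<open>a\<close> and \<open>a'\<close>.\<close>
      then obtain v v' a a' where *: "v \<in> V" "v' \<in> V" "nb v \<subseteq> N0" "nb v' \<subseteq> N0"
        "a \<in> nb v" "a \<notin> nb v'" "a' \<in> nb v'" "a' \<notin> nb v" by blast
      have a: "a \<in> N0" "a' \<in> N0" "a \<in> V" "a' \<in> V" using * by (auto simp: nb_def)
      have aL: "R l a" if "l \<in> L" for l using LR[OF that] a by auto
      have aL': "a \<notin> L" "a' \<notin> L" using a N0L by auto
      have vN: "x \<notin> N0" if "x \<in> V" "nb x \<subseteq> N0" for x
      proof
        assume "x \<in> N0"
        then have "l0 \<in> nb x" using LR[OF l0 that(1)] sym LD l0 by (auto simp: nb_def)
        then show False using that(2) N0L l0 by auto
      qed
      have R: "R v a" "R v' a'" "\<not> R v' a" "\<not> R v a'" using * a by (auto simp: nb_def)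
      have ne: "v \<notin> N0" "v' \<notin> N0" using vN * by auto
      have "sp (insert v (insert v' L)) {a, a'}"
      proof (rule spI)
        fix c assume "c \<in> insert v (insert v' L)"
        then show "\<exists>d\<in>{a, a'}. R c d" using aL R by auto
      next
        fix d assume "d \<in> {a, a'}"
        moreover have "B a v'" "B a' v" using R a ne sym by (auto simp: B_def)
        ultimately show "\<exists>c\<in>insert v (insert v' L). B d c" by auto
      qed (use *(1,2) aL' LD a ne in auto)
      moreover have "card L \<le> card (insert v (insert v' L))" by (rule card_mono) (use fL in auto)
      then have "k \<le> card (insert v (insert v' L))" using kL by simp
      ultimately show thesis by (rule fin_by) auto
    qed
  qed
qed

end

section \<open>Solutions of ae-formulas and their kernels, case by case\<close>

definition wit :: "nat set \<Rightarrow> (nat \<Rightarrow> nat \<Rightarrow> bool) \<Rightarrow> (bool \<Rightarrow> bool \<Rightarrow> bool) \<Rightarrow> nat set \<Rightarrow> nat \<Rightarrow> bool" where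
  "wit V R T C x \<longleftrightarrow> (\<exists>y\<in>V. y \<noteq> x \<and> T (R x y) (y \<in> C))"

text \<open>\<open>I c b\<close> and \<open>O c b\<close> tell whether a vertex in \<open>C\<close>, respectively outside of \<open>C\<close>, is satisfied by
  another vertex to which it is adjacent iff \<open>c\<close>, and which lies in \<open>C\<close> iff \<open>b\<close>; \<open>si\<close> and \<open>so\<close>
  tell whether it is satisfied by itself.\<close>

definition sol :: "nat set \<Rightarrow> (nat \<Rightarrow> nat \<Rightarrow> bool) \<Rightarrow> bool \<Rightarrow> bool \<Rightarrow> (bool \<Rightarrow> bool \<Rightarrow> bool) \<Rightarrow> (bool \<Rightarrow> bool \<Rightarrow> bool)
    \<Rightarrow> nat set \<Rightarrow> bool" where
  "sol V R si so I O' C \<longleftrightarrow> C \<subseteq> V \<and> (\<forall>x\<in>C. si \<or> wit V R I C x) \<and> (\<forall>x\<in>V - C. so \<or> wit V R O' C x)"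

lemma solI:
  assumes "C \<subseteq> V" "\<And>x. x \<in> C \<Longrightarrow> si \<or> wit V R I C x" "\<And>x. x \<in> V - C \<Longrightarrow> so \<or> wit V R O' C x"
  shows "sol V R si so I O' C"
  unfolding sol_def using assms by auto

lemma witI: "y \<in> V \<Longrightarrow> y \<noteq> x \<Longrightarrow> T (R x y) (y \<in> C) \<Longrightarrow> wit V R T C x"
  unfolding wit_def by auto

definition gk :: "nat \<Rightarrow> nat" where "gk k = 256 * 4 ^ k"

text \<open>The last three are the thresholds that the cases below ask for; only the final one, from
  counting neighbourhoods in \<open>unpeeled_many\<close>, is exponential. As a power of two,
  \<open>gk k\<close> is easily bounded by the tower \<open>FF\<close>.\<close>

lemma gk_bounds: "k \<le> gk k" "15 * k + 40 \<le> gk k" "2 * k * k + 16 * k + 16 \<le> gk k" "2 * k + 2 ^ k * (k + 1) < gk k"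
proof -
  have k2: "k + 1 \<le> 2 ^ k" using less_exp[of k] by (simp only: Suc_eq_plus1[symmetric] Suc_le_eq)
  have e: "(4::nat) ^ k = 2 ^ k * 2 ^ k" by (simp add: power_mult_distrib[symmetric])
  have k4: "(k + 1) * (k + 1) \<le> 4 ^ k" unfolding e by (rule mult_mono) (use k2 in auto)
  have l: "2 ^ k * (k + 1) \<le> 4 ^ k" unfolding e by (rule mult_mono) (use k2 in auto)
  have "k * k + 2 * k + 1 \<le> 4 ^ k" using k4 by simp
  then show "k \<le> gk k" "15 * k + 40 \<le> gk k" "2 * k * k + 16 * k + 16 \<le> gk k" "2 * k + 2 ^ k * (k + 1) < gk k"
    using l unfolding gk_def by linarith+
qed

text \<open>If there is a solution with \<open>k\<close> elements, then \<open>Y\<close> holds and \<open>S\<close> is large, or there is one of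
  a shape that can be searched for. This is what the circuits test.\<close>

definition kern :: "nat set \<Rightarrow> (nat set \<Rightarrow> bool) \<Rightarrow> bool \<Rightarrow> nat set \<Rightarrow> bool" where
  "kern V P Y S \<longleftrightarrow>
     (\<forall>k. Y \<and> gk k \<le> card S \<longrightarrow> (\<exists>C. P C \<and> k \<le> card C)) \<and>
     (\<forall>C. P C \<longrightarrow> (\<exists>C'. P C' \<and> card C \<le> card C' \<and> (card (V - C') \<le> 4 \<or> C' = S \<or> (Y \<and> C' \<subseteq> S))))"

lemma kernI:
  assumes "\<And>k. Y \<Longrightarrow> gk k \<le> card S \<Longrightarrow> \<exists>C. P C \<and> k \<le> card C"
    and "\<And>C. P C \<Longrightarrow> 4 < card (V - C) \<Longrightarrow>
      \<exists>C'. P C' \<and> card C \<le> card C' \<and> (card (V - C') \<le> 4 \<or> C' = S \<or> (Y \<and> C' \<subseteq> S))"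
  shows "kern V P Y S"
  unfolding kern_def using assms by (meson le_refl not_le)

context grph
begin

definition W :: "nat set" where "W = {x \<in> V. \<exists>y\<in>V. R x y}"
text \<open>The vertices outside of the components that consist of a single edge.\<close>

definition Z :: "nat set" where
  "Z = {x \<in> V. \<not> (\<exists>y\<in>V. R x y \<and> (\<forall>z\<in>V. R x z \<longrightarrow> z = y) \<and> (\<forall>z\<in>V. R y z \<longrightarrow> z = x))}"
definition univ :: "nat \<Rightarrow> bool" where "univ x \<longleftrightarrow> (\<forall>y\<in>V. y \<noteq> x \<longrightarrow> R x y)"
definition Vp :: "nat set" where "Vp = {x \<in> V. \<not> univ x}"
text \<open>When the outside can only be served by blue edges, universal vertices must lie in
  \<open>C\<close>. A vertex of \<open>J'\<close> then has no red neighbour outside and cannot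
  belong to \<open>C\<close>.\<close>

definition J' :: "nat set" where "J' = {x \<in> Vp. \<forall>y\<in>V. R x y \<longrightarrow> univ y}"

lemma WV: "W \<subseteq> V" by (auto simp: W_def)
lemma fW [simp]: "finite W" by (rule finS[OF WV])
lemma W_nb: "w \<in> W \<Longrightarrow> \<exists>y\<in>W. R w y" unfolding W_def using sym by blast

lemma notW: "x \<in> V \<Longrightarrow> x \<notin> W \<Longrightarrow> y \<in> V \<Longrightarrow> \<not> R x y"
  by (auto simp: W_def)

text \<open>A solution missing at most four vertices is larger than any solution missing more, so
  exhibiting one of them settles a case.\<close>

lemma small_D:
  assumes "P C'" "card (V - C') \<le> 4" "4 < card (V - C)" "C \<subseteq> V" "C' \<subseteq> V"
  shows "\<exists>C'. P C' \<and> card C \<le> card C' \<and> (card (V - C') \<le> 4 \<or> C' = S \<or> (Y \<and> C' \<subseteq> S))"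
proof -
  have "card (V - C) = card V - card C" by (rule card_Diff_subset) (use assms finS in auto)
  moreover have "card (V - C') = card V - card C'" by (rule card_Diff_subset) (use assms finS in auto)
  ultimately have "card C \<le> card C'" using assms(2,3) by linarith
  then show ?thesis using assms by blast
qed

lemma small_D':
  assumes "P (V - D)" "card D \<le> 4" "D \<subseteq> V" "4 < card (V - C)" "C \<subseteq> V"
  shows "\<exists>C'. P C' \<and> card C \<le> card C' \<and> (card (V - C') \<le> 4 \<or> C' = S \<or> (Y \<and> C' \<subseteq> S))"
  by (rule small_D[where P=P and C'="V - D"]) (use assms in \<open>auto simp: double_diff\<close>)

lemma other_vertex:
  assumes "4 < card X" shows "\<exists>y\<in>X. y \<noteq> a \<and> y \<noteq> b"
proof (rule ccontr)
  assume "\<not> ?thesis" then have "X \<subseteq> {a, b}" by auto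
  then have "card X \<le> card {a, b}" by (rule card_mono[rotated]) simp
  then show False using assms by (simp add: card_insert_if split: if_splits)
qed

lemma big_V: "4 < card (V - C) \<Longrightarrow> 4 < card V"
  using card_mono[of V "V - C"] by simp

lemma ex_out: "4 < card (V - C) \<Longrightarrow> \<exists>d. d \<in> V - C"
  using card.empty by (metis all_not_in_conv not_less_zero)

lemma kern_all:
  assumes "si \<or> (I True True \<and> I False True)"
  shows "kern V (sol V R si so I O') False {}"
proof (rule kernI)
  fix C assume C: "sol V R si so I O' C" and big: "4 < card (V - C)"
  have V4: "4 < card V" using big by (rule big_V)
  have "sol V R si so I O' (V - {})"
  proof (rule solI)
    fix x assume x: "x \<in> V - {}"
    obtain y where "y \<in> V" "y \<noteq> x" using other_vertex[OF V4] by blast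
    moreover have "I (R x y) True" if "I True True \<and> I False True" using that by (cases "R x y") auto
    ultimately have "wit V R I (V - {}) x" if "I True True \<and> I False True"
      using that by (intro witI[of y]) auto
    then show "si \<or> wit V R I (V - {}) x" using assms by auto
  qed auto
  then show "\<exists>C'. sol V R si so I O' C' \<and> card C \<le> card C' \<and> (card (V - C') \<le> 4 \<or> C' = {} \<or> (False \<and> C' \<subseteq> {}))"
    by (rule small_D') (use C big in \<open>auto simp: sol_def\<close>)
qed simp

lemma kern_no_in:
  assumes "\<not> si" "\<And>a b. \<not> I a b"
  shows "kern V (sol V R si so I O') False {}"
proof (rule kernI)
  fix C assume C: "sol V R si so I O' C"
  then have "C = {}" using assms by (auto simp: sol_def wit_def)
  then show "\<exists>C'. sol V R si so I O' C' \<and> card C \<le> card C' \<and> (card (V - C') \<le> 4 \<or> C' = {} \<or> (False \<and> C' \<subseteq> {}))"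
    using C by blast
qed simp

text \<open>One vertex \<open>d\<close> outside satisfies everything inside. Hence all vertices can
  enter \<open>C\<close> except \<open>d\<close> and, if \<open>d\<close> needs a partner outside,
  that partner, which \<open>d\<close> serves in turn.\<close>

lemma kern_out_both:
  assumes "I True False" "I False False"
  shows "kern V (sol V R si so I O') False {}"
proof (rule kernI)
  fix C assume C: "sol V R si so I O' C" and big: "4 < card (V - C)"
  obtain d where d: "d \<in> V - C" using ex_out[OF big] by blast
  have CV: "C \<subseteq> V" using C by (auto simp: sol_def)
  have ins: "wit V R I (V - D) x" if "D \<subseteq> V" "d \<in> D" "x \<in> V - D" for D x
    using that assms by (intro witI[of d]) (cases "R x d"; auto)+
  have "so \<or> wit V R O' C d" using C d by (auto simp: sol_def)
  then have "so \<or> (\<exists>y\<in>C. y \<noteq> d \<and> O' (R d y) True) \<or> (\<exists>y\<in>V - C. y \<noteq> d \<and> O' (R d y) False)"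
  proof
    assume "wit V R O' C d"
    then obtain y where "y \<in> V" "y \<noteq> d" "O' (R d y) (y \<in> C)" unfolding wit_def by blast
    then show ?thesis by (cases "y \<in> C") auto
  qed simp
  then consider so | y where "y \<in> C" "y \<noteq> d" "O' (R d y) True" | y where "y \<in> V - C" "y \<noteq> d" "O' (R d y) False"
    by blast
  then have "\<exists>D. sol V R si so I O' (V - D) \<and> card D \<le> 4 \<and> D \<subseteq> V"
  proof cases
    case 1
    have "sol V R si so I O' (V - {d})" by (rule solI) (use 1 ins d in auto)
    then show ?thesis using d by (intro exI[of _ "{d}"]) auto
  next
    case (2 y)
    have "sol V R si so I O' (V - {d})"
    proof (rule solI)
      fix x assume "x \<in> V - (V - {d})"
      then have "x = d" by auto
      then show "so \<or> wit V R O' (V - {d}) x" using 2 CV by (intro disjI2 witI[of y]) auto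
    qed (use ins d in auto)
    then show ?thesis using d by (intro exI[of _ "{d}"]) auto
  next
    case (3 y)
    have Rs: "R y d = R d y" using sym by blast
    have "sol V R si so I O' (V - {d, y})"
    proof (rule solI)
      fix x assume "x \<in> V - (V - {d, y})"
      then consider "x = d" | "x = y" by auto
      then show "so \<or> wit V R O' (V - {d, y}) x"
      proof cases
        case 1 then show ?thesis using 3 by (intro disjI2 witI[of y]) auto
      next
        case 2 then show ?thesis using 3 d Rs by (intro disjI2 witI[of d]) auto
      qed
    qed (use ins[of "{d, y}"] 3 d in auto)
    then show ?thesis using d 3 by (intro exI[of _ "{d, y}"]) (auto simp: card_insert_if)
  qed
  then obtain D where D: "sol V R si so I O' (V - D)" "card D \<le> 4" "D \<subseteq> V" by blast
  show "\<exists>C'. sol V R si so I O' C' \<and> card C \<le> card C' \<and> (card (V - C') \<le> 4 \<or> C' = {} \<or> (False \<and> C' \<subseteq> {}))"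
    by (rule small_D'[where P="sol V R si so I O'", OF D big CV])
qed simp

text \<open>Without isolated vertices all of \<open>V\<close> works. An isolated vertex left outside
  is blue to everything and so satisfies the whole inside; at most one companion is needed if blue
  edges can serve the outside. Otherwise the outside needs red edges, and up to four vertices are
  left out such that every other vertex keeps a red neighbour inside or has a blue one
  outside.\<close>

lemma kern_redin_blueout:
  assumes I: "I True True" "I False False" "\<not> I False True" "\<not> I True False" and si: "\<not> si"
  shows "kern V (sol V R si so I O') False {}"
proof (rule kernI)
  fix C assume C: "sol V R si so I O' C" and big: "4 < card (V - C)"
  have CV: "C \<subseteq> V" using C by (auto simp: sol_def)
  have V4: "4 < card V" using big by (rule big_V)
  let ?G = "\<lambda>D. sol V R si so I O' (V - D) \<and> card D \<le> 4 \<and> D \<subseteq> V"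
  have inI: "wit V R I (V - D) x" if "x \<in> V - D" "(\<exists>y\<in>V - D. R x y) \<or> (\<exists>y\<in>D. y \<noteq> x \<and> \<not> R x y)" "D \<subseteq> V" for x D
    using that(2)
  proof
    assume "\<exists>y\<in>V - D. R x y"
    then obtain y where "y \<in> V - D" "R x y" by blast
    then show ?thesis using I by (intro witI[of y]) auto
  next
    assume "\<exists>y\<in>D. y \<noteq> x \<and> \<not> R x y"
    then obtain y where "y \<in> D" "y \<noteq> x" "\<not> R x y" by blast
    then show ?thesis using I that by (intro witI[of y]) auto
  qed
  have G: "?G D" if "D \<subseteq> V" "card D \<le> 4"
    "\<And>x. x \<in> V - D \<Longrightarrow> (\<exists>y\<in>V - D. R x y) \<or> (\<exists>y\<in>D. y \<noteq> x \<and> \<not> R x y)"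
    "\<And>x. x \<in> D \<Longrightarrow> so \<or> wit V R O' (V - D) x" for D
  proof -
    have "sol V R si so I O' (V - D)"
    proof (rule solI)
      fix x assume "x \<in> V - D"
      from inI[OF this that(3)[OF this] that(1)] show "si \<or> wit V R I (V - D) x" ..
    next
      fix x assume "x \<in> V - (V - D)"
      then have "x \<in> D" by auto
      from that(4)[OF this] show "so \<or> wit V R O' (V - D) x" .
    qed auto
    then show ?thesis using that by auto
  qed
  have "\<exists>D. ?G D"
  proof (cases "W = V")
    case True
    have "?G {}" by (rule G) (use True in \<open>auto simp: W_def\<close>)
    then show ?thesis ..
  next
    case False
    then obtain j where j: "j \<in> V" "\<And>y. y \<in> V \<Longrightarrow> \<not> R j y" using WV by (auto simp: W_def)
    have jR: "\<not> R y j" if "y \<in> V" for y using j(2)[OF that] sym by blast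
    have ins: "x \<in> V - D \<Longrightarrow> (\<exists>y\<in>V - D. R x y) \<or> (\<exists>y\<in>D. y \<noteq> x \<and> \<not> R x y)" if "j \<in> D" for x D
      using that jR[of x] by auto
    obtain d0 where d0: "d0 \<in> V" "d0 \<noteq> j" using other_vertex[OF V4] by blast
    consider "so \<or> O' False True" | "O' False False" | "\<not> so" "\<not> O' False True" "\<not> O' False False" by auto
    then show ?thesis
    proof cases
      case 1
      have "?G {j}"
      proof (rule G)
        fix x assume "x \<in> {j}"
        then have "wit V R O' (V - {j}) x" if "O' False True" using that d0 j by (intro witI[of d0]) auto
        then show "so \<or> wit V R O' (V - {j}) x" using 1 by auto
      next
        fix x assume "x \<in> V - {j}" then show "(\<exists>y\<in>V - {j}. R x y) \<or> (\<exists>y\<in>{j}. y \<noteq> x \<and> \<not> R x y)" using ins by blast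
      qed (use j in auto)
      then show ?thesis ..
    next
      case 2
      have "?G {j, d0}"
      proof (rule G)
        fix x assume "x \<in> {j, d0}"
        then consider "x = j" | "x = d0" by auto
        then show "so \<or> wit V R O' (V - {j, d0}) x"
        proof cases
          case 1 then show ?thesis using 2 d0 j by (intro disjI2 witI[of d0]) auto
        next
          case 2 then show ?thesis using \<open>O' False False\<close> d0 j jR by (intro disjI2 witI[of j]) auto
        qed
      next
        fix x assume "x \<in> V - {j, d0}" then show "(\<exists>y\<in>V - {j, d0}. R x y) \<or> (\<exists>y\<in>{j, d0}. y \<noteq> x \<and> \<not> R x y)" using ins by blast
      qed (use j d0 in \<open>auto simp: card_insert_if\<close>)
      then show ?thesis ..
    next
      case 3
      have Dred: "\<exists>y\<in>V. R x y \<and> O' True (y \<in> C)" if "x \<in> V - C" for x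
      proof -
        have "wit V R O' C x" using C that 3 by (auto simp: sol_def)
        then obtain y where y: "y \<in> V" "O' (R x y) (y \<in> C)" unfolding wit_def by blast
        then have "R x y" using 3 by (cases "R x y"; cases "y \<in> C") auto
        then show ?thesis using y by auto
      qed
      then have DW: "V - C \<subseteq> W" by (auto simp: W_def)
      have bigW: "\<exists>w\<in>W. w \<notin> X" if "card X \<le> 4" "finite X" for X
      proof (rule ccontr)
        assume "\<not> ?thesis"
        then have "V - C \<subseteq> X" using DW by auto
        then have "card (V - C) \<le> card X" by (rule card_mono[rotated]) (rule that)
        then show False using that big by simp
      qed
      obtain d where d: "d \<in> V - C" using ex_out[OF big] by blast
      show ?thesis
      proof (cases "O' True True")
        case OT: True
        show ?thesis
        proof (cases "\<exists>w\<in>W. \<forall>x\<in>V. \<not> (R x w \<and> (\<forall>z\<in>V. R x z \<longrightarrow> z = w))")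
          case True
          then obtain w where w: "w \<in> W" "\<And>x. x \<in> V \<Longrightarrow> R x w \<Longrightarrow> \<exists>z\<in>V. R x z \<and> z \<noteq> w" by blast
          obtain u where u: "u \<in> V" "R w u" using w(1) by (auto simp: W_def)
          have "?G {w}"
          proof (rule G)
            fix x assume "x \<in> V - {w}"
            then show "(\<exists>y\<in>V - {w}. R x y) \<or> (\<exists>y\<in>{w}. y \<noteq> x \<and> \<not> R x y)" using w(2)[of x] by (cases "R x w") auto
          next
            fix x assume "x \<in> {w}"
            moreover have "u \<noteq> w" using u by auto
            ultimately show "so \<or> wit V R O' (V - {w}) x" using u OT by (intro disjI2 witI[of u]) auto
          qed (use w WV in auto)
          then show ?thesis ..
        next
          case False
          \<comment> \<open>If every vertex of \<open>W\<close> is the only neighbour of some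
            vertex, applying this twice shows that the edges form a matching. Then one end of each
            of two edges is left out, as no vertex is red to both.\<close>
          then have K: "\<exists>x\<in>V. R x w \<and> (\<forall>z\<in>V. R x z \<longrightarrow> z = w)" if "w \<in> W" for w using that by blast
          have "\<exists>x\<in>V. R x w \<and> (\<forall>z\<in>V. R x z \<longrightarrow> z = w) \<and> (\<forall>z\<in>V. R w z \<longrightarrow> z = x)" if w: "w \<in> W" for w
          proof -
            obtain x where x: "x \<in> V" "R x w" "\<And>z. z \<in> V \<Longrightarrow> R x z \<Longrightarrow> z = w" using K[OF w] by blast
            then have "x \<in> W" using w WV by (auto simp: W_def)
            then obtain y where y: "y \<in> V" "R y x" "\<And>z. z \<in> V \<Longrightarrow> R y z \<Longrightarrow> z = x" using K by blast
            then have "y = w" using x(3) sym by blast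
            then show ?thesis using x y by blast
          qed
          then obtain p where p: "\<And>w. w \<in> W \<Longrightarrow> p w \<in> V \<and> R (p w) w \<and> (\<forall>z\<in>V. R (p w) z \<longrightarrow> z = w) \<and> (\<forall>z\<in>V. R w z \<longrightarrow> z = p w)"
            by metis
          have dW: "d \<in> W" using d DW by auto
          obtain e where e: "e \<in> W" "e \<noteq> d" "e \<noteq> p d" 
          proof -
            have "card {d, p d} \<le> 4" by (simp add: card_insert_if)
            from bigW[OF this] show thesis using that by auto
          qed
          have "?G {d, e}"
          proof (rule G)
            fix x assume x: "x \<in> V - {d, e}"
            have "\<not> R x d \<or> \<not> R x e"
            proof (rule ccontr)
              assume "\<not> ?thesis"
              then have r: "R d x" "R x e" using sym by auto
              then have "x = p d" using p[OF dW] x by auto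
              then have "e = d" using p[OF dW] r(2) e(1) WV by auto
              then show False using e(2) by simp
            qed
            then show "(\<exists>y\<in>V - {d, e}. R x y) \<or> (\<exists>y\<in>{d, e}. y \<noteq> x \<and> \<not> R x y)" using x by auto
          next
            have pw: "p d \<in> V" "p e \<in> V" "R d (p d)" "R e (p e)" using p[OF dW] p[OF e(1)] sym by auto
            have "p d \<noteq> d" "p e \<noteq> e" using pw irr by auto
            moreover have "p e \<noteq> d" using p[OF e(1)] p[OF dW] e WV dW by blast
            ultimately have ne: "p d \<in> V - {d, e}" "p e \<in> V - {d, e}" using pw e by auto
            fix x assume "x \<in> {d, e}"
            then consider "x = d" | "x = e" by auto
            then show "so \<or> wit V R O' (V - {d, e}) x"
            proof cases
              case 1 then show ?thesis using pw ne OT by (intro disjI2 witI[of "p d"]) auto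
            next
              case 2 then show ?thesis using pw ne OT by (intro disjI2 witI[of "p e"]) auto
            qed
          qed (use dW e WV in \<open>auto simp: card_insert_if\<close>)
          then show ?thesis ..
        qed
      next
        case OT: False
        have Dred': "\<exists>y\<in>V - C. R x y \<and> O' True False" if x: "x \<in> V - C" for x
        proof -
          obtain y where y: "y \<in> V" "R x y" "O' True (y \<in> C)" using Dred[OF x] by blast
          then have "y \<notin> C" using OT by (metis (full_types))
          then show ?thesis using y by auto
        qed
        obtain y where y: "y \<in> V - C" "R d y" and OF: "O' True False" using Dred'[OF d] by blast
        show ?thesis
        \<comment> \<open>Leaving out the ends of an edge fails only if some vertex has exactly
          these two neighbours. If this happens for every edge, all components with edges are
          triangles.\<close>
        proof (cases "\<exists>u\<in>V. \<exists>w\<in>V. R u w \<and> (\<forall>x\<in>V. \<not> (R x u \<and> R x w \<and> (\<forall>z\<in>V. R x z \<longrightarrow> z = u \<or> z = w)))")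
          case True
          then obtain u w where uw: "u \<in> V" "w \<in> V" "R u w"
            "\<And>x. x \<in> V \<Longrightarrow> R x u \<Longrightarrow> R x w \<Longrightarrow> \<exists>z\<in>V. R x z \<and> z \<noteq> u \<and> z \<noteq> w" by blast
          have ne: "u \<noteq> w" using uw(3) irr by auto
          have "?G {u, w}"
          proof (rule G)
            fix x assume x: "x \<in> V - {u, w}"
            then show "(\<exists>y\<in>V - {u, w}. R x y) \<or> (\<exists>y\<in>{u, w}. y \<noteq> x \<and> \<not> R x y)" using uw(4)[of x] by (cases "R x u"; cases "R x w") auto
          next
            fix x assume "x \<in> {u, w}"
            then consider "x = u" | "x = w" by auto
            then show "so \<or> wit V R O' (V - {u, w}) x"
            proof cases
              case 1 then show ?thesis using uw ne OF by (intro disjI2 witI[of w]) auto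
            next
              case 2 then show ?thesis using uw(1) sym[OF uw(3)] ne OF by (intro disjI2 witI[of u]) auto
            qed
          qed (use uw in \<open>auto simp: card_insert_if\<close>)
          then show ?thesis ..
        next
          case False
          then have T: "\<exists>x\<in>V. R x u \<and> R x w \<and> (\<forall>z\<in>V. R x z \<longrightarrow> z = u \<or> z = w)" if "u \<in> V" "w \<in> V" "R u w" for u w
            using that by blast
          have tri: "\<exists>x\<in>V. R x u \<and> R x w \<and> (\<forall>z\<in>V. R x z \<longrightarrow> z = u \<or> z = w) \<and> (\<forall>z\<in>V. R u z \<longrightarrow> z = x \<or> z = w) \<and> (\<forall>z\<in>V. R w z \<longrightarrow> z = x \<or> z = u)"
            if uw: "u \<in> V" "w \<in> V" "R u w" for u w
          proof -
            obtain x where x: "x \<in> V" "R x u" "R x w" "\<And>z. z \<in> V \<Longrightarrow> R x z \<Longrightarrow> z = u \<or> z = w" using T[OF uw] by blast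
            obtain a where a: "a \<in> V" "R a x" "R a u" "\<And>z. z \<in> V \<Longrightarrow> R a z \<Longrightarrow> z = x \<or> z = u"
              using T[OF x(1) uw(1) x(2)] by blast
            have aw: "a = w" using x(4)[OF a(1) sym[OF a(2)]] a(3) irr by auto
            obtain b where b: "b \<in> V" "R b x" "R b w" "\<And>z. z \<in> V \<Longrightarrow> R b z \<Longrightarrow> z = x \<or> z = w"
              using T[OF x(1) uw(2) x(3)] by blast
            have bu: "b = u" using x(4)[OF b(1) sym[OF b(2)]] b(3) irr by auto
            show ?thesis
              using x(4) a(4) b(4) unfolding aw bu by (intro bexI[OF _ x(1)] conjI x(2,3)) auto
          qed
          have dyV: "d \<in> V" "y \<in> V" using d y by auto
          obtain x where X: "x \<in> V" "R x d \<and> R x y \<and> (\<forall>z\<in>V. R x z \<longrightarrow> z = d \<or> z = y) \<and>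
            (\<forall>z\<in>V. R d z \<longrightarrow> z = x \<or> z = y) \<and> (\<forall>z\<in>V. R y z \<longrightarrow> z = x \<or> z = d)"
            using tri[OF dyV y(2)] by (rule bexE)
          have x: "x \<in> V" "R x d" "R x y" "\<And>z. z \<in> V \<Longrightarrow> R x z \<Longrightarrow> z = d \<or> z = y"
            "\<And>z. z \<in> V \<Longrightarrow> R d z \<Longrightarrow> z = x \<or> z = y" "\<And>z. z \<in> V \<Longrightarrow> R y z \<Longrightarrow> z = x \<or> z = d"
            using X by blast+
          have c3: "card {d, y, x} \<le> 4" by (simp add: card_insert_if)
          obtain e where e: "e \<in> W" "e \<notin> {d, y, x}" using bigW[OF c3] by blast
          then obtain f where f: "f \<in> V" "R e f" "e \<in> V" by (auto simp: W_def)
          have fn: "f \<notin> {d, y, x}"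
          proof
            assume "f \<in> {d, y, x}"
            then have "e \<in> {d, y, x}" using x(4,5,6)[OF f(3)] sym[OF f(2)] by auto
            then show False using e by auto
          qed
          \<comment> \<open>One edge from each of two different triangles: nobody is red to vertices
            of both. This is where four vertices are needed outside, hence the bound in
            \<open>kern\<close>.\<close>
          let ?D = "{d, y, e, f}"
          have c4: "card ?D \<le> 4" by (simp add: card_insert_if)
          have "?G ?D"
          proof (rule G)
            fix v assume v: "v \<in> V - ?D"
            have "\<not> R v d \<or> \<not> R v e"
            proof (rule ccontr)
              assume "\<not> ?thesis"
              then have vd: "R d v" "R v e" using sym by auto
              then have "v = x" using x(5)[of v] v by auto
              then show False using x(4)[OF f(3)] vd e by auto
            qed
            then show "(\<exists>y\<in>V - ?D. R v y) \<or> (\<exists>y\<in>?D. y \<noteq> v \<and> \<not> R v y)" using v by auto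
          next
            have ne: "d \<noteq> y" "e \<noteq> f" using y f irr by auto
            fix v assume "v \<in> ?D"
            then consider "v = d" | "v = y" | "v = e" | "v = f" by auto
            then show "so \<or> wit V R O' (V - ?D) v"
            proof cases
              case 1 then show ?thesis using y ne dyV OF by (intro disjI2 witI[of y]) auto
            next
              case 2 then show ?thesis using sym[OF y(2)] ne dyV OF by (intro disjI2 witI[of d]) auto
            next
              case 3 then show ?thesis using f ne OF by (intro disjI2 witI[of f]) auto
            next
              case 4 then show ?thesis using sym[OF f(2)] f ne OF by (intro disjI2 witI[of e]) auto
            qed
          qed (use dyV f c4 in auto)
          then show ?thesis ..
        qed
      qed
    qed
  qed
  then obtain D where D: "sol V R si so I O' (V - D)" "card D \<le> 4" "D \<subseteq> V" by blast
  show "\<exists>C'. sol V R si so I O' C' \<and> card C \<le> card C' \<and> (card (V - C') \<le> 4 \<or> C' = {} \<or> (False \<and> C' \<subseteq> {}))"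
    by (rule small_D'[where P="sol V R si so I O'", OF D big CV])
qed simp

text \<open>Every vertex of \<open>C\<close> needs a red neighbour, so \<open>C\<close> lies in
  \<open>W\<close>, and the inside of \<open>W\<close> supports itself. \<open>W\<close> can only
  fail if a single isolated vertex \<open>j\<close> needs a companion outside, and then one or two
  vertices of \<open>W\<close> can join it there.\<close>

lemma kern_redin:
  assumes I: "I True True" "\<not> I False False" "\<not> I False True" and si: "\<not> si"
  shows "kern V (sol V R si so I O') False W"
proof (rule kernI)
  fix C assume C: "sol V R si so I O' C" and big: "4 < card (V - C)"
  have CV: "C \<subseteq> V" using C by (auto simp: sol_def)
  have inR: "\<exists>y\<in>V. R x y" if "x \<in> C" for x
  proof -
    have "wit V R I C x" using C that si by (auto simp: sol_def)
    then obtain y where "y \<in> V" "I (R x y) (y \<in> C)" unfolding wit_def by blast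
    then show ?thesis using I by (cases "R x y"; cases "y \<in> C") auto
  qed
  then have CW: "C \<subseteq> W" using CV unfolding W_def by blast
  have cCW: "card C \<le> card W" by (rule card_mono[OF fW CW])
  let ?goal = "\<exists>C'. sol V R si so I O' C' \<and> card C \<le> card C' \<and> (card (V - C') \<le> 4 \<or> C' = W \<or> (False \<and> C' \<subseteq> W))"
  have solW: ?goal if "\<And>x. x \<in> V - W \<Longrightarrow> so \<or> wit V R O' W x"
  proof -
    have "sol V R si so I O' W"
    proof (rule solI)
      fix x assume "x \<in> W"
      from W_nb[OF this] obtain y where "y \<in> W" "R x y" by blast
      then show "si \<or> wit V R I W x" using I WV irr by (intro disjI2 witI[of y]) auto
    qed (use WV that in auto)
    then show ?thesis using cCW by blast
  qed
  show ?goal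
  proof (cases "\<forall>x\<in>V - W. so \<or> wit V R O' W x")
    case True
    then show ?thesis using solW by blast
  next
    case False
    then obtain j where j: "j \<in> V" "j \<notin> W" "\<not> so" "\<not> wit V R O' W j" by auto
    have jR1: "\<not> R j y" if "y \<in> V" for y using notW[of j y] j that by simp
    have jR: "\<not> R j y" "\<not> R y j" if "y \<in> V" for y using jR1[OF that] sym[of y j] by blast+
    have "j \<in> V - C" using j CW by auto
    then have "wit V R O' C j" using C j by (auto simp: sol_def)
    then obtain y where y: "y \<in> V" "y \<noteq> j" "O' False (y \<in> C)" using jR unfolding wit_def by auto
    have yC: "y \<notin> C"
    proof
      assume "y \<in> C"
      then have "wit V R O' W j" using y CW jR by (intro witI[of y]) auto
      then show False using j by simp
    qed
    then have OFF: "O' False False" using y by simp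
    have yW: "y \<in> W"
    proof (rule ccontr)
      assume "y \<notin> W"
      then have "wit V R O' W j" using y jR yC by (intro witI[of y]) auto
      then show False using j by simp
    qed
    have onlyj: "V - W = {j}"
    proof (rule ccontr)
      assume "V - W \<noteq> {j}"
      then obtain i where "i \<in> V" "i \<notin> W" "i \<noteq> j" using j by auto
      then have "wit V R O' W j" using jR OFF by (intro witI[of i]) auto
      then show False using j by simp
    qed
    have G: ?goal if D: "D \<subseteq> W" "D \<noteq> {}" "card D \<le> 3" "\<And>x. x \<in> W - D \<Longrightarrow> (\<exists>z\<in>W - D. R x z) \<or> (I True False \<and> (\<exists>z\<in>D. R x z))" for D
    proof -
      have fD: "finite D" by (rule finite_subset[OF D(1) fW])
      have "sol V R si so I O' (V - insert j D)"
      proof (rule solI)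
        fix x assume "x \<in> V - insert j D"
        then have x: "x \<in> W - D" using onlyj by auto
        from D(4)[OF this] show "si \<or> wit V R I (V - insert j D) x"
        proof
          assume "\<exists>z\<in>W - D. R x z"
          then obtain z where z: "z \<in> W - D" "R x z" by blast
          then have "z \<in> V - insert j D" "z \<noteq> x" using WV j by auto
          then show ?thesis using z(2) I by (intro disjI2 witI[of z]) auto
        next
          assume "I True False \<and> (\<exists>z\<in>D. R x z)"
          then obtain z where "z \<in> D" "R x z" "I True False" by blast
          then show ?thesis using WV D irr by (intro disjI2 witI[of z]) auto
        qed
      next
        fix x assume "x \<in> V - (V - insert j D)"
        then consider "x = j" | "x \<in> D" by auto
        then show "so \<or> wit V R O' (V - insert j D) x"
        proof cases
          case 1
          obtain z where "z \<in> D" using D by auto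
          then have "z \<in> V" "z \<noteq> j" using D WV j by auto
          then show ?thesis using \<open>z \<in> D\<close> 1 jR OFF by (intro disjI2 witI[of z]) auto
        next
          case 2
          then have "x \<in> V" "x \<noteq> j" using D WV j by auto
          then show ?thesis using j jR OFF by (intro disjI2 witI[of j]) auto
        qed
      qed auto
      moreover have "card (insert j D) \<le> 4" using D fD by (simp add: card_insert_if)
      moreover have "insert j D \<subseteq> V" using j D WV by auto
      ultimately show ?thesis by (rule small_D'[where P="sol V R si so I O'", OF _ _ _ big CV])
    qed
    show ?thesis
    proof (cases "I True False")
      case True
      show ?thesis
      proof (rule G[of "{y}"])
        fix x assume x: "x \<in> W - {y}"
        then obtain u where "u \<in> W" "R x u" using W_nb by blast
        then show "(\<exists>z\<in>W - {y}. R x z) \<or> (I True False \<and> (\<exists>z\<in>{y}. R x z))"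
          using True by (cases "u = y") auto
      qed (use yW in auto)
    next
      case nI: False
      show ?thesis
      \<comment> \<open>\<open>y\<close> may go unless it is the only neighbour of some
        \<open>x\<close>. Then \<open>x\<close> may go, since only \<open>y\<close> loses a
        neighbour, unless \<open>x\<close> is also the only neighbour of \<open>y\<close>; in that
        case the whole component goes.\<close>
      proof (cases "\<exists>x\<in>W. \<forall>z\<in>W. R x z \<longrightarrow> z = y")
        case False
        show ?thesis by (rule G[of "{y}"]) (use yW False in auto)
      next
        case True
        then obtain x where x: "x \<in> W" "\<And>z. z \<in> W \<Longrightarrow> R x z \<Longrightarrow> z = y" by blast
        have Rxy: "R x y" using W_nb[OF x(1)] x(2) by auto
        then have xy: "x \<noteq> y" by auto
        show ?thesis
        proof (cases "\<forall>z\<in>W. R y z \<longrightarrow> z = x")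
          case False
          then obtain z where z: "z \<in> W" "R y z" "z \<noteq> x" by blast
          show ?thesis
          proof (rule G[of "{x}"])
            fix v assume v: "v \<in> W - {x}"
            obtain u where u: "u \<in> W" "R v u" using W_nb v by blast
            have "u \<noteq> x \<or> v = y" using x(2)[of v] u sym v by auto
            then show "(\<exists>z\<in>W - {x}. R v z) \<or> (I True False \<and> (\<exists>z\<in>{x}. R v z))"
              using u z by auto
          qed (use x(1) in auto)
        next
          case True
          show ?thesis
          proof (rule G[of "{x, y}"])
            fix v assume v: "v \<in> W - {x, y}"
            obtain u where u: "u \<in> W" "R v u" using W_nb v by blast
            have "u \<noteq> x" "u \<noteq> y" using x(2)[of v] True u sym v by auto
            then show "(\<exists>z\<in>W - {x, y}. R v z) \<or> (I True False \<and> (\<exists>z\<in>{x, y}. R v z))"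
              using u by auto
          qed (use x(1) yW in \<open>auto simp: card_insert_if\<close>)
        qed
      qed
    qed
  qed
qed simp

text \<open>From here on only \<open>I True False\<close> holds: every vertex of \<open>C\<close> needs a neighbour outside of \<open>C\<close>.\<close>

abbreviation "Iro \<equiv> (\<lambda>c b. c \<and> \<not> b)"

lemma wit_Iro: "C \<subseteq> V \<Longrightarrow> wit V R Iro C x \<longleftrightarrow> (\<exists>d\<in>V - C. R x d)"
proof
  assume "wit V R Iro C x"
  then show "\<exists>d\<in>V - C. R x d" unfolding wit_def by auto
next
  assume "\<exists>d\<in>V - C. R x d"
  then obtain d where "d \<in> V - C" "R x d" by auto
  moreover from this have "d \<noteq> x" by auto
  ultimately show "wit V R Iro C x" by (intro witI[of d]) auto
qed

lemma sol_sub_W: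
  assumes "sol V R False so Iro O' C"
  shows "C \<subseteq> W" "C \<subseteq> V"
proof -
  show "C \<subseteq> V" using assms by (simp add: sol_def)
  show "C \<subseteq> W"
  proof
    fix x assume "x \<in> C"
    then have "wit V R Iro C x" "x \<in> V" using assms by (auto simp: sol_def)
    then show "x \<in> W" unfolding W_def wit_def by blast
  qed
qed

text \<open>Every solution lies in \<open>W\<close> by \<open>sol_sub_W\<close>, so the second half
  of \<open>kern\<close> is immediate and only large \<open>W\<close> remains.\<close>

lemma kern_W:
  assumes "\<And>k. gk k \<le> card W \<Longrightarrow> \<exists>C. sol V R False so Iro O' C \<and> k \<le> card C"
  shows "kern V (sol V R False so Iro O') True W"
  by (rule kernI) (use assms sol_sub_W in blast)+

lemma gkW:
  assumes "gk k \<le> card W"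
  obtains C where "C \<subseteq> W" "k + 2 \<le> card C" "\<And>c. c \<in> C \<Longrightarrow> \<exists>d\<in>W - C. R c d" "\<And>d. d \<in> W - C \<Longrightarrow> \<exists>c\<in>C. R d c"
proof -
  obtain C where C: "C \<subseteq> W" "card W \<le> 2 * card C" "\<And>c. c \<in> C \<Longrightarrow> \<exists>d\<in>W - C. R c d" "\<And>d. d \<in> W - C \<Longrightarrow> \<exists>c\<in>C. R d c"
    by (rule dominating_partition[OF WV W_nb]) (assumption, rule that)
  have "k + 2 \<le> card C" using C(2) assms gk_bounds(2)[of k] by linarith
  then show ?thesis using that[of C] C by blast
qed

lemma kern_so: "kern V (sol V R False True Iro O') True W"
proof (rule kern_W)
  fix k assume "gk k \<le> card W"
  then obtain C where C: "C \<subseteq> W" "k + 2 \<le> card C" "\<And>c. c \<in> C \<Longrightarrow> \<exists>d\<in>W - C. R c d" using gkW by metis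
  have CV: "C \<subseteq> V" using C WV by auto
  have "sol V R False True Iro O' C"
    by (rule solI) (use CV C(3) WV in \<open>auto simp: wit_Iro[OF CV]\<close>, blast)
  then show "\<exists>C. sol V R False True Iro O' C \<and> k \<le> card C" using C(2) by (intro exI[of _ C]) auto
qed

text \<open>In a dominating partition of \<open>W\<close> the inside and the outside serve each
  other by red edges. An isolated vertex is blue to everything and is served by any vertex of
  \<open>C\<close>, or any vertex of \<open>W - C\<close>.\<close>

lemma sol_red_in:
  assumes "O' True True" "V = W \<or> O' False True \<or> O' False False" "gk k \<le> card W"
  shows "\<exists>C. sol V R False so Iro O' C \<and> k \<le> card C"
proof -
  obtain C where C: "C \<subseteq> W" "k + 2 \<le> card C" "\<And>c. c \<in> C \<Longrightarrow> \<exists>d\<in>W - C. R c d" "\<And>d. d \<in> W - C \<Longrightarrow> \<exists>c\<in>C. R d c"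
    using gkW[OF assms(3)] by metis
  have CV: "C \<subseteq> V" using C WV by auto
  have "C \<noteq> {}" using C(2) by auto
  then obtain c where c: "c \<in> C" by auto
  obtain d where d: "d \<in> W - C" using C(3)[OF c] by auto
  have "sol V R False so Iro O' C"
  proof (rule solI)
    fix x assume "x \<in> C"
    then show "False \<or> wit V R Iro C x" using C(3)[of x] WV unfolding wit_Iro[OF CV] by blast
  next
    fix x assume x: "x \<in> V - C"
    show "so \<or> wit V R O' C x"
    proof (cases "x \<in> W")
      case True
      then obtain y where y: "y \<in> C" "R x y" using C(4)[of x] x by auto
      then have "y \<noteq> x" by auto
      then show ?thesis using y CV assms(1) by (intro disjI2 witI[of y]) auto
    next
      case False
      then consider "O' False True" | "O' False False" using assms(2) x by auto
      then show ?thesis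
      proof cases
        case 1
        then show ?thesis using c x CV notW[of x c] False by (intro disjI2 witI[of c]) auto
      next
        case 2
        then show ?thesis using d x WV notW[of x d] False by (intro disjI2 witI[of d]) auto
      qed
    qed
  qed (rule CV)
  then show ?thesis using C(2) by (intro exI[of _ C]) auto
qed

lemma kern_r1: "O' True True \<Longrightarrow> O' False True \<or> O' False False \<Longrightarrow> kern V (sol V R False so Iro O') True W"
  by (rule kern_W) (use sol_red_in in blast)

lemma no_blue_W:
  assumes "sol V R False False Iro O' C" "\<not> O' False True" "\<not> O' False False"
  shows "W = V"
proof
  show "V \<subseteq> W"
  proof
    fix x assume x: "x \<in> V"
    show "x \<in> W"
    proof (cases "x \<in> C")
      case True then show ?thesis using sol_sub_W[OF assms(1)] by auto
    next
      case False
      then have "wit V R O' C x" using assms(1) x by (auto simp: sol_def)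
      then obtain y where y: "y \<in> V" "O' (R x y) (y \<in> C)" unfolding wit_def by blast
      then have "R x y" using assms(2,3) by (cases "R x y"; cases "y \<in> C") auto
      then show ?thesis using x y by (auto simp: W_def)
    qed
  qed
qed (rule WV)

lemma kern_r1_only:
  assumes "O' True True" "\<not> O' False True" "\<not> O' False False"
  shows "kern V (sol V R False False Iro O') (W = V) W"
proof (rule kernI)
  fix k assume "W = V" "gk k \<le> card W"
  then show "\<exists>C. sol V R False False Iro O' C \<and> k \<le> card C" using sol_red_in[where O'=O', OF assms(1)] by blast
next
  fix C assume C: "sol V R False False Iro O' C"
  have "W = V" by (rule no_blue_W[OF C assms(2,3)])
  then show "\<exists>C'. sol V R False False Iro O' C' \<and> card C \<le> card C' \<and> (card (V - C') \<le> 4 \<or> C' = W \<or> (W = V \<and> C' \<subseteq> W))"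
    using C sol_sub_W by blast
qed

text \<open>Any other vertex outside serves the outside here. Giving up one element \<open>c\<close>
  of a dominating partition ensures two vertices outside, which serve each other and everything
  else.\<close>

lemma kern_r0b0:
  assumes "O' True False" "O' False False"
  shows "kern V (sol V R False so Iro O') True W"
proof (rule kern_W)
  fix k assume "gk k \<le> card W"
  then obtain C where C: "C \<subseteq> W" "k + 2 \<le> card C" "\<And>c. c \<in> C \<Longrightarrow> \<exists>d\<in>W - C. R c d" using gkW by metis
  have "C \<noteq> {}" using C(2) by auto
  then obtain c where c: "c \<in> C" by auto
  obtain d where d: "d \<in> W - C" using C(3)[OF c] by auto
  let ?C = "C - {c}"
  have CV: "?C \<subseteq> V" using C WV by auto
  have O: "O' r False" for r using assms by (cases r) auto
  have "sol V R False so Iro O' ?C"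
  proof (rule solI)
    fix x assume "x \<in> ?C"
    then show "False \<or> wit V R Iro ?C x" using C(3)[of x] WV unfolding wit_Iro[OF CV] by blast
  next
    fix x assume x: "x \<in> V - ?C"
    have "c \<in> V" "d \<in> V" "c \<noteq> d" using c d C WV by auto
    then have "wit V R O' ?C x" using c d O by (cases "x = c") (intro witI[of d], auto intro: witI[of c])
    then show "so \<or> wit V R O' ?C x" ..
  qed (rule CV)
  moreover have "k \<le> card ?C" using C(1,2) c fW finite_subset by (subst card_Diff_singleton) auto
  ultimately show "\<exists>C. sol V R False so Iro O' C \<and> k \<le> card C" by blast
qed

lemma Z_nb: "x \<in> Z \<Longrightarrow> y \<in> V \<Longrightarrow> R x y \<Longrightarrow> y \<in> Z \<inter> W"
proof -
  assume x: "x \<in> Z" and y: "y \<in> V" "R x y"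
  have "y \<in> Z"
  proof (rule ccontr)
    assume "y \<notin> Z"
    then obtain z where z: "z \<in> V" "R y z" "\<And>u. u \<in> V \<Longrightarrow> R y u \<Longrightarrow> u = z" "\<And>u. u \<in> V \<Longrightarrow> R z u \<Longrightarrow> u = y"
      using y(1) unfolding Z_def by blast
    have "x \<in> V" using x by (auto simp: Z_def)
    then have "z = x" using z(3)[OF _ sym[OF y(2)]] by simp
    then have "\<exists>y\<in>V. R x y \<and> (\<forall>z\<in>V. R x z \<longrightarrow> z = y) \<and> (\<forall>z\<in>V. R y z \<longrightarrow> z = x)"
      using z(3,4) unfolding \<open>z = x\<close> by (intro bexI[OF _ y(1)] conjI y(2)) auto
    then show False using x unfolding Z_def by blast
  qed
  moreover have "y \<in> W" using x y sym by (auto simp: W_def Z_def)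
  ultimately show ?thesis by simp
qed

text \<open>No edge leaves \<open>Z\<close>, and within \<open>Z\<close> the hypothesis
  \<open>noK2\<close> of \<open>total_dominating\<close> holds. Vertices of single-edge components
  keep their only neighbour because \<open>C\<close> avoids these components.\<close>

lemma Z_total:
  assumes "5 * k + 3 \<le> card (Z \<inter> W)"
  obtains C where "C \<subseteq> Z \<inter> W" "k \<le> card C" "\<And>x. x \<in> W \<Longrightarrow> \<exists>y\<in>V - C. R x y"
proof -
  interpret S: grph "Z \<inter> W" R by unfold_locales (auto simp: sym)
  obtain C where C: "C \<subseteq> Z \<inter> W" "k \<le> card C" "\<And>v. v \<in> Z \<inter> W \<Longrightarrow> \<exists>y\<in>Z \<inter> W - C. R v y"
  proof (rule S.total_dominating[OF _ _ assms])
    fix v assume v: "v \<in> Z \<inter> W"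
    then obtain y where "y \<in> V" "R v y" by (auto simp: W_def)
    then show "\<exists>y\<in>Z \<inter> W. R v y" using Z_nb[of v y] v by blast
  next
    fix u v assume uv: "u \<in> Z \<inter> W" "v \<in> Z \<inter> W" "R u v"
    have uvV: "u \<in> V" "v \<in> V" using uv WV by auto
    have "\<not> ((\<forall>z\<in>V. R u z \<longrightarrow> z = v) \<and> (\<forall>z\<in>V. R v z \<longrightarrow> z = u))"
      using uv uvV unfolding Z_def by blast
    then obtain z where "z \<in> V" "R u z \<and> z \<noteq> v \<or> R v z \<and> z \<noteq> u" by blast
    then show "\<exists>y\<in>Z \<inter> W. R u y \<and> y \<noteq> v \<or> R v y \<and> y \<noteq> u" using Z_nb uv by blast
  qed (rule that)
  have "\<exists>y\<in>V - C. R x y" if x: "x \<in> W" for x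
  proof (cases "x \<in> Z")
    case True
    then show ?thesis using C(3)[of x] x WV by auto
  next
    case False
    obtain y where y: "y \<in> V" "R x y" using x by (auto simp: W_def)
    have "y \<notin> Z" using Z_nb[of y x] sym[OF y(2)] x WV False by auto
    then show ?thesis using y C by auto
  qed
  then show ?thesis using that[of C] C by blast
qed

text \<open>If a solution contained a vertex of a single-edge component, its partner would have to
  be outside to support it, but would then have no neighbour outside itself. So solutions stay in
  \<open>Z\<close>.\<close>

lemma kern_r0:
  assumes "O' True False" "\<not> O' True True" "\<not> O' False True" "\<not> O' False False"
  shows "kern V (sol V R False False Iro O') (W = V) Z"
proof (rule kernI)
  fix k assume W: "W = V" and k: "gk k \<le> card Z"
  have ZV: "Z \<inter> W = Z" unfolding W by (auto simp: Z_def)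
  have "5 * k + 3 \<le> card (Z \<inter> W)" unfolding ZV using k gk_bounds(2)[of k] by linarith
  then obtain C where C: "C \<subseteq> Z \<inter> W" "k \<le> card C" "\<And>x. x \<in> W \<Longrightarrow> \<exists>y\<in>V - C. R x y" using Z_total by metis
  have CV: "C \<subseteq> V" using C WV by auto
  have "sol V R False False Iro O' C"
  proof (rule solI)
    fix x assume "x \<in> C"
    then show "False \<or> wit V R Iro C x" using C(3)[of x] CV W unfolding wit_Iro[OF CV] by blast
  next
    fix x assume "x \<in> V - C"
    then obtain y where "y \<in> V - C" "R x y" using C(3)[of x] W by auto
    moreover from this have "y \<noteq> x" by auto
    ultimately show "False \<or> wit V R O' C x" using assms(1) by (intro disjI2 witI[of y]) auto
  qed (rule CV)
  then show "\<exists>C. sol V R False False Iro O' C \<and> k \<le> card C" using C by blast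
next
  fix C assume C: "sol V R False False Iro O' C"
  have W: "W = V" by (rule no_blue_W[OF C assms(3,4)])
  note CV = sol_sub_W(2)[OF C]
  have "C \<subseteq> Z"
  proof
    fix x assume x: "x \<in> C"
    show "x \<in> Z"
    proof (rule ccontr)
      assume "x \<notin> Z"
      then obtain y where y: "y \<in> V" "R x y" "\<And>u. u \<in> V \<Longrightarrow> R x u \<Longrightarrow> u = y" "\<And>u. u \<in> V \<Longrightarrow> R y u \<Longrightarrow> u = x"
        using x CV unfolding Z_def by blast
      have "wit V R Iro C x" using C x by (auto simp: sol_def)
      then have "y \<notin> C" using y(3) unfolding wit_Iro[OF CV] by blast
      then have "wit V R O' C y" using C y(1) by (auto simp: sol_def)
      then obtain z where z: "z \<in> V" "O' (R y z) (z \<in> C)" unfolding wit_def by blast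
      then have "R y z \<and> z \<notin> C" using assms by (cases "R y z"; cases "z \<in> C") auto
      then show False using y(4)[OF z(1)] x by auto
    qed
  qed
  then show "\<exists>C'. sol V R False False Iro O' C' \<and> card C \<le> card C' \<and> (card (V - C') \<le> 4 \<or> C' = Z \<or> (W = V \<and> C' \<subseteq> Z))"
    using C W by blast
qed

text \<open>If \<open>Z \<inter> W\<close> is too small for \<open>Z_total\<close>, there are many
  single-edge components. One end of each forms \<open>C\<close>: the other end is its red support,
  and is itself blue to an element of \<open>C\<close> from another component.\<close>

lemma kern_r0b1:
  assumes "O' True False" "O' False True"
  shows "kern V (sol V R False so Iro O') True W"
proof (rule kern_W)
  fix k assume k: "gk k \<le> card W"
  have J: "wit V R O' C x" if "x \<in> V" "x \<notin> W" "c \<in> C" "C \<subseteq> W" for C c x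
    using that WV notW[of x c] assms(2) by (intro witI[of c]) auto
  show "\<exists>C. sol V R False so Iro O' C \<and> k \<le> card C"
  proof (cases "5 * (k + 1) + 3 \<le> card (Z \<inter> W)")
    case True
    then obtain C where C: "C \<subseteq> Z \<inter> W" "k + 1 \<le> card C" "\<And>x. x \<in> W \<Longrightarrow> \<exists>y\<in>V - C. R x y" using Z_total by metis
    have CV: "C \<subseteq> V" using C WV by auto
    have "C \<noteq> {}" using C(2) by auto
    then obtain c where c: "c \<in> C" by auto
    have "sol V R False so Iro O' C"
    proof (rule solI)
      fix x assume "x \<in> C"
      then show "False \<or> wit V R Iro C x" using C(1) C(3)[of x] unfolding wit_Iro[OF CV] by blast
    next
      fix x assume x: "x \<in> V - C"
      show "so \<or> wit V R O' C x"
      proof (cases "x \<in> W")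
        case True
        then obtain y where "y \<in> V - C" "R x y" using C(3)[of x] by auto
        moreover from this have "y \<noteq> x" by auto
        ultimately show ?thesis using assms(1) by (intro disjI2 witI[of y]) auto
      next
        case False
        then show ?thesis using J[of x c C] x c C(1) by auto
      qed
    qed (rule CV)
    then show ?thesis using C(2) by (intro exI[of _ C]) auto
  next
    case False
    define K where "K = W - Z"
    have fK: "finite K" by (simp add: K_def)
    have "\<forall>x\<in>K. \<exists>y. y \<in> V \<and> R x y \<and> (\<forall>z\<in>V. R x z \<longrightarrow> z = y) \<and> (\<forall>z\<in>V. R y z \<longrightarrow> z = x)"
      using WV unfolding K_def Z_def by blast
    then obtain p where p: "\<And>x. x \<in> K \<Longrightarrow> p x \<in> V \<and> R x (p x) \<and> (\<forall>z\<in>V. R x z \<longrightarrow> z = p x) \<and> (\<forall>z\<in>V. R (p x) z \<longrightarrow> z = x)" by metis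
    have KV: "K \<subseteq> V" using WV by (auto simp: K_def)
    have pK: "p x \<in> K" "p (p x) = x" "p x \<noteq> x" if x: "x \<in> K" for x
    proof -
      have xV: "x \<in> V" using x KV by auto
      have r: "R (p x) x" using p[OF x] sym by blast
      have "p x \<in> W" using p[OF x] r xV by (auto simp: W_def)
      moreover have "p x \<notin> Z" using Z_nb[of "p x" x] r xV x by (auto simp: K_def)
      ultimately show k: "p x \<in> K" by (simp add: K_def)
      show "p (p x) = x" using p[OF k] p[OF x] by blast
      show "p x \<noteq> x" using r by auto
    qed
    define C where "C = {x \<in> K. x < p x}"
    have fC: "finite C" using fK by (simp add: C_def)
    have "K \<subseteq> C \<union> p ` C"
    proof
      fix x assume x: "x \<in> K"
      show "x \<in> C \<union> p ` C"
      proof (cases "x < p x")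
        case True then show ?thesis using x by (simp add: C_def)
      next
        case False
        then have "p x \<in> C" using pK[OF x] by (auto simp: C_def)
        then have "p (p x) \<in> p ` C" by (rule imageI)
        then show ?thesis using pK(2)[OF x] by simp
      qed
    qed
    then have "card K \<le> card (C \<union> p ` C)" by (rule card_mono[rotated]) (use fC in auto)
    also have "\<dots> \<le> 2 * card C" using card_Un_le[of C "p ` C"] card_image_le[OF fC, of p] by linarith
    finally have "card K \<le> 2 * card C" .
    moreover have "card W \<le> card K + card (Z \<inter> W)"
    proof -
      have "W = K \<union> (Z \<inter> W)" by (auto simp: K_def)
      then show ?thesis using card_Un_le[of K "Z \<inter> W"] by simp
    qed
    moreover have "card (Z \<inter> W) < 5 * k + 8" using False by simp
    moreover have "15 * k + 40 \<le> card W" using k gk_bounds(2)[of k] by (rule order_trans[rotated])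
    ultimately have cC: "k + 2 \<le> card C" by simp
    have CV: "C \<subseteq> V" using KV by (auto simp: C_def)
    have CW: "C \<subseteq> W" by (auto simp: C_def K_def)
    have two: "\<exists>c\<in>C. c \<noteq> a" for a
    proof (rule ccontr)
      assume "\<not> ?thesis" then have "C \<subseteq> {a}" by auto
      then have "card C \<le> card {a}" by (rule card_mono[rotated]) simp
      then show False using cC by simp
    qed
    have pC: "p x \<notin> C" if "x \<in> C" for x using that pK(2)[of x] by (auto simp: C_def)
    have "sol V R False so Iro O' C"
    proof (rule solI)
      fix x assume x: "x \<in> C"
      then have "x \<in> K" by (simp add: C_def)
      then show "False \<or> wit V R Iro C x" using p[of x] pC[OF x] unfolding wit_Iro[OF CV] by blast
    next
      fix x assume x: "x \<in> V - C"
      consider "x \<in> Z" "x \<in> W" | "x \<in> K" | "x \<notin> W" by (auto simp: K_def)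
      then have "wit V R O' C x"
      proof cases
        case 1
        then obtain y where y: "y \<in> V" "R x y" by (auto simp: W_def)
        then have "y \<in> Z" using Z_nb 1 by blast
        then have "y \<notin> C" by (auto simp: C_def K_def)
        moreover have "y \<noteq> x" using y by auto
        ultimately show ?thesis using y assms(1) by (intro witI[of y]) auto
      next
        case 2
        obtain c where c: "c \<in> C" "c \<noteq> p x" using two by blast
        have "\<not> R x c" using p[OF 2] c CV by blast
        then show ?thesis using c x CV assms(2) by (intro witI[of c]) auto
      next
        case 3
        obtain c where c: "c \<in> C" using two by blast
        show ?thesis by (rule J[OF _ 3 c CW]) (use x in simp)
      qed
      then show "so \<or> wit V R O' C x" ..
    qed (rule CV)
    then show ?thesis using cC by (intro exI[of _ C]) auto
  qed
qed

lemma kern_none: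
  assumes "\<And>a b. \<not> O' a b"
  shows "kern V (sol V R False False I O') False {}"
proof (rule kernI)
  fix C assume C: "sol V R False False I O' C" and big: "4 < card (V - C)"
  have "V - C = {}" using C assms by (auto simp: sol_def wit_def)
  then have "card (V - C) = 0" by (simp only: card.empty)
  then have False using big by linarith
  then show "\<exists>C'. sol V R False False I O' C' \<and> card C \<le> card C' \<and> (card (V - C') \<le> 4 \<or> C' = {} \<or> (False \<and> C' \<subseteq> {}))" ..
qed simp

text \<open>These solutions are exactly the self-supporting pairs that cover \<open>V\<close>;
  nonempty ones exist iff \<open>alt4\<close> holds, and none contains a peeled vertex.\<close>

lemma kern_b1:
  assumes "\<And>a b. O' a b \<longleftrightarrow> \<not> a \<and> b"
  shows "kern V (sol V R False False Iro O') alt4 {x \<in> V. \<not> peeled x}"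
proof -
  have e: "sol V R False False Iro O' C \<longleftrightarrow> sp C (V - C)" for C
  proof (cases "C \<subseteq> V")
    case True
    have "wit V R O' C x \<longleftrightarrow> (\<exists>c\<in>C. B x c)" for x
      using True unfolding wit_def assms B_def by auto
    then show ?thesis using True unfolding sol_def sp_def wit_Iro[OF True] by auto
  next
    case False then show ?thesis by (auto simp: sol_def sp_def)
  qed
  show ?thesis unfolding e
  proof (rule kernI)
    fix k assume a: alt4 and k: "gk k \<le> card {x \<in> V. \<not> peeled x}"
    have "2 * k + 2 ^ k * (k + 1) < card {x \<in> V. \<not> peeled x}" using k gk_bounds(4)[of k] by linarith
    then obtain C where "sp C (V - C)" "k \<le> card C" by (rule unpeeled_many[OF a])
    then show "\<exists>C. sp C (V - C) \<and> k \<le> card C" by blast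
  next
    fix C assume C: "sp C (V - C)" and big: "4 < card (V - C)"
    have "C \<noteq> {}"
    proof
      assume "C = {}"
      then have "V - C = {}" using C by (auto simp: sp_def)
      then have "card (V - C) = 0" by (simp only: card.empty)
      then show False using big by linarith
    qed
    then have a: alt4 by (rule sp_alt4[OF C])
    have "C \<subseteq> {x \<in> V. \<not> peeled x}" using peeled_out[OF C] C by (auto simp: sp_def)
    then show "\<exists>C'. sp C' (V - C') \<and> card C \<le> card C' \<and>
      (card (V - C') \<le> 4 \<or> C' = {x \<in> V. \<not> peeled x} \<or> (alt4 \<and> C' \<subseteq> {x \<in> V. \<not> peeled x}))"
      using C a by blast
  qed
qed

lemma univ_red: "univ x \<Longrightarrow> y \<in> V \<Longrightarrow> y \<noteq> x \<Longrightarrow> R x y" by (auto simp: univ_def)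

lemma Vp_blue: "x \<in> Vp \<Longrightarrow> \<exists>y\<in>Vp. y \<noteq> x \<and> \<not> R x y"
proof -
  assume x: "x \<in> Vp"
  then obtain y where y: "y \<in> V" "y \<noteq> x" "\<not> R x y" by (auto simp: Vp_def univ_def)
  have "\<not> univ y"
  proof
    assume "univ y"
    then have "R y x" using x y(2) by (auto simp: univ_def Vp_def)
    from sym[OF this] show False using y(3) by simp
  qed
  then show ?thesis using y by (auto simp: Vp_def)
qed

text \<open>All universal vertices enter \<open>C\<close>. If they are fewer than \<open>k\<close>,
  further elements \<open>M\<close> come from \<open>W'\<close>, the non-universal vertices with a
  non-universal neighbour. If \<open>J'\<close> is empty, \<open>blue_total_dominating\<close>
  applies. Otherwise a vertex of \<open>J'\<close> is blue to all of \<open>Vp\<close> and serves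
  the outside, so the simpler \<open>dominating_partition\<close> is enough.\<close>

lemma sol_blue_out:
  assumes "O' False False" "Vp \<noteq> {}" "gk k \<le> card (V - J')"
  shows "\<exists>C. sol V R False so Iro O' C \<and> k \<le> card C"
proof -
  define U where "U = V - Vp"
  have U: "univ u" if "u \<in> U" for u using that by (auto simp: U_def Vp_def)
  define W' where "W' = Vp - J'"
  have VpV: "Vp \<subseteq> V" and fVp: "finite Vp" using finS by (auto simp: Vp_def)
  have fW': "finite W'" and fU: "finite U" using fVp by (auto simp: W'_def U_def)
  have fin_sol: ?thesis if C: "C = U \<union> M" "M \<subseteq> W'" "k \<le> card U + card M" "M \<noteq> Vp"
    "\<And>x. x \<in> M \<Longrightarrow> \<exists>y\<in>Vp - M. R x y" "\<And>x. x \<in> Vp - M \<Longrightarrow> \<exists>y\<in>Vp - M. y \<noteq> x \<and> \<not> R x y" for C M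
  proof -
    have MV: "M \<subseteq> Vp" using C(2) by (auto simp: W'_def)
    have CV: "C \<subseteq> V" using C MV VpV by (auto simp: U_def)
    have VC: "V - C = Vp - M" using C MV VpV by (auto simp: U_def)
    obtain v where v: "v \<in> Vp - M" using C(4) MV by auto
    have "sol V R False so Iro O' C"
    proof (rule solI)
      fix x assume "x \<in> C"
      then have "\<exists>d\<in>V - C. R x d" unfolding VC
      proof (cases "x \<in> U")
        case True
        then have "v \<noteq> x" using v by (auto simp: U_def)
        then have "R x v" using univ_red[OF U[OF True]] v VpV by auto
        then show "\<exists>d\<in>Vp - M. R x d" using v by blast
      next
        case False
        then show "\<exists>d\<in>Vp - M. R x d" using C \<open>x \<in> C\<close> by auto
      qed
      then show "False \<or> wit V R Iro C x" unfolding wit_Iro[OF CV] by simp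
    next
      fix x assume "x \<in> V - C"
      then obtain y where "y \<in> V - C" "y \<noteq> x" "\<not> R x y" using C(6) unfolding VC by blast
      then show "so \<or> wit V R O' C x" using assms(1) by (intro disjI2 witI[of y]) auto
    qed (rule CV)
    moreover have "card C = card U + card M" unfolding C(1)
      by (rule card_Un_disjoint) (use fU fW' C(2) finite_subset in \<open>auto simp: U_def W'_def\<close>)
    ultimately show ?thesis using C(3) by (intro exI[of _ C]) auto
  qed
  have S: "V - J' = U \<union> W'" using VpV by (auto simp: U_def W'_def J'_def)
  have cS: "card (V - J') \<le> card U + card W'" unfolding S by (rule card_Un_le)
  show ?thesis
  proof (cases "k \<le> card U")
    case True
    show ?thesis by (rule fin_sol[of "U \<union> {}" "{}"]) (use True assms(2) Vp_blue in auto)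
  next
    case False
    note g = gk_bounds(3)[of k]
    have bigW: "2 * k * k + 5 * k + 5 \<le> card W'" using cS assms(3) False g by linarith
    have redW: "\<exists>y\<in>W'. R x y" if x: "x \<in> W'" for x
    proof -
      obtain y where y: "y \<in> V" "R x y" "\<not> univ y" using x by (auto simp: W'_def J'_def)
      have "y \<notin> J'"
      proof
        assume "y \<in> J'"
        then have "univ x" using sym[OF y(2)] x VpV by (auto simp: J'_def W'_def)
        then show False using x by (auto simp: W'_def Vp_def)
      qed
      then show ?thesis using y by (auto simp: W'_def Vp_def)
    qed
    show ?thesis
    proof (cases "J' = {}")
      case True
      then have W'Vp: "W' = Vp" by (auto simp: W'_def)
      interpret S: grph Vp R by unfold_locales (auto simp: fVp sym)
      have bl: "\<exists>y\<in>Vp. S.B v y" if "v \<in> Vp" for v using Vp_blue[OF that] by (auto simp: S.B_def)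
      obtain C where C: "C \<subseteq> Vp" "k \<le> card C" "\<And>c. c \<in> C \<Longrightarrow> \<exists>d\<in>Vp - C. R c d"
        "\<And>d. d \<in> Vp - C \<Longrightarrow> \<exists>y\<in>Vp - C. S.B d y"
        by (rule S.blue_total_dominating[OF _ bl, of k]) (use redW bigW that in \<open>unfold W'Vp, auto\<close>)
      have ne: "C \<noteq> Vp"
      proof
        assume "C = Vp"
        then show False using C(3) assms(2) by auto
      qed
      have C4: "\<exists>y\<in>Vp - C. y \<noteq> d \<and> \<not> R d y" if "d \<in> Vp - C" for d
        using C(4)[OF that] unfolding S.B_def by auto
      show ?thesis by (rule fin_sol[of "U \<union> C" C]) (use C(1-3) C4 ne W'Vp in auto)
    next
      case False
      then obtain j where j: "j \<in> J'" by auto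
      have jb: "\<not> R j y" "\<not> R y j" if "y \<in> Vp" for y
        using that j sym VpV by (auto simp: J'_def Vp_def)
      have W'V: "W' \<subseteq> V" using VpV by (auto simp: W'_def)
      obtain C where C: "C \<subseteq> W'" "card W' \<le> 2 * card C" "\<And>c. c \<in> C \<Longrightarrow> \<exists>d\<in>W' - C. R c d"
        by (rule dominating_partition[OF W'V redW]) (assumption, rule that)
      have jV: "j \<in> Vp - C" using j C(1) by (auto simp: J'_def W'_def)
      have "k \<le> card C" "C \<noteq> {}" using C(2) bigW by auto
      then obtain c where c: "c \<in> C" by auto
      obtain d where d: "d \<in> W' - C" using C(3)[OF c] by auto
      have dj: "d \<noteq> j" "d \<in> Vp - C" using d j by (auto simp: W'_def)
      show ?thesis
      proof (rule fin_sol[of "U \<union> C" C])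
        fix x assume "x \<in> C"
        then show "\<exists>y\<in>Vp - C. R x y" using C(3)[of x] by (auto simp: W'_def)
      next
        fix x assume x: "x \<in> Vp - C"
        show "\<exists>y\<in>Vp - C. y \<noteq> x \<and> \<not> R x y"
          using jb[of x] jb(1)[of d] jV dj x by (cases "x = j") auto
      qed (use C(1) jV \<open>k \<le> card C\<close> in auto)
    qed
  qed
qed

lemma kern_b0:
  assumes O: "O' False False" "\<not> O' True True" "\<not> O' True False"
  shows "kern V (sol V R False False Iro O') (Vp \<noteq> {}) (V - J')"
proof (rule kernI)
  fix k assume "Vp \<noteq> {}" "gk k \<le> card (V - J')"
  then show "\<exists>C. sol V R False False Iro O' C \<and> k \<le> card C" using sol_blue_out[where O'=O', OF O(1)] by blast
next
  fix C assume C: "sol V R False False Iro O' C" and big: "4 < card (V - C)"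
  note CV = sol_sub_W(2)[OF C]
  have outb: "\<not> univ x" if x: "x \<in> V - C" for x
  proof -
    have "wit V R O' C x" using C x by (auto simp: sol_def)
    then obtain y where y: "y \<in> V" "y \<noteq> x" "O' (R x y) (y \<in> C)" unfolding wit_def by blast
    then have "\<not> R x y" using O by (cases "R x y"; cases "y \<in> C") auto
    then show ?thesis using y by (auto simp: univ_def)
  qed
  obtain d where "d \<in> V - C" using ex_out[OF big] by blast
  then have Vp: "Vp \<noteq> {}" using outb by (auto simp: Vp_def)
  have "C \<subseteq> V - J'"
  proof
    fix x assume x: "x \<in> C"
    have "wit V R Iro C x" using C x by (auto simp: sol_def)
    then obtain d where "d \<in> V - C" "R x d" unfolding wit_Iro[OF CV] by blast
    then have "x \<notin> J'" using outb unfolding J'_def by blast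
    then show "x \<in> V - J'" using x CV by auto
  qed
  then show "\<exists>C'. sol V R False False Iro O' C' \<and> card C \<le> card C' \<and>
      (card (V - C') \<le> 4 \<or> C' = V - J' \<or> (Vp \<noteq> {} \<and> C' \<subseteq> V - J'))"
    using C Vp by blast
qed

end

section \<open>Naming the kernels, combining the cases, exchanging the colours\<close>

datatype shape = Nope | Noniso | Noniso_all | NoK2 | Nonuniv | Unpeeled

context grph
begin

text \<open>Names for the finitely many pairs \<open>Y\<close>, \<open>S\<close> make it possible to
  choose one kernel for a formula uniformly in the graph and to write it as a fixed first-order
  formula.\<close>

fun shY :: "shape \<Rightarrow> bool" where
  "shY Nope = False" | "shY Noniso = True" | "shY Noniso_all = (W = V)" | "shY NoK2 = (W = V)"
| "shY Nonuniv = (Vp \<noteq> {})" | "shY Unpeeled = alt4"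

fun shS :: "shape \<Rightarrow> nat set" where
  "shS Nope = {}" | "shS Noniso = W" | "shS Noniso_all = W" | "shS NoK2 = Z"
| "shS Nonuniv = V - J'" | "shS Unpeeled = {x \<in> V. \<not> peeled x}"

end

text \<open>The truth values of \<open>I\<close> leave four cases with a shape that does not depend
  on \<open>O'\<close>, and the case \<open>Iro\<close>, where a to h run through the truth values
  of \<open>O'\<close>.\<close>

lemma kern_redin_all:
  assumes "\<not> si" "\<not> I False True" "I True True \<or> \<not> I False False"
  shows "\<exists>y sh. \<forall>V R. grph V R \<longrightarrow> kern V (sol V R si so I O') (y \<and> grph.shY V R sh) (grph.shS V R sh)"
proof (cases "I True True")
  case IT: True
  show ?thesis
  proof (cases "I False False")
    case True
    show ?thesis
    proof (cases "I True False")
      case True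
      have "kern V (sol V R si so I O') (False \<and> grph.shY V R Nope) (grph.shS V R Nope)" if "grph V R" for V R
        unfolding grph.shS.simps[OF that] simp_thms by (rule grph.kern_out_both[where I=I, OF that True \<open>I False False\<close>])
      then show ?thesis by blast
    next
      case False
      have "kern V (sol V R si so I O') (False \<and> grph.shY V R Nope) (grph.shS V R Nope)" if "grph V R" for V R
        unfolding grph.shS.simps[OF that] simp_thms
        by (rule grph.kern_redin_blueout[where I=I, OF that IT True assms(2) False assms(1)])
      then show ?thesis by blast
    qed
  next
    case False
    have "kern V (sol V R si so I O') (False \<and> grph.shY V R Noniso) (grph.shS V R Noniso)" if "grph V R" for V R
      unfolding grph.shS.simps[OF that] simp_thms
      by (rule grph.kern_redin[where I=I, OF that IT False assms(2) assms(1)])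
    then show ?thesis by blast
  qed
next
  case IT: False
  then have IF: "\<not> I False False" using assms(3) by simp
  show ?thesis
  proof (cases "I True False")
    case False
    have "\<not> I a b" for a b using assms(2) IT IF False by (cases a; cases b) auto
    then have "kern V (sol V R si so I O') (False \<and> grph.shY V R Nope) (grph.shS V R Nope)" if "grph V R" for V R
      unfolding grph.shS.simps[OF that] simp_thms by (rule grph.kern_no_in[where I=I, OF that assms(1)])
    then show ?thesis by blast
  next
    case True
    have I: "I = (\<lambda>c b. c \<and> \<not> b)"
    proof (intro ext)
      fix c b show "I c b = (c \<and> \<not> b)" using True IT IF assms(2) by (cases c; cases b) auto
    qed
    have si: "si = False" using assms(1) by simp
    have "\<exists>sh. \<forall>V R. grph V R \<longrightarrow> kern V (sol V R False so (\<lambda>c b. c \<and> \<not> b) O') (grph.shY V R sh) (grph.shS V R sh)"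
    proof (cases so)
      case True
      have "kern V (sol V R False so (\<lambda>c b. c \<and> \<not> b) O') (grph.shY V R Noniso) (grph.shS V R Noniso)" if "grph V R" for V R
        using grph.kern_so[OF that] True by (simp add: grph.shS.simps[OF that] grph.shY.simps[OF that])
      then show ?thesis by blast
    next
      case False
      then have so: "so = False" by simp
      consider (a) "O' True True" "O' False True \<or> O' False False" | (b) "O' True True" "\<not> O' False True" "\<not> O' False False"
        | (c) "O' True False" "O' False False" | (d) "O' True False" "O' False True"
        | (e) "O' True False" "\<not> O' True True" "\<not> O' False True" "\<not> O' False False"
        | (f) "O' False False" "\<not> O' True True" "\<not> O' True False"
        | (g) "O' False True" "\<not> O' True True" "\<not> O' True False" "\<not> O' False False"
        | (h) "\<not> O' True True" "\<not> O' True False" "\<not> O' False True" "\<not> O' False False" by blast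
      then show ?thesis
      proof cases
        case a
        have "kern V (sol V R False so (\<lambda>c b. c \<and> \<not> b) O') (grph.shY V R Noniso) (grph.shS V R Noniso)" if "grph V R" for V R
          using grph.kern_r1[where O'=O', OF that a] by (simp add: grph.shS.simps[OF that] grph.shY.simps[OF that])
        then show ?thesis by blast
      next
        case b
        have "kern V (sol V R False so (\<lambda>c b. c \<and> \<not> b) O') (grph.shY V R Noniso_all) (grph.shS V R Noniso_all)" if "grph V R" for V R
          using grph.kern_r1_only[where O'=O', OF that b] so by (simp add: grph.shS.simps[OF that] grph.shY.simps[OF that])
        then show ?thesis by blast
      next
        case c
        have "kern V (sol V R False so (\<lambda>c b. c \<and> \<not> b) O') (grph.shY V R Noniso) (grph.shS V R Noniso)" if "grph V R" for V R
          using grph.kern_r0b0[where O'=O', OF that c] by (simp add: grph.shS.simps[OF that] grph.shY.simps[OF that])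
        then show ?thesis by blast
      next
        case d
        have "kern V (sol V R False so (\<lambda>c b. c \<and> \<not> b) O') (grph.shY V R Noniso) (grph.shS V R Noniso)" if "grph V R" for V R
          using grph.kern_r0b1[where O'=O', OF that d] by (simp add: grph.shS.simps[OF that] grph.shY.simps[OF that])
        then show ?thesis by blast
      next
        case e
        have "kern V (sol V R False so (\<lambda>c b. c \<and> \<not> b) O') (grph.shY V R NoK2) (grph.shS V R NoK2)" if "grph V R" for V R
          using grph.kern_r0[where O'=O', OF that e] so by (simp add: grph.shS.simps[OF that] grph.shY.simps[OF that])
        then show ?thesis by blast
      next
        case f
        have "kern V (sol V R False so (\<lambda>c b. c \<and> \<not> b) O') (grph.shY V R Nonuniv) (grph.shS V R Nonuniv)" if "grph V R" for V R
          using grph.kern_b0[where O'=O', OF that f] so by (simp add: grph.shS.simps[OF that] grph.shY.simps[OF that])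
        then show ?thesis by blast
      next
        case g
        have g': "O' a b \<longleftrightarrow> \<not> a \<and> b" for a b using g by (cases a; cases b) auto
        have "kern V (sol V R False so (\<lambda>c b. c \<and> \<not> b) O') (grph.shY V R Unpeeled) (grph.shS V R Unpeeled)" if "grph V R" for V R
          using grph.kern_b1[where O'=O', OF that g'] so by (simp add: grph.shS.simps[OF that] grph.shY.simps[OF that])
        then show ?thesis by blast
      next
        case h
        have h': "\<not> O' a b" for a b using h by (cases a; cases b) auto
        have "kern V (sol V R False so (\<lambda>c b. c \<and> \<not> b) O') (grph.shY V R Nope) (grph.shS V R Nope)" if "grph V R" for V R
          using grph.kern_none[where O'=O', OF that h'] so by (simp add: grph.shS.simps[OF that] grph.shY.simps[OF that])
        then show ?thesis by blast
      qed
    qed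
    then obtain sh where sh: "\<And>V R. grph V R \<Longrightarrow> kern V (sol V R False so (\<lambda>c b. c \<and> \<not> b) O') (grph.shY V R sh) (grph.shS V R sh)" by blast
    show ?thesis unfolding I si
      by (intro exI[of _ True] exI[of _ sh] allI impI) (use sh in simp)
  qed
qed

text \<open>The graph itself for \<open>c = True\<close> and its complement for
  \<open>c = False\<close>. Complementing turns the cases with blue supports into those with red
  supports, which halves the work.\<close>

definition recol :: "bool \<Rightarrow> (nat \<Rightarrow> nat \<Rightarrow> bool) \<Rightarrow> nat \<Rightarrow> nat \<Rightarrow> bool" where
  "recol c R x y \<longleftrightarrow> x \<noteq> y \<and> (R x y \<longleftrightarrow> c)"

lemma recol_grph: "grph V R \<Longrightarrow> grph V (recol c R)"
  by (rule grph.intro) (auto simp: recol_def grph.fin dest: grph.sym)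

lemma sol_recol: "sol V (recol c R) si so I O' C \<longleftrightarrow> sol V R si so (\<lambda>a b. I (a = c) b) (\<lambda>a b. O' (a = c) b) C"
proof -
  have "wit V (recol c R) T C x \<longleftrightarrow> wit V R (\<lambda>a b. T (a = c) b) C x" for T x
    unfolding wit_def recol_def by (intro bex_cong refl conj_cong) auto
  then show ?thesis unfolding sol_def by simp
qed

text \<open>The flag \<open>y\<close> is there because \<open>Y\<close> may have to be false although \<open>S\<close> is not the empty set of
  \<open>Nope\<close>.\<close>

theorem kern_exists:
  "\<exists>c y sh. \<forall>V R. grph V R \<longrightarrow>
     kern V (sol V R si so I O') (y \<and> grph.shY V (recol c R) sh) (grph.shS V (recol c R) sh)"
proof -
  have swap: ?thesis if h: "\<exists>y sh. \<forall>V R. grph V R \<longrightarrow>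
     kern V (sol V R si so (\<lambda>a b. I (a = c) b) (\<lambda>a b. O' (a = c) b)) (y \<and> grph.shY V R sh) (grph.shS V R sh)" for c
  proof -
    have e: "(\<lambda>a b. I ((a = c) = c) b) = I" "(\<lambda>a b. O' ((a = c) = c) b) = O'" by (cases c; simp)+
    obtain y sh where *: "\<And>V R. grph V R \<Longrightarrow>
     kern V (sol V R si so (\<lambda>a b. I (a = c) b) (\<lambda>a b. O' (a = c) b)) (y \<and> grph.shY V R sh) (grph.shS V R sh)" using h by blast
    have "kern V (sol V R si so I O') (y \<and> grph.shY V (recol c R) sh) (grph.shS V (recol c R) sh)" if "grph V R" for V R
    proof -
      have "sol V (recol c R) si so (\<lambda>a b. I (a = c) b) (\<lambda>a b. O' (a = c) b) = sol V R si so I O'"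
        by (rule ext) (simp only: sol_recol e)
      then show ?thesis using *[OF recol_grph[OF that, of c]] by simp
    qed
    then show ?thesis by blast
  qed
  consider (a) "si \<or> (I True True \<and> I False True)" | (b) "I True False" "I False False"
    | (c) "\<not> si" "\<not> I False True" "I True True \<or> \<not> I False False"
    | (d) "\<not> si" "\<not> I True True" "I False True \<or> \<not> I True False" by blast
  then show ?thesis
  proof cases
    case a
    have "kern V (sol V R si so I O') (False \<and> grph.shY V (recol True R) Nope) (grph.shS V (recol True R) Nope)" if "grph V R" for V R
      unfolding grph.shS.simps[OF recol_grph[OF that]] simp_thms by (rule grph.kern_all[where I=I, OF that a])
    then show ?thesis by blast
  next
    case b
    have "kern V (sol V R si so I O') (False \<and> grph.shY V (recol True R) Nope) (grph.shS V (recol True R) Nope)" if "grph V R" for V R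
      unfolding grph.shS.simps[OF recol_grph[OF that]] simp_thms by (rule grph.kern_out_both[where I=I, OF that b])
    then show ?thesis by blast
  next
    case c
    show ?thesis by (rule swap[of True], rule kern_redin_all) (use c in simp_all)
  next
    case d
    show ?thesis by (rule swap[of False], rule kern_redin_all) (use d in simp_all)
  qed
qed

section \<open>Circuits\<close>

text \<open>Circuits as trees without shared gates: at constant depth the sizes stay under control,
  and trees compose more easily than lists of gates.\<close>

datatype bf = BIn nat | BNeg bf | BAll "bf list" | BAny "bf list"

fun bev :: "word \<Rightarrow> bf \<Rightarrow> bool" where
  "bev w (BIn i) \<longleftrightarrow> w ! i"
| "bev w (BNeg t) \<longleftrightarrow> \<not> bev w t"
| "bev w (BAll ts) \<longleftrightarrow> (\<forall>t\<in>set ts. bev w t)"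
| "bev w (BAny ts) \<longleftrightarrow> (\<exists>t\<in>set ts. bev w t)"

fun bsz :: "bf \<Rightarrow> nat" where
  "bsz (BIn i) = 1"
| "bsz (BNeg t) = Suc (bsz t)"
| "bsz (BAll ts) = Suc (sum_list (map bsz ts))"
| "bsz (BAny ts) = Suc (sum_list (map bsz ts))"

fun bok :: "nat \<Rightarrow> nat \<Rightarrow> bf \<Rightarrow> bool" where
  "bok n d (BIn i) \<longleftrightarrow> i < n"
| "bok n d (BNeg t) \<longleftrightarrow> 0 < d \<and> bok n (d - 1) t"
| "bok n d (BAll ts) \<longleftrightarrow> 0 < d \<and> (\<forall>t\<in>set ts. bok n (d - 1) t)"
| "bok n d (BAny ts) \<longleftrightarrow> 0 < d \<and> (\<forall>t\<in>set ts. bok n (d - 1) t)"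

lemma bok_mono: "bok n d t \<Longrightarrow> d \<le> d' \<Longrightarrow> bok n d' t"
proof (induction t arbitrary: d d')
  case (BNeg t)
  have "bok n (d' - 1) t" by (rule BNeg.IH[of "d - 1"]) (use BNeg.prems in auto)
  then show ?case using BNeg.prems by simp
next
  case (BAll ts)
  have "bok n (d' - 1) t" if "t \<in> set ts" for t
    by (rule BAll.IH[OF that, of "d - 1"]) (use BAll.prems that in auto)
  then show ?case using BAll.prems by simp
next
  case (BAny ts)
  have "bok n (d' - 1) t" if "t \<in> set ts" for t
    by (rule BAny.IH[OF that, of "d - 1"]) (use BAny.prems that in auto)
  then show ?case using BAny.prems by simp
qed auto

section \<open>Flattening formula trees into circuits\<close>

definition run :: "('v list \<Rightarrow> gate \<Rightarrow> 'v) \<Rightarrow> circuit \<Rightarrow> 'v list" where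
  "run F gs = foldl (\<lambda>vs g. vs @ [F vs g]) [] gs"

lemma run_snoc: "run F (gs @ [g]) = run F gs @ [F (run F gs) g]"
  by (simp add: run_def)

lemma run_append: "\<exists>zs. run F (gs @ hs) = run F gs @ zs \<and> length zs = length hs"
proof (induction hs rule: rev_induct)
  case (snoc h hs)
  then obtain zs where "run F (gs @ hs) = run F gs @ zs" "length zs = length hs" by blast
  then show ?case using run_snoc[of F "gs @ hs" h] by auto
qed simp

lemma length_run: "length (run F gs) = length gs"
  using run_append[of F "[]" gs] by (auto simp: run_def)

lemma run_nth: "j < length gs \<Longrightarrow> run F (gs @ hs) ! j = run F gs ! j"
  using run_append[of F gs hs] length_run[of F gs] by (auto simp: nth_append)

definition wfl :: "nat \<Rightarrow> circuit \<Rightarrow> bool" where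
  "wfl n gs \<longleftrightarrow> (\<forall>m < length gs. wf_gate n m (gs ! m))"

lemma wfl_snoc: "wfl n gs \<Longrightarrow> wf_gate n (length gs) g \<Longrightarrow> wfl n (gs @ [g])"
  unfolding wfl_def by (auto simp: nth_append less_Suc_eq)

definition realizes :: "circuit \<Rightarrow> nat \<Rightarrow> nat \<Rightarrow> bf \<Rightarrow> bool" where
  "realizes gs j d t \<longleftrightarrow> j < length gs \<and> (\<forall>w. run (gate_val w) gs ! j = bev w t) \<and> run gate_depth gs ! j \<le> d"

lemma realizes_append: "realizes gs j d t \<Longrightarrow> realizes (gs @ hs) j d t"
  unfolding realizes_def by (auto simp: run_nth)

lemma realizes_last:
  assumes "\<And>w. gate_val w (run (gate_val w) gs) g = bev w t" "gate_depth (run gate_depth gs) g \<le> d"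
  shows "realizes (gs @ [g]) (length gs) d t"
  unfolding realizes_def using assms by (auto simp: run_snoc nth_append length_run)

lemma flatten_list:
  assumes "\<And>t gs. t \<in> set ts \<Longrightarrow> wfl n gs \<Longrightarrow>
      \<exists>hs. length hs \<le> bsz t \<and> wfl n (gs @ hs) \<and> hs \<noteq> [] \<and> realizes (gs @ hs) (length gs + length hs - 1) d t"
    and "wfl n gs"
  shows "\<exists>hs js. length hs \<le> sum_list (map bsz ts) \<and> wfl n (gs @ hs) \<and> length js = length ts \<and>
      (\<forall>i < length ts. realizes (gs @ hs) (js ! i) d (ts ! i))"
  using assms
proof (induction ts arbitrary: gs)
  case (Cons t ts)
  obtain hs where hs: "length hs \<le> bsz t" "wfl n (gs @ hs)" "realizes (gs @ hs) (length gs + length hs - 1) d t"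
    using Cons.prems(1)[of t gs] Cons.prems(2) by auto
  obtain hs' js where js: "length hs' \<le> sum_list (map bsz ts)" "wfl n ((gs @ hs) @ hs')" "length js = length ts"
    "\<forall>i < length ts. realizes ((gs @ hs) @ hs') (js ! i) d (ts ! i)"
    using Cons.IH[of "gs @ hs"] Cons.prems(1) hs(2) by (metis list.set_intros(2))
  show ?case
    by (rule exI[of _ "hs @ hs'"], rule exI[of _ "(length gs + length hs - 1) # js"])
      (use hs js realizes_append[OF hs(3), of hs'] in \<open>auto simp: nth_Cons split: nat.split\<close>)
qed auto

lemma in_set_conv: "length js = length ts \<Longrightarrow> (\<forall>i < length ts. P (js ! i) (ts ! i)) \<Longrightarrow>
    (\<forall>j\<in>set js. \<exists>t\<in>set ts. P j t) \<and> (\<forall>t\<in>set ts. \<exists>j\<in>set js. P j t)"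
proof (intro conjI ballI)
  fix j assume "length js = length ts" and P: "\<forall>i < length ts. P (js ! i) (ts ! i)" and "j \<in> set js"
  then obtain i where "i < length ts" "j = js ! i" by (auto simp: in_set_conv_nth)
  then show "\<exists>t\<in>set ts. P j t" using P by (intro bexI[of _ "ts ! i"]) auto
next
  fix t assume "length js = length ts" and P: "\<forall>i < length ts. P (js ! i) (ts ! i)" and "t \<in> set ts"
  then obtain i where "i < length js" "i < length ts" "t = ts ! i" by (auto simp: in_set_conv_nth)
  then show "\<exists>j\<in>set js. P j t" using P by (intro bexI[of _ "js ! i"]) auto
qed

lemma Max_insert_le: "finite A \<Longrightarrow> (\<And>a. a \<in> A \<Longrightarrow> a \<le> (d::nat)) \<Longrightarrow> Max (insert 0 A) \<le> d"
  by simp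

text \<open>Gates are appended in post-order behind an arbitrary circuit \<open>gs\<close>, whose
  gates keep their positions and values; the root comes last, where the output is read.\<close>

lemma flatten:
  "bok n d t \<Longrightarrow> wfl n gs \<Longrightarrow>
   \<exists>hs. length hs \<le> bsz t \<and> wfl n (gs @ hs) \<and> hs \<noteq> [] \<and> realizes (gs @ hs) (length gs + length hs - 1) d t"
proof (induction t arbitrary: gs d)
  case (BIn i)
  show ?case
    by (rule exI[of _ "[Input i]"]) (use BIn in \<open>auto intro!: wfl_snoc realizes_last\<close>)
next
  case (BNeg t)
  obtain hs where hs: "length hs \<le> bsz t" "wfl n (gs @ hs)" "hs \<noteq> []"
    "realizes (gs @ hs) (length gs + length hs - 1) (d - 1) t"
    using BNeg.IH[of "d - 1" gs] BNeg.prems by auto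
  let ?j = "length gs + length hs - 1"
  have "realizes ((gs @ hs) @ [NotG ?j]) (length (gs @ hs)) d (BNeg t)"
    by (rule realizes_last) (use hs(4) BNeg.prems(1) in \<open>auto simp: realizes_def\<close>)
  moreover have "wfl n ((gs @ hs) @ [NotG ?j])"
    by (rule wfl_snoc) (use hs in \<open>auto simp: realizes_def\<close>)
  ultimately show ?case
    by (intro exI[of _ "hs @ [NotG ?j]"]) (use hs in auto)
next
  case (BAll ts)
  obtain hs js where hs: "length hs \<le> sum_list (map bsz ts)" "wfl n (gs @ hs)" "length js = length ts"
    "\<forall>i < length ts. realizes (gs @ hs) (js ! i) (d - 1) (ts ! i)"
    using flatten_list[of ts n "d - 1" gs] BAll by (metis bok.simps(3))
  note R = in_set_conv[OF hs(3,4)]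
  have "realizes ((gs @ hs) @ [AndG js]) (length (gs @ hs)) d (BAll ts)"
  proof (rule realizes_last)
    show "gate_val w (run (gate_val w) (gs @ hs)) (AndG js) = bev w (BAll ts)" for w
      using R unfolding realizes_def by (simp, metis)
    have "Max (insert 0 ((!) (run gate_depth (gs @ hs)) ` set js)) \<le> d - 1"
      by (rule Max_insert_le) (use R in \<open>auto simp: realizes_def\<close>)
    moreover have "0 < d" using BAll.prems(1) by simp
    ultimately show "gate_depth (run gate_depth (gs @ hs)) (AndG js) \<le> d"
      unfolding gate_depth.simps by linarith
  qed
  moreover have "wfl n ((gs @ hs) @ [AndG js])"
    by (rule wfl_snoc[OF hs(2)]) (use R in \<open>auto simp: realizes_def\<close>)
  ultimately show ?case
    by (intro exI[of _ "hs @ [AndG js]"]) (use hs in auto)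
next
  case (BAny ts)
  obtain hs js where hs: "length hs \<le> sum_list (map bsz ts)" "wfl n (gs @ hs)" "length js = length ts"
    "\<forall>i < length ts. realizes (gs @ hs) (js ! i) (d - 1) (ts ! i)"
    using flatten_list[of ts n "d - 1" gs] BAny by (metis bok.simps(4))
  note R = in_set_conv[OF hs(3,4)]
  have "realizes ((gs @ hs) @ [OrG js]) (length (gs @ hs)) d (BAny ts)"
  proof (rule realizes_last)
    show "gate_val w (run (gate_val w) (gs @ hs)) (OrG js) = bev w (BAny ts)" for w
      using R unfolding realizes_def by (simp, metis)
    have "Max (insert 0 ((!) (run gate_depth (gs @ hs)) ` set js)) \<le> d - 1"
      by (rule Max_insert_le) (use R in \<open>auto simp: realizes_def\<close>)
    moreover have "0 < d" using BAny.prems(1) by simp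
    ultimately show "gate_depth (run gate_depth (gs @ hs)) (OrG js) \<le> d"
      unfolding gate_depth.simps by linarith
  qed
  moreover have "wfl n ((gs @ hs) @ [OrG js])"
    by (rule wfl_snoc[OF hs(2)]) (use R in \<open>auto simp: realizes_def\<close>)
  ultimately show ?case
    by (intro exI[of _ "hs @ [OrG js]"]) (use hs in auto)
qed

lemma bf_circuit:
  assumes "bok n d t"
  shows "\<exists>gs. wf_circuit n gs \<and> length gs \<le> bsz t \<and> depth gs \<le> d \<and> (\<forall>w. accepts gs w = bev w t)"
proof -
  have "wfl n []" by (simp add: wfl_def)
  from flatten[OF assms this] obtain hs where hs: "length hs \<le> bsz t" "wfl n hs" "hs \<noteq> []" "realizes hs (length hs - 1) d t"
    by auto
  have l: "last (run F hs) = run F hs ! (length hs - 1)" for F :: "'v list \<Rightarrow> gate \<Rightarrow> 'v"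
    using hs(3) length_run[of F hs] by (metis last_conv_nth length_0_conv)
  have "depth hs \<le> d" using hs(4) l[of gate_depth] by (simp add: depth_def realizes_def run_def)
  moreover have "accepts hs w = bev w t" for w
    using hs(4) l[of "gate_val w"] by (simp add: accepts_def realizes_def run_def)
  ultimately show ?thesis using hs by (auto simp: wf_circuit_def wfl_def)
qed

text \<open>The size may be a joint polynomial in \<open>F k + n\<close>: since
  \<open>F k + n + 2\<close> is at most \<open>(F k + k + 3) * (n + 1)\<close>, parameter and length
  separate into factors.\<close>

lemma para_AC0I:
  assumes F: "computable F" and p: "polyb p"
    and t: "\<And>n k. bok n d (t n k) \<and> bsz (t n k) \<le> p (F k + n) \<and>
        (\<forall>w. length w = n \<longrightarrow> (bev w (t n k) \<longleftrightarrow> (w, k) \<in> Q))"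
  shows "Q \<in> para_AC0"
proof -
  obtain c where c: "\<And>N. p N \<le> (N + 2) ^ c" using p unfolding polyb_def by blast
  define f where "f = (\<lambda>k. (F k + k + 3) ^ c)"
  have f: "computable f" unfolding f_def by (rule computable_pow[OF F computable_id])
  have "\<forall>n k. \<exists>gs. wf_circuit n gs \<and> length gs \<le> bsz (t n k) \<and> depth gs \<le> d \<and> (\<forall>w. accepts gs w = bev w (t n k))"
    using bf_circuit t by blast
  then obtain C where C: "\<And>n k. wf_circuit n (C n k) \<and> length (C n k) \<le> bsz (t n k) \<and> depth (C n k) \<le> d \<and>
      (\<forall>w. accepts (C n k) w = bev w (t n k))" by metis
  have "length (C n k) \<le> f k * (n + 1) ^ c" for n k
  proof -
    have "length (C n k) \<le> p (F k + n)" using C t le_trans by blast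
    also have "\<dots> \<le> (F k + n + 2) ^ c" by (rule c)
    also have "\<dots> \<le> ((F k + k + 3) * (n + 1)) ^ c" by (rule power_mono) (simp_all add: algebra_simps)
    finally show ?thesis by (simp only: f_def power_mult_distrib)
  qed
  then have "computable f \<and> (\<forall>n k. wf_circuit n (C n k) \<and> length (C n k) \<le> f k * (n + 1) ^ c \<and> depth (C n k) \<le> d \<and>
        (\<forall>w. length w = n \<longrightarrow> (accepts (C n k) w \<longleftrightarrow> (w, k) \<in> Q)))"
    using C t f by simp
  then show ?thesis unfolding para_AC0_def by blast
qed

subsection \<open>Evaluating formulas on graphs\<close>

text \<open>Position of the pair \<open>[a, b]\<close> in an encoding: \<open>n\<close> ones and a
  zero come before the table, and \<open>List.n_lists\<close> lets the first coordinate run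
  fastest.\<close>

definition gpos :: "nat \<Rightarrow> nat \<Rightarrow> nat \<Rightarrow> nat" where "gpos n a b = n + 1 + (a + n * b)"

definition bT :: bf where "bT = BAll []"
definition bF :: bf where "bF = BAny []"

lemma bTF [simp]: "bev w bT" "\<not> bev w bF" "bsz bT = 1" "bsz bF = 1" "bok n d bT \<longleftrightarrow> 0 < d" "bok n d bF \<longleftrightarrow> 0 < d"
  by (auto simp: bT_def bF_def)

text \<open>\<open>X\<close> supplies a membership formula for each vertex, so the set variable can
  be instantiated by a set that is itself computed from the input graph.\<close>

fun trf :: "nat \<Rightarrow> (nat \<Rightarrow> bf) \<Rightarrow> (nat \<Rightarrow> nat) \<Rightarrow> fo \<Rightarrow> bf" where
  "trf n X v Bot = bF"
| "trf n X v (Eq x y) = (if v x = v y then bT else bF)"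
| "trf n X v (Rel i xs) = BIn (gpos n (v (xs ! 0)) (v (xs ! 1)))"
| "trf n X v (Mem xs) = X (v (xs ! 0))"
| "trf n X v (Neg \<phi>) = BNeg (trf n X v \<phi>)"
| "trf n X v (Conj \<phi> \<psi>) = BAll [trf n X v \<phi>, trf n X v \<psi>]"
| "trf n X v (Disj \<phi> \<psi>) = BAny [trf n X v \<phi>, trf n X v \<psi>]"
| "trf n X v (Forall x \<phi>) = BAll (map (\<lambda>a. trf n X (v(x := a)) \<phi>) [0..<n])"
| "trf n X v (Exists x \<phi>) = BAny (map (\<lambda>a. trf n X (v(x := a)) \<phi>) [0..<n])"

definition gr :: "nat \<Rightarrow> word \<Rightarrow> nat struct" where
  "gr n w = \<lparr>univ = {..<n}, rel = (\<lambda>i. {[a, b] | a b. a < n \<and> b < n \<and> w ! gpos n a b})\<rparr>"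

lemma univ_gr [simp]: "struct.univ (gr n w) = {..<n}" by (simp add: gr_def)

definition memb :: "nat \<Rightarrow> word \<Rightarrow> (nat \<Rightarrow> bf) \<Rightarrow> nat set" where
  "memb n w X = {u. u < n \<and> bev w (X u)}"

lemma bev_trf:
  assumes "fo_over graph_vocabulary 1 \<phi>" "\<And>x. x \<in> free_vars \<phi> \<Longrightarrow> v x < n"
  shows "bev w (trf n X v \<phi>) \<longleftrightarrow> sat (gr n w) ((\<lambda>u. [u]) ` memb n w X) v \<phi>"
  using assms
proof (induction \<phi> arbitrary: v)
  case (Rel i xs)
  then obtain a b where "xs = [a, b]" by (auto simp: length_Suc_conv numeral_2_eq_2)
  then show ?case using Rel by (auto simp: gr_def)
next
  case (Mem xs)
  then obtain a where "xs = [a]" by (auto simp: length_Suc_conv)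
  then show ?case using Mem by (auto simp: memb_def)
next
  case (Forall x \<phi>)
  have "bev w (trf n X (v(x := a)) \<phi>) \<longleftrightarrow> sat (gr n w) ((\<lambda>u. [u]) ` memb n w X) (v(x := a)) \<phi>" if "a < n" for a
    by (rule Forall.IH) (use Forall.prems that in auto)
  then show ?case by auto
next
  case (Exists x \<phi>)
  have "bev w (trf n X (v(x := a)) \<phi>) \<longleftrightarrow> sat (gr n w) ((\<lambda>u. [u]) ` memb n w X) (v(x := a)) \<phi>" if "a < n" for a
    by (rule Exists.IH) (use Exists.prems that in auto)
  then show ?case by auto
qed auto

lemma gpos_less: "a < n \<Longrightarrow> b < n \<Longrightarrow> gpos n a b < n + 1 + n * n"
proof -
  assume a: "a < n" "b < n"
  then have "n * b + n \<le> n * n" using mult_le_mono2[of "Suc b" n n] by simp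
  then show ?thesis using a by (simp add: gpos_def)
qed

lemma bok_trf:
  assumes "fo_over graph_vocabulary 1 \<phi>" "\<And>x. x \<in> free_vars \<phi> \<Longrightarrow> v x < n" "\<And>u. u < n \<Longrightarrow> bok (n + 1 + n * n) d (X u)"
  shows "bok (n + 1 + n * n) (size \<phi> + d + 1) (trf n X v \<phi>)"
  using assms(1,2)
proof (induction \<phi> arbitrary: v)
  case (Rel i xs)
  then obtain a b where "xs = [a, b]" by (auto simp: length_Suc_conv numeral_2_eq_2)
  then show ?case using Rel gpos_less[of "v a" n "v b"] by auto
next
  case (Mem xs)
  then obtain a where "xs = [a]" by (auto simp: length_Suc_conv)
  then show ?case using Mem bok_mono[OF assms(3)[of "v a"], of "Suc d"] by simp
next
  case (Neg \<phi>)
  then show ?case by auto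
next
  case (Conj \<phi> \<psi>)
  have "bok (n + 1 + n * n) (size \<phi> + d + 1) (trf n X v \<phi>)" "bok (n + 1 + n * n) (size \<psi> + d + 1) (trf n X v \<psi>)"
    using Conj by auto
  then show ?case by (auto intro: bok_mono)
next
  case (Disj \<phi> \<psi>)
  have "bok (n + 1 + n * n) (size \<phi> + d + 1) (trf n X v \<phi>)" "bok (n + 1 + n * n) (size \<psi> + d + 1) (trf n X v \<psi>)"
    using Disj by auto
  then show ?case by (auto intro: bok_mono)
next
  case (Forall x \<phi>)
  have "bok (n + 1 + n * n) (size \<phi> + d + 1) (trf n X (v(x := a)) \<phi>)" if "a < n" for a
    by (rule Forall.IH) (use Forall.prems that in auto)
  then show ?case by auto
next
  case (Exists x \<phi>)
  have "bok (n + 1 + n * n) (size \<phi> + d + 1) (trf n X (v(x := a)) \<phi>)" if "a < n" for a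
    by (rule Exists.IH) (use Exists.prems that in auto)
  then show ?case by auto
qed auto

lemma sum_list_le: "(\<And>x. x \<in> set xs \<Longrightarrow> f x \<le> M) \<Longrightarrow> sum_list (map f xs) \<le> length xs * (M::nat)"
  by (induction xs) (auto simp: add_mono)

lemma bsz_trf:
  assumes "fo_over graph_vocabulary 1 \<phi>" "\<And>x. x \<in> free_vars \<phi> \<Longrightarrow> v x < n" "\<And>u. u < n \<Longrightarrow> bsz (X u) \<le> M" "0 < M"
  shows "bsz (trf n X v \<phi>) \<le> (n + 3) ^ (2 * size \<phi> + 1) * M"
  using assms(1,2)
proof (induction \<phi> arbitrary: v)
  case (Mem xs)
  then obtain a where "xs = [a]" by (auto simp: length_Suc_conv)
  then show ?case using Mem assms(3)[of "v a"] by (auto intro: le_trans)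
next
  case (Neg \<phi>)
  let ?x = "(n + 3) ^ (2 * size \<phi> + 1) * M"
  have "bsz (trf n X v \<phi>) \<le> ?x" using Neg by auto
  moreover have "1 \<le> ?x" using assms(4) by simp
  ultimately have "bsz (trf n X v (Neg \<phi>)) \<le> (n + 3) * ?x" by (simp add: algebra_simps)
  also have "\<dots> \<le> (n + 3) * ((n + 3) * ?x)" by simp
  finally show ?case by (simp add: mult.assoc)
next
  case (Conj \<phi> \<psi>)
  let ?x = "(n + 3) ^ (2 * size \<phi> + 1 + (2 * size \<psi> + 1)) * M"
  have "bsz (trf n X v \<phi>) \<le> (n + 3) ^ (2 * size \<phi> + 1) * M" "bsz (trf n X v \<psi>) \<le> (n + 3) ^ (2 * size \<psi> + 1) * M" using Conj by auto
  moreover have "(n + 3) ^ (2 * size \<phi> + 1) * M \<le> ?x"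
    by (rule mult_le_mono1, rule power_increasing) simp_all
  moreover have "(n + 3) ^ (2 * size \<psi> + 1) * M \<le> ?x"
    by (rule mult_le_mono1, rule power_increasing) simp_all
  moreover have "1 \<le> ?x" using assms(4) by simp
  moreover have "bsz (trf n X v (Conj \<phi> \<psi>)) = Suc (bsz (trf n X v \<phi>) + bsz (trf n X v \<psi>))" by simp
  ultimately have "bsz (trf n X v (Conj \<phi> \<psi>)) \<le> 3 * ?x" by linarith
  also have "\<dots> \<le> (n + 3) * ?x" by (rule mult_le_mono1) simp
  finally show ?case by (simp add: mult.assoc)
next
  case (Disj \<phi> \<psi>)
  let ?x = "(n + 3) ^ (2 * size \<phi> + 1 + (2 * size \<psi> + 1)) * M"
  have "bsz (trf n X v \<phi>) \<le> (n + 3) ^ (2 * size \<phi> + 1) * M" "bsz (trf n X v \<psi>) \<le> (n + 3) ^ (2 * size \<psi> + 1) * M" using Disj by auto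
  moreover have "(n + 3) ^ (2 * size \<phi> + 1) * M \<le> ?x"
    by (rule mult_le_mono1, rule power_increasing) simp_all
  moreover have "(n + 3) ^ (2 * size \<psi> + 1) * M \<le> ?x"
    by (rule mult_le_mono1, rule power_increasing) simp_all
  moreover have "1 \<le> ?x" using assms(4) by simp
  moreover have "bsz (trf n X v (Disj \<phi> \<psi>)) = Suc (bsz (trf n X v \<phi>) + bsz (trf n X v \<psi>))" by simp
  ultimately have "bsz (trf n X v (Disj \<phi> \<psi>)) \<le> 3 * ?x" by linarith
  also have "\<dots> \<le> (n + 3) * ?x" by (rule mult_le_mono1) simp
  finally show ?case by (simp add: mult.assoc)
next
  case (Forall x \<phi>)
  let ?x = "(n + 3) ^ (2 * size \<phi> + 1) * M"
  have "bsz (trf n X (v(x := a)) \<phi>) \<le> ?x" if "a < n" for a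
    by (rule Forall.IH) (use Forall.prems that in auto)
  then have "bsz (trf n X v (Forall x \<phi>)) \<le> Suc (n * ?x)"
    using sum_list_le[of "[0..<n]" "\<lambda>a. bsz (trf n X (v(x := a)) \<phi>)" ?x] by (simp add: comp_def)
  moreover have "1 \<le> ?x" using assms(4) by simp
  ultimately have "bsz (trf n X v (Forall x \<phi>)) \<le> (n + 3) * ?x" by (simp add: algebra_simps)
  also have "\<dots> \<le> (n + 3) * ((n + 3) * ?x)" by simp
  finally show ?case by (simp add: mult.assoc)
next
  case (Exists x \<phi>)
  let ?x = "(n + 3) ^ (2 * size \<phi> + 1) * M"
  have "bsz (trf n X (v(x := a)) \<phi>) \<le> ?x" if "a < n" for a
    by (rule Exists.IH) (use Exists.prems that in auto)
  then have "bsz (trf n X v (Exists x \<phi>)) \<le> Suc (n * ?x)"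
    using sum_list_le[of "[0..<n]" "\<lambda>a. bsz (trf n X (v(x := a)) \<phi>)" ?x] by (simp add: comp_def)
  moreover have "1 \<le> ?x" using assms(4) by simp
  ultimately have "bsz (trf n X v (Exists x \<phi>)) \<le> (n + 3) * ?x" by (simp add: algebra_simps)
  also have "\<dots> \<le> (n + 3) * ((n + 3) * ?x)" by simp
  finally show ?case by (simp add: mult.assoc)
qed (use assms(4) in auto)

subsection \<open>Encodings\<close>

text \<open>The number with these digits in base \<open>n\<close>, least significant first; by
  \<open>nth_n_lists\<close> it is the position of the tuple in \<open>List.n_lists\<close>.\<close>

fun lval :: "nat \<Rightarrow> nat list \<Rightarrow> nat" where
  "lval n [] = 0"
| "lval n (x # xs) = x + n * lval n xs"

lemma lval_less: "set xs \<subseteq> {..<n} \<Longrightarrow> lval n xs < n ^ length xs"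
proof (induction xs)
  case (Cons x xs)
  then have "Suc (lval n xs) \<le> n ^ length xs" by auto
  from mult_le_mono2[OF this, of n] show ?case using Cons.prems by auto
qed auto

lemma nth_concat_blocks:
  assumes "\<And>x. x \<in> set L \<Longrightarrow> length (f x) = n" "j < length L" "i < n"
  shows "concat (map f L) ! (i + n * j) = f (L ! j) ! i"
  using assms
proof (induction L arbitrary: j)
  case (Cons x L)
  show ?case
  proof (cases j)
    case 0
    then show ?thesis using Cons.prems by (simp add: nth_append)
  next
    case (Suc j')
    then have "concat (map f L) ! (i + n * j') = f (L ! j') ! i" using Cons by auto
    moreover have "i + n * j = length (f x) + (i + n * j')" using Suc Cons.prems(1)[of x] by simp
    ultimately show ?thesis using Suc by (simp add: nth_append)
  qed
qed simp

lemma nth_n_lists: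
  "length xs = r \<Longrightarrow> set xs \<subseteq> {..<n} \<Longrightarrow> List.n_lists r [0..<n] ! lval n xs = xs"
proof (induction r arbitrary: xs)
  case (Suc r)
  then obtain x ys where xs: "xs = x # ys" by (cases xs) auto
  have l: "lval n ys < length (List.n_lists r [0..<n])"
    using lval_less[of ys n] Suc.prems xs by (simp add: length_n_lists)
  have "List.n_lists (Suc r) [0..<n] ! (x + n * lval n ys) = map (\<lambda>y. y # (List.n_lists r [0..<n] ! lval n ys)) [0..<n] ! x"
    unfolding List.n_lists.simps by (rule nth_concat_blocks) (use l Suc.prems xs in auto)
  then show ?case using Suc xs by auto
qed simp

lemma set_n_lists_upt: "set (List.n_lists r [0..<n]) = {xs. length xs = r \<and> set xs \<subseteq> {..<n}}"
  by (auto simp: set_n_lists lessThan_atLeast0)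

lemma encode_graph:
  assumes "struct.univ G = {..<n}"
  shows "encode graph_vocabulary G = replicate n True @ [False] @ map (\<lambda>xs. xs \<in> struct.rel G 0) (List.n_lists 2 [0..<n])"
  using assms by (simp add: encode_def Let_def)

lemma length_encode_graph: "struct.univ G = {..<n} \<Longrightarrow> length (encode graph_vocabulary G) = n + 1 + n * n"
  by (simp add: encode_graph length_n_lists power2_eq_square)

lemma encode_graph_nth:
  assumes "struct.univ G = {..<n}" "a < n" "b < n"
  shows "encode graph_vocabulary G ! gpos n a b \<longleftrightarrow> [a, b] \<in> struct.rel G 0"
proof -
  have "a + n * b < length (List.n_lists 2 [0..<n])"
    using gpos_less[OF assms(2,3)] by (simp add: length_n_lists power2_eq_square gpos_def)
  moreover have "List.n_lists 2 [0..<n] ! (a + n * b) = [a, b]"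
    using nth_n_lists[of "[a, b]" 2 n] assms by simp
  ultimately show ?thesis unfolding encode_graph[OF assms(1)] gpos_def by (simp add: nth_append)
qed

definition valid :: "nat \<Rightarrow> word \<Rightarrow> bool" where
  "valid n w \<longleftrightarrow> (\<forall>i<n. w ! i) \<and> \<not> w ! n \<and>
     (\<forall>a<n. \<not> w ! gpos n a a \<and> (\<forall>b<n. w ! gpos n a b \<longleftrightarrow> w ! gpos n b a))"

definition biff :: "bf \<Rightarrow> bf \<Rightarrow> bf" where
  "biff s t = BAny [BAll [s, t], BAll [BNeg s, BNeg t]]"

definition vf :: "nat \<Rightarrow> bf" where
  "vf n = BAll (map BIn [0..<n] @ [BNeg (BIn n)] @ concat (map (\<lambda>a. BNeg (BIn (gpos n a a)) #
     map (\<lambda>b. biff (BIn (gpos n a b)) (BIn (gpos n b a))) [0..<n]) [0..<n]))"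

lemma bev_biff [simp]: "bev w (biff s t) \<longleftrightarrow> (bev w s \<longleftrightarrow> bev w t)"
  by (auto simp: biff_def)

lemma bev_vf: "bev w (vf n) \<longleftrightarrow> valid n w"
  unfolding vf_def valid_def by (auto simp: ball_Un)

lemma bok_vf: "bok (n + 1 + n * n) 4 (vf n)"
proof -
  have "gpos n a b < Suc (n + n * n)" if "a < n" "b < n" for a b using gpos_less[OF that] by simp
  then show ?thesis unfolding vf_def biff_def by auto
qed

lemma sum_list_concat_le:
  "(\<And>x. x \<in> set xs \<Longrightarrow> sum_list (map g (f x)) \<le> M) \<Longrightarrow> sum_list (map g (concat (map f xs))) \<le> length xs * (M::nat)"
  by (induction xs) (auto simp: add_mono)

lemma bsz_vf: "bsz (vf n) \<le> 4 + n + n * (2 + n * 9)"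
proof -
  have "sum_list (map bsz (concat (map (\<lambda>a. BNeg (BIn (gpos n a a)) #
     map (\<lambda>b. biff (BIn (gpos n a b)) (BIn (gpos n b a))) [0..<n]) [0..<n]))) \<le> n * (2 + n * 9)"
    using sum_list_concat_le[of "[0..<n]" bsz "\<lambda>a. BNeg (BIn (gpos n a a)) #
      map (\<lambda>b. biff (BIn (gpos n a b)) (BIn (gpos n b a))) [0..<n]" "2 + n * 9"]
    by (simp add: biff_def comp_def sum_list_triv)
  then show ?thesis unfolding vf_def by (simp add: comp_def sum_list_triv)
qed

text \<open>The length of the input determines the number of vertices, so each input length can be
  given the tree for that number.\<close>

lemma size_inj: "n + 1 + n * n = m + 1 + m * (m::nat) \<Longrightarrow> n = m"
proof (rule ccontr)
  assume e: "n + 1 + n * n = m + 1 + m * m" and "n \<noteq> m"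
  then consider "n < m" | "m < n" by linarith
  then show False
  proof cases
    case 1 then have "n * n \<le> m * m" by (intro mult_le_mono) auto
    then show False using e 1 by linarith
  next
    case 2 then have "m * m \<le> n * n" by (intro mult_le_mono) auto
    then show False using e 2 by linarith
  qed
qed

lemma sat_struct_cong:
  "struct.univ A = struct.univ A' \<Longrightarrow> struct.rel A 0 = struct.rel A' 0 \<Longrightarrow> fo_over graph_vocabulary 1 \<phi> \<Longrightarrow>
   sat A X v \<phi> \<longleftrightarrow> sat A' X v \<phi>"
  by (induction \<phi> arbitrary: v) auto

lemma sat_cong: "(\<And>x. x \<in> free_vars \<phi> \<Longrightarrow> v x = v' x) \<Longrightarrow> sat A X v \<phi> \<longleftrightarrow> sat A X v' \<phi>"
proof (induction \<phi> arbitrary: v v')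
  case (Rel i xs)
  then have "map v xs = map v' xs" by auto
  then show ?case by (simp del: map_eq_conv)
next
  case (Mem xs)
  then have "map v xs = map v' xs" by auto
  then show ?case by (simp del: map_eq_conv)
next
  case (Conj \<phi> \<psi>)
  then show ?case by (metis UnCI free_vars.simps(6) sat.simps(6))
next
  case (Disj \<phi> \<psi>)
  then show ?case by (metis UnCI free_vars.simps(7) sat.simps(7))
next
  case (Forall x \<phi>)
  have "sat A X (v(x := a)) \<phi> \<longleftrightarrow> sat A X (v'(x := a)) \<phi>" for a
    by (rule Forall.IH) (use Forall.prems in auto)
  then show ?case by simp
next
  case (Exists x \<phi>)
  have "sat A X (v(x := a)) \<phi> \<longleftrightarrow> sat A X (v'(x := a)) \<phi>" for a
    by (rule Exists.IH) (use Exists.prems in auto)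
  then show ?case by simp
next
  case (Neg \<phi>)
  have "sat A X v \<phi> \<longleftrightarrow> sat A X v' \<phi>" by (rule Neg.IH) (use Neg.prems in simp)
  then show ?case by simp
next
  case (Eq x y)
  have "v x = v' x" "v y = v' y" using Eq by simp_all
  then show ?case by simp
qed simp

lemma models_closed: "free_vars \<phi> = {} \<Longrightarrow> models A X \<phi> \<longleftrightarrow> sat A X v \<phi>"
  unfolding models_def using sat_cong[of \<phi>] by blast

lemma basic_gr: "valid n w \<Longrightarrow> basic_graph (gr n w)"
  unfolding basic_graph_def finite_struct_def valid_def gr_def tuples_def by auto

lemma gr_encode:
  assumes "basic_graph G" "struct.univ G = {..<n}"
  shows "struct.rel (gr n (encode graph_vocabulary G)) 0 = struct.rel G 0"
proof -
  have "struct.rel G 0 \<subseteq> tuples {..<n} 2" using assms by (auto simp: basic_graph_def finite_struct_def)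
  then have "\<exists>a b. xs = [a, b] \<and> a < n \<and> b < n" if "xs \<in> struct.rel G 0" for xs
    using that by (fastforce simp: tuples_def length_Suc_conv numeral_2_eq_2)
  then show ?thesis using encode_graph_nth[OF assms(2)] by (fastforce simp: gr_def)
qed

lemma valid_encode:
  assumes "basic_graph G" "struct.univ G = {..<n}"
  shows "valid n (encode graph_vocabulary G)"
proof -
  have "encode graph_vocabulary G ! i" if "i < n" for i using that by (simp add: encode_graph[OF assms(2)] nth_append)
  moreover have "\<not> encode graph_vocabulary G ! n" by (simp add: encode_graph[OF assms(2)] nth_append)
  ultimately show ?thesis
    using assms(1) encode_graph_nth[OF assms(2)] unfolding valid_def basic_graph_def by auto
qed

lemma encode_gr:
  assumes "valid n w" "length w = n + 1 + n * n"
  shows "encode graph_vocabulary (gr n w) = w"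
proof (rule nth_equalityI)
  show l: "length (encode graph_vocabulary (gr n w)) = length w" using assms by (simp add: length_encode_graph)
  fix i assume "i < length (encode graph_vocabulary (gr n w))"
  then have i: "i < n + 1 + n * n" using l assms by simp
  have e: "encode graph_vocabulary (gr n w) = replicate n True @ [False] @ map (\<lambda>xs. xs \<in> struct.rel (gr n w) 0) (List.n_lists 2 [0..<n])"
    by (rule encode_graph) simp
  consider "i < n" | "i = n" | "n < i" by linarith
  then show "encode graph_vocabulary (gr n w) ! i = w ! i"
  proof cases
    case 1 then show ?thesis using assms(1) by (simp add: e nth_append valid_def)
  next
    case 2 then show ?thesis using assms(1) by (simp add: e nth_append valid_def)
  next
    case 3
    define j where "j = i - (n + 1)"
    have j: "i = n + 1 + j" "j < n * n" using 3 i by (auto simp: j_def)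
    then have n0: "0 < n" by (cases n) auto
    have ab: "j mod n < n" "j div n < n" using n0 j(2) by (auto simp: less_mult_imp_div_less)
    have g: "i = gpos n (j mod n) (j div n)" using j by (simp add: gpos_def)
    have "encode graph_vocabulary (gr n w) ! i \<longleftrightarrow> [j mod n, j div n] \<in> struct.rel (gr n w) 0"
      unfolding g by (rule encode_graph_nth) (use ab in auto)
    also have "\<dots> \<longleftrightarrow> w ! i" unfolding g using ab by (simp add: gr_def)
    finally show ?thesis .
  qed
qed

lemma fd_problem_iff:
  assumes "fo_over graph_vocabulary 1 \<phi>" "length w = n + 1 + n * n"
  shows "(w, k) \<in> fd_problem \<phi> \<longleftrightarrow> valid n w \<and> models_ge (gr n w) k \<phi>"
proof
  assume "(w, k) \<in> fd_problem \<phi>"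
  then obtain G m where G: "w = encode graph_vocabulary G" "basic_graph G" "struct.univ G = {..<m}" "models_ge G k \<phi>"
    unfolding fd_problem_def by auto
  have "m = n" using G(1) assms(2) length_encode_graph[OF G(3)] size_inj[of m n] by simp
  then have u: "struct.univ G = {..<n}" using G by simp
  have "models A' X \<phi> \<longleftrightarrow> models G X \<phi>" if "A' = gr n w" for A' X
    unfolding models_def that using sat_struct_cong[of "gr n w" G \<phi> X] gr_encode[OF G(2) u] u assms(1) G(1) by auto
  then have "models_ge (gr n w) k \<phi>" using G(4) u unfolding models_ge_def by auto
  then show "valid n w \<and> models_ge (gr n w) k \<phi>" using valid_encode[OF G(2) u] G(1) by simp
next
  assume "valid n w \<and> models_ge (gr n w) k \<phi>"
  then show "(w, k) \<in> fd_problem \<phi>"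
    using encode_gr[OF _ assms(2)] basic_gr unfolding fd_problem_def
    by (auto intro!: exI[of _ "gr n w"])
qed

lemma fd_problem_length:
  assumes "(w, k) \<in> fd_problem \<phi>" shows "\<exists>n. length w = n + 1 + n * n"
  using assms length_encode_graph unfolding fd_problem_def by blast

subsection \<open>Hashing by bit positions\<close>

fun bits :: "nat list \<Rightarrow> nat \<Rightarrow> nat" where
  "bits [] u = 0"
| "bits (i # P) u = (if bit u i then 1 else 0) + 2 * bits P u"

lemma bits_less: "bits P u < 2 ^ length P"
proof (induction P)
  case (Cons i P)
  then show ?case by (auto split: if_splits)
qed simp

lemma bits_eq: "bits P u = bits P v \<longleftrightarrow> (\<forall>i\<in>set P. bit u i = bit v i)"
proof (induction P)
  case (Cons i P)
  have "bits (i # P) u = bits (i # P) v \<longleftrightarrow> bit u i = bit v i \<and> bits P u = bits P v"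
    by (cases "bit u i"; cases "bit v i"; simp; presburger)
  then show ?case using Cons by simp
qed simp

text \<open>By induction on the set: on the positions chosen so far a new element agrees with at
  most one old element, as these are already separated, and one further position tells these two
  apart.\<close>

lemma separating_bits:
  fixes S :: "nat set"
  shows "finite S \<Longrightarrow> S \<subseteq> {..<2 ^ l} \<Longrightarrow> \<exists>I \<subseteq> {..<l}. card I \<le> card S \<and>
     (\<forall>u\<in>S. \<forall>v\<in>S. (\<forall>i\<in>I. bit u i = bit v i) \<longrightarrow> u = v)"
proof (induction S rule: finite_induct)
  case (insert x S)
  then obtain I where I: "I \<subseteq> {..<l}" "card I \<le> card S" "\<And>u v. u \<in> S \<Longrightarrow> v \<in> S \<Longrightarrow> (\<forall>i\<in>I. bit u i = bit v i) \<Longrightarrow> u = v"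
    by auto
  show ?case
  proof (cases "\<exists>s\<in>S. \<forall>i\<in>I. bit x i = bit s i")
    case False
    have "u = v" if "u \<in> insert x S" "v \<in> insert x S" "\<forall>i\<in>I. bit u i = bit v i" for u v
      using that False I(3)[of u v] by (cases "u = x"; cases "v = x") auto
    moreover have "card I \<le> card (insert x S)" using I(2) insert.hyps by simp
    ultimately show ?thesis using I(1) by (intro exI[of _ I]) blast
  next
    case True
    then obtain s where s: "s \<in> S" "\<forall>i\<in>I. bit x i = bit s i" by auto
    have "x \<noteq> s" using s insert.hyps by auto
    then obtain i where i: "bit x i \<noteq> bit s i" using bit_eqI by metis
    have lt: "x < 2 ^ l" "s < 2 ^ l" using insert.prems s by auto
    have "i < l"
    proof (rule ccontr)
      assume "\<not> i < l"
      then have "(2::nat) ^ l \<le> 2 ^ i" by (intro power_increasing) auto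
      then have "x < 2 ^ i" "s < 2 ^ i" using lt by linarith+
      then have "x div 2 ^ i = 0" "s div 2 ^ i = 0" by simp_all
      then show False using i by (simp add: bit_iff_odd)
    qed
    have fI: "finite I" using I(1) finite_subset by blast
    have eq: "u = v" if u: "u \<in> insert x S" and v: "v \<in> insert x S" and b: "\<forall>j\<in>insert i I. bit u j = bit v j" for u v
    proof -
      have xs: "t = s" if "t \<in> S" "\<forall>j\<in>I. bit x j = bit t j" for t using I(3)[OF that(1) s(1)] s(2) that(2) by auto
      show ?thesis
      proof (cases "u = x")
        case True
        show ?thesis
        proof (rule ccontr)
          assume "u \<noteq> v"
          then have "v \<in> S" using True v by auto
          then have "v = s" using xs[of v] b True by auto
          then show False using b i True by auto
        qed
      next
        case False
        then have uS: "u \<in> S" using u by auto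
        show ?thesis
        proof (cases "v = x")
          case True
          then have "u = s" using xs[OF uS] b by auto
          then show ?thesis using b i True by auto
        next
          case False
          then show ?thesis using I(3)[OF uS, of v] v b by auto
        qed
      qed
    qed
    have "card (insert i I) \<le> card (insert x S)" using I(2) fI insert.hyps by (simp add: card_insert_if)
    then show ?thesis using I(1) \<open>i < l\<close> eq by (intro exI[of _ "insert i I"]) auto
  qed
qed auto

text \<open>Projections to at most \<open>m\<close> bit positions. Numbers below \<open>n\<close>
  have so few positions that even all subsets of positions number at most \<open>2 * n + 1\<close>,
  while the range \<open>2 ^ m\<close> does not depend on \<open>n\<close>.\<close>

lemma hash_family_ex:
  "\<exists>hs :: (nat \<Rightarrow> nat) list. length hs \<le> 2 * n + 2 \<and> (\<forall>h\<in>set hs. \<forall>u. h u < 2 ^ m) \<and>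
     (\<forall>S \<subseteq> {..<n}. card S \<le> m \<longrightarrow> (\<exists>h\<in>set hs. inj_on h S))"
proof -
  have "\<exists>l. n \<le> 2 ^ l \<and> 2 ^ l \<le> 2 * n + 1"
  proof (induction n)
    case 0 show ?case by (rule exI[of _ 0]) simp
  next
    case (Suc n)
    then obtain l where l: "n \<le> 2 ^ l" "2 ^ l \<le> 2 * n + 1" by blast
    show ?case
    proof (cases "n = 2 ^ l")
      case True then show ?thesis by (intro exI[of _ "Suc l"]) auto
    next
      case False then show ?thesis using l by (intro exI[of _ l]) auto
    qed
  qed
  then obtain l where l: "n \<le> 2 ^ l" "2 ^ l \<le> 2 * n + 1" by blast
  let ?hs = "map bits (filter (\<lambda>P. length P \<le> m) (subseqs [0..<l]))"
  have "length ?hs \<le> length (subseqs [0..<l])" by simp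
  also have "\<dots> = 2 ^ l" by (simp add: length_subseqs)
  finally have "length ?hs \<le> 2 * n + 2" using l by simp
  moreover have "h u < 2 ^ m" if h: "h \<in> set ?hs" for h u
  proof -
    obtain P where "h = bits P" "length P \<le> m" using h by auto
    moreover from this have "2 ^ length P \<le> (2::nat) ^ m" by (intro power_increasing) auto
    ultimately show ?thesis using order.strict_trans2[OF bits_less[of P u]] by simp
  qed
  moreover have "\<exists>h\<in>set ?hs. inj_on h S" if S: "S \<subseteq> {..<n}" "card S \<le> m" for S
  proof -
    have "finite S" "S \<subseteq> {..<2 ^ l}" using S l finite_subset by auto
    from separating_bits[OF this]
    obtain I where I: "I \<subseteq> {..<l}" "card I \<le> card S" "\<forall>u\<in>S. \<forall>v\<in>S. (\<forall>i\<in>I. bit u i = bit v i) \<longrightarrow> u = v"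
      by (elim exE conjE)
    let ?P = "filter (\<lambda>i. i \<in> I) [0..<l]"
    have sP: "set ?P = I" using I(1) by auto
    have "length ?P = card I" using distinct_card[of ?P] sP by simp
    then have "bits ?P \<in> set ?hs" using I(2) S(2) by (auto intro!: imageI subseq_filter_left)
    moreover have "inj_on (bits ?P) S" using I(3) unfolding inj_on_def bits_eq sP by blast
    ultimately show ?thesis by blast
  qed
  ultimately show ?thesis by blast
qed

definition hs :: "nat \<Rightarrow> nat \<Rightarrow> (nat \<Rightarrow> nat) list" where
  "hs n m = (SOME hs. length hs \<le> 2 * n + 2 \<and> (\<forall>h\<in>set hs. \<forall>u. h u < 2 ^ m) \<and>
     (\<forall>S \<subseteq> {..<n}. card S \<le> m \<longrightarrow> (\<exists>h\<in>set hs. inj_on h S)))"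

lemma hs: "length (hs n m) \<le> 2 * n + 2" "h \<in> set (hs n m) \<Longrightarrow> h u < 2 ^ m"
  "S \<subseteq> {..<n} \<Longrightarrow> card S \<le> m \<Longrightarrow> \<exists>h\<in>set (hs n m). inj_on h S"
  using someI_ex[OF hash_family_ex[of n m]] unfolding hs_def by blast+

text \<open>Counting to \<open>k\<close> at constant depth: some hash function and some
  \<open>k\<close> hash values such that each value is taken by a vertex satisfying
  \<open>T\<close>. Choosing \<open>k\<close> vertices directly would cost
  \<open>n ^ k\<close>.\<close>

definition thr :: "nat \<Rightarrow> nat \<Rightarrow> (nat \<Rightarrow> bf) \<Rightarrow> bf" where
  "thr n k T = BAny (map (\<lambda>(h, K). BAll (map (\<lambda>c. BAny (map T (filter (\<lambda>u. h u = c) [0..<n]))) K))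
     (List.product (hs n k) (filter (\<lambda>K. length K = k) (subseqs [0..<2 ^ k]))))"

lemma bev_thr: "bev w (thr n k T) \<longleftrightarrow> k \<le> card (memb n w T)"
proof
  assume "bev w (thr n k T)"
  then obtain h K where K: "subseq K [0..<2 ^ k]" "length K = k"
    "\<And>c. c \<in> set K \<Longrightarrow> \<exists>u<n. h u = c \<and> bev w (T u)"
    unfolding thr_def by auto
  have "set K \<subseteq> h ` memb n w T" using K(3) by (fastforce simp: memb_def)
  then have "card (set K) \<le> card (h ` memb n w T)" by (rule card_mono[rotated]) (simp add: memb_def)
  also have "\<dots> \<le> card (memb n w T)" by (rule card_image_le) (simp add: memb_def)
  finally show "k \<le> card (memb n w T)"
    using distinct_card[of K] K(1,2) subseqs_distinctD[of K "[0..<2 ^ k]"] by simp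
next
  assume "k \<le> card (memb n w T)"
  then obtain S where S: "S \<subseteq> memb n w T" "card S = k" using obtain_subset_with_card_n by metis
  have Sn: "S \<subseteq> {..<n}" using S by (auto simp: memb_def)
  obtain h where h: "h \<in> set (hs n k)" "inj_on h S" using hs(3)[OF Sn] S(2) by auto
  let ?K = "filter (\<lambda>c. c \<in> h ` S) [0..<2 ^ k]"
  have sK: "set ?K = h ` S" using hs(2)[OF h(1)] by auto
  have "length ?K = k" using distinct_card[of ?K] sK card_image[OF h(2)] S(2) by simp
  then have "(h, ?K) \<in> set (List.product (hs n k) (filter (\<lambda>K. length K = k) (subseqs [0..<2 ^ k])))"
    using h(1) by (auto intro: subseq_filter_left)
  moreover have "bev w (BAll (map (\<lambda>c. BAny (map T (filter (\<lambda>u. h u = c) [0..<n]))) ?K))"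
    using sK S(1) Sn by (auto simp: memb_def)
  ultimately show "bev w (thr n k T)" unfolding thr_def bev.simps(4) set_map
    by (intro bexI[OF _ imageI[of "(h, ?K)"]]) (simp_all only: prod.case)
qed

lemma bok_thr: "(\<And>u. u < n \<Longrightarrow> bok N d (T u)) \<Longrightarrow> bok N (d + 3) (thr n k T)"
  unfolding thr_def by (auto simp: numeral_3_eq_3)

lemma bsz_thr:
  assumes "\<And>u. u < n \<Longrightarrow> bsz (T u) \<le> M"
  shows "bsz (thr n k T) \<le> 1 + (2 * n + 2) * 2 ^ (2 ^ k) * (1 + 2 ^ k * (1 + n * M))"
proof -
  let ?f = "\<lambda>(h, K). BAll (map (\<lambda>c. BAny (map T (filter (\<lambda>u. h u = c) [0..<n]))) K)"
  let ?L = "List.product (hs n k) (filter (\<lambda>K. length K = k) (subseqs [0..<2 ^ k]))"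
  have i: "bsz (BAny (map T (filter (\<lambda>u. h u = c) [0..<n]))) \<le> 1 + n * M" for h :: "nat \<Rightarrow> nat" and c
  proof -
    have "sum_list (map (\<lambda>u. bsz (T u)) (filter (\<lambda>u. h u = c) [0..<n])) \<le> length (filter (\<lambda>u. h u = c) [0..<n]) * M"
      by (rule sum_list_le) (use assms in auto)
    also have "\<dots> \<le> n * M" by (rule mult_le_mono1) (metis diff_zero length_filter_le length_upt)
    finally show ?thesis by (simp add: comp_def)
  qed
  have "bsz (?f X) \<le> 1 + 2 ^ k * (1 + n * M)" if "X \<in> set ?L" for X
  proof -
    obtain h K where X: "X = (h, K)" by (cases X)
    have "length K = k" using that X by auto
    have "sum_list (map (\<lambda>c. bsz (BAny (map T (filter (\<lambda>u. h u = c) [0..<n])))) K) \<le> length K * (1 + n * M)"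
      by (rule sum_list_le) (rule i)
    also have "\<dots> \<le> 2 ^ k * (1 + n * M)" using \<open>length K = k\<close> less_exp[of k] by (intro mult_le_mono1) simp
    finally show ?thesis unfolding X by (simp add: comp_def)
  qed
  then have "sum_list (map (\<lambda>X. bsz (?f X)) ?L) \<le> length ?L * (1 + 2 ^ k * (1 + n * M))" by (rule sum_list_le)
  also have "\<dots> \<le> (2 * n + 2) * 2 ^ (2 ^ k) * (1 + 2 ^ k * (1 + n * M))"
  proof (rule mult_le_mono1)
    have "length (filter (\<lambda>K. length K = k) (subseqs [0..<2 ^ k])) \<le> length (subseqs [0..<(2::nat) ^ k])"
      by (rule length_filter_le)
    then show "length ?L \<le> (2 * n + 2) * 2 ^ (2 ^ k)"
      unfolding length_product by (intro mult_le_mono hs(1)) (simp add: length_subseqs)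
  qed
  finally show ?thesis unfolding thr_def by (simp add: comp_def)
qed

text \<open>The common scheme of both membership proofs. The circuit accepts if \<open>yes\<close>
  holds, or if some candidate set has \<open>k\<close> elements and satisfies the formula.
  Candidates are checked by the circuit, so soundness has to be shown for \<open>yes\<close>
  only.\<close>

theorem fd_para_AC0I:
  fixes cands :: "nat \<Rightarrow> nat \<Rightarrow> (nat \<Rightarrow> bf) list" and yes :: "nat \<Rightarrow> nat \<Rightarrow> bf"
  assumes \<phi>: "fo_over graph_vocabulary 1 \<phi>" "free_vars \<phi> = {}"
    and F: "computable F" "\<And>k. 2 ^ (2 ^ k) \<le> F k" and p: "polyb p"
    and len: "\<And>n k. length (cands n k) \<le> p (F k + n)"
    and cand: "\<And>n k X u. X \<in> set (cands n k) \<Longrightarrow> u < n \<Longrightarrow> bok (n + 1 + n * n) d (X u) \<and> bsz (X u) \<le> p (F k + n)"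
    and yes: "\<And>n k. bok (n + 1 + n * n) d (yes n k) \<and> bsz (yes n k) \<le> p (F k + n)"
    and sound: "\<And>n k w. length w = n + 1 + n * n \<Longrightarrow> valid n w \<Longrightarrow> bev w (yes n k) \<Longrightarrow> models_ge (gr n w) k \<phi>"
    and complete: "\<And>n k w. length w = n + 1 + n * n \<Longrightarrow> valid n w \<Longrightarrow> models_ge (gr n w) k \<phi> \<Longrightarrow>
       bev w (yes n k) \<or> (\<exists>X\<in>set (cands n k). k \<le> card (memb n w X) \<and> models (gr n w) ((\<lambda>u. [u]) ` memb n w X) \<phi>)"
  shows "fd_problem \<phi> \<in> para_AC0"
proof -
  define t where "t = (\<lambda>n k. BAll [vf n, BAny (yes n k # map (\<lambda>X. BAll [thr n k X, trf n X (\<lambda>_. 0) \<phi>]) (cands n k))])"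
  define D where "D = size \<phi> + d + 10"
  have okc: "bok (n + 1 + n * n) (d + 3) (thr n k X)" "bok (n + 1 + n * n) (size \<phi> + d + 1) (trf n X (\<lambda>_. 0) \<phi>)"
    if "X \<in> set (cands n k)" for n k X
    using bok_thr[of n "n + 1 + n * n" d X k] bok_trf[OF \<phi>(1), of "\<lambda>_. 0" n d X] cand[OF that] \<phi>(2) by auto
  have ok: "bok (n + 1 + n * n) D (t n k)" for n k
  proof -
    have D: "4 \<le> D - 1" "d \<le> D - 1 - 1" "d + 3 \<le> D - 1 - 1 - 1" "size \<phi> + d + 1 \<le> D - 1 - 1 - 1" "0 < D - 1 - 1" "0 < D - 1" "0 < D"
      by (simp_all add: D_def)
    have "bok (n + 1 + n * n) (D - 1) (vf n)" by (rule bok_mono[OF bok_vf D(1)])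
    moreover have "bok (n + 1 + n * n) (D - 1 - 1) (yes n k)" using yes[of n k] bok_mono[OF _ D(2)] by blast
    moreover have "bok (n + 1 + n * n) (D - 1 - 1) (BAll [thr n k X, trf n X (\<lambda>_. 0) \<phi>])" if "X \<in> set (cands n k)" for X
      using bok_mono[OF okc(1)[OF that] D(3)] bok_mono[OF okc(2)[OF that] D(4)] D(5) by simp
    ultimately show ?thesis unfolding t_def using D(6,7) by (simp del: bok.simps(3) add: bok.simps(3)[of _ D])
  qed
  let ?P = "\<lambda>N. p N + 1"
  define q where "q = (\<lambda>N. 9 + (4 + N + N * (2 + N * 9)) + p N + p N * (1 + (1 + (2 * N + 2) * N * (1 + N * (1 + N * ?P N))) + (N + 3) ^ (2 * size \<phi> + 1) * ?P N))"
  have q: "polyb q" unfolding q_def by (intro polyb_intros p)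
  have sz: "bsz (t n k) \<le> q (F k + n)" for n k
  proof -
    let ?N = "F k + n"
    have k2: "2 ^ k \<le> ?N" "2 ^ (2 ^ k) \<le> ?N" using F(2)[of k] less_exp[of "2 ^ k"] by linarith+
    have "bsz (BAll [thr n k X, trf n X (\<lambda>_. 0) \<phi>]) \<le> 1 + (1 + (2 * ?N + 2) * ?N * (1 + ?N * (1 + ?N * ?P ?N))) + (?N + 3) ^ (2 * size \<phi> + 1) * ?P ?N"
      if X: "X \<in> set (cands n k)" for X
    proof -
      have M: "bsz (X u) \<le> ?P ?N" if "u < n" for u using cand[OF X that] by simp
      have "bsz (thr n k X) \<le> 1 + (2 * n + 2) * 2 ^ (2 ^ k) * (1 + 2 ^ k * (1 + n * ?P ?N))"
        by (rule bsz_thr) (rule M)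
      also have "\<dots> \<le> 1 + (2 * ?N + 2) * ?N * (1 + ?N * (1 + ?N * ?P ?N))"
        by (intro add_mono mult_mono k2) auto
      finally have 1: "bsz (thr n k X) \<le> 1 + (2 * ?N + 2) * ?N * (1 + ?N * (1 + ?N * ?P ?N))" .
      have "bsz (trf n X (\<lambda>_. 0) \<phi>) \<le> (n + 3) ^ (2 * size \<phi> + 1) * ?P ?N"
        by (rule bsz_trf[OF \<phi>(1)]) (use M \<phi>(2) in auto)
      also have "\<dots> \<le> (?N + 3) ^ (2 * size \<phi> + 1) * ?P ?N" by (intro mult_le_mono1 power_mono) auto
      finally show ?thesis using 1 by simp
    qed
    then have "sum_list (map (\<lambda>X. bsz (BAll [thr n k X, trf n X (\<lambda>_. 0) \<phi>])) (cands n k)) \<le> length (cands n k) *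
      (1 + (1 + (2 * ?N + 2) * ?N * (1 + ?N * (1 + ?N * ?P ?N))) + (?N + 3) ^ (2 * size \<phi> + 1) * ?P ?N)"
      by (rule sum_list_le)
    also have "\<dots> \<le> p ?N * (1 + (1 + (2 * ?N + 2) * ?N * (1 + ?N * (1 + ?N * ?P ?N))) + (?N + 3) ^ (2 * size \<phi> + 1) * ?P ?N)"
      by (rule mult_le_mono1) (rule len)
    finally have 1: "sum_list (map (\<lambda>X. bsz (BAll [thr n k X, trf n X (\<lambda>_. 0) \<phi>])) (cands n k)) \<le> p ?N * (1 + (1 + (2 * ?N + 2) * ?N * (1 + ?N * (1 + ?N * ?P ?N))) + (?N + 3) ^ (2 * size \<phi> + 1) * ?P ?N)" .
    have "bsz (vf n) \<le> 4 + ?N + ?N * (2 + ?N * 9)"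
      by (rule order_trans[OF bsz_vf]) (intro add_mono mult_mono, auto)
    moreover have "bsz (t n k) = 2 + bsz (vf n) + bsz (yes n k) + sum_list (map (\<lambda>X. bsz (BAll [thr n k X, trf n X (\<lambda>_. 0) \<phi>])) (cands n k))"
      unfolding t_def by (simp add: comp_def del: bsz.simps(1))
    ultimately show ?thesis using 1 yes[of n k] unfolding q_def by linarith
  qed
  have sem: "bev w (t n k) \<longleftrightarrow> (w, k) \<in> fd_problem \<phi>" if w: "length w = n + 1 + n * n" for n k w
  proof -
    have m: "bev w (trf n X (\<lambda>_. 0) \<phi>) \<longleftrightarrow> models (gr n w) ((\<lambda>u. [u]) ` memb n w X) \<phi>" for X
      using bev_trf[OF \<phi>(1), of "\<lambda>_. 0" n w X] \<phi>(2) models_closed[OF \<phi>(2), of "gr n w" _ "\<lambda>_. 0"] by simp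
    have c: "models_ge (gr n w) k \<phi>" if "k \<le> card (memb n w X)" "models (gr n w) ((\<lambda>u. [u]) ` memb n w X) \<phi>" for X
      unfolding models_ge_def using that by (intro exI[of _ "memb n w X"]) (auto simp: memb_def)
    show ?thesis unfolding fd_problem_iff[OF \<phi>(1) w] t_def
      using sound[OF w, of k] complete[OF w, of k] c by (auto simp: bev_vf bev_thr m)
  qed
  define t' where "t' = (\<lambda>N k. if \<exists>n. N = n + 1 + n * n then t (THE n. N = n + 1 + n * n) k else bF)"
  have t': "t' (n + 1 + n * n) k = t n k" for n k
  proof -
    have "(THE m. n + 1 + n * n = m + 1 + m * m) = n" by (rule the_equality) (rule refl, rule size_inj, erule sym)
    then show ?thesis unfolding t'_def by auto
  qed
  obtain e where e: "\<And>N. q N \<le> (N + 2) ^ e" using q unfolding polyb_def by blast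
  show ?thesis
  proof (rule para_AC0I[OF F(1), of "\<lambda>N. (N + 2) ^ e + 1" D t'])
    show "polyb (\<lambda>N. (N + 2) ^ e + 1)" by (intro polyb_intros)
    fix N k
    show "bok N D (t' N k) \<and> bsz (t' N k) \<le> (F k + N + 2) ^ e + 1 \<and> (\<forall>w. length w = N \<longrightarrow> (bev w (t' N k) \<longleftrightarrow> (w, k) \<in> fd_problem \<phi>))"
    proof (cases "\<exists>n. N = n + 1 + n * n")
      case True
      then obtain n where n: "N = n + 1 + n * n" by blast
      have "q (F k + n) \<le> (F k + n + 2) ^ e" by (rule e)
      also have "\<dots> \<le> (F k + N + 2) ^ e" by (rule power_mono) (use n in auto)
      finally have "bsz (t n k) \<le> (F k + N + 2) ^ e + 1" using sz[of n k] by linarith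
      then show ?thesis using ok[of n k] sem unfolding n t' by auto
    next
      case False
      then have "t' N k = bF" unfolding t'_def by simp
      moreover have "(w, k) \<notin> fd_problem \<phi>" if "length w = N" for w using fd_problem_length[of w k \<phi>] False that by auto
      ultimately show ?thesis by (simp add: D_def)
    qed
  qed
qed

subsection \<open>Prefixes of equal quantifiers\<close>

lemma prenex_QE: "prenex (replicate i QE @ p) \<phi> \<Longrightarrow> \<exists>zs \<chi>. \<phi> = foldr Exists zs \<chi> \<and> prenex p \<chi>"
proof (induction i arbitrary: \<phi>)
  case 0
  then show ?case by (intro exI[of _ "[]"]) auto
next
  case (Suc i)
  then obtain x \<phi>' where x: "\<phi> = Exists x \<phi>'" "prenex (replicate i QE @ p) \<phi>'" by (cases \<phi>) auto
  from Suc.IH[OF x(2)] obtain zs \<chi> where "\<phi>' = foldr Exists zs \<chi>" "prenex p \<chi>" by (elim exE conjE)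
  then show ?case using x by (intro exI[of _ "x # zs"]) auto
qed

lemma prenex_QA: "prenex (replicate i QA) \<phi> \<Longrightarrow> \<exists>zs \<chi>. \<phi> = foldr Forall zs \<chi> \<and> quantifier_free \<chi>"
proof (induction i arbitrary: \<phi>)
  case 0
  then show ?case by (intro exI[of _ "[]"]) auto
next
  case (Suc i)
  then obtain x \<phi>' where x: "\<phi> = Forall x \<phi>'" "prenex (replicate i QA) \<phi>'" by (cases \<phi>) auto
  from Suc.IH[OF x(2)] obtain zs \<chi> where "\<phi>' = foldr Forall zs \<chi>" "quantifier_free \<chi>" by (elim exE conjE)
  then show ?case using x by (intro exI[of _ "x # zs"]) auto
qed

lemma sat_foldr_Exists: "sat A X v (foldr Exists zs \<chi>) \<longleftrightarrow>
   (\<exists>v'. (\<forall>x. x \<notin> set zs \<longrightarrow> v' x = v x) \<and> (\<forall>z\<in>set zs. v' z \<in> struct.univ A) \<and> sat A X v' \<chi>)"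
proof (induction zs arbitrary: v)
  case Nil
  have "(\<forall>x. v' x = v x) \<longleftrightarrow> v' = v" for v' by auto
  then show ?case by simp
next
  case (Cons z zs)
  have "sat A X v (foldr Exists (z # zs) \<chi>) \<longleftrightarrow> (\<exists>a\<in>struct.univ A. \<exists>v'. (\<forall>x. x \<notin> set zs \<longrightarrow> v' x = (v(z := a)) x) \<and>
     (\<forall>z\<in>set zs. v' z \<in> struct.univ A) \<and> sat A X v' \<chi>)" by (simp add: Cons.IH)
  also have "\<dots> \<longleftrightarrow> (\<exists>v'. (\<forall>x. x \<notin> set (z # zs) \<longrightarrow> v' x = v x) \<and> (\<forall>z\<in>set (z # zs). v' z \<in> struct.univ A) \<and> sat A X v' \<chi>)"
  proof
    assume "\<exists>a\<in>struct.univ A. \<exists>v'. (\<forall>x. x \<notin> set zs \<longrightarrow> v' x = (v(z := a)) x) \<and> (\<forall>z\<in>set zs. v' z \<in> struct.univ A) \<and> sat A X v' \<chi>"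
    then obtain a v' where h: "a \<in> struct.univ A" "\<forall>x. x \<notin> set zs \<longrightarrow> v' x = (v(z := a)) x" "\<forall>z\<in>set zs. v' z \<in> struct.univ A" "sat A X v' \<chi>"
      by (elim bexE exE conjE)
    have "v' z \<in> struct.univ A" using h(1,2,3) by (cases "z \<in> set zs") auto
    then show "\<exists>v'. (\<forall>x. x \<notin> set (z # zs) \<longrightarrow> v' x = v x) \<and> (\<forall>z\<in>set (z # zs). v' z \<in> struct.univ A) \<and> sat A X v' \<chi>"
      using h by (intro exI[of _ v']) auto
  next
    assume "\<exists>v'. (\<forall>x. x \<notin> set (z # zs) \<longrightarrow> v' x = v x) \<and> (\<forall>z\<in>set (z # zs). v' z \<in> struct.univ A) \<and> sat A X v' \<chi>"
    then obtain v' where h: "\<forall>x. x \<notin> set (z # zs) \<longrightarrow> v' x = v x" "\<forall>z\<in>set (z # zs). v' z \<in> struct.univ A" "sat A X v' \<chi>"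
      by (elim exE conjE)
    then show "\<exists>a\<in>struct.univ A. \<exists>v'. (\<forall>x. x \<notin> set zs \<longrightarrow> v' x = (v(z := a)) x) \<and> (\<forall>z\<in>set zs. v' z \<in> struct.univ A) \<and> sat A X v' \<chi>"
      by (intro bexI[of _ "v' z"] exI[of _ v']) auto
  qed
  finally show ?case .
qed

lemma sat_foldr_Forall: "sat A X v (foldr Forall zs \<chi>) \<longleftrightarrow>
   (\<forall>v'. (\<forall>x. x \<notin> set zs \<longrightarrow> v' x = v x) \<longrightarrow> (\<forall>z\<in>set zs. v' z \<in> struct.univ A) \<longrightarrow> sat A X v' \<chi>)"
proof -
  have "sat A X v (foldr Forall zs \<chi>) \<longleftrightarrow> \<not> sat A X v (foldr Exists zs (Neg \<chi>))" for v
    by (induction zs arbitrary: v) auto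
  then show ?thesis unfolding sat_foldr_Exists by auto
qed

lemma free_vars_foldr [simp]: "free_vars (foldr Exists zs \<chi>) = free_vars \<chi> - set zs"
  "free_vars (foldr Forall zs \<chi>) = free_vars \<chi> - set zs"
  by (induction zs) auto

lemma fo_over_foldr [simp]: "fo_over \<tau> s (foldr Exists zs \<chi>) = fo_over \<tau> s \<chi>"
  "fo_over \<tau> s (foldr Forall zs \<chi>) = fo_over \<tau> s \<chi>"
  by (induction zs) auto

lemma finite_free_vars: "finite (free_vars \<phi>)" by (induction \<phi>) auto

lemma sat_set_cong:
  "quantifier_free \<psi> \<Longrightarrow> fo_over \<tau> 1 \<psi> \<Longrightarrow> (\<And>x. x \<in> free_vars \<psi> \<Longrightarrow> [v x] \<in> X \<longleftrightarrow> [v x] \<in> Y) \<Longrightarrow> sat A X v \<psi> \<longleftrightarrow> sat A Y v \<psi>"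
proof (induction \<psi>)
  case (Mem xs)
  then obtain x where "xs = [x]" by (auto simp: length_Suc_conv)
  then show ?case using Mem by auto
qed auto

text \<open>Accommodates the \<open>2 ^ gk k\<close> hash values and the sets of hash values,
  \<open>2 ^ (2 ^ gk k)\<close> in number. The innermost exponent has the form that
  \<open>computable_pow\<close> yields for the identity.\<close>

definition FF :: "nat \<Rightarrow> nat" where "FF k = 2 ^ (2 ^ (2 ^ ((k + k + 3) ^ 3)))"

lemma computable_FF: "computable FF"
  unfolding FF_def by (intro computable_exp computable_pow computable_id)

lemma FF_ge: "2 ^ (2 ^ (gk k)) \<le> FF k" "2 ^ (2 ^ k) \<le> FF k"
proof -
  have c: "2 * k + 8 \<le> (k + k + 3) ^ 3"
  proof -
    have "9 * (k + k + 3) \<le> (k + k + 3) ^ 2 * (k + k + 3)"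
      by (rule mult_le_mono1) (use power_mono[of 3 "k + k + 3" 2] in simp)
    then show ?thesis by (simp add: power3_eq_cube power2_eq_square)
  qed
  have "gk k = 2 ^ (2 * k + 8)" by (simp add: gk_def power_add power_mult)
  also have "\<dots> \<le> 2 ^ ((k + k + 3) ^ 3)" by (rule power_increasing[OF c]) simp
  finally have g: "gk k \<le> 2 ^ ((k + k + 3) ^ 3)" .
  then show 1: "2 ^ (2 ^ (gk k)) \<le> FF k" unfolding FF_def by (intro power_increasing) auto
  have "(2::nat) ^ (2 ^ k) \<le> 2 ^ (2 ^ (gk k))" using gk_bounds(1)[of k] by (intro power_increasing) auto
  from this 1 show "2 ^ (2 ^ k) \<le> FF k" by (rule order_trans)
qed

subsection \<open>Patterns below e*a\<close>

lemma single_mem [simp]: "[u] \<in> (\<lambda>u. [u]) ` C \<longleftrightarrow> u \<in> C" by auto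

text \<open>With the values \<open>vs\<close> and their membership fixed, an instance of the matrix
  at \<open>u\<close> depends on no membership except those of \<open>vs\<close> and of
  \<open>u\<close>. So every \<open>u\<close> outside \<open>vs\<close> that may be in can be put in
  independently of the others, and \<open>D\<close> is the largest solution. The second form of
  \<chi>, with a dummy \<open>y\<close>, covers prefixes without the final universal
  quantifier.\<close>

lemma ea_complete:
  fixes v :: "nat \<Rightarrow> 'a"
  assumes \<psi>: "quantifier_free \<psi>" "fo_over \<tau> 1 \<psi>" "free_vars \<psi> \<subseteq> insert y (set zs)"
    and \<chi>: "\<chi> = Forall y \<psi> \<or> (\<chi> = \<psi> \<and> y \<notin> free_vars \<psi>)"
    and C: "C \<subseteq> struct.univ A" and s: "sat A ((\<lambda>u. [u]) ` C) v \<chi>"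
  defines "vs \<equiv> v ` set zs"
  defines "D \<equiv> {u \<in> struct.univ A. if u \<in> vs then u \<in> C else sat A ((\<lambda>u. [u]) ` insert u (C \<inter> vs)) (v(y := u)) \<psi>}"
  shows "C \<subseteq> D" "sat A ((\<lambda>u. [u]) ` D) v \<chi>"
proof -
  have vals: "(v(y := u)) x \<in> insert u vs" if "x \<in> free_vars \<psi>" for x u
    using that \<psi>(3) by (auto simp: vs_def)
  have cong: "sat A ((\<lambda>u. [u]) ` P) (v(y := u)) \<psi> \<longleftrightarrow> sat A ((\<lambda>u. [u]) ` Q) (v(y := u)) \<psi>"
    if "\<And>t. t \<in> insert u vs \<Longrightarrow> t \<in> P \<longleftrightarrow> t \<in> Q" for P Q u
    by (rule sat_set_cong[OF \<psi>(1,2)]) (simp only: single_mem, rule that[OF vals])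
  have sv: "sat A X (v(y := u)) \<psi> \<longleftrightarrow> sat A X v \<psi>" if "\<chi> = \<psi>" "y \<notin> free_vars \<psi>" for X u
    by (rule sat_cong) (use that in auto)
  have sC: "sat A ((\<lambda>u. [u]) ` C) (v(y := u)) \<psi>" if "u \<in> struct.univ A" for u using \<chi> s that sv[of _ u] by auto
  show CD: "C \<subseteq> D"
  proof
    fix u assume u: "u \<in> C"
    have "sat A ((\<lambda>u. [u]) ` insert u (C \<inter> vs)) (v(y := u)) \<psi>" if "u \<notin> vs"
      using cong[of u "insert u (C \<inter> vs)" C] sC[of u] u C by auto
    then show "u \<in> D" using u C by (auto simp: D_def)
  qed
  have vsD: "t \<in> D \<longleftrightarrow> t \<in> C" if "t \<in> vs" for t using that C by (auto simp: D_def)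
  have sD: "sat A ((\<lambda>u. [u]) ` D) (v(y := u)) \<psi>" if u: "u \<in> struct.univ A" for u
  proof (cases "u \<in> D \<and> u \<notin> vs")
    case True
    then have "sat A ((\<lambda>u. [u]) ` insert u (C \<inter> vs)) (v(y := u)) \<psi>" by (auto simp: D_def)
    then show ?thesis using cong[of u "insert u (C \<inter> vs)" D] vsD True by blast
  next
    case False
    then have "u \<in> D \<longleftrightarrow> u \<in> C" using CD vsD by auto
    then show ?thesis using cong[of u D C] vsD sC[OF u] by blast
  qed
  from \<chi> show "sat A ((\<lambda>u. [u]) ` D) v \<chi>"
  proof
    assume "\<chi> = Forall y \<psi>" then show ?thesis using sD by simp
  next
    assume h: "\<chi> = \<psi> \<and> y \<notin> free_vars \<psi>"
    then have "sat A ((\<lambda>u. [u]) ` D) v \<psi> \<longleftrightarrow> sat A ((\<lambda>u. [u]) ` C) v \<psi>"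
      by (intro sat_set_cong[OF \<psi>(1,2)]) (use \<psi>(3) vsD in \<open>auto simp: vs_def\<close>)
    then show ?thesis using h s by simp
  qed
qed

lemma ea_para_AC0:
  assumes \<phi>: "\<phi> = foldr Exists zs \<chi>" "fo_over graph_vocabulary 1 \<phi>" "free_vars \<phi> = {}"
    and \<psi>: "quantifier_free \<psi>" and \<chi>: "\<chi> = Forall y \<psi> \<or> (\<chi> = \<psi> \<and> y \<notin> free_vars \<psi>)"
  shows "fd_problem \<phi> \<in> para_AC0"
proof -
  define l where "l = length zs"
  define asg where "asg = (\<lambda>vals x. case map_of (zip zs vals) x of Some a \<Rightarrow> a | None \<Rightarrow> (0::nat))"
  \<comment> \<open>\<open>vals\<close> are the guessed values and \<open>M\<close> those guessed to
    be in \<open>C\<close>. For other vertices \<open>u\<close> the membership formula is the matrix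
    itself, evaluated at \<open>u\<close> with \<open>M\<close> and \<open>u\<close> as the
    set.\<close>
  define cnd where "cnd = (\<lambda>n vals M u. if u \<in> set vals then (if u \<in> set M then bT else bF)
     else trf n (\<lambda>t. if t = u \<or> t \<in> set M then bT else bF) ((asg vals)(y := u)) \<psi>)"
  \<comment> \<open>At most \<open>n ^ l * 2 ^ l\<close> candidates, which is polynomial because
    \<open>l\<close> depends on the formula only.\<close>
  define cands where "cands = (\<lambda>n (k::nat). concat (map (\<lambda>vals. map (cnd n vals) (subseqs vals)) (List.n_lists l [0..<n])))"
  define p where "p = (\<lambda>N. (N ^ l * 2 ^ l + (N + 3) ^ (2 * size \<psi> + 1)) + 1 :: nat)"
  have fo: "fo_over graph_vocabulary 1 \<psi>" using \<phi>(1,2) \<chi> by auto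
  have fv: "free_vars \<psi> \<subseteq> insert y (set zs)" using \<phi>(1,3) \<chi> by auto
  have asg_map: "asg (map v zs) z = v z" if "z \<in> set zs" for v z
    unfolding asg_def by (simp add: map_of_zip_map that)
  have asg_less: "((asg vals)(y := u)) x < n" if "vals \<in> set (List.n_lists l [0..<n])" "u < n" "x \<in> free_vars \<psi>" for vals n u x
  proof (cases "x = y")
    case False
    then have "x \<in> set zs" using fv that by auto
    moreover have l': "length vals = length zs" "set vals \<subseteq> {..<n}" using that(1) by (auto simp: set_n_lists_upt l_def)
    ultimately obtain a where "map_of (zip zs vals) x = Some a" using map_of_zip_is_Some[of zs vals x] by auto
    moreover from this have "a \<in> set vals" by (meson map_of_SomeD set_zip_rightD)
    ultimately show ?thesis using False l' by (auto simp: asg_def)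
  qed (use that in auto)
  show ?thesis
  proof (rule fd_para_AC0I[OF \<phi>(2,3) computable_FF FF_ge(2), of p cands "size \<psi> + 2" "\<lambda>_ _. bF"])
    show "polyb p" unfolding p_def by (intro polyb_intros)
    fix n k
    have "length (cands n k) = sum_list (map (\<lambda>vals. length (subseqs vals)) (List.n_lists l [0..<n]))"
      by (simp add: cands_def length_concat comp_def)
    also have "\<dots> \<le> length (List.n_lists l [0..<n]) * 2 ^ l"
      by (rule sum_list_le) (auto simp: length_subseqs set_n_lists_upt)
    also have "\<dots> \<le> (FF k + n) ^ l * 2 ^ l" by (simp add: length_n_lists power_mono)
    finally show "length (cands n k) \<le> p (FF k + n)" by (simp add: p_def)
    show "bok (n + 1 + n * n) (size \<psi> + 2) bF \<and> bsz bF \<le> p (FF k + n)" by (simp add: p_def)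
    show "bok (n + 1 + n * n) (size \<psi> + 2) (X u) \<and> bsz (X u) \<le> p (FF k + n)" if X: "X \<in> set (cands n k)" and u: "u < n" for X u
    proof -
      obtain vals M where vM: "vals \<in> set (List.n_lists l [0..<n])" "X = cnd n vals M"
        using X by (auto simp: cands_def)
      have "bok (n + 1 + n * n) (size \<psi> + 1 + 1) (trf n (\<lambda>t. if t = u \<or> t \<in> set M then bT else bF) ((asg vals)(y := u)) \<psi>)"
        by (rule bok_trf[OF fo]) (use asg_less[OF vM(1) u] in auto)
      moreover have b: "bsz (trf n (\<lambda>t. if t = u \<or> t \<in> set M then bT else bF) ((asg vals)(y := u)) \<psi>) \<le> (n + 3) ^ (2 * size \<psi> + 1) * 1"
        by (rule bsz_trf[OF fo]) (use asg_less[OF vM(1) u] in auto)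
      moreover have "(n + 3) ^ (2 * size \<psi> + 1) \<le> (FF k + n + 3) ^ (2 * size \<psi> + 1)" by (rule power_mono) auto
      ultimately show ?thesis unfolding vM(2) cnd_def p_def by (auto simp: numeral_2_eq_2)
    qed
    fix w :: word
    show "models_ge (gr n w) k \<phi>" if "bev w bF" using that by simp
    assume "models_ge (gr n w) k \<phi>"
    then obtain C where C: "C \<subseteq> {..<n}" "k \<le> card C" "models (gr n w) ((\<lambda>u. [u]) ` C) \<phi>"
      by (auto simp: models_ge_def)
    then have "sat (gr n w) ((\<lambda>u. [u]) ` C) (\<lambda>_. 0) (foldr Exists zs \<chi>)" unfolding models_def \<phi>(1) by blast
    then obtain v where v: "\<forall>z\<in>set zs. v z < n" "sat (gr n w) ((\<lambda>u. [u]) ` C) v \<chi>"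
      unfolding sat_foldr_Exists by auto
    define vs where "vs = map v zs"
    define M where "M = filter (\<lambda>u. u \<in> C) vs"
    define X where "X = cnd n vs M"
    have vs: "vs \<in> set (List.n_lists l [0..<n])" using v(1) by (auto simp: vs_def set_n_lists_upt l_def)
    have svs: "set vs = v ` set zs" by (simp add: vs_def)
    have XC: "X \<in> set (cands n k)"
      unfolding cands_def X_def using vs by (auto intro!: bexI[of _ vs] imageI simp: M_def subseq_filter_left)
    have bX: "bev w (X u) \<longleftrightarrow> (if u \<in> v ` set zs then u \<in> C else sat (gr n w) ((\<lambda>u. [u]) ` insert u (C \<inter> v ` set zs)) (v(y := u)) \<psi>)"
      if u: "u < n" for u
    proof -
      have m: "memb n w (\<lambda>t. if t = u \<or> t \<in> set M then bT else bF) = insert u (C \<inter> v ` set zs)"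
        using u C(1) by (auto simp: memb_def M_def svs)
      have "bev w (trf n (\<lambda>t. if t = u \<or> t \<in> set M then bT else bF) ((asg vs)(y := u)) \<psi>) \<longleftrightarrow>
         sat (gr n w) ((\<lambda>u. [u]) ` insert u (C \<inter> v ` set zs)) ((asg vs)(y := u)) \<psi>"
        unfolding m[symmetric] by (rule bev_trf[OF fo]) (use asg_less[OF vs u] in auto)
      also have "\<dots> \<longleftrightarrow> sat (gr n w) ((\<lambda>u. [u]) ` insert u (C \<inter> v ` set zs)) (v(y := u)) \<psi>"
        by (rule sat_cong) (use fv asg_map[of _ v] in \<open>auto simp: vs_def\<close>)
      finally show ?thesis unfolding X_def cnd_def svs by (simp add: M_def svs)
    qed
    have m: "memb n w X = {u \<in> struct.univ (gr n w). if u \<in> v ` set zs then u \<in> C else sat (gr n w) ((\<lambda>u. [u]) ` insert u (C \<inter> v ` set zs)) (v(y := u)) \<psi>}"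
      unfolding memb_def using bX by auto
    note ea = ea_complete[OF \<psi> fo fv \<chi>, of C "gr n w" v, unfolded univ_gr, OF C(1) v(2), folded m[unfolded univ_gr]]
    have "finite (memb n w X)" by (simp add: memb_def)
    then have "k \<le> card (memb n w X)" using C(2) card_mono[OF _ ea(1)] by simp
    moreover have "models (gr n w) ((\<lambda>u. [u]) ` memb n w X) \<phi>"
    proof -
      have "sat (gr n w) ((\<lambda>u. [u]) ` memb n w X) v \<phi>"
        unfolding \<phi>(1) sat_foldr_Exists using ea(2) v(1) by (intro exI[of _ v]) auto
      then show ?thesis using models_closed[OF \<phi>(3)] by blast
    qed
    ultimately show "bev w bF \<or> (\<exists>X\<in>set (cands n k). k \<le> card (memb n w X) \<and> models (gr n w) ((\<lambda>u. [u]) ` memb n w X) \<phi>)"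
      using XC by blast
  qed
qed

lemma subseq_ea: "subseq p (replicate m QE @ [QA]) \<Longrightarrow> \<exists>i. p = replicate i QE \<or> p = replicate i QE @ [QA]"
proof (induction m arbitrary: p)
  case 0
  then show ?case by (cases p) (auto intro: exI[of _ 0] split: if_splits)
next
  case (Suc m)
  show ?case
  proof (cases "\<exists>p'. p = QE # p'")
    case True
    then obtain p' where p: "p = QE # p'" by blast
    then have "subseq p' (replicate m QE @ [QA])" using Suc.prems by simp
    from Suc.IH[OF this] obtain i where "p' = replicate i QE \<or> p' = replicate i QE @ [QA]" by (rule exE)
    then show ?thesis using p by (intro exI[of _ "Suc i"]) auto
  next
    case False
    then have "subseq p (replicate m QE @ [QA])" using Suc.prems by (cases p) (auto split: if_splits)
    then show ?thesis by (rule Suc.IH)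
  qed
qed

lemma ea_pattern:
  assumes "subseq p (replicate m QE @ [QA])"
  shows "p_FD_basic p \<subseteq> para_AC0"
proof
  fix Q assume "Q \<in> p_FD_basic p"
  then obtain \<phi> where \<phi>: "Q = fd_problem \<phi>" "fo_over graph_vocabulary 1 \<phi>" "free_vars \<phi> = {}" "prenex p \<phi>"
    unfolding p_FD_basic_def by auto
  from subseq_ea[OF assms] obtain i q where p: "p = replicate i QE @ q" "q = [] \<or> q = [QA]" by auto
  obtain zs \<chi> where z: "\<phi> = foldr Exists zs \<chi>" "prenex q \<chi>" using prenex_QE[OF \<phi>(4)[unfolded p(1)]] by (elim exE conjE)
  from p(2) show "Q \<in> para_AC0"
  proof
    assume "q = []"
    then have "quantifier_free \<chi>" using z by simp
    moreover obtain y where "y \<notin> free_vars \<chi>" using ex_new_if_finite[OF infinite_UNIV_nat finite_free_vars] by blast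
    ultimately show ?thesis unfolding \<phi>(1) by (intro ea_para_AC0[OF z(1) \<phi>(2,3)]) auto
  next
    assume "q = [QA]"
    then obtain y \<psi> where "\<chi> = Forall y \<psi>" "quantifier_free \<psi>" using z by (cases \<chi>) auto
    then show ?thesis unfolding \<phi>(1) by (intro ea_para_AC0[OF z(1) \<phi>(2,3)]) auto
  qed
qed

subsection \<open>The pattern ae\<close>

definition adj :: "nat \<Rightarrow> word \<Rightarrow> nat \<Rightarrow> nat \<Rightarrow> bool" where
  "adj n w a b \<longleftrightarrow> a < n \<and> b < n \<and> w ! gpos n a b"

lemma rel_gr [simp]: "[a, b] \<in> struct.rel (gr n w) i \<longleftrightarrow> adj n w a b"
  by (auto simp: gr_def adj_def)

lemma grph_adj: "valid n w \<Longrightarrow> grph {..<n} (adj n w)"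
  by unfold_locales (auto simp: valid_def adj_def)

text \<open>In a symmetric, irreflexive graph every atom over two vertices is determined by four
  bits: equality, adjacency and the two memberships.\<close>

lemma pair_type:
  assumes "quantifier_free \<psi>" "fo_over graph_vocabulary 1 \<psi>" "free_vars \<psi> \<subseteq> {x, y}"
  shows "\<exists>T. \<forall>n w C v a b. valid n w \<longrightarrow>
    (sat (gr n w) ((\<lambda>u. [u]) ` C) (v(x := a, y := b)) \<psi> \<longleftrightarrow> T (a = b) (adj n w a b) (a \<in> C) (b \<in> C))"
  using assms
proof (induction \<psi>)
  case Bot
  then show ?case by (intro exI[of _ "\<lambda>_ _ _ _. False"]) simp
next
  case (Eq p q)
  \<comment> \<open>The tests ask whether a variable is \<open>y\<close>, never whether it is
    \<open>x\<close>. This stays correct if both are the same variable, where the second update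
    wins.\<close>
  then show ?case by (intro exI[of _ "\<lambda>e _ _ _. (p = y) = (q = y) \<or> e"]) auto
next
  case (Rel i xs)
  then obtain p q where "xs = [p, q]" by (auto simp: length_Suc_conv numeral_2_eq_2)
  moreover have "valid n w \<Longrightarrow> \<not> adj n w a a" "valid n w \<Longrightarrow> adj n w a b \<longleftrightarrow> adj n w b a" for n w a b
    by (auto simp: valid_def adj_def)
  ultimately show ?case using Rel by (intro exI[of _ "\<lambda>_ r _ _. (p = y) \<noteq> (q = y) \<and> r"]) auto
next
  case (Mem xs)
  then obtain p where "xs = [p]" by (auto simp: length_Suc_conv)
  then show ?case using Mem by (intro exI[of _ "\<lambda>_ _ i j. if p = y then j else i"]) auto
next
  case (Neg \<psi>)
  have "quantifier_free \<psi>" "fo_over graph_vocabulary 1 \<psi>" "free_vars \<psi> \<subseteq> {x, y}" using Neg.prems by simp_all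
  from Neg.IH[OF this] obtain T where "\<forall>n w C v a b. valid n w \<longrightarrow>
    (sat (gr n w) ((\<lambda>u. [u]) ` C) (v(x := a, y := b)) \<psi> \<longleftrightarrow> T (a = b) (adj n w a b) (a \<in> C) (b \<in> C))" by (rule exE)
  then show ?case by (intro exI[of _ "\<lambda>e r i j. \<not> T e r i j"]) (simp only: sat.simps simp_thms)
next
  case (Conj \<psi>1 \<psi>2)
  have 1: "quantifier_free \<psi>1" "fo_over graph_vocabulary 1 \<psi>1" "free_vars \<psi>1 \<subseteq> {x, y}"
    and 2: "quantifier_free \<psi>2" "fo_over graph_vocabulary 1 \<psi>2" "free_vars \<psi>2 \<subseteq> {x, y}" using Conj.prems by simp_all
  obtain T1 where "\<forall>n w C v a b. valid n w \<longrightarrow>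
    (sat (gr n w) ((\<lambda>u. [u]) ` C) (v(x := a, y := b)) \<psi>1 \<longleftrightarrow> T1 (a = b) (adj n w a b) (a \<in> C) (b \<in> C))"
    using Conj.IH(1)[OF 1] by (rule exE)
  moreover obtain T2 where "\<forall>n w C v a b. valid n w \<longrightarrow>
    (sat (gr n w) ((\<lambda>u. [u]) ` C) (v(x := a, y := b)) \<psi>2 \<longleftrightarrow> T2 (a = b) (adj n w a b) (a \<in> C) (b \<in> C))"
    using Conj.IH(2)[OF 2] by (rule exE)
  ultimately show ?case by (intro exI[of _ "\<lambda>e r i j. T1 e r i j \<and> T2 e r i j"]) (simp only: sat.simps simp_thms cong: imp_cong)
next
  case (Disj \<psi>1 \<psi>2)
  have 1: "quantifier_free \<psi>1" "fo_over graph_vocabulary 1 \<psi>1" "free_vars \<psi>1 \<subseteq> {x, y}"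
    and 2: "quantifier_free \<psi>2" "fo_over graph_vocabulary 1 \<psi>2" "free_vars \<psi>2 \<subseteq> {x, y}" using Disj.prems by simp_all
  obtain T1 where "\<forall>n w C v a b. valid n w \<longrightarrow>
    (sat (gr n w) ((\<lambda>u. [u]) ` C) (v(x := a, y := b)) \<psi>1 \<longleftrightarrow> T1 (a = b) (adj n w a b) (a \<in> C) (b \<in> C))"
    using Disj.IH(1)[OF 1] by (rule exE)
  moreover obtain T2 where "\<forall>n w C v a b. valid n w \<longrightarrow>
    (sat (gr n w) ((\<lambda>u. [u]) ` C) (v(x := a, y := b)) \<psi>2 \<longleftrightarrow> T2 (a = b) (adj n w a b) (a \<in> C) (b \<in> C))"
    using Disj.IH(2)[OF 2] by (rule exE)
  ultimately show ?case by (intro exI[of _ "\<lambda>e r i j. T1 e r i j \<or> T2 e r i j"]) (simp only: sat.simps simp_thms cong: imp_cong)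
qed simp_all

text \<open>\<open>si\<close> and \<open>so\<close> stem from choosing the vertex itself as the
  witness for \<open>y\<close>; \<open>I\<close> and \<open>O'\<close> describe the proper
  witnesses.\<close>

lemma ae_sol:
  assumes "quantifier_free \<psi>" "fo_over graph_vocabulary 1 \<psi>" "free_vars (Forall x (Exists y \<psi>)) = {}"
  shows "\<exists>si so I O'. \<forall>n w C. valid n w \<longrightarrow> C \<subseteq> {..<n} \<longrightarrow>
    (models (gr n w) ((\<lambda>u. [u]) ` C) (Forall x (Exists y \<psi>)) \<longleftrightarrow> sol {..<n} (adj n w) si so I O' C)"
proof -
  have "free_vars \<psi> \<subseteq> {x, y}" using assms(3) by auto
  from pair_type[OF assms(1,2) this] obtain T where T: "\<And>n w C v a b. valid n w \<Longrightarrow>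
    sat (gr n w) ((\<lambda>u. [u]) ` C) (v(x := a, y := b)) \<psi> \<longleftrightarrow> T (a = b) (adj n w a b) (a \<in> C) (b \<in> C)" by blast
  have "models (gr n w) ((\<lambda>u. [u]) ` C) (Forall x (Exists y \<psi>)) \<longleftrightarrow>
     sol {..<n} (adj n w) (T True False True True) (T True False False False) (\<lambda>c b. T False c True b) (\<lambda>c b. T False c False b) C"
    if w: "valid n w" and C: "C \<subseteq> {..<n}" for n w C
  proof -
    have irr: "\<not> adj n w a a" for a using w by (auto simp: valid_def adj_def)
    have 1: "(\<exists>b<n. T (a = b) (adj n w a b) (a \<in> C) (b \<in> C)) \<longleftrightarrow>
      T True False (a \<in> C) (a \<in> C) \<or> wit {..<n} (adj n w) (\<lambda>c b. T False c (a \<in> C) b) C a" (is "?l \<longleftrightarrow> ?r") if "a < n" for a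
    proof
      assume ?l
      then obtain b where b: "b < n" "T (a = b) (adj n w a b) (a \<in> C) (b \<in> C)" by auto
      show ?r
      proof (cases "a = b")
        case True then show ?thesis using b irr by auto
      next
        case False then show ?thesis using b unfolding wit_def by auto
      qed
    next
      assume ?r
      then show ?l
      proof
        assume "T True False (a \<in> C) (a \<in> C)"
        then show ?l using that irr by (intro exI[of _ a]) auto
      next
        assume "wit {..<n} (adj n w) (\<lambda>c b. T False c (a \<in> C) b) C a"
        then show ?l unfolding wit_def by (metis lessThan_iff)
      qed
    qed
    have "models (gr n w) ((\<lambda>u. [u]) ` C) (Forall x (Exists y \<psi>)) \<longleftrightarrow> (\<forall>a<n. \<exists>b<n. T (a = b) (adj n w a b) (a \<in> C) (b \<in> C))"
      unfolding models_def by (simp add: T[OF w] Ball_def Bex_def)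
    also have "\<dots> \<longleftrightarrow> (\<forall>a<n. T True False (a \<in> C) (a \<in> C) \<or> wit {..<n} (adj n w) (\<lambda>c b. T False c (a \<in> C) b) C a)"
      using 1 by blast
    also have "\<dots> \<longleftrightarrow> (\<forall>a\<in>C. T True False True True \<or> wit {..<n} (adj n w) (\<lambda>c b. T False c True b) C a) \<and>
       (\<forall>a\<in>{..<n} - C. T True False False False \<or> wit {..<n} (adj n w) (\<lambda>c b. T False c False b) C a)" (is "?A \<longleftrightarrow> ?B")
    proof
      assume A: ?A
      have "a < n" if "a \<in> C" for a using that C by auto
      then show ?B using A by fastforce
    next
      assume B: ?B
      have "T True False (a \<in> C) (a \<in> C) \<or> wit {..<n} (adj n w) (\<lambda>c b. T False c (a \<in> C) b) C a" if "a < n" for a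
        using B that by (cases "a \<in> C") auto
      then show ?A by blast
    qed
    finally show ?thesis using C unfolding sol_def by blast
  qed
  then show ?thesis by blast
qed

section \<open>First-order definitions of the kernels\<close>

definition Imp :: "fo \<Rightarrow> fo \<Rightarrow> fo" where "Imp \<phi> \<psi> = Disj (Neg \<phi>) \<psi>"
definition adjf :: "bool \<Rightarrow> nat \<Rightarrow> nat \<Rightarrow> fo" where
  "adjf c a b = Conj (Neg (Eq a b)) (if c then Rel 0 [a, b] else Neg (Rel 0 [a, b]))"
definition nonadjf :: "bool \<Rightarrow> nat \<Rightarrow> nat \<Rightarrow> fo" where
  "nonadjf c a b = Conj (Neg (Eq a b)) (Neg (adjf c a b))"
text \<open>Variable 3 is bound here and in \<open>nbf\<close>, so their arguments are always taken
  from the variables 0 to 2.\<close>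

definition univf :: "bool \<Rightarrow> nat \<Rightarrow> fo" where
  "univf c a = Forall 3 (Imp (Neg (Eq 3 a)) (adjf c a 3))"
definition nbf :: "bool \<Rightarrow> nat \<Rightarrow> nat \<Rightarrow> fo" where
  "nbf c a b = Forall 3 (Imp (adjf c a 3) (adjf c b 3))"

fun shYf :: "bool \<Rightarrow> shape \<Rightarrow> fo" where
  "shYf c Nope = Bot"
| "shYf c Noniso = Neg Bot"
| "shYf c Noniso_all = Forall 0 (Exists 1 (adjf c 0 1))"
| "shYf c NoK2 = Forall 0 (Exists 1 (adjf c 0 1))"
| "shYf c Nonuniv = Exists 0 (Neg (univf c 0))"
| "shYf c Unpeeled = Exists 0 (Exists 1 (Exists 2 (Exists 3
     (Conj (adjf c 0 1) (Conj (nonadjf c 1 2) (Conj (adjf c 2 3) (nonadjf c 3 0)))))))"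

fun shSf :: "bool \<Rightarrow> shape \<Rightarrow> fo" where
  "shSf c Nope = Bot"
| "shSf c Noniso = Exists 1 (adjf c 0 1)"
| "shSf c Noniso_all = Exists 1 (adjf c 0 1)"
| "shSf c NoK2 = Neg (Exists 1 (Conj (adjf c 0 1)
     (Conj (Forall 2 (Imp (adjf c 0 2) (Eq 2 1))) (Forall 2 (Imp (adjf c 1 2) (Eq 2 0))))))"
| "shSf c Nonuniv = Neg (Conj (Neg (univf c 0)) (Forall 1 (Imp (adjf c 0 1) (univf c 1))))"
| "shSf c Unpeeled = Neg (Conj
     (Forall 1 (Imp (adjf c 0 1) (Forall 2 (Imp (nonadjf c 2 1) (nbf c 2 0)))))
     (Forall 1 (Forall 2 (Imp (nbf c 1 0) (Imp (nbf c 2 0) (Disj (nbf c 1 2) (nbf c 2 1)))))))"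

lemma shf_fo [simp]: "fo_over graph_vocabulary 1 (shYf c sh)" "fo_over graph_vocabulary 1 (shSf c sh)"
  by (cases sh; simp add: adjf_def nonadjf_def univf_def nbf_def Imp_def)+

lemma shf_free: "free_vars (shYf c sh) = {}" "free_vars (shSf c sh) \<subseteq> {0}"
  by (cases sh; simp add: adjf_def nonadjf_def univf_def nbf_def Imp_def; fail | (cases sh; auto simp: adjf_def nonadjf_def univf_def nbf_def Imp_def))+

lemma sat_Imp [simp]: "sat A X v (Imp \<phi> \<psi>) \<longleftrightarrow> (sat A X v \<phi> \<longrightarrow> sat A X v \<psi>)" by (auto simp: Imp_def)

lemma sat_adjf [simp]: "sat (gr n w) X v (adjf c a b) \<longleftrightarrow> recol c (adj n w) (v a) (v b)"
  by (auto simp: adjf_def recol_def)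

lemma sat_nonadjf [simp]: "sat (gr n w) X v (nonadjf c a b) \<longleftrightarrow> v a \<noteq> v b \<and> \<not> recol c (adj n w) (v a) (v b)"
  by (simp add: nonadjf_def)

context
  fixes n :: nat and w :: word and c :: bool
  assumes val: "valid n w"
begin

interpretation grph "{..<n}" "recol c (adj n w)"
  by (rule recol_grph[OF grph_adj[OF val]])

lemma sat_univf: "a \<noteq> 3 \<Longrightarrow> sat (gr n w) X v (univf c a) \<longleftrightarrow> univ (v a)"
  by (auto simp: univf_def univ_def)

lemma sat_nbf: "a \<noteq> 3 \<Longrightarrow> b \<noteq> 3 \<Longrightarrow> sat (gr n w) X v (nbf c a b) \<longleftrightarrow> nb (v a) \<subseteq> nb (v b)"
  by (auto simp: nbf_def nb_def)

lemma sat_shYf: "sat (gr n w) X v (shYf c sh) \<longleftrightarrow> shY sh"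
proof (cases sh)
  case Nonuniv
  then show ?thesis by (auto simp: sat_univf Vp_def)
next
  case Unpeeled
  have "sat (gr n w) X v (shYf c Unpeeled) \<longleftrightarrow> alt4"
    unfolding alt4_def shYf.simps by (simp add: B_def)
  then show ?thesis using Unpeeled by simp
qed (auto simp: W_def)

lemma sat_shSf: "v 0 < n \<Longrightarrow> sat (gr n w) X v (shSf c sh) \<longleftrightarrow> v 0 \<in> shS sh"
proof (cases sh)
  case Nonuniv
  assume "v 0 < n"
  then show ?thesis using Nonuniv by (auto simp: sat_univf Vp_def J'_def)
next
  case NoK2
  assume "v 0 < n"
  then show ?thesis using NoK2 by (simp add: Z_def) 
next
  case Unpeeled
  assume v: "v 0 < n"
  have "sat (gr n w) X v (Neg (shSf c Unpeeled)) \<longleftrightarrow> peeled (v 0)"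
    unfolding peeled_def nb_def[of "v 0"] shSf.simps using v by (simp add: sat_nbf B_def nb_def[of "v 0"] Ball_def, blast)
  then have "(\<not> sat (gr n w) X v (shSf c Unpeeled)) = peeled (v 0)" unfolding sat.simps(5) .
  then show ?thesis unfolding Unpeeled shS.simps mem_Collect_eq lessThan_iff using v by blast
qed (auto simp: W_def)

end

lemma ae_para_AC0:
  assumes \<psi>: "quantifier_free \<psi>" and \<phi>: "\<phi> = Forall x (Exists y \<psi>)" "fo_over graph_vocabulary 1 \<phi>" "free_vars \<phi> = {}"
  shows "fd_problem \<phi> \<in> para_AC0"
proof -
  have fo: "fo_over graph_vocabulary 1 \<psi>" using \<phi> by simp
  from ae_sol[OF \<psi> fo \<phi>(3)[unfolded \<phi>(1)]] obtain si so I O' where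
    m: "\<And>n w C. valid n w \<Longrightarrow> C \<subseteq> {..<n} \<Longrightarrow> models (gr n w) ((\<lambda>u. [u]) ` C) \<phi> \<longleftrightarrow> sol {..<n} (adj n w) si so I O' C"
    unfolding \<phi>(1) by blast
  from kern_exists[of si so I O'] obtain c yy sh where
    "\<forall>V R. grph V R \<longrightarrow> kern V (sol V R si so I O') (yy \<and> grph.shY V (recol c R) sh) (grph.shS V (recol c R) sh)"
    by (elim exE)
  then have kern: "\<And>n w. valid n w \<Longrightarrow> kern {..<n} (sol {..<n} (adj n w) si so I O')
      (yy \<and> grph.shY {..<n} (recol c (adj n w)) sh) (grph.shS {..<n} (recol c (adj n w)) sh)"
    using grph_adj by blast
  define inS where "inS = (\<lambda>n u. trf n (\<lambda>_. bF) (\<lambda>_. u) (shSf c sh))"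
  define yes where "yes = (\<lambda>n k. if yy then BAll [trf n (\<lambda>_. bF) (\<lambda>_. 0) (shYf c sh), thr n (gk k) (inS n)] else bF)"
  \<comment> \<open>The elements of \<open>S\<close> with hash value in \<open>K\<close>. When
    \<open>h\<close> is injective on \<open>S\<close>, every subset of \<open>S\<close> arises in
    this way.\<close>
  define hc where "hc = (\<lambda>n (h :: nat \<Rightarrow> nat, K) u. if h u \<in> set K then inS n u else bF)"
  \<comment> \<open>The complements of tuples of fewer than five vertices, then \<open>S\<close>,
    then the subsets of \<open>S\<close> cut out by hash values: the three alternatives of
    \<open>kern\<close>.\<close>
  define cands where "cands = (\<lambda>n k. concat (map (\<lambda>r. map (\<lambda>xs u. if u \<in> set xs then bF else bT) (List.n_lists r [0..<n])) [0..<5]) @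
     inS n # map (hc n) (List.product (hs n (gk k)) (subseqs [0..<2 ^ gk k])))"
  define M where "M = (\<lambda>N. (N + 3) ^ (2 * size (shSf c sh) + 1) :: nat)"
  define p where "p = (\<lambda>N. (5 * N ^ 4 + 5) + 1 + (2 * N + 2) * N + M N + (N + 3) ^ (2 * size (shYf c sh) + 1) + 3 + (2 * N + 2) * N * (1 + N * (1 + N * M N)) :: nat)"
  define d where "d = size (shYf c sh) + size (shSf c sh) + 6"
  have M1: "1 \<le> M N" for N by (simp add: M_def)
  have S: "bev w (inS n u) \<longleftrightarrow> u \<in> grph.shS {..<n} (recol c (adj n w)) sh" if "valid n w" "u < n" for n w u
  proof -
    have "bev w (inS n u) \<longleftrightarrow> sat (gr n w) ((\<lambda>u. [u]) ` memb n w (\<lambda>_. bF)) (\<lambda>_. u) (shSf c sh)"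
      unfolding inS_def by (rule bev_trf[OF shf_fo(2)]) (use that in auto)
    then show ?thesis using sat_shSf[OF that(1), of "\<lambda>_. u"] that(2) by simp
  qed
  have SV: "grph.shS {..<n} (recol c (adj n w)) sh \<subseteq> {..<n}" if w: "valid n w" for n w
  proof -
    interpret grph "{..<n}" "recol c (adj n w)" by (rule recol_grph[OF grph_adj[OF w]])
    show ?thesis by (cases sh) (auto simp: W_def Z_def)
  qed
  have mS: "memb n w (inS n) = grph.shS {..<n} (recol c (adj n w)) sh" if w: "valid n w" for n w
    using S[OF w] SV[OF w] unfolding memb_def by auto
  have okS: "bok (n + 1 + n * n) (size (shSf c sh) + 2) (inS n u)" if "u < n" for n u
    using bok_trf[OF shf_fo(2), of c sh "\<lambda>_. u" n 1 "\<lambda>_. bF"] that unfolding inS_def by simp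
  have szS: "bsz (inS n u) \<le> M n" if "u < n" for n u
    using bsz_trf[OF shf_fo(2), of c sh "\<lambda>_. u" n "\<lambda>_. bF" 1] that unfolding inS_def M_def by simp
  have Mm: "M n \<le> M (N + n)" for n N unfolding M_def by (rule power_mono) auto
  have syes: "bev w (yes n k) \<longleftrightarrow> (yy \<and> grph.shY {..<n} (recol c (adj n w)) sh) \<and> gk k \<le> card (grph.shS {..<n} (recol c (adj n w)) sh)"
    if w: "valid n w" for n w k
  proof -
    have "bev w (trf n (\<lambda>_. bF) (\<lambda>_. 0) (shYf c sh)) \<longleftrightarrow> grph.shY {..<n} (recol c (adj n w)) sh"
      using bev_trf[OF shf_fo(1), of c sh "\<lambda>_. 0" n w "\<lambda>_. bF"] sat_shYf[OF w] shf_free(1) by simp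
    then show ?thesis unfolding yes_def by (simp add: bev_thr mS[OF w])
  qed
  have inc: "inS n \<in> set (cands n k)" "\<And>xs. length xs < 5 \<Longrightarrow> set xs \<subseteq> {..<n} \<Longrightarrow> (\<lambda>u. if u \<in> set xs then bF else bT) \<in> set (cands n k)"
    "\<And>h K. h \<in> set (hs n (gk k)) \<Longrightarrow> subseq K [0..<2 ^ gk k] \<Longrightarrow> hc n (h, K) \<in> set (cands n k)" for n k
    unfolding cands_def by (auto simp: set_n_lists_upt)
  show ?thesis
  proof (rule fd_para_AC0I[OF \<phi>(2,3) computable_FF FF_ge(2), of p cands d yes])
    show "polyb p" unfolding p_def M_def by (intro polyb_intros)
    fix n k
    let ?N = "FF k + n"
    have G: "2 ^ gk k \<le> ?N" "2 ^ (2 ^ gk k) \<le> ?N" using FF_ge(1)[of k] less_exp[of "2 ^ gk k"] by linarith+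
    have ar: "a + (b + Suc 0) \<le> 5 * q + 5 + 1 + r + m1 + m2 + 3 + m3"
      if "a \<le> 5 * (q + 1)" "b \<le> r" for a b q r m1 m2 m3 :: nat using that by simp
    have "length (concat (map (\<lambda>r. map (\<lambda>xs u. if u \<in> set xs then bF else bT) (List.n_lists r [0..<n])) [0..<5])) \<le> 5 * (?N ^ 4 + 1)"
    proof -
      have "sum_list (map (\<lambda>r. n ^ r) [0..<5]) \<le> length [0..<5] * (?N ^ 4 + 1)"
      proof (rule sum_list_le)
        fix r assume "r \<in> set [0..<5::nat]"
        then have "n ^ r \<le> n ^ 4 + 1" using power_increasing[of r 4 n] by (cases "n = 0") (auto simp: power_0_left)
        also have "n ^ 4 \<le> ?N ^ 4" by (rule power_mono) auto
        finally show "n ^ r \<le> ?N ^ 4 + 1" by simp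
      qed
      then show ?thesis by (simp add: length_concat comp_def length_n_lists)
    qed
    moreover have "length (List.product (hs n (gk k)) (subseqs [0..<2 ^ gk k])) \<le> (2 * ?N + 2) * ?N"
      unfolding length_product using G(2) hs(1)[of n "gk k"] by (intro mult_mono) (auto simp: length_subseqs)
    ultimately show "length (cands n k) \<le> p ?N" unfolding cands_def p_def length_append list.size length_map
      by (rule ar)
    show "bok (n + 1 + n * n) d (X u) \<and> bsz (X u) \<le> p ?N" if X: "X \<in> set (cands n k)" and u: "u < n" for X u
    proof -
      have "X u = bT \<or> X u = bF \<or> X u = inS n u" using X unfolding cands_def hc_def by auto
      moreover have "bok (n + 1 + n * n) d (inS n u)" by (rule bok_mono[OF okS[OF u]]) (simp add: d_def)
      moreover have "bsz (inS n u) \<le> p ?N" using szS[OF u] Mm[of n "FF k"] by (simp add: p_def)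
      ultimately show ?thesis by (auto simp: p_def d_def)
    qed
    show "bok (n + 1 + n * n) d (yes n k) \<and> bsz (yes n k) \<le> p ?N"
    proof -
      have "bok (n + 1 + n * n) (size (shYf c sh) + 1 + 1) (trf n (\<lambda>_. bF) (\<lambda>_. 0) (shYf c sh))"
        by (rule bok_trf[OF shf_fo(1)]) (auto simp: shf_free)
      then have 1: "bok (n + 1 + n * n) (d - 1) (trf n (\<lambda>_. bF) (\<lambda>_. 0) (shYf c sh))" by (rule bok_mono) (simp add: d_def)
      have "bok (n + 1 + n * n) (size (shSf c sh) + 2 + 3) (thr n (gk k) (inS n))" by (rule bok_thr) (rule okS)
      then have 2: "bok (n + 1 + n * n) (d - 1) (thr n (gk k) (inS n))" by (rule bok_mono) (simp add: d_def)
      have "bsz (trf n (\<lambda>_. bF) (\<lambda>_. 0) (shYf c sh)) \<le> (n + 3) ^ (2 * size (shYf c sh) + 1) * 1"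
        by (rule bsz_trf[OF shf_fo(1)]) (auto simp: shf_free)
      also have "\<dots> \<le> (?N + 3) ^ (2 * size (shYf c sh) + 1)" unfolding mult_1_right by (rule power_mono) auto
      finally have 3: "bsz (trf n (\<lambda>_. bF) (\<lambda>_. 0) (shYf c sh)) \<le> (?N + 3) ^ (2 * size (shYf c sh) + 1)" .
      have "bsz (thr n (gk k) (inS n)) \<le> 1 + (2 * n + 2) * 2 ^ (2 ^ gk k) * (1 + 2 ^ gk k * (1 + n * M n))"
        by (rule bsz_thr) (rule szS)
      also have "\<dots> \<le> 1 + (2 * ?N + 2) * ?N * (1 + ?N * (1 + ?N * M ?N))"
        by (intro add_mono mult_mono G Mm) auto
      finally have 4: "bsz (thr n (gk k) (inS n)) \<le> 1 + (2 * ?N + 2) * ?N * (1 + ?N * (1 + ?N * M ?N))" .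
      have "0 < d" by (simp add: d_def)
      show ?thesis
      proof (cases yy)
        case True
        have "bsz (yes n k) = 1 + bsz (trf n (\<lambda>_. bF) (\<lambda>_. 0) (shYf c sh)) + bsz (thr n (gk k) (inS n))"
          using True by (simp add: yes_def)
        then have "bsz (yes n k) \<le> p ?N" using 3 4 unfolding p_def by linarith
        moreover have "bok (n + 1 + n * n) d (yes n k)" using True 1 2 \<open>0 < d\<close> by (simp add: yes_def)
        ultimately show ?thesis by simp
      next
        case False
        then show ?thesis using \<open>0 < d\<close> by (simp add: yes_def p_def)
      qed
    qed
    fix w :: word
    assume w: "valid n w"
    let ?S = "grph.shS {..<n} (recol c (adj n w)) sh"
    let ?Y = "yy \<and> grph.shY {..<n} (recol c (adj n w)) sh"
    note kn = kern[OF w, unfolded kern_def]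
    show "models_ge (gr n w) k \<phi>" if b: "bev w (yes n k)"
    proof -
      obtain C where C: "sol {..<n} (adj n w) si so I O' C" "k \<le> card C"
        using conjunct1[OF kn] b[unfolded syes[OF w]] by blast
      then have "C \<subseteq> {..<n}" by (simp add: sol_def)
      then show ?thesis using C m[OF w] unfolding models_ge_def by (intro exI[of _ C]) auto
    qed
    assume "models_ge (gr n w) k \<phi>"
    then obtain C where C: "C \<subseteq> {..<n}" "k \<le> card C" "models (gr n w) ((\<lambda>u. [u]) ` C) \<phi>"
      by (auto simp: models_ge_def)
    then have "sol {..<n} (adj n w) si so I O' C" using m[OF w C(1)] by blast
    then obtain C' where C': "sol {..<n} (adj n w) si so I O' C'" "card C \<le> card C'"
      "card ({..<n} - C') \<le> 4 \<or> C' = ?S \<or> (?Y \<and> C' \<subseteq> ?S)" using conjunct2[OF kn] by blast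
    have C'n: "C' \<subseteq> {..<n}" using C'(1) by (simp add: sol_def)
    have fin: "bev w (yes n k) \<or> (\<exists>X\<in>set (cands n k). k \<le> card (memb n w X) \<and> models (gr n w) ((\<lambda>u. [u]) ` memb n w X) \<phi>)"
      if "X \<in> set (cands n k)" "memb n w X = C'" for X
      using that C'(1,2) C(2) m[OF w C'n] by (intro disjI2 bexI[of _ X]) auto
    from C'(3) show "bev w (yes n k) \<or> (\<exists>X\<in>set (cands n k). k \<le> card (memb n w X) \<and> models (gr n w) ((\<lambda>u. [u]) ` memb n w X) \<phi>)"
    proof (elim disjE conjE)
      assume c4: "card ({..<n} - C') \<le> 4"
      obtain xs where xs: "set xs = {..<n} - C'" "distinct xs" using finite_distinct_list[of "{..<n} - C'"] by auto
      then have "length xs < 5" using c4 distinct_card[of xs] by simp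
      then have "(\<lambda>u. if u \<in> set xs then bF else bT) \<in> set (cands n k)" by (rule inc(2)) (use xs in auto)
      moreover have "memb n w (\<lambda>u. if u \<in> set xs then bF else bT) = C'"
        using xs(1) C'n unfolding memb_def by auto
      ultimately show ?thesis by (rule fin)
    next
      assume "C' = ?S"
      then show ?thesis using fin[OF inc(1)] mS[OF w] by simp
    next
      assume Y: "yy" "grph.shY {..<n} (recol c (adj n w)) sh" and CS: "C' \<subseteq> ?S"
      show ?thesis
      proof (cases "gk k \<le> card ?S")
        case True
        then show ?thesis using Y syes[OF w, of k] by simp
      next
        case False
        obtain h where h: "h \<in> set (hs n (gk k))" "inj_on h ?S" using hs(3)[OF SV[OF w], of "gk k"] False by auto
        let ?K = "filter (\<lambda>c. c \<in> h ` C') [0..<2 ^ gk k]"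
        have sK: "set ?K = h ` C'" using hs(2)[OF h(1)] by auto
        have "u \<in> C'" if "u \<in> ?S" "h u \<in> h ` C'" for u using that h(2) CS by (auto dest: inj_onD)
        then have "u \<in> memb n w (hc n (h, ?K)) \<longleftrightarrow> u \<in> C'" for u
          unfolding memb_def hc_def prod.case sK using S[OF w, of u] CS C'n by (cases "h u \<in> h ` C'") auto
        then have "memb n w (hc n (h, ?K)) = C'" by blast
        then show ?thesis by (rule fin[OF inc(3)[OF h(1)], rotated]) (rule subseq_filter_left)
      qed
    qed
  qed
qed

lemma ae_pattern:
  assumes "subseq p [QA, QE]"
  shows "p_FD_basic p \<subseteq> para_AC0"
proof (cases "p = [QA, QE]")
  case True
  show ?thesis
  proof
    fix Q assume "Q \<in> p_FD_basic p"
    then obtain \<phi> where \<phi>: "Q = fd_problem \<phi>" "fo_over graph_vocabulary 1 \<phi>" "free_vars \<phi> = {}" "prenex [QA, QE] \<phi>"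
      unfolding p_FD_basic_def True by auto
    then obtain x \<phi>' where "\<phi> = Forall x \<phi>'" "prenex [QE] \<phi>'" by (cases \<phi>) auto
    moreover from this obtain y \<psi> where "\<phi>' = Exists y \<psi>" "quantifier_free \<psi>" by (cases \<phi>') auto
    ultimately show "Q \<in> para_AC0" unfolding \<phi>(1) by (intro ae_para_AC0[OF _ _ \<phi>(2,3)]) auto
  qed
next
  case False
  \<comment> \<open>The proper subsequences of ae are also subsequences of ea, which is treated
    already.\<close>
  then have "p = [] \<or> p = [QA] \<or> p = [QE]" using assms
    by (cases p; cases "tl p") (auto split: if_splits dest: list_emb_length)
  then have "subseq p (replicate 1 QE @ [QA])" by auto
  then show ?thesis by (rule ea_pattern)
qed

section \<open>Hardness\<close>

subsection \<open>Weighted Fagin definability as a compatibility problem\<close>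

fun mems :: "fo \<Rightarrow> nat list list" where
  "mems (Mem xs) = [xs]"
| "mems (Neg \<phi>) = mems \<phi>"
| "mems (Conj \<phi> \<psi>) = mems \<phi> @ mems \<psi>"
| "mems (Disj \<phi> \<psi>) = mems \<phi> @ mems \<psi>"
| "mems _ = []"

lemma sat_mems_cong:
  "quantifier_free \<psi> \<Longrightarrow> (\<And>xs. xs \<in> set (mems \<psi>) \<Longrightarrow> map v xs \<in> X \<longleftrightarrow> map v xs \<in> Y) \<Longrightarrow> sat A X v \<psi> \<longleftrightarrow> sat A Y v \<psi>"
  by (induction \<psi>) auto

lemma mems_fo: "fo_over \<tau> s \<psi> \<Longrightarrow> quantifier_free \<psi> \<Longrightarrow> xs \<in> set (mems \<psi>) \<Longrightarrow> length xs = s \<and> set xs \<subseteq> free_vars \<psi>"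
  by (induction \<psi>) auto

lemma sat_rel_cong:
  "struct.univ A = struct.univ A' \<Longrightarrow> (\<And>i. i < length \<tau> \<Longrightarrow> struct.rel A i = struct.rel A' i) \<Longrightarrow> fo_over \<tau> s \<phi> \<Longrightarrow>
   sat A X v \<phi> \<longleftrightarrow> sat A' X v \<phi>"
  by (induction \<phi> arbitrary: v) auto

lemma set_n_lists_tuples: "set (List.n_lists r [0..<n]) = tuples {..<n} r"
  by (auto simp: set_n_lists_upt tuples_def)

lemma card_tuples: "card (tuples {..<n::nat} r) = n ^ r"
  using distinct_card[OF distinct_n_lists[of "[0..<n]" r]] by (simp add: set_n_lists_tuples length_n_lists)

lemma finite_tuples [simp]: "finite (tuples {..<n::nat} r)"
  unfolding set_n_lists_tuples[symmetric] by (rule finite_set)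

lemma lval_tuples: "t \<in> tuples {..<n} r \<Longrightarrow> lval n t < n ^ r"
  using lval_less[of t n] by (auto simp: tuples_def)

lemma inj_lval: "inj_on (lval n) (tuples {..<n} r)"
  by (rule inj_on_inverseI[where g = "\<lambda>m. List.n_lists r [0..<n] ! m"]) (auto simp: tuples_def nth_n_lists)

lemma lval_surj: "lval n ` tuples {..<n} r = {..<n ^ r}"
  by (rule card_subset_eq) (auto simp: lval_tuples card_image[OF inj_lval] card_tuples)

lemma lval_nth: "m < n ^ r \<Longrightarrow> lval n (List.n_lists r [0..<n] ! m) = m"
proof -
  assume m: "m < n ^ r"
  then obtain t where t: "t \<in> tuples {..<n} r" "m = lval n t" using lval_surj[of n r] by blast
  then have "List.n_lists r [0..<n] ! m = t" by (auto simp: tuples_def nth_n_lists)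
  then show ?thesis using t by simp
qed

lemma nth_concat_upt: "i < l \<Longrightarrow> m < length (f i) \<Longrightarrow> concat (map f [0..<l]) ! ((\<Sum>j<i. length (f j)) + m) = f i ! m"
proof (induction l)
  case (Suc l)
  have len: "length (concat (map f [0..<l])) = (\<Sum>j<l. length (f j))"
    by (simp add: length_concat comp_def interv_sum_list_conv_sum_set_nat lessThan_atLeast0)
  show ?case
  proof (cases "i = l")
    case True
    then show ?thesis using Suc.prems len by (simp add: nth_append)
  next
    case False
    then have i: "i < l" using Suc.prems by simp
    have "(\<Sum>j<i. length (f j)) + m < (\<Sum>j<Suc i. length (f j))" using Suc.prems by simp
    also have "\<dots> \<le> (\<Sum>j<l. length (f j))" by (rule sum_mono2) (use i in auto)
    finally show ?thesis using Suc.IH[OF i Suc.prems(2)] len by (simp add: nth_append)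
  qed
qed simp

lemma concat_slices: "concat (map (\<lambda>i. take (g i) (drop (\<Sum>j<i. g j) u)) [0..<l]) = take (\<Sum>j<l. g j :: nat) u"
  by (induction l) (auto simp: take_add)

section \<open>Decoding words into structures\<close>

lemma lead_replicate [simp]: "lead (replicate n True @ False # u) = n"
  by (induction n) (auto simp: lead_def)

lemma lead_split: "lead w < length w \<Longrightarrow> w = replicate (lead w) True @ False # drop (Suc (lead w)) w"
proof -
  assume l: "lead w < length w"
  have "takeWhile (\<lambda>b. b) w = replicate (lead w) True"
    unfolding lead_def by (rule replicate_eqI) (auto dest: set_takeWhileD)
  moreover have "dropWhile (\<lambda>b. b) w = drop (lead w) w" unfolding lead_def by (rule dropWhile_eq_drop)
  moreover have "drop (lead w) w = False # drop (Suc (lead w)) w"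
    using l nth_length_takeWhile[of "\<lambda>b. b" w] Cons_nth_drop_Suc[OF l] by (auto simp: lead_def)
  ultimately show ?thesis using takeWhile_dropWhile_id[of "\<lambda>b. b" w] by simp
qed

locale wdp =
  fixes \<tau> :: vocabulary and s :: nat and zs :: "nat list" and \<psi> :: fo
  assumes qf: "quantifier_free \<psi>" and fo: "fo_over \<tau> s \<psi>" and fv: "free_vars \<psi> \<subseteq> set zs"
begin

text \<open>Position in an encoding at which the table of relation \<open>i\<close> begins.\<close>

definition off :: "nat \<Rightarrow> nat \<Rightarrow> nat" where "off n i = n + 1 + (\<Sum>j<i. n ^ (\<tau> ! j))"
text \<open>By \<open>encode_dec\<close> and \<open>dec_encode\<close> this characterises encodings:
  only the length has to fit the number of leading ones, as the tables may hold arbitrary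
  bits.\<close>

definition wval :: "word \<Rightarrow> bool" where "wval w \<longleftrightarrow> length w = off (lead w) (length \<tau>)"
definition dec :: "word \<Rightarrow> nat struct" where
  "dec w = \<lparr>univ = {..<lead w}, rel = (\<lambda>i. {xs \<in> tuples {..<lead w} (\<tau> ! i). w ! (off (lead w) i + lval (lead w) xs)})\<rparr>"

lemma finite_dec: "finite_struct \<tau> (dec w)" by (auto simp: finite_struct_def dec_def)

lemma encode_dec:
  assumes "wval w" shows "encode \<tau> (dec w) = w"
proof -
  define n where "n = lead w"
  define u where "u = drop (Suc n) w"
  have l: "length w = Suc n + (\<Sum>j<length \<tau>. n ^ (\<tau> ! j))" using assms by (simp add: wval_def off_def n_def)
  have w: "w = replicate n True @ False # u" unfolding n_def u_def by (rule lead_split) (use l in \<open>simp add: n_def\<close>)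
  have "map (\<lambda>xs. xs \<in> struct.rel (dec w) i) (List.n_lists (\<tau> ! i) [0..<n]) = take (n ^ (\<tau> ! i)) (drop (\<Sum>j<i. n ^ (\<tau> ! j)) u)"
    if i: "i < length \<tau>" for i
  proof (rule nth_equalityI)
    have "(\<Sum>j<i. n ^ (\<tau> ! j)) + n ^ (\<tau> ! i) = (\<Sum>j<Suc i. n ^ (\<tau> ! j))" by simp
    also have "\<dots> \<le> (\<Sum>j<length \<tau>. n ^ (\<tau> ! j))" by (rule sum_mono2) (use i in auto)
    also have "\<dots> = length u" using l by (simp add: u_def)
    finally have le: "(\<Sum>j<i. n ^ (\<tau> ! j)) + n ^ (\<tau> ! i) \<le> length u" .
    then show "length (map (\<lambda>xs. xs \<in> struct.rel (dec w) i) (List.n_lists (\<tau> ! i) [0..<n])) = length (take (n ^ (\<tau> ! i)) (drop (\<Sum>j<i. n ^ (\<tau> ! j)) u))"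
      by (simp add: length_n_lists)
    fix m assume "m < length (map (\<lambda>xs. xs \<in> struct.rel (dec w) i) (List.n_lists (\<tau> ! i) [0..<n]))"
    then have m: "m < n ^ (\<tau> ! i)" by (simp add: length_n_lists)
    define xs where "xs = List.n_lists (\<tau> ! i) [0..<n] ! m"
    have "xs \<in> tuples {..<n} (\<tau> ! i)" unfolding xs_def set_n_lists_tuples[symmetric] by (rule nth_mem) (use m in \<open>simp add: length_n_lists\<close>)
    then have "xs \<in> struct.rel (dec w) i \<longleftrightarrow> w ! (off n i + m)" using lval_nth[OF m] by (simp add: dec_def n_def[symmetric] xs_def)
    also have "w ! (off n i + m) = u ! ((\<Sum>j<i. n ^ (\<tau> ! j)) + m)" using l unfolding u_def by (simp add: off_def ac_simps)
    finally show "map (\<lambda>xs. xs \<in> struct.rel (dec w) i) (List.n_lists (\<tau> ! i) [0..<n]) ! m = take (n ^ (\<tau> ! i)) (drop (\<Sum>j<i. n ^ (\<tau> ! j)) u) ! m"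
      using m le by (simp add: length_n_lists xs_def)
  qed
  then have "concat (map (\<lambda>i. map (\<lambda>xs. xs \<in> struct.rel (dec w) i) (List.n_lists (\<tau> ! i) [0..<n])) [0..<length \<tau>]) =
    concat (map (\<lambda>i. take (n ^ (\<tau> ! i)) (drop (\<Sum>j<i. n ^ (\<tau> ! j)) u)) [0..<length \<tau>])"
    by (intro arg_cong[of _ _ concat] map_cong) auto
  also have "\<dots> = u" unfolding concat_slices using l by (simp add: u_def)
  finally have "encode \<tau> (dec w) = replicate n True @ [False] @ u"
    unfolding encode_def Let_def by (simp add: dec_def n_def)
  then show ?thesis using w by simp
qed

lemma dec_encode:
  assumes A: "finite_struct \<tau> A" "struct.univ A = {..<n}"
  shows "wval (encode \<tau> A)" "lead (encode \<tau> A) = n" "i < length \<tau> \<Longrightarrow> struct.rel (dec (encode \<tau> A)) i = struct.rel A i"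
proof -
  let ?f = "\<lambda>i. map (\<lambda>xs. xs \<in> struct.rel A i) (List.n_lists (\<tau> ! i) [0..<n])"
  have e: "encode \<tau> A = replicate n True @ False # concat (map ?f [0..<length \<tau>])"
    using A(2) by (simp add: encode_def)
  show l: "lead (encode \<tau> A) = n" unfolding e by simp
  have lf: "length (?f i) = n ^ (\<tau> ! i)" for i by (simp add: length_n_lists)
  show "wval (encode \<tau> A)" unfolding wval_def l unfolding e
    by (simp add: off_def length_concat comp_def interv_sum_list_conv_sum_set_nat lessThan_atLeast0 length_n_lists)
  assume i: "i < length \<tau>"
  have "encode \<tau> A ! (off n i + lval n xs) \<longleftrightarrow> xs \<in> struct.rel A i" if t: "xs \<in> tuples {..<n} (\<tau> ! i)" for xs
  proof -
    have "encode \<tau> A ! (off n i + lval n xs) = concat (map ?f [0..<length \<tau>]) ! ((\<Sum>j<i. length (?f j)) + lval n xs)"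
      unfolding e off_def lf by (simp add: nth_append)
    also have "\<dots> = ?f i ! lval n xs" by (rule nth_concat_upt[OF i]) (use lval_tuples[OF t] in \<open>simp add: length_n_lists\<close>)
    also have "\<dots> = (xs \<in> struct.rel A i)" using lval_tuples[OF t] t by (simp add: length_n_lists nth_n_lists tuples_def)
    finally show ?thesis .
  qed
  moreover have "struct.rel A i \<subseteq> tuples {..<n} (\<tau> ! i)" using A i by (auto simp: finite_struct_def)
  ultimately show "struct.rel (dec (encode \<tau> A)) i = struct.rel A i" unfolding dec_def l by auto
qed

definition solves :: "word \<Rightarrow> nat list set \<Rightarrow> bool" where
  "solves w S \<longleftrightarrow> (\<forall>v. (\<forall>z\<in>set zs. v z < lead w) \<longrightarrow> sat (dec w) S v \<psi>)"

lemma models_solves: "models (dec w) S (foldr Forall zs \<psi>) \<longleftrightarrow> solves w S"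
proof -
  have "models (dec w) S (foldr Forall zs \<psi>) \<longleftrightarrow> sat (dec w) S (\<lambda>_. 0) (foldr Forall zs \<psi>)"
    by (rule models_closed) (use fv in auto)
  also have "\<dots> \<longleftrightarrow> solves w S"
  proof
    assume h: "sat (dec w) S (\<lambda>_. 0) (foldr Forall zs \<psi>)"
    have "sat (dec w) S v \<psi>" if v: "\<forall>z\<in>set zs. v z < lead w" for v
    proof -
      let ?v = "\<lambda>x. if x \<in> set zs then v x else 0"
      have "sat (dec w) S ?v \<psi>" using h v unfolding sat_foldr_Forall by (simp add: dec_def)
      moreover have "sat (dec w) S ?v \<psi> \<longleftrightarrow> sat (dec w) S v \<psi>" by (rule sat_cong) (use fv in auto)
      ultimately show ?thesis by simp
    qed
    then show "solves w S" by (simp add: solves_def)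
  next
    assume "solves w S"
    then show "sat (dec w) S (\<lambda>_. 0) (foldr Forall zs \<psi>)" unfolding sat_foldr_Forall solves_def by (simp add: dec_def)
  qed
  finally show ?thesis .
qed

lemma wd_iff: "(w, k) \<in> wd_problem \<tau> s (foldr Forall zs \<psi>) \<longleftrightarrow>
   wval w \<and> (\<exists>S \<subseteq> tuples {..<lead w} s. card S = k \<and> solves w S)" (is "?l \<longleftrightarrow> ?r")
proof
  assume ?l
  then obtain A n S where A: "w = encode \<tau> A" "finite_struct \<tau> A" "struct.univ A = {..<n}" "S \<subseteq> tuples {..<n} s" "card S = k"
    "models A S (foldr Forall zs \<psi>)" unfolding wd_problem_def by auto
  note de = dec_encode[OF A(2,3), folded A(1)]
  have "models (dec w) S (foldr Forall zs \<psi>)"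
    using A(6) sat_rel_cong[of "dec w" A \<tau> s "foldr Forall zs \<psi>"] de A(3) fo unfolding models_def by (simp add: dec_def)
  then show ?r using A(4,5) de unfolding models_solves by auto
next
  assume r: ?r
  then obtain S where S: "wval w" "S \<subseteq> tuples {..<lead w} s" "card S = k" "solves w S" by (elim conjE exE)
  have u: "struct.univ (dec w) = {..<lead w}" by (simp add: dec_def)
  have "\<exists>S \<subseteq> tuples (struct.univ (dec w)) s. card S = k \<and> models (dec w) S (foldr Forall zs \<psi>)"
    unfolding models_solves u using S by (intro exI[of _ S]) simp
  then show ?l unfolding wd_problem_def mem_Collect_eq using encode_dec[OF S(1)] finite_dec[of w] u
    by (intro exI[of _ "dec w"] exI[of _ k]) simp
qed

definition ms :: "nat list list" where "ms = mems \<psi>"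
text \<open>One interval for each atom of the set variable and a spare one, so that a node has an
  interval even if there are no such atoms.\<close>

definition Q :: nat where "Q = length ms + 1"

end

text \<open>A node is a list of \<open>Q\<close> triples: the index of an interval, its left end,
  and its right end, which is excluded.\<close>

definition dI :: "nat list \<Rightarrow> nat \<Rightarrow> nat" where "dI d j = d ! (3 * j)"
definition dL :: "nat list \<Rightarrow> nat \<Rightarrow> nat" where "dL d j = d ! (3 * j + 1)"
definition dR :: "nat list \<Rightarrow> nat \<Rightarrow> nat" where "dR d j = d ! (3 * j + 2)"

lemma digits_eqI:
  assumes "length d = 3 * q" "length d' = 3 * q" "\<And>j. j < q \<Longrightarrow> dI d j = dI d' j \<and> dL d j = dL d' j \<and> dR d j = dR d' j"
  shows "d = d'"
proof (rule nth_equalityI)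
  fix i assume "i < length d"
  then have i: "i div 3 < q" using assms(1) by auto
  consider "i = 3 * (i div 3)" | "i = 3 * (i div 3) + 1" | "i = 3 * (i div 3) + 2" by linarith
  then show "d ! i = d' ! i" using assms(3)[OF i] unfolding dI_def dL_def dR_def by cases metis+
qed (use assms in simp)

definition node :: "(nat \<Rightarrow> nat) \<Rightarrow> nat list \<Rightarrow> nat list" where
  "node e I = concat (map (\<lambda>i. [i, e i, e (Suc i)]) I)"

lemma length_node: "length (node e I) = 3 * length I" by (induction I) (auto simp: node_def)

lemma node_digits: "j < length I \<Longrightarrow> dI (node e I) j = I ! j \<and> dL (node e I) j = e (I ! j) \<and> dR (node e I) j = e (Suc (I ! j))"
  using nth_concat_blocks[of I "\<lambda>i. [i, e i, e (Suc i)]" 3 j 0] nth_concat_blocks[of I "\<lambda>i. [i, e i, e (Suc i)]" 3 j 1]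
    nth_concat_blocks[of I "\<lambda>i. [i, e i, e (Suc i)]" 3 j 2]
  unfolding dI_def dL_def dR_def node_def by (simp add: ac_simps)

context wdp begin

text \<open>Makes all nodes of a compatible family speak about one common sequence of
  boundaries.\<close>

definition cons :: "nat list \<Rightarrow> nat list \<Rightarrow> bool" where
  "cons d d' \<longleftrightarrow> (\<forall>i<Q. \<forall>j<Q. (dI d i = dI d' j \<longrightarrow> dL d i = dL d' j \<and> dR d i = dR d' j) \<and>
     (Suc (dI d i) = dI d' j \<longrightarrow> dR d i = dL d' j))"

text \<open>Pins the boundary sequence down at 0 and, for index \<open>k + 1\<close>, just beyond
  the codes of all tuples. The \<open>k\<close> boundaries in between are the elements of the
  solution; codes are shifted by one to make room for 0.\<close>

definition rng :: "word \<Rightarrow> nat \<Rightarrow> nat list \<Rightarrow> nat \<Rightarrow> bool" where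
  "rng w k d j \<longleftrightarrow> dI d j < k + 2 \<and> dL d j < dR d j \<and> (dI d j = 0 \<longrightarrow> dL d j = 0) \<and>
     (dI d j = k + 1 \<longrightarrow> dL d j = lead w ^ s + 1)"

definition within :: "word \<Rightarrow> nat list \<Rightarrow> (nat \<Rightarrow> nat) \<Rightarrow> bool" where
  "within w d v \<longleftrightarrow> (\<forall>j<length ms. dL d j \<le> Suc (lval (lead w) (map v (ms ! j))) \<and> Suc (lval (lead w) (map v (ms ! j))) < dR d j)"

text \<open>A tuple located in one of the intervals belongs to the solution iff its code is the left
  end of that interval. The left ends listed in the node therefore replace the solution when the
  matrix is evaluated.\<close>

definition fits :: "word \<Rightarrow> nat list \<Rightarrow> bool" where
  "fits w d \<longleftrightarrow> (\<forall>v. (\<forall>z\<in>set zs. v z < lead w) \<longrightarrow> within w d v \<longrightarrow>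
     sat (dec w) {t. \<exists>j<Q. Suc (lval (lead w) t) = dL d j} v \<psi>)"

definition good :: "word \<Rightarrow> nat \<Rightarrow> nat list \<Rightarrow> bool" where
  "good w k d \<longleftrightarrow> (\<forall>j<Q. rng w k d j) \<and> fits w d"

text \<open>If the word encodes no structure, every two nodes are in conflict, even a node with
  itself, which yields a no-instance.\<close>

definition conf :: "word \<Rightarrow> nat \<Rightarrow> nat list \<Rightarrow> nat list \<Rightarrow> bool" where
  "conf w k d d' \<longleftrightarrow> \<not> (wval w \<and> good w k d \<and> good w k d' \<and> cons d d' \<and> cons d' d)"

lemma conf_sym: "conf w k d d' \<longleftrightarrow> conf w k d' d" by (auto simp: conf_def)

text \<open>Indices go up to \<open>k + 1\<close> and boundaries up to
  \<open>lead w ^ s + 2\<close>; the bound is also large enough for the tag digits 0 to 3 of the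
  gadget graph.\<close>

definition nodes :: "word \<Rightarrow> nat \<Rightarrow> nat list set" where
  "nodes w k = tuples {..<lead w ^ s + k + 4} (3 * Q)"

text \<open>The set \<open>S\<close> splits the numbers up to \<open>n\<^sup>s + 1\<close> into intervals. A node picks an interval for each
  atom \<open>X(...)\<close> of the formula, and thus knows the truth value of these atoms if the tuples
  lie in these intervals.\<close>

lemma interval_truth:
  fixes e :: "nat \<Rightarrow> nat"
  assumes e: "\<And>i j. i < j \<Longrightarrow> j \<le> k + 2 \<Longrightarrow> e i < e j" "e 0 = 0" "e (k + 1) = lead w ^ s + 1"
    and S: "S = {t \<in> tuples {..<lead w} s. Suc (lval (lead w) t) \<in> e ` {1..k}}"
    and d: "\<And>j. j < Q \<Longrightarrow> dI d j < k + 2 \<and> dL d j = e (dI d j) \<and> dR d j = e (Suc (dI d j))"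
    and v: "\<forall>z\<in>set zs. v z < lead w" and wi: "within w d v"
  shows "sat (dec w) {t. \<exists>j<Q. Suc (lval (lead w) t) = dL d j} v \<psi> \<longleftrightarrow> sat (dec w) S v \<psi>"
proof (rule sat_mems_cong[OF qf])
  fix xs assume "xs \<in> set (mems \<psi>)"
  then obtain j where j: "j < length ms" "xs = ms ! j" unfolding ms_def by (metis in_set_conv_nth)
  have "length xs = s \<and> set xs \<subseteq> free_vars \<psi>" by (rule mems_fo[OF fo qf]) fact
  then have t: "map v xs \<in> tuples {..<lead w} s" using v fv by (auto simp: tuples_def)
  let ?l = "Suc (lval (lead w) (map v xs))"
  have jQ: "j < Q" using j by (simp add: Q_def)
  have I: "e (dI d j) \<le> ?l" "?l < e (Suc (dI d j))" using wi j d[OF jQ] unfolding within_def by auto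
  have l: "?l < lead w ^ s + 1" using lval_tuples[OF t] by simp
  have le: "e i \<le> e j" if "i \<le> j" "j \<le> k + 2" for i j using e(1)[of i j] that by (cases "i = j") auto
  show "map v xs \<in> {t. \<exists>j<Q. Suc (lval (lead w) t) = dL d j} \<longleftrightarrow> map v xs \<in> S"
  proof
    assume "map v xs \<in> {t. \<exists>j<Q. Suc (lval (lead w) t) = dL d j}"
    then obtain j' where j': "j' < Q" "?l = e (dI d j')" using d by auto
    have "dI d j' \<noteq> 0" using j' e(2) by (metis nat.distinct(1))
    moreover have "dI d j' \<le> k"
    proof (rule ccontr)
      assume "\<not> dI d j' \<le> k"
      then have "dI d j' = k + 1" using d[OF j'(1)] by simp
      then show False using j'(2) e(3) l by simp
    qed
    ultimately show "map v xs \<in> S" unfolding S using t j' by auto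
  next
    assume "map v xs \<in> S"
    then obtain i where i: "i \<in> {1..k}" "?l = e i" unfolding S by auto
    have "dI d j < k + 2" using d[OF jQ] by simp
    have "\<not> i < dI d j" using e(1)[of i "dI d j"] I i d[OF jQ] by auto
    moreover have "\<not> Suc (dI d j) \<le> i" using le[of "Suc (dI d j)" i] I i by auto
    ultimately have "i = dI d j" by simp
    then show "map v xs \<in> {t. \<exists>j<Q. Suc (lval (lead w) t) = dL d j}" using i d[OF jQ] jQ by auto
  qed
qed

lemma solution_nodes:
  assumes "wval w" "S \<subseteq> tuples {..<lead w} s" "card S = k" "solves w S"
  shows "\<exists>X \<subseteq> nodes w k. (k + 2) ^ Q \<le> card X \<and> (\<forall>a\<in>X. \<forall>b\<in>X. \<not> conf w k a b)"
proof -
  define n where "n = lead w"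
  define P where "P = (\<lambda>t. Suc (lval n t)) ` S"
  have fS: "finite S" using finite_subset[OF assms(2) finite_tuples] .
  have "inj_on (\<lambda>t. Suc (lval n t)) S"
    using inj_on_subset[OF inj_lval[of n s]] assms(2) by (auto simp: inj_on_def n_def)
  then have P: "finite P" "card P = k" using assms(3) fS by (auto simp: P_def card_image)
  have Pr: "0 < p \<and> p < n ^ s + 1" if "p \<in> P" for p using that assms(2) lval_tuples[of _ n s] by (auto simp: P_def n_def)
  define es where "es = sorted_list_of_set P"
  have es: "sorted_wrt (<) es" "set es = P" "length es = k"
    using P by (auto simp: es_def)
  \<comment> \<open>The shifted codes of \<open>S\<close> in order, between the two fixed
    boundaries. The last entry only serves as the right end of interval
    \<open>k + 1\<close>.\<close>
  define el where "el = 0 # es @ [n ^ s + 1, n ^ s + 2]"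
  define e where "e = (\<lambda>i. el ! i)"
  have sel: "sorted_wrt (<) el" unfolding el_def using es Pr by (auto simp: sorted_wrt_append less_SucI)
  have mono: "e i < e j" if "i < j" "j \<le> k + 2" for i j
    unfolding e_def by (rule sorted_wrt_nth_less[OF sel]) (use that es(3) in \<open>simp_all add: el_def\<close>)
  have e0: "e 0 = 0" "e (k + 1) = n ^ s + 1" "e (k + 2) = n ^ s + 2"
    using es(3) by (auto simp: e_def el_def nth_append)
  have eP: "e ` {1..k} = P"
  proof -
    have "e (Suc i) = es ! i" if "i < k" for i using that es(3) by (simp add: e_def el_def nth_append)
    then have "e ` Suc ` {..<k} = (!) es ` {..<k}" by (auto simp: image_iff)
    moreover have "Suc ` {..<k} = {1..k}" by (auto simp: image_Suc_lessThan)
    moreover have "(!) es ` {..<k} = P" using es(2,3) by (auto simp: in_set_conv_nth image_iff)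
    ultimately show ?thesis by simp
  qed
  have S: "S = {t \<in> tuples {..<lead w} s. Suc (lval (lead w) t) \<in> e ` {1..k}}"
    unfolding eP P_def n_def using assms(2) inj_onD[OF inj_lval[of "lead w" s]] by (auto simp: subset_iff)
  \<comment> \<open>One node for each vector of \<open>Q\<close> interval indices,
    \<open>(k + 2) ^ Q\<close> in all.\<close>
  define X where "X = node e ` tuples {..<k + 2} Q"
  have dig: "dI (node e I) j < k + 2 \<and> dI (node e I) j = I ! j \<and> dL (node e I) j = e (dI (node e I) j) \<and> dR (node e I) j = e (Suc (dI (node e I) j))"
    if "I \<in> tuples {..<k + 2} Q" "j < Q" for I j
  proof -
    have "j < length I" "set I \<subseteq> {..<k + 2}" using that by (simp_all add: tuples_def)
    then have "I ! j < k + 2" using nth_mem[of j I] by (meson lessThan_iff subsetD)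
    then show ?thesis using node_digits[OF \<open>j < length I\<close>, of e] by simp
  qed
  have "inj_on (node e) (tuples {..<k + 2} Q)"
  proof (rule inj_onI)
    fix I I' assume I: "I \<in> tuples {..<k + 2} Q" "I' \<in> tuples {..<k + 2} Q" "node e I = node e I'"
    show "I = I'" by (rule nth_equalityI) (use I dig[OF I(1)] dig[OF I(2)] in \<open>auto simp: tuples_def\<close>)
  qed
  then have "card X = (k + 2) ^ Q" unfolding X_def by (simp add: card_image card_tuples)
  moreover have "X \<subseteq> nodes w k"
  proof
    fix d assume "d \<in> X"
    then obtain I where I: "I \<in> tuples {..<k + 2} Q" "d = node e I" by (auto simp: X_def)
    have eb: "e i < n ^ s + k + 4" if "i \<le> k + 2" for i
      using mono[of i "k + 2"] e0(3) that by (cases "i = k + 2") auto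
    have "set d \<subseteq> {..<n ^ s + k + 4}" using I(1) eb unfolding I(2) node_def tuples_def by fastforce
    then show "d \<in> nodes w k" using I length_node[of e I] by (simp add: nodes_def tuples_def n_def)
  qed
  moreover have "\<not> conf w k a b" if a: "a \<in> X" and b: "b \<in> X" for a b
  proof -
    obtain I I' where I: "I \<in> tuples {..<k + 2} Q" "a = node e I" and I': "I' \<in> tuples {..<k + 2} Q" "b = node e I'"
      using a b by (auto simp: X_def)
    have "good w k d" if d: "d \<in> X" for d
    proof -
      obtain J where J: "J \<in> tuples {..<k + 2} Q" "d = node e J" using d by (auto simp: X_def)
      note D = dig[OF J(1), folded J(2)]
      have "rng w k d j" if j: "j < Q" for j
        using D[OF j] mono[of "dI d j" "Suc (dI d j)"] e0 by (auto simp: rng_def n_def)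
      moreover have "fits w d" unfolding fits_def
      proof (intro allI impI)
        fix v assume v: "\<forall>z\<in>set zs. v z < lead w" "within w d v"
        have "sat (dec w) S v \<psi>" using assms(4) v(1) by (auto simp: solves_def)
        then show "sat (dec w) {t. \<exists>j<Q. Suc (lval (lead w) t) = dL d j} v \<psi>"
          using interval_truth[of k e w S d v, OF mono e0(1) e0(2)[unfolded n_def] S _ v] D by blast
      qed
      ultimately show ?thesis by (simp add: good_def)
    qed
    moreover have "cons (node e J) (node e J')" if J: "J \<in> tuples {..<k + 2} Q" "J' \<in> tuples {..<k + 2} Q" for J J'
      unfolding cons_def using dig[OF J(1)] dig[OF J(2)] by metis
    ultimately show ?thesis using a b I I' assms(1) by (simp add: conf_def)
  qed
  ultimately show ?thesis by (intro exI[of _ X]) auto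
qed

text \<open>Compatible nodes with equal index vectors are equal, so \<open>(k + 2) ^ Q\<close> nodes
  realise every vector. The constant vectors yield the boundaries \<open>e\<close>, hence
  \<open>S\<close>; for an assignment, the node whose intervals contain the tuples of all atoms
  certifies the matrix.\<close>

lemma nodes_solution:
  assumes X: "X \<subseteq> nodes w k" "(k + 2) ^ Q \<le> card X" "\<forall>a\<in>X. \<forall>b\<in>X. \<not> conf w k a b"
  shows "wval w \<and> (\<exists>S \<subseteq> tuples {..<lead w} s. card S = k \<and> solves w S)"
proof -
  define n where "n = lead w"
  have Q0: "0 < Q" by (simp add: Q_def)
  have c: "wval w" "good w k d" "cons d d'" if "d \<in> X" "d' \<in> X" for d d' using X(3) that by (auto simp: conf_def)
  have fin: "finite X" using finite_subset[OF X(1)] by (simp add: nodes_def)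
  define iv where "iv = (\<lambda>d. map (dI d) [0..<Q])"
  have iv: "iv ` X \<subseteq> tuples {..<k + 2} Q"
    using c(2) unfolding iv_def tuples_def good_def rng_def by fastforce
  have "inj_on iv X"
  proof (rule inj_onI)
    fix d d' assume d: "d \<in> X" "d' \<in> X" "iv d = iv d'"
    have "dI d j = dI d' j" if "j < Q" for j using d(3) that unfolding iv_def by auto
    moreover have "length d = 3 * Q" "length d' = 3 * Q" using X(1) d by (auto simp: nodes_def tuples_def)
    ultimately show "d = d'" using c(3)[OF d(1,2)] by (intro digits_eqI[of d Q d']) (auto simp: cons_def)
  qed
  then have "card (iv ` X) = card X" by (rule card_image)
  then have ivX: "iv ` X = tuples {..<k + 2} Q"
    using card_seteq[OF finite_tuples iv] X(2) by (simp add: card_tuples)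
  have ex: "\<exists>d\<in>X. \<forall>j<Q. dI d j = I ! j" if "I \<in> tuples {..<k + 2} Q" for I
  proof -
    have "I \<in> iv ` X" using ivX that by simp
    then obtain d where "I = iv d" "d \<in> X" by (rule imageE)
    then show ?thesis by (intro bexI[of _ d]) (auto simp: iv_def)
  qed
  have "\<exists>d\<in>X. \<forall>j<Q. dI d j = i" if "i < k + 2" for i
  proof -
    have "replicate Q i \<in> tuples {..<k + 2} Q" using that by (auto simp: tuples_def)
    from ex[OF this] show ?thesis by simp
  qed
  then obtain nd where nd: "\<And>i. i < k + 2 \<Longrightarrow> nd i \<in> X" "\<And>i j. i < k + 2 \<Longrightarrow> j < Q \<Longrightarrow> dI (nd i) j = i" by metis
  define e where "e = (\<lambda>i. if i < k + 2 then dL (nd i) 0 else dR (nd (k + 1)) 0)"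
  have R: "dR (nd i) 0 = e (Suc i)" if "i < k + 2" for i
  proof (cases "Suc i < k + 2")
    case True
    have "cons (nd i) (nd (Suc i))" by (rule c(3)[OF nd(1)[OF that] nd(1)[OF True]])
    then have "Suc (dI (nd i) 0) = dI (nd (Suc i)) 0 \<longrightarrow> dR (nd i) 0 = dL (nd (Suc i)) 0" using Q0 unfolding cons_def by blast
    then show ?thesis using nd(2)[OF that Q0] nd(2)[OF True Q0] True by (simp add: e_def)
  next
    case False
    then have "i = k + 1" using that by simp
    then show ?thesis by (simp add: e_def)
  qed
  have LR: "dI d j < k + 2 \<and> dL d j = e (dI d j) \<and> dR d j = e (Suc (dI d j))" if d: "d \<in> X" and j: "j < Q" for d j
  proof -
    have i: "dI d j < k + 2" using c(2)[OF d d] j by (simp add: good_def rng_def)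
    have "cons d (nd (dI d j))" by (rule c(3)[OF d nd(1)[OF i]])
    then have "dI d j = dI (nd (dI d j)) 0 \<longrightarrow> dL d j = dL (nd (dI d j)) 0 \<and> dR d j = dR (nd (dI d j)) 0"
      using j Q0 unfolding cons_def by blast
    then show ?thesis using nd(2)[OF i Q0] R[OF i] i by (simp add: e_def)
  qed
  have rng: "rng w k (nd i) 0" if "i < k + 2" for i using c(2)[OF nd(1)[OF that] nd(1)[OF that]] Q0 by (simp add: good_def)
  have e0: "e 0 = 0" using rng[of 0] nd(2)[of 0 0] Q0 by (simp add: rng_def e_def)
  have ek: "e (k + 1) = n ^ s + 1" using rng[of "k + 1"] nd(2)[of "k + 1" 0] Q0 by (simp add: rng_def e_def n_def)
  have step: "e i < e (Suc i)" if "i < k + 2" for i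
    using rng[OF that] R[OF that] that by (simp add: rng_def e_def)
  have mono: "e i < e j" if "i < j" "j \<le> k + 2" for i j
    using that
  proof (induction j)
    case (Suc j)
    show ?case
    proof (cases "i = j")
      case True then show ?thesis using step[of j] Suc.prems by simp
    next
      case False then show ?thesis using Suc step[of j] by (simp add: less_trans)
    qed
  qed simp
  define S where "S = {t \<in> tuples {..<lead w} s. Suc (lval (lead w) t) \<in> e ` {1..k}}"
  have "card S = k"
  proof -
    have inj: "inj_on (\<lambda>t. Suc (lval n t)) S"
      using inj_on_subset[OF inj_lval[of n s]] by (auto simp: inj_on_def n_def S_def)
    have "(\<lambda>t. Suc (lval n t)) ` S = e ` {1..k}"
    proof
      show "(\<lambda>t. Suc (lval n t)) ` S \<subseteq> e ` {1..k}" by (auto simp: S_def n_def)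
      show "e ` {1..k} \<subseteq> (\<lambda>t. Suc (lval n t)) ` S"
      proof
        fix p assume "p \<in> e ` {1..k}"
        then obtain i where i: "1 \<le> i" "i \<le> k" "p = e i" by auto
        have "0 < p" "p < n ^ s + 1" using mono[of 0 i] mono[of i "k + 1"] i e0 ek by auto
        then have "p - 1 \<in> lval n ` tuples {..<n} s" unfolding lval_surj by auto
        then obtain t where t: "t \<in> tuples {..<n} s" "p - 1 = lval n t" by auto
        then have "p = Suc (lval n t)" using \<open>0 < p\<close> by simp
        then show "p \<in> (\<lambda>t. Suc (lval n t)) ` S" using t \<open>p \<in> e ` {1..k}\<close> by (auto simp: S_def n_def)
      qed
    qed
    then have "card S = card (e ` {1..k})" using card_image[OF inj] by simp
    moreover have "inj_on e {1..k}"
    proof (rule inj_onI)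
      fix i j assume "i \<in> {1..k}" "j \<in> {1..k}" "e i = e j"
      then show "i = j" using mono[of i j] mono[of j i] by (cases i j rule: linorder_cases) auto
    qed
    ultimately show ?thesis by (simp add: card_image)
  qed
  moreover have "solves w S" unfolding solves_def
  proof (intro allI impI)
    fix v assume v: "\<forall>z\<in>set zs. v z < lead w"
    have "\<exists>i\<le>k. e i \<le> Suc (lval n (map v (ms ! j))) \<and> Suc (lval n (map v (ms ! j))) < e (Suc i)" if j: "j < length ms" for j
    proof -
      let ?l = "Suc (lval n (map v (ms ! j)))"
      have "ms ! j \<in> set (mems \<psi>)" using j by (simp add: ms_def)
      then have "length (ms ! j) = s \<and> set (ms ! j) \<subseteq> free_vars \<psi>" by (rule mems_fo[OF fo qf])
      then have "map v (ms ! j) \<in> tuples {..<n} s" using v fv by (auto simp: tuples_def n_def)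
      then have l: "?l < e (k + 1)" using lval_tuples ek by simp
      define i where "i = (LEAST i. ?l < e (Suc i))"
      have i: "?l < e (Suc i)" "i \<le> k" unfolding i_def using l by (auto intro: LeastI Least_le)
      have "e i \<le> ?l"
      proof (cases i)
        case (Suc i')
        then have "\<not> ?l < e (Suc i')" using not_less_Least[of i' "\<lambda>i. ?l < e (Suc i)"] unfolding i_def by simp
        then show ?thesis using Suc by simp
      qed (simp add: e0)
      then show ?thesis using i by blast
    qed
    then obtain J where J: "\<And>j. j < length ms \<Longrightarrow> J j \<le> k \<and> e (J j) \<le> Suc (lval n (map v (ms ! j))) \<and> Suc (lval n (map v (ms ! j))) < e (Suc (J j))"
      by metis
    \<comment> \<open>The spare interval may have any index; 0 is taken.\<close>
    have "map J [0..<length ms] @ [0] \<in> tuples {..<k + 2} Q" using J by (fastforce simp: tuples_def Q_def)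
    from ex[OF this] obtain d where d: "d \<in> X" "\<And>j. j < Q \<Longrightarrow> dI d j = (map J [0..<length ms] @ [0]) ! j" by blast
    have "within w d v" unfolding within_def
    proof (intro allI impI)
      fix j assume j: "j < length ms"
      then have "dI d j = J j" "j < Q" using d(2)[of j] by (auto simp: Q_def nth_append)
      then show "dL d j \<le> Suc (lval (lead w) (map v (ms ! j))) \<and> Suc (lval (lead w) (map v (ms ! j))) < dR d j"
        using LR[OF d(1), of j] J[OF j] by (simp add: n_def)
    qed
    moreover have "fits w d" using c(2)[OF d(1) d(1)] by (simp add: good_def)
    ultimately show "sat (dec w) S v \<psi>"
      using interval_truth[of k e w S d v, OF mono e0 ek[unfolded n_def] S_def LR[OF d(1)] v] v unfolding fits_def by blast
  qed
  moreover have "wval w" using c(1)[OF nd(1)[of 0] nd(1)[of 0]] by simp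
  ultimately show ?thesis by (intro conjI exI[of _ S]) (auto simp: S_def)
qed

theorem wd_nodes: "(w, k) \<in> wd_problem \<tau> s (foldr Forall zs \<psi>) \<longleftrightarrow>
   (\<exists>X \<subseteq> nodes w k. (k + 2) ^ Q \<le> card X \<and> (\<forall>a\<in>X. \<forall>b\<in>X. \<not> conf w k a b))"
  unfolding wd_iff
proof
  assume "wval w \<and> (\<exists>S \<subseteq> tuples {..<lead w} s. card S = k \<and> solves w S)"
  then obtain S where "wval w" "S \<subseteq> tuples {..<lead w} s" "card S = k" "solves w S" by (elim conjE exE)
  then show "\<exists>X \<subseteq> nodes w k. (k + 2) ^ Q \<le> card X \<and> (\<forall>a\<in>X. \<forall>b\<in>X. \<not> conf w k a b)" by (rule solution_nodes)
next
  assume "\<exists>X \<subseteq> nodes w k. (k + 2) ^ Q \<le> card X \<and> (\<forall>a\<in>X. \<forall>b\<in>X. \<not> conf w k a b)"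
  then obtain X where "X \<subseteq> nodes w k" "(k + 2) ^ Q \<le> card X" "\<forall>a\<in>X. \<forall>b\<in>X. \<not> conf w k a b" by (elim conjE exE)
  then show "wval w \<and> (\<exists>S \<subseteq> tuples {..<lead w} s. card S = k \<and> solves w S)" by (rule nodes_solution)
qed

end

subsection \<open>Padding patterns\<close>

lemma prenex_pad:
  "subseq q p \<Longrightarrow> prenex q \<phi> \<Longrightarrow> \<exists>\<phi>'. prenex p \<phi>' \<and> free_vars \<phi>' = free_vars \<phi> \<and> (\<forall>\<tau> s. fo_over \<tau> s \<phi>' = fo_over \<tau> s \<phi>) \<and>
     (\<forall>(A :: 'a struct) X v. struct.univ A \<noteq> {} \<longrightarrow> sat A X v \<phi>' = sat A X v \<phi>)"
proof (induction p arbitrary: q \<phi> rule: list.induct)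
  case Nil
  then show ?case by (intro exI[of _ \<phi>]) (cases q; simp)
next
  case (Cons c p)
  consider (m) q' where "q = c # q'" "subseq q' p" | (s) "subseq q p"
    using Cons.prems(1) by (cases q) (auto split: if_splits)
  then show ?case
  proof cases
    case m
    obtain x \<phi>1 where x: "\<phi> = (if c = QA then Forall x \<phi>1 else Exists x \<phi>1)" "prenex q' \<phi>1"
      using Cons.prems(2) m(1) by (cases c; cases \<phi>) auto
    from Cons.IH[OF m(2) x(2)] obtain \<phi>' where "prenex p \<phi>'" "free_vars \<phi>' = free_vars \<phi>1" "\<forall>\<tau> s. fo_over \<tau> s \<phi>' = fo_over \<tau> s \<phi>1"
      "\<forall>(A :: 'a struct) X v. struct.univ A \<noteq> {} \<longrightarrow> sat A X v \<phi>' = sat A X v \<phi>1" by (elim exE conjE)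
    then show ?thesis unfolding x(1)
      by (intro exI[of _ "if c = QA then Forall x \<phi>' else Exists x \<phi>'"]) (cases c; simp)
  next
    case s
    from Cons.IH[OF s Cons.prems(2)] obtain \<phi>' where f: "prenex p \<phi>'" "free_vars \<phi>' = free_vars \<phi>" "\<forall>\<tau> s. fo_over \<tau> s \<phi>' = fo_over \<tau> s \<phi>"
      "\<forall>(A :: 'a struct) X v. struct.univ A \<noteq> {} \<longrightarrow> sat A X v \<phi>' = sat A X v \<phi>" by (elim exE conjE)
    obtain y where y: "y \<notin> free_vars \<phi>'" using ex_new_if_finite[OF infinite_UNIV_nat finite_free_vars] by blast
    have e: "sat A X (v(y := a)) \<phi>' \<longleftrightarrow> sat A X v \<phi>'" for A :: "'a struct" and X v a
      by (rule sat_cong) (use y in auto)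
    show ?thesis
      by (intro exI[of _ "if c = QA then Forall y \<phi>' else Exists y \<phi>'"]) (use f y e in \<open>cases c; auto\<close>)
  qed
qed

subsection \<open>Triangles outside of C\<close>

text \<open>The matrix of both the eae and the aee sentence; \<open>z\<close> only matters for
  \<open>x\<close> in \<open>X\<close>, which allows one fixed choice of \<open>z\<close> for all
  \<open>x\<close>.\<close>

definition mtx :: "('v \<Rightarrow> 'v \<Rightarrow> bool) \<Rightarrow> 'v set \<Rightarrow> 'v \<Rightarrow> 'v \<Rightarrow> 'v \<Rightarrow> bool" where
  "mtx R X x y z \<longleftrightarrow> (if x \<in> X then y \<notin> X \<and> z \<notin> X \<and> R x y \<and> R x z \<and> R y z else R x y \<and> y \<notin> X)"

text \<open>A vertex of \<open>X\<close> needs two adjacent neighbours outside of \<open>X\<close>, and all other vertices need one.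
  This forces \<open>X\<close> to consist of vertices \<open>V a\<close>; the neighbours \<open>V a\<close> and \<open>V b\<close> of \<open>E a b\<close> cannot
  both be in \<open>X\<close>.\<close>

locale gadget =
  fixes U N :: "'v set" and cf :: "'v \<Rightarrow> 'v \<Rightarrow> bool" and V :: "'v \<Rightarrow> 'v" and E :: "'v \<Rightarrow> 'v \<Rightarrow> 'v" and T1 T2 :: 'v
  assumes fin: "finite U" and csym: "cf a b \<Longrightarrow> cf b a"
    and inU: "T1 \<in> U" "T2 \<in> U" "a \<in> N \<Longrightarrow> V a \<in> U" "a \<in> N \<Longrightarrow> b \<in> N \<Longrightarrow> E a b \<in> U"
    and inj: "V a = V b \<Longrightarrow> a = b" "a \<in> N \<Longrightarrow> b \<in> N \<Longrightarrow> c \<in> N \<Longrightarrow> d \<in> N \<Longrightarrow> E a b = E c d \<Longrightarrow> a = c \<and> b = d"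
    and dist [simp]: "T1 \<noteq> T2" "T1 \<noteq> V a" "T2 \<noteq> V a" "T1 \<noteq> E a b" "T2 \<noteq> E a b" "V c \<noteq> E a b"
begin

declare dist[THEN not_sym, simp]

definition CE :: "'v set" where "CE = {E a b | a b. a \<in> N \<and> b \<in> N \<and> cf a b}"

text \<open>\<open>T1\<close> serves everything outside except itself, served by \<open>T2\<close>,
  and the conflict vertices; \<open>T1\<close> and \<open>T2\<close> complete the triangle of each
  \<open>V a\<close>. A conflict vertex sees only its two ends, and elements of \<open>U\<close>
  that code nothing hang on \<open>T1\<close> alone.\<close>

definition R0 :: "'v \<Rightarrow> 'v \<Rightarrow> bool" where
  "R0 u v \<longleftrightarrow> (u = T1 \<and> v \<noteq> T1 \<and> v \<notin> CE) \<or> (u = T2 \<and> v \<in> V ` N) \<or>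
     (\<exists>a\<in>N. \<exists>b\<in>N. cf a b \<and> u = E a b \<and> (v = V a \<or> v = V b))"

definition R :: "'v \<Rightarrow> 'v \<Rightarrow> bool" where "R u v \<longleftrightarrow> R0 u v \<or> R0 v u"

lemma R_sym: "R u v \<Longrightarrow> R v u" by (auto simp: R_def)

lemma not_CE [simp]: "T1 \<notin> CE" "T2 \<notin> CE" "V a \<notin> CE" by (auto simp: CE_def)

lemma R_T1: "R T1 v \<longleftrightarrow> v \<noteq> T1 \<and> v \<notin> CE" by (auto simp: R_def R0_def)
lemma R_T2: "R T2 v \<longleftrightarrow> v = T1 \<or> v \<in> V ` N" by (auto simp: R_def R0_def)
lemma R_V: "a \<in> N \<Longrightarrow> R (V a) v \<longleftrightarrow> v = T1 \<or> v = T2 \<or> (\<exists>b\<in>N. cf a b \<and> (v = E a b \<or> v = E b a))"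
proof -
  assume a: "a \<in> N"
  have "\<not> R0 (V a) v" unfolding R0_def using dist by metis
  moreover have "R0 v (V a) \<longleftrightarrow> v = T1 \<or> v = T2 \<or> (\<exists>b\<in>N. cf a b \<and> (v = E a b \<or> v = E b a))"
  proof
    assume "R0 v (V a)"
    then show "v = T1 \<or> v = T2 \<or> (\<exists>b\<in>N. cf a b \<and> (v = E a b \<or> v = E b a))"
      unfolding R0_def by (metis inj(1) csym)
  next
    assume "v = T1 \<or> v = T2 \<or> (\<exists>b\<in>N. cf a b \<and> (v = E a b \<or> v = E b a))"
    then show "R0 v (V a)" unfolding R0_def using a not_CE(3) dist csym by (metis imageI)
  qed
  ultimately show ?thesis by (simp add: R_def)
qed
lemma R_E: "a \<in> N \<Longrightarrow> b \<in> N \<Longrightarrow> cf a b \<Longrightarrow> R (E a b) v \<longleftrightarrow> v = V a \<or> v = V b"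
proof -
  assume ab: "a \<in> N" "b \<in> N" "cf a b"
  then have "E a b \<in> CE" by (auto simp: CE_def)
  then have "\<not> R0 v (E a b)" unfolding R0_def using dist by (metis imageE)
  moreover have "R0 (E a b) v \<longleftrightarrow> v = V a \<or> v = V b" unfolding R0_def using ab inj(2) dist by metis
  ultimately show ?thesis by (simp add: R_def)
qed
lemma R_other: "u \<in> U \<Longrightarrow> u \<noteq> T1 \<Longrightarrow> u \<noteq> T2 \<Longrightarrow> u \<notin> V ` N \<Longrightarrow> u \<notin> CE \<Longrightarrow> R u v \<longleftrightarrow> v = T1"
  unfolding R_def R0_def CE_def by blast

lemma R_irr: "\<not> R u u"
proof
  assume "R u u"
  then have "R0 u u" by (simp add: R_def)
  then show False unfolding R0_def using dist by (metis imageE)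
qed

definition solution :: "nat \<Rightarrow> 'v set \<Rightarrow> bool" where
  "solution K X \<longleftrightarrow> X \<subseteq> N \<and> K \<le> card X \<and> (\<forall>a\<in>X. \<forall>b\<in>X. \<not> cf a b)"

text \<open>\<open>T2\<close> is the same witness for \<open>z\<close> throughout, so it can be
  quantified before \<open>x\<close>: this is the stronger eae form.\<close>

lemma forward:
  assumes "solution K X"
  shows "\<exists>C \<subseteq> U. K \<le> card C \<and> (\<exists>z\<in>U. \<forall>x\<in>U. \<exists>y\<in>U. mtx R C x y z)"
proof -
  have X: "X \<subseteq> N" "K \<le> card X" "\<And>a b. a \<in> X \<Longrightarrow> b \<in> X \<Longrightarrow> \<not> cf a b" using assms by (auto simp: solution_def)
  have c: "card (V ` X) = card X" by (rule card_image) (rule inj_onI, erule inj(1))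
  have T: "T1 \<notin> V ` X" "T2 \<notin> V ` X" using dist by blast+
  have "\<exists>y\<in>U. mtx R (V ` X) x y T2" if x: "x \<in> U" for x
  proof (cases "x \<in> V ` X")
    case True
    then obtain a where a: "a \<in> X" "x = V a" by blast
    have "R T1 T2" "R x T1" "R x T2" using a X(1) R_V[of a] R_T1 by auto
    then show ?thesis using True T inU by (intro bexI[of _ T1]) (auto simp: mtx_def)
  next
    case False
    have "\<exists>y\<in>U. R x y \<and> y \<notin> V ` X"
    proof (cases "x \<in> CE")
      case True
      then obtain a b where ab: "a \<in> N" "b \<in> N" "cf a b" "x = E a b" by (auto simp: CE_def)
      then have "V a \<notin> V ` X \<or> V b \<notin> V ` X" using X(3) inj(1) by blast
      then show ?thesis using R_E[OF ab(1-3)] ab inU by blast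
    next
      case nc: False
      show ?thesis
      proof (cases "x = T1")
        case True
        then show ?thesis using R_T1[of T2] T inU by (intro bexI[of _ T2]) auto
      next
        case False
        then have "R x T1" using R_T1[of x] nc R_sym by blast
        then show ?thesis using T inU by blast
      qed
    qed
    then show ?thesis using False by (auto simp: mtx_def)
  qed
  then show ?thesis using X inU c by (intro exI[of _ "V ` X"]) auto
qed

text \<open>Only the weaker aee form is assumed, so both patterns are covered. Conflict vertices and
  vertices that code nothing lie in no triangle and cannot be in \<open>C\<close>, while an element
  \<open>V a\<close> needs both \<open>T1\<close> and \<open>T2\<close> outside. The sets containing
  only \<open>T1\<close> or only \<open>T2\<close> are excluded by the size 2.\<close>

lemma backward:
  assumes C: "C \<subseteq> U" "K \<le> card C" "\<forall>x\<in>U. \<exists>y\<in>U. \<exists>z\<in>U. mtx R C x y z" and K: "2 \<le> K"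
  shows "\<exists>X. solution K X"
proof -
  have tri: "\<exists>y z. y \<notin> C \<and> z \<notin> C \<and> R x y \<and> R x z \<and> R y z" if "x \<in> C" for x
    using C(1,3) that unfolding mtx_def by (metis subsetD)
  have nbr: "\<exists>y. y \<notin> C \<and> R x y" if "x \<in> U" "x \<notin> C" for x using C(3) that unfolding mtx_def by metis
  have nVV: "\<not> R (V a) (V b)" if "a \<in> N" for a b using R_V[OF that, of "V b"] dist by metis
  have EC: "E a b \<notin> C" if ab: "a \<in> N" "b \<in> N" "cf a b" for a b
  proof
    assume "E a b \<in> C"
    then obtain y z where "R (E a b) y" "R (E a b) z" "R y z" using tri by blast
    then show False using R_E[OF ab] nVV ab by auto
  qed
  have other: "u \<notin> C" if "u \<in> U" "u \<noteq> T1" "u \<noteq> T2" "u \<notin> V ` N" for u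
  proof
    assume u: "u \<in> C"
    then have "u \<notin> CE" using EC by (auto simp: CE_def)
    then show False using tri[OF u] R_other[OF that] R_irr by metis
  qed
  have sub: "C \<subseteq> insert T1 (insert T2 (V ` N))" using C(1) other by blast
  have V2: "T1 \<notin> C \<and> T2 \<notin> C" if a: "a \<in> N" "V a \<in> C" for a
  proof -
    obtain y z where yz: "y \<notin> C" "z \<notin> C" "R (V a) y" "R (V a) z" "R y z" using tri[OF a(2)] by blast
    have eT: "\<not> R (E p q) T1" "\<not> R (E p q) T2" "\<not> R (E p q) (E p' q')" if "p \<in> N" "q \<in> N" "cf p q" for p q p' q'
      using R_E[OF that] dist by metis+
    have y: "y = T1 \<or> y = T2 \<or> y \<in> CE" and z: "z = T1 \<or> z = T2 \<or> z \<in> CE"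
      using yz(3,4) R_V[OF a(1)] csym a(1) unfolding CE_def by blast+
    have "y \<notin> CE" using z yz(5) eT unfolding CE_def by blast
    moreover have "z \<notin> CE" using y yz(5) R_sym[OF yz(5)] eT unfolding CE_def by blast
    moreover have "y \<noteq> z" using yz(5) R_irr by auto
    ultimately show ?thesis using y z yz by auto
  qed
  have T12: "\<not> (T1 \<in> C \<and> T2 \<in> C)"
  proof
    assume T: "T1 \<in> C \<and> T2 \<in> C"
    then obtain y z where yz: "y \<notin> C" "z \<notin> C" "R T2 y" "R T2 z" "R y z" using tri by blast
    then have "y \<in> V ` N" "z \<in> V ` N" using R_T2 T by auto
    then show False using nVV yz(5) by blast
  qed
  have "C \<subseteq> V ` N"
  proof (rule ccontr)
    assume "\<not> C \<subseteq> V ` N"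
    then have "T1 \<in> C \<or> T2 \<in> C" using sub by auto
    then have "C \<inter> V ` N = {}" using V2 by blast
    then have "C \<subseteq> {T1} \<or> C \<subseteq> {T2}" using sub T12 by blast
    then have "card C \<le> 1" using card_mono[of "{T1}" C] card_mono[of "{T2}" C] by auto
    then show False using C(2) K by simp
  qed
  then obtain X where X: "X \<subseteq> N" "C = V ` X" by (meson subset_imageE)
  have "card C = card X" unfolding X(2) by (rule card_image) (rule inj_onI, erule inj(1))
  moreover have "\<not> cf a b" if ab: "a \<in> X" "b \<in> X" for a b
  proof
    assume c: "cf a b"
    have N: "a \<in> N" "b \<in> N" using ab X(1) by auto
    obtain y where "y \<notin> C" "R (E a b) y" using nbr[OF inU(4)[OF N] EC[OF N c]] by blast
    then show False using R_E[OF N c] ab X(2) by auto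
  qed
  ultimately show ?thesis using C(2) X(1) by (intro exI[of _ X]) (simp add: solution_def)
qed

end

subsection \<open>Graphs on lists\<close>

definition lst :: "'v set \<Rightarrow> ('v \<Rightarrow> 'v \<Rightarrow> bool) \<Rightarrow> 'v struct" where
  "lst U R = \<lparr>univ = U, rel = (\<lambda>_. {[u, v] | u v. u \<in> U \<and> v \<in> U \<and> R u v})\<rparr>"

text \<open>Vertices of the constructed graphs are lists of digits. Encodings speak of numbers, so a
  vertex is renamed to its position in \<open>L\<close>.\<close>

definition lgr :: "'v list \<Rightarrow> ('v \<Rightarrow> 'v \<Rightarrow> bool) \<Rightarrow> nat struct" where
  "lgr L R = lst {..<length L} (\<lambda>a b. R (L ! a) (L ! b))"

lemma sat_lgr:
  assumes L: "distinct L" and C: "C \<subseteq> {..<length L}"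
  shows "fo_over graph_vocabulary 1 \<phi> \<Longrightarrow> (\<And>x. x \<in> free_vars \<phi> \<Longrightarrow> v x < length L) \<Longrightarrow>
    sat (lgr L R) ((\<lambda>u. [u]) ` C) v \<phi> \<longleftrightarrow> sat (lst (set L) R) ((\<lambda>u. [u]) ` ((!) L ` C)) (\<lambda>x. L ! v x) \<phi>"
proof (induction \<phi> arbitrary: v)
  case (Eq x y)
  then show ?case using nth_eq_iff_index_eq[OF L] by simp
next
  case (Rel i xs)
  then obtain a b where "xs = [a, b]" by (auto simp: length_Suc_conv numeral_2_eq_2)
  then show ?case using Rel.prems(2) by (auto simp: lgr_def lst_def)
next
  case (Mem xs)
  then obtain a where a: "xs = [a]" by (auto simp: length_Suc_conv)
  have "v a \<in> C \<longleftrightarrow> L ! v a \<in> (!) L ` C"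
    using Mem.prems(2)[of a] a C nth_eq_iff_index_eq[OF L] by (auto simp: image_iff subset_iff)
  then show ?case using a by (simp only: sat.simps list.map single_mem)
next
  case (Forall x \<phi>)
  have f: "fo_over graph_vocabulary 1 \<phi>" using Forall.prems(1) by simp
  have u: "(\<lambda>y. L ! (v(x := a)) y) = (\<lambda>y. L ! v y)(x := L ! a)" for a by auto
  have "sat (lgr L R) ((\<lambda>u. [u]) ` C) (v(x := a)) \<phi> \<longleftrightarrow> sat (lst (set L) R) ((\<lambda>u. [u]) ` ((!) L ` C)) ((\<lambda>y. L ! v y)(x := L ! a)) \<phi>"
    if "a < length L" for a
    unfolding u[symmetric] by (rule Forall.IH[OF f]) (use that Forall.prems(2) in auto)
  then show ?case by (simp add: lgr_def lst_def set_conv_nth) blast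
next
  case (Exists x \<phi>)
  have f: "fo_over graph_vocabulary 1 \<phi>" using Exists.prems(1) by simp
  have u: "(\<lambda>y. L ! (v(x := a)) y) = (\<lambda>y. L ! v y)(x := L ! a)" for a by auto
  have "sat (lgr L R) ((\<lambda>u. [u]) ` C) (v(x := a)) \<phi> \<longleftrightarrow> sat (lst (set L) R) ((\<lambda>u. [u]) ` ((!) L ` C)) ((\<lambda>y. L ! v y)(x := L ! a)) \<phi>"
    if "a < length L" for a
    unfolding u[symmetric] by (rule Exists.IH[OF f]) (use that Exists.prems(2) in auto)
  then show ?case by (simp add: lgr_def lst_def set_conv_nth) blast
qed simp_all

lemma models_ge_lgr:
  assumes L: "distinct L" "L \<noteq> []" and \<phi>: "fo_over graph_vocabulary 1 \<phi>" "free_vars \<phi> = {}"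
  shows "models_ge (lgr L R) k \<phi> \<longleftrightarrow>
    (\<exists>X \<subseteq> set L. k \<le> card X \<and> models (lst (set L) R) ((\<lambda>u. [u]) ` X) \<phi>)"
proof -
  have u: "struct.univ (lgr L R) = {..<length L}" by (simp add: lgr_def lst_def)
  have m: "models (lgr L R) ((\<lambda>u. [u]) ` C) \<phi> \<longleftrightarrow> models (lst (set L) R) ((\<lambda>u. [u]) ` ((!) L ` C)) \<phi>"
    if "C \<subseteq> {..<length L}" for C
    using sat_lgr[OF L(1) that \<phi>(1), of "\<lambda>_. 0" R] \<phi>(2) models_closed[OF \<phi>(2)] by (metis empty_iff)
  have inj: "inj_on ((!) L) C" if "C \<subseteq> {..<length L}" for C
    using that nth_eq_iff_index_eq[OF L(1)] by (auto simp: inj_on_def subset_iff)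
  show ?thesis
  proof
    assume "models_ge (lgr L R) k \<phi>"
    then obtain C where C: "C \<subseteq> {..<length L}" "k \<le> card C" "models (lgr L R) ((\<lambda>u. [u]) ` C) \<phi>"
      unfolding models_ge_def u by auto
    then show "\<exists>X \<subseteq> set L. k \<le> card X \<and> models (lst (set L) R) ((\<lambda>u. [u]) ` X) \<phi>"
      using m[OF C(1)] card_image[OF inj[OF C(1)]] by (intro exI[of _ "(!) L ` C"]) auto
  next
    assume "\<exists>X \<subseteq> set L. k \<le> card X \<and> models (lst (set L) R) ((\<lambda>u. [u]) ` X) \<phi>"
    then obtain X where X: "X \<subseteq> set L" "k \<le> card X" "models (lst (set L) R) ((\<lambda>u. [u]) ` X) \<phi>" by (elim exE conjE)
    have "set L = (!) L ` {..<length L}" by (auto simp: set_conv_nth)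
    then obtain C where C: "C \<subseteq> {..<length L}" "X = (!) L ` C" using X(1) by (metis subset_imageE)
    then show "models_ge (lgr L R) k \<phi>" unfolding models_ge_def u
      using m[OF C(1)] card_image[OF inj[OF C(1)]] X by (intro exI[of _ C]) simp
  qed
qed

lemma encode_lgr: "encode graph_vocabulary (lgr L R) = replicate (length L) True @ [False] @ concat (map (\<lambda>v. map (\<lambda>u. R u v) L) L)"
proof -
  have "map (\<lambda>xs. xs \<in> struct.rel (lgr L R) 0) (List.n_lists 2 [0..<length L]) =
     concat (map (\<lambda>b. map (\<lambda>a. R (L ! a) (L ! b)) [0..<length L]) [0..<length L])"
    by (auto simp: numeral_2_eq_2 lgr_def lst_def map_concat comp_def intro!: arg_cong[of _ _ concat])
  also have "\<dots> = concat (map (\<lambda>v. map (\<lambda>a. R (L ! a) v) [0..<length L]) (map ((!) L) [0..<length L]))"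
    by (simp add: comp_def)
  also have "\<dots> = concat (map (\<lambda>v. map (\<lambda>u. R u v) (map ((!) L) [0..<length L])) (map ((!) L) [0..<length L]))"
    by (simp add: comp_def)
  finally have "map (\<lambda>xs. xs \<in> struct.rel (lgr L R) 0) (List.n_lists 2 [0..<length L]) = concat (map (\<lambda>v. map (\<lambda>u. R u v) L) L)"
    unfolding map_nth .
  moreover have "struct.univ (lgr L R) = {..<length L}" by (simp add: lgr_def lst_def)
  ultimately show ?thesis by (simp add: encode_graph)
qed

lemma basic_lgr: "(\<And>u v. R u v \<Longrightarrow> R v u) \<Longrightarrow> (\<And>u. \<not> R u u) \<Longrightarrow> basic_graph (lgr L R)"
  by (auto simp: basic_graph_def finite_struct_def lgr_def lst_def tuples_def)

lemma fd_lgr: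
  assumes "distinct L" "L \<noteq> []" "fo_over graph_vocabulary 1 \<phi>" "free_vars \<phi> = {}"
    "\<And>u v. R u v \<Longrightarrow> R v u" "\<And>u. \<not> R u u"
  shows "(encode graph_vocabulary (lgr L R), k) \<in> fd_problem \<phi> \<longleftrightarrow>
    (\<exists>X \<subseteq> set L. k \<le> card X \<and> models (lst (set L) R) ((\<lambda>u. [u]) ` X) \<phi>)"
  unfolding models_ge_lgr[OF assms(1-4), symmetric]
proof
  have u: "struct.univ (lgr L R) = {..<length L}" by (simp add: lgr_def lst_def)
  assume "models_ge (lgr L R) k \<phi>"
  then show "(encode graph_vocabulary (lgr L R), k) \<in> fd_problem \<phi>"
    unfolding fd_problem_def using basic_lgr[of R L, OF assms(5,6)] u by blast
next
  have u: "struct.univ (lgr L R) = {..<length L}" by (simp add: lgr_def lst_def)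
  assume "(encode graph_vocabulary (lgr L R), k) \<in> fd_problem \<phi>"
  then obtain G n where G: "encode graph_vocabulary (lgr L R) = encode graph_vocabulary G" "basic_graph G"
    "struct.univ G = {..<n}" "models_ge G k \<phi>" unfolding fd_problem_def by auto
  have n: "n = length L" using arg_cong[OF G(1), of length] length_encode_graph[OF u] length_encode_graph[OF G(3)] size_inj by metis
  have "struct.rel (lgr L R) 0 = struct.rel G 0"
    using gr_encode[OF basic_lgr[of R L, OF assms(5,6)] u] gr_encode[OF G(2) G(3)[unfolded n]] G(1) by simp
  then have "models (lgr L R) X \<phi> \<longleftrightarrow> models G X \<phi>" for X
    unfolding models_def using sat_struct_cong[of "lgr L R" G \<phi> X] assms(3) u G(3) n by auto
  then show "models_ge (lgr L R) k \<phi>" using G(3,4) u n unfolding models_ge_def by auto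
qed

subsection \<open>Programs that write graphs\<close>

definition put :: "(nat \<Rightarrow> nat) \<Rightarrow> nat \<Rightarrow> nat list \<Rightarrow> nat \<Rightarrow> nat" where
  "put e p us = (\<lambda>x. if p \<le> x \<and> x < p + length us then us ! (x - p) else e x)"

lemma put_Cons: "(put e (Suc p) us)(p := u) = put e p (u # us)"
proof (rule ext)
  fix x
  show "((put e (Suc p) us)(p := u)) x = put e p (u # us) x"
  proof (cases "p < x")
    case True
    then obtain y where "x = Suc (p + y)" using less_iff_Suc_add by blast
    then show ?thesis by (simp add: put_def Suc_diff_le)
  qed (auto simp: put_def)
qed

text \<open>The loop over variable \<open>p\<close> becomes the innermost one, matching
  \<open>List.n_lists\<close>, where the first coordinate runs fastest.\<close>

fun loops :: "nat \<Rightarrow> nat \<Rightarrow> tm \<Rightarrow> cmd \<Rightarrow> cmd" where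
  "loops p 0 t c = c"
| "loops p (Suc m) t c = loops (Suc p) m t (CFor p t c)"

lemma concat_map_concat: "concat (map f (concat xss)) = concat (map (\<lambda>xs. concat (map f xs)) xss)"
  by (induction xss) auto

lemma cval_loops:
  assumes t: "\<And>e e'. (\<And>x. x < 3 \<Longrightarrow> e x = e' x) \<Longrightarrow> tval e t = tval e' t" and "3 \<le> p"
  shows "cval w e (loops p m t c) = concat (map (\<lambda>us. cval w (put e p us) c) (List.n_lists m [0..<tval e t]))"
  using assms(2)
proof (induction m arbitrary: p c)
  case 0
  have "put e p [] = e" by (rule ext) (simp add: put_def)
  then show ?case by simp
next
  case (Suc m)
  have "tval (put e (Suc p) us) t = tval e t" for us by (rule t) (use Suc.prems in \<open>auto simp: put_def\<close>)
  then show ?case using Suc by (simp add: put_Cons comp_def concat_map_concat)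
qed

text \<open>Turns a graph on all lists of \<open>D\<close> digits, with edges decided by an
  expression \<open>b\<close>, into a polynomial reduction. The bound \<open>tB\<close> may depend
  on the variables 0 to 2 only, as the loop variables come after these.\<close>

lemma graph_polyred:
  assumes tB: "\<And>e e'. (\<And>x. x < 3 \<Longrightarrow> e x = e' x) \<Longrightarrow> tval e tB = tval e' tB" "\<And>e. 0 < tval e tB"
    and \<phi>: "fo_over graph_vocabulary 1 \<phi>" "free_vars \<phi> = {}"
    and K: "\<And>w k. tval (env0 w k) tK \<le> (k + 2) ^ c"
    and R: "\<And>w k u v. R w k u v \<Longrightarrow> R w k v u" "\<And>w k u. \<not> R w k u u"
    and b: "\<And>w k u v. u \<in> tuples {..<tval (env0 w k) tB} D \<Longrightarrow> v \<in> tuples {..<tval (env0 w k) tB} D \<Longrightarrow>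
       bval w (put (put (env0 w k) (3 + D) v) 3 u) b \<longleftrightarrow> R w k u v"
    and Q: "\<And>w k. (w, k) \<in> Q \<longleftrightarrow> (\<exists>X \<subseteq> tuples {..<tval (env0 w k) tB} D. tval (env0 w k) tK \<le> card X \<and>
       models (lst (tuples {..<tval (env0 w k) tB} D) (R w k)) ((\<lambda>u. [u]) ` X) \<phi>)"
  shows "polyred Q (fd_problem \<phi>)"
proof -
  \<comment> \<open>The encoding symbol by symbol: one \<open>True\<close> per vertex, the
    separating \<open>False\<close>, and the adjacency matrix. The outer block of loops runs over
    the second vertex.\<close>
  define cm where "cm = CSeq (CFor 3 (tpow tB D) (Emit (BNot (BLess (TC 0) (TC 0))))) (CSeq (Emit (BLess (TC 0) (TC 0)))
    (loops (3 + D) D tB (loops 3 D tB (Emit b))))"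
  from loop_program[of cm tK] obtain P d where P: "\<And>w k. \<exists>s. runs P (start w k) s ((length w + k + 2) ^ d) \<and>
     s 0 = cval w (env0 w k) cm \<and> s 1 = replicate (tval (env0 w k) tK) True" by blast
  have sem: "cval w (env0 w k) cm = encode graph_vocabulary (lgr (List.n_lists D [0..<tval (env0 w k) tB]) (R w k))" for w k
  proof -
    let ?B = "tval (env0 w k) tB"
    let ?L = "List.n_lists D [0..<?B]"
    have B: "tval (put (env0 w k) (3 + D) v) tB = ?B" for v by (rule tB(1)) (simp add: put_def)
    have "cval w (env0 w k) (loops (3 + D) D tB (loops 3 D tB (Emit b))) =
       concat (map (\<lambda>v. concat (map (\<lambda>u. [bval w (put (put (env0 w k) (3 + D) v) 3 u) b]) ?L)) ?L)"
      using cval_loops[OF tB(1), of 3 w _ D "Emit b"] cval_loops[OF tB(1), of "3 + D" w "env0 w k" D] by (simp add: B)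
    also have "\<dots> = concat (map (\<lambda>v. concat (map (\<lambda>u. [R w k u v]) ?L)) ?L)"
      by (intro arg_cong[of _ _ concat] map_cong refl) (simp only: set_n_lists_tuples b)
    also have "\<dots> = concat (map (\<lambda>v. map (\<lambda>u. R w k u v) ?L) ?L)" by (simp add: concat_map_singleton)
    finally show ?thesis unfolding encode_lgr cm_def by (simp add: length_n_lists map_replicate_const concat_map_singleton)
  qed
  show ?thesis unfolding polyred_def
  proof (intro exI[of _ P] exI[of _ "c + d"] allI)
    fix w k
    obtain s where s: "runs P (start w k) s ((length w + k + 2) ^ d)" "s 0 = cval w (env0 w k) cm"
      "s 1 = replicate (tval (env0 w k) tK) True" using P by blast
    let ?B = "tval (env0 w k) tB"
    let ?L = "List.n_lists D [0..<?B]"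
    have "replicate D 0 \<in> tuples {..<?B} D" using tB(2) by (auto simp: tuples_def)
    then have "?L \<noteq> []" unfolding set_n_lists_tuples[symmetric] by auto
    moreover have "distinct ?L" by (rule distinct_n_lists) simp
    ultimately have "(w, k) \<in> Q \<longleftrightarrow> (s 0, tval (env0 w k) tK) \<in> fd_problem \<phi>"
      unfolding s(2) sem Q using fd_lgr[of ?L \<phi> "R w k" "tval (env0 w k) tK", OF _ _ \<phi> R] by (simp add: set_n_lists_tuples)
    moreover have "runs P (start w k) s ((length w + k + 2) ^ (c + d))"
      by (rule runs_mono[OF s(1)]) (simp add: power_increasing)
    moreover have "(k + 2) ^ c \<le> (k + 2) ^ (c + d)" by (rule power_increasing) auto
    then have "tval (env0 w k) tK \<le> (k + 2) ^ (c + d)" using K[of w k] by (rule le_trans[rotated])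
    ultimately show "\<exists>s k'. runs P (start w k) s ((length w + k + 2) ^ (c + d)) \<and> s 1 = replicate k' True \<and>
       k' \<le> (k + 2) ^ (c + d) \<and> ((w, k) \<in> Q \<longleftrightarrow> (s 0, k') \<in> fd_problem \<phi>)" using s(3) by blast
  qed
qed

subsection \<open>The reductions as programs\<close>

definition BOr :: "bx \<Rightarrow> bx \<Rightarrow> bx" where "BOr a b = BNot (BAnd (BNot a) (BNot b))"
definition BImp :: "bx \<Rightarrow> bx \<Rightarrow> bx" where "BImp a b = BNot (BAnd a (BNot b))"
definition BEqu :: "tm \<Rightarrow> tm \<Rightarrow> bx" where "BEqu a b = BAnd (BNot (BLess a b)) (BNot (BLess b a))"
definition BFalse :: bx where "BFalse = BLess (TC 0) (TC 0)"
definition bigA :: "bx list \<Rightarrow> bx" where "bigA bs = foldr BAnd bs (BNot BFalse)"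
definition bigO :: "bx list \<Rightarrow> bx" where "bigO bs = foldr BOr bs BFalse"

lemma bval_derived [simp]:
  "bval w e (BOr a b) \<longleftrightarrow> bval w e a \<or> bval w e b" "bval w e (BImp a b) \<longleftrightarrow> (bval w e a \<longrightarrow> bval w e b)"
  "bval w e (BEqu t u) \<longleftrightarrow> tval e t = tval e u" "\<not> bval w e BFalse"
  by (auto simp: BOr_def BImp_def BEqu_def BFalse_def)

lemma bval_bigA [simp]: "bval w e (bigA bs) \<longleftrightarrow> (\<forall>b\<in>set bs. bval w e b)"
  unfolding bigA_def by (induction bs) auto

lemma bval_bigO [simp]: "bval w e (bigO bs) \<longleftrightarrow> (\<exists>b\<in>set bs. bval w e b)"
  unfolding bigO_def by (induction bs) auto

fun lvt :: "nat \<Rightarrow> nat list \<Rightarrow> tm" where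
  "lvt a [] = TC 0"
| "lvt a (x # xs) = TAdd (TV (a + x)) (TMul (TV 2) (lvt a xs))"

lemma tval_lvt [simp]: "tval e (lvt a xs) = lval (e 2) (map (\<lambda>x. e (a + x)) xs)"
  by (induction xs) auto

definition holds_at :: "(nat \<Rightarrow> nat) \<Rightarrow> nat \<Rightarrow> nat list \<Rightarrow> bool" where
  "holds_at e p d \<longleftrightarrow> (\<forall>i<length d. e (p + i) = d ! i)"

lemma holds_at_append: "holds_at e p (xs @ ys) \<longleftrightarrow> holds_at e p xs \<and> holds_at e (p + length xs) ys"
proof -
  have "(\<forall>i<length xs + length ys. e (p + i) = (xs @ ys) ! i) \<longleftrightarrow>
    (\<forall>i<length xs. e (p + i) = (xs @ ys) ! i) \<and> (\<forall>i<length ys. e (p + (length xs + i)) = (xs @ ys) ! (length xs + i))"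
    (is "?l \<longleftrightarrow> ?r")
  proof
    assume r: ?r
    show ?l
    proof (intro allI impI)
      fix i assume i: "i < length xs + length ys"
      show "e (p + i) = (xs @ ys) ! i"
      proof (cases "i < length xs")
        case False
        then obtain j where "i = length xs + j" using le_Suc_ex[of "length xs" i] by auto
        then show ?thesis using r i by auto
      qed (use r in auto)
    qed
  qed auto
  then show ?thesis unfolding holds_at_def by (simp add: nth_append add.assoc)
qed

text \<open>Variables below \<open>a\<close> hold the input data and the digits of the two vertices;
  those from \<open>a\<close> on hold the assignment of the formula.\<close>

definition ext :: "nat \<Rightarrow> (nat \<Rightarrow> nat) \<Rightarrow> (nat \<Rightarrow> nat) \<Rightarrow> nat \<Rightarrow> nat" where
  "ext a e v = (\<lambda>y. if y < a then e y else v (y - a))"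

lemma ext_simps [simp]: "y < a \<Longrightarrow> ext a e v y = e y" "ext a e v (a + x) = v x" by (auto simp: ext_def)

lemma holds_at_ext: "holds_at e p d \<Longrightarrow> p + length d \<le> a \<Longrightarrow> holds_at (ext a e v) p d"
  by (auto simp: holds_at_def)

definition exsb :: "nat \<Rightarrow> nat list \<Rightarrow> bx \<Rightarrow> bx" where "exsb a zs b = foldr (\<lambda>z. BEx (a + z) (TV 2)) zs b"

lemma bval_exsb: "2 < a \<Longrightarrow> bval w e (exsb a zs b) \<longleftrightarrow>
   (\<exists>v. (\<forall>x. x \<notin> set zs \<longrightarrow> v x = e (a + x)) \<and> (\<forall>z\<in>set zs. v z < e 2) \<and> bval w (ext a e v) b)"
proof (induction zs arbitrary: e)
  case Nil
  have "ext a e (\<lambda>x. e (a + x)) = e" by (auto simp: ext_def fun_eq_iff)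
  moreover have "(\<forall>x. v x = e (a + x)) \<longleftrightarrow> v = (\<lambda>x. e (a + x))" for v by auto
  ultimately show ?case by (simp add: exsb_def)
next
  case (Cons z zs)
  have ex: "ext a (e(a + z := c)) v = ext a e v" for c v by (auto simp: ext_def fun_eq_iff)
  have e2: "(e(a + z := c)) 2 = e 2" for c using Cons.prems by simp
  have "bval w e (exsb a (z # zs) b) \<longleftrightarrow> (\<exists>c<e 2. \<exists>v. (\<forall>x. x \<notin> set zs \<longrightarrow> v x = (e(a + z := c)) (a + x)) \<and>
     (\<forall>z\<in>set zs. v z < e 2) \<and> bval w (ext a e v) b)"
    using Cons.IH[OF Cons.prems] unfolding exsb_def by (simp only: foldr.simps comp_def bval.simps tval.simps ex e2)
  also have "\<dots> \<longleftrightarrow> (\<exists>v. (\<forall>x. x \<notin> set (z # zs) \<longrightarrow> v x = e (a + x)) \<and> (\<forall>z\<in>set (z # zs). v z < e 2) \<and> bval w (ext a e v) b)"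
  proof
    assume "\<exists>c<e 2. \<exists>v. (\<forall>x. x \<notin> set zs \<longrightarrow> v x = (e(a + z := c)) (a + x)) \<and> (\<forall>z\<in>set zs. v z < e 2) \<and> bval w (ext a e v) b"
    then obtain c v where h: "c < e 2" "\<forall>x. x \<notin> set zs \<longrightarrow> v x = (e(a + z := c)) (a + x)" "\<forall>z\<in>set zs. v z < e 2" "bval w (ext a e v) b"
      by (elim exE conjE)
    have "v z < e 2" using h(1,2,3) by (cases "z \<in> set zs") auto
    then show "\<exists>v. (\<forall>x. x \<notin> set (z # zs) \<longrightarrow> v x = e (a + x)) \<and> (\<forall>z\<in>set (z # zs). v z < e 2) \<and> bval w (ext a e v) b"
      using h by (intro exI[of _ v]) auto
  next
    assume "\<exists>v. (\<forall>x. x \<notin> set (z # zs) \<longrightarrow> v x = e (a + x)) \<and> (\<forall>z\<in>set (z # zs). v z < e 2) \<and> bval w (ext a e v) b"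
    then obtain v where h: "\<forall>x. x \<notin> set (z # zs) \<longrightarrow> v x = e (a + x)" "\<forall>z\<in>set (z # zs). v z < e 2" "bval w (ext a e v) b"
      by (elim exE conjE)
    then show "\<exists>c<e 2. \<exists>v. (\<forall>x. x \<notin> set zs \<longrightarrow> v x = (e(a + z := c)) (a + x)) \<and> (\<forall>z\<in>set zs. v z < e 2) \<and> bval w (ext a e v) b"
      by (intro exI[of _ "v z"] conjI exI[of _ v]) auto
  qed
  finally show ?case .
qed

definition tI :: "nat \<Rightarrow> nat \<Rightarrow> tm" where "tI p j = TV (p + 3 * j)"
definition tL :: "nat \<Rightarrow> nat \<Rightarrow> tm" where "tL p j = TV (p + (3 * j + 1))"
definition tR :: "nat \<Rightarrow> nat \<Rightarrow> tm" where "tR p j = TV (p + (3 * j + 2))"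

lemma tval_digits:
  assumes "holds_at e p d" "length d = 3 * q" "j < q"
  shows "tval e (tI p j) = dI d j" "tval e (tL p j) = dL d j" "tval e (tR p j) = dR d j"
proof -
  have "3 * j < length d" "3 * j + 1 < length d" "3 * j + 2 < length d" using assms(2,3) by linarith+
  then show "tval e (tI p j) = dI d j" "tval e (tL p j) = dL d j" "tval e (tR p j) = dR d j"
    using assms(1) unfolding holds_at_def tI_def tL_def tR_def dI_def dL_def dR_def tval.simps by blast+
qed

definition eqf :: "nat \<Rightarrow> nat \<Rightarrow> nat \<Rightarrow> bx" where
  "eqf l p p' = bigA (map (\<lambda>i. BEqu (TV (p + i)) (TV (p' + i))) [0..<l])"
definition zerof :: "nat \<Rightarrow> nat \<Rightarrow> bx" where
  "zerof l p = bigA (map (\<lambda>i. BEqu (TV (p + i)) (TC 0)) [0..<l])"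

lemma bval_eqf: "holds_at e p d \<Longrightarrow> holds_at e p' d' \<Longrightarrow> length d = l \<Longrightarrow> length d' = l \<Longrightarrow> bval w e (eqf l p p') \<longleftrightarrow> d = d'"
  unfolding eqf_def holds_at_def by (auto intro: nth_equalityI)

lemma bval_zerof: "holds_at e p d \<Longrightarrow> length d = l \<Longrightarrow> bval w e (zerof l p) \<longleftrightarrow> d = replicate l 0"
proof -
  assume "holds_at e p d" "length d = l"
  then have "bval w e (zerof l p) \<longleftrightarrow> (\<forall>i<l. d ! i = 0)" by (auto simp: zerof_def holds_at_def)
  also have "\<dots> \<longleftrightarrow> d = replicate l 0" using \<open>length d = l\<close> by (simp add: list_eq_iff_nth_eq)
  finally show ?thesis .
qed

definition mtxf :: fo where
  "mtxf = Conj (Disj (Neg (Mem [0])) (Conj (Neg (Mem [1])) (Conj (Neg (Mem [2])) (Conj (Rel 0 [0, 1]) (Conj (Rel 0 [0, 2]) (Rel 0 [1, 2]))))))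
     (Disj (Mem [0]) (Conj (Rel 0 [0, 1]) (Neg (Mem [1]))))"

lemma sat_mtxf: "v 0 \<in> U \<Longrightarrow> v 1 \<in> U \<Longrightarrow> v 2 \<in> U \<Longrightarrow> sat (lst U R) ((\<lambda>u. [u]) ` X) v mtxf \<longleftrightarrow> mtx R X (v 0) (v 1) (v 2)"
  by (auto simp: mtxf_def mtx_def lst_def)

text \<open>Two blocks of digits and a tag: 0 marks the vertices \<open>V a\<close>, 1 the conflict
  vertices, and 2 and 3 the two special vertices \<open>gT 2\<close> and
  \<open>gT 3\<close>.\<close>

definition gV :: "nat list \<Rightarrow> nat list" where "gV d = d @ d @ [0]"
definition gE :: "nat list \<Rightarrow> nat list \<Rightarrow> nat list" where "gE d d' = d @ d' @ [1]"

section \<open>Expressions that decide conflicts\<close>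

context wdp begin

definition offt :: "nat \<Rightarrow> tm" where
  "offt i = foldr (\<lambda>j t. TAdd (tpow (TV 2) (\<tau> ! j)) t) [0..<i] (TAdd (TV 2) (TC 1))"

lemma tval_offt [simp]: "tval e (offt i) = off (e 2) i"
proof -
  have "tval e (foldr (\<lambda>j t. TAdd (tpow (TV 2) (\<tau> ! j)) t) js t) = (\<Sum>j\<leftarrow>js. e 2 ^ (\<tau> ! j)) + tval e t" for js t
    by (induction js) auto
  then show ?thesis by (simp add: offt_def off_def interv_sum_list_conv_sum_set_nat lessThan_atLeast0)
qed

definition wvalf :: bx where "wvalf = BEqu (TV 1) (offt (length \<tau>))"

definition rngf :: "nat \<Rightarrow> nat \<Rightarrow> bx" where
  "rngf p j = bigA [BLess (tI p j) (TAdd (TV 0) (TC 2)), BLess (tL p j) (tR p j),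
     BImp (BEqu (tI p j) (TC 0)) (BEqu (tL p j) (TC 0)),
     BImp (BEqu (tI p j) (TAdd (TV 0) (TC 1))) (BEqu (tL p j) (TAdd (tpow (TV 2) s) (TC 1)))]"

definition withinf :: "nat \<Rightarrow> nat \<Rightarrow> bx" where
  "withinf a p = bigA (map (\<lambda>j. BAnd (BNot (BLess (TAdd (lvt a (ms ! j)) (TC 1)) (tL p j)))
     (BLess (TAdd (lvt a (ms ! j)) (TC 1)) (tR p j))) [0..<length ms])"

fun qff :: "nat \<Rightarrow> nat \<Rightarrow> fo \<Rightarrow> bx" where
  "qff a p (Eq x y) = BEqu (TV (a + x)) (TV (a + y))"
| "qff a p (Rel i xs) = BBit (TAdd (offt i) (lvt a xs))"
| "qff a p (Mem xs) = bigO (map (\<lambda>j. BEqu (TAdd (lvt a xs) (TC 1)) (tL p j)) [0..<Q])"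
| "qff a p (Neg \<phi>) = BNot (qff a p \<phi>)"
| "qff a p (Conj \<phi> \<phi>') = BAnd (qff a p \<phi>) (qff a p \<phi>')"
| "qff a p (Disj \<phi> \<phi>') = BOr (qff a p \<phi>) (qff a p \<phi>')"
| "qff a p _ = BFalse"

definition fitsf :: "nat \<Rightarrow> nat \<Rightarrow> bx" where
  "fitsf a p = BNot (exsb a zs (BAnd (withinf a p) (BNot (qff a p \<psi>))))"

definition goodf :: "nat \<Rightarrow> nat \<Rightarrow> bx" where
  "goodf a p = BAnd (bigA (map (rngf p) [0..<Q])) (fitsf a p)"

definition consf :: "nat \<Rightarrow> nat \<Rightarrow> bx" where
  "consf p p' = bigA (map (\<lambda>i. bigA (map (\<lambda>j. BAnd
     (BImp (BEqu (tI p i) (tI p' j)) (BAnd (BEqu (tL p i) (tL p' j)) (BEqu (tR p i) (tR p' j))))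
     (BImp (BEqu (TAdd (tI p i) (TC 1)) (tI p' j)) (BEqu (tR p i) (tL p' j)))) [0..<Q])) [0..<Q])"

definition conff :: "nat \<Rightarrow> nat \<Rightarrow> nat \<Rightarrow> bx" where
  "conff a p p' = BNot (bigA [wvalf, goodf a p, goodf a p', consf p p', consf p' p])"

lemma off_less: "i < length \<tau> \<Longrightarrow> off n i + n ^ (\<tau> ! i) \<le> off n (length \<tau>)"
proof -
  assume i: "i < length \<tau>"
  have "(\<Sum>j<Suc i. n ^ (\<tau> ! j)) \<le> (\<Sum>j<length \<tau>. n ^ (\<tau> ! j))" by (rule sum_mono2) (use i in auto)
  then show ?thesis by (simp add: off_def)
qed

lemma bval_qff:
  assumes w: "wval w" "e 2 = lead w" and d: "holds_at e p d" "length d = 3 * Q"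
  shows "quantifier_free \<phi> \<Longrightarrow> fo_over \<tau> s \<phi> \<Longrightarrow> \<forall>x\<in>free_vars \<phi>. e (a + x) < lead w \<Longrightarrow>
    bval w e (qff a p \<phi>) \<longleftrightarrow> sat (dec w) {t. \<exists>j<Q. Suc (lval (lead w) t) = dL d j} (\<lambda>x. e (a + x)) \<phi>"
proof (induction \<phi>)
  case (Rel i xs)
  let ?xs = "map (\<lambda>x. e (a + x)) xs"
  have i: "i < length \<tau>" using Rel.prems by simp
  have t: "?xs \<in> tuples {..<lead w} (\<tau> ! i)" using Rel.prems by (auto simp: tuples_def)
  have "off (lead w) i + lval (lead w) ?xs < length w"
    using lval_tuples[OF t] off_less[OF i, of "lead w"] w(1) by (simp add: wval_def)
  then show ?case using t w(2) by (simp add: dec_def)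
next
  case (Mem xs)
  have "(\<exists>j\<in>{0..<Q}. lval (lead w) (map (\<lambda>x. e (a + x)) xs) + 1 = tval e (tL p j)) \<longleftrightarrow>
     (\<exists>j<Q. Suc (lval (lead w) (map (\<lambda>x. e (a + x)) xs)) = dL d j)"
    using tval_digits(2)[OF d] by auto
  then show ?case using w(2) by simp
qed auto

lemma within_cong: "(\<And>z. z \<in> set zs \<Longrightarrow> v z = v' z) \<Longrightarrow> within w d v \<longleftrightarrow> within w d v'"
proof -
  assume h: "\<And>z. z \<in> set zs \<Longrightarrow> v z = v' z"
  have "map v (ms ! j) = map v' (ms ! j)" if "j < length ms" for j
  proof -
    have "ms ! j \<in> set (mems \<psi>)" using that by (simp add: ms_def)
    then have "set (ms ! j) \<subseteq> free_vars \<psi>" using mems_fo[OF fo qf] by blast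
    then show ?thesis using h fv by auto
  qed
  then show ?thesis unfolding within_def by (simp del: map_eq_conv)
qed

lemma bval_withinf:
  assumes "e 2 = lead w" "holds_at e p d" "length d = 3 * Q"
  shows "bval w e (withinf a p) \<longleftrightarrow> within w d (\<lambda>x. e (a + x))"
proof -
  have "tval e (tL p j) = dL d j" "tval e (tR p j) = dR d j" if "j < length ms" for j
    using tval_digits(2,3)[OF assms(2,3), of j] that by (simp_all add: Q_def)
  then show ?thesis unfolding withinf_def within_def using assms(1) by (auto simp: not_less)
qed

lemma bval_fitsf:
  assumes w: "wval w" "e 2 = lead w" and d: "holds_at e p d" "length d = 3 * Q" and a: "2 < a" "p + 3 * Q \<le> a"
  shows "bval w e (fitsf a p) \<longleftrightarrow> fits w d"
proof -
  let ?Y = "{t. \<exists>j<Q. Suc (lval (lead w) t) = dL d j}"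
  have e: "bval w (ext a e v) (BAnd (withinf a p) (BNot (qff a p \<psi>))) \<longleftrightarrow> within w d v \<and> \<not> sat (dec w) ?Y v \<psi>"
    if "\<forall>z\<in>set zs. v z < lead w" for v
  proof -
    have h: "holds_at (ext a e v) p d" using d a by (intro holds_at_ext) auto
    have e2: "ext a e v 2 = lead w" using w(2) a(1) by simp
    have "bval w (ext a e v) (qff a p \<psi>) \<longleftrightarrow> sat (dec w) ?Y (\<lambda>x. ext a e v (a + x)) \<psi>"
      by (rule bval_qff[OF w(1) e2 h d(2) qf fo]) (use fv that in auto)
    then show ?thesis using bval_withinf[OF e2 h d(2), of a] by simp
  qed
  have "bval w e (fitsf a p) \<longleftrightarrow> \<not> (\<exists>v. (\<forall>x. x \<notin> set zs \<longrightarrow> v x = e (a + x)) \<and> (\<forall>z\<in>set zs. v z < lead w) \<and>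
      bval w (ext a e v) (BAnd (withinf a p) (BNot (qff a p \<psi>))))"
    unfolding fitsf_def bval.simps(3) bval_exsb[OF a(1)] w(2) ..
  also have "\<dots> \<longleftrightarrow> fits w d"
  proof
    assume h: "\<not> (\<exists>v. (\<forall>x. x \<notin> set zs \<longrightarrow> v x = e (a + x)) \<and> (\<forall>z\<in>set zs. v z < lead w) \<and>
      bval w (ext a e v) (BAnd (withinf a p) (BNot (qff a p \<psi>))))"
    show "fits w d" unfolding fits_def
    proof (intro allI impI)
      fix v assume v: "\<forall>z\<in>set zs. v z < lead w" "within w d v"
      define v' where "v' = (\<lambda>x. if x \<in> set zs then v x else e (a + x))"
      have v': "\<forall>z\<in>set zs. v' z < lead w" "\<forall>x. x \<notin> set zs \<longrightarrow> v' x = e (a + x)" using v by (auto simp: v'_def)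
      then have "\<not> (within w d v' \<and> \<not> sat (dec w) ?Y v' \<psi>)" using h e[OF v'(1)] by blast
      moreover have "within w d v'" using v(2) within_cong[of v' v] by (simp add: v'_def)
      moreover have "sat (dec w) ?Y v' \<psi> \<longleftrightarrow> sat (dec w) ?Y v \<psi>" by (rule sat_cong) (use fv in \<open>auto simp: v'_def\<close>)
      ultimately show "sat (dec w) ?Y v \<psi>" by blast
    qed
  next
    assume f: "fits w d"
    show "\<not> (\<exists>v. (\<forall>x. x \<notin> set zs \<longrightarrow> v x = e (a + x)) \<and> (\<forall>z\<in>set zs. v z < lead w) \<and>
      bval w (ext a e v) (BAnd (withinf a p) (BNot (qff a p \<psi>))))"
    proof
      assume "\<exists>v. (\<forall>x. x \<notin> set zs \<longrightarrow> v x = e (a + x)) \<and> (\<forall>z\<in>set zs. v z < lead w) \<and>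
        bval w (ext a e v) (BAnd (withinf a p) (BNot (qff a p \<psi>)))"
      then obtain v where v: "\<forall>z\<in>set zs. v z < lead w" "bval w (ext a e v) (BAnd (withinf a p) (BNot (qff a p \<psi>)))"
        by (elim exE conjE)
      then show False using e[OF v(1)] f unfolding fits_def by blast
    qed
  qed
  finally show ?thesis .
qed

lemma bval_conff:
  assumes e: "e 0 = k" "e 1 = length w" "e 2 = lead w" and d: "holds_at e p d" "length d = 3 * Q" and d': "holds_at e p' d'" "length d' = 3 * Q"
    and a: "2 < a" "p + 3 * Q \<le> a" "p' + 3 * Q \<le> a"
  shows "bval w e (conff a p p') \<longleftrightarrow> conf w k d d'"
\<comment> \<open>Only encodings guarantee that the bits looked up by \<open>qff\<close> exist. For
  other words both sides hold because of the conjunct \<open>wvalf\<close>.\<close>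
proof (cases "wval w")
  case True
  have r: "bval w e (rngf p j) \<longleftrightarrow> rng w k d j" if "holds_at e p d" "length d = 3 * Q" "j < Q" for p d j
    using e tval_digits[OF that] by (simp add: rngf_def rng_def)
  have g: "bval w e (goodf a p) \<longleftrightarrow> good w k d" if h: "holds_at e p d" "length d = 3 * Q" "p + 3 * Q \<le> a" for p d
    using bval_fitsf[OF True e(3) h(1,2) a(1) h(3)] r[OF h(1,2)] by (auto simp: goodf_def good_def)
  have c: "bval w e (consf p p') \<longleftrightarrow> cons d d'"
    if "holds_at e p d" "length d = 3 * Q" "holds_at e p' d'" "length d' = 3 * Q" for p d p' d'
    using tval_digits[OF that(1,2)] tval_digits[OF that(3,4)] by (simp add: consf_def cons_def, simp add: Ball_def)
  show ?thesis unfolding conff_def conf_def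
    using g[OF d a(2)] g[OF d' a(3)] c[OF d d'] c[OF d' d] e True by (simp add: wvalf_def wval_def)
next
  case False
  then show ?thesis using e by (simp add: conff_def conf_def wvalf_def wval_def)
qed

definition tB :: tm where "tB = TAdd (TAdd (tpow (TV 2) s) (TV 0)) (TC 4)"
definition tK :: tm where "tK = tpow (TAdd (TV 0) (TC 2)) Q"

lemma tB: "(\<And>x. x < 3 \<Longrightarrow> e x = e' x) \<Longrightarrow> tval e tB = tval e' tB" "0 < tval e tB"
  "tval (env0 w k) tB = lead w ^ s + k + 4" "tval (env0 w k) tK = (k + 2) ^ Q"
  by (simp_all add: tB_def tK_def env0_def)

lemma nodes_tB: "nodes w k = tuples {..<tval (env0 w k) tB} (3 * Q)" unfolding nodes_def tB(3) ..

lemma put_env: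
  fixes w k u v D
  assumes "length u = D" "length v = D"
  defines "e \<equiv> put (put (env0 w k) (3 + D) v) 3 u"
  shows "e 0 = k" "e 1 = length w" "e 2 = lead w" "holds_at e 3 u" "holds_at e (3 + D) v"
  using assms(1,2) by (auto simp: e_def put_def env0_def holds_at_def)

lemma K2: "2 \<le> (k + 2 :: nat) ^ Q" using power_increasing[of 1 Q "k + 2"] by (simp add: Q_def)

theorem polyred_independent:
  assumes \<phi>: "fo_over graph_vocabulary 1 \<phi>" "free_vars \<phi> = {}"
    and sat: "\<forall>(A :: nat list struct) X v. struct.univ A \<noteq> {} \<longrightarrow> sat A X v \<phi> =
       sat A X v (Forall 0 (Forall 1 (Neg (Conj (Mem [0]) (Conj (Mem [1]) (Rel 0 [0, 1]))))))"
  shows "polyred (wd_problem \<tau> s (foldr Forall zs \<psi>)) (fd_problem \<phi>)"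
proof -
  define D where "D = 3 * Q"
  \<comment> \<open>Graphs have no loops, so a node in conflict with itself is made adjacent to all
    other nodes. As at least two nodes are sought, this excludes it from every solution.\<close>
  define R where "R = (\<lambda>w k u v. u \<noteq> v \<and> (conf w k u v \<or> conf w k u u \<or> conf w k v v))"
  define b where "b = BAnd (BNot (eqf D 3 (3 + D))) (BOr (conff (3 + D + D) 3 (3 + D)) (BOr (conff (3 + D + D) 3 3) (conff (3 + D + D) (3 + D) (3 + D))))"
  show ?thesis
  proof (rule graph_polyred[of tB \<phi> tK Q R D b, OF tB(1,2) \<phi>])
    fix w k u v
    show "tval (env0 w k) tK \<le> (k + 2) ^ Q" by (simp add: tB)
    show "R w k u v \<Longrightarrow> R w k v u" "\<not> R w k u u" using conf_sym by (auto simp: R_def)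
    show "bval w (put (put (env0 w k) (3 + D) v) 3 u) b \<longleftrightarrow> R w k u v"
      if "u \<in> tuples {..<tval (env0 w k) tB} D" "v \<in> tuples {..<tval (env0 w k) tB} D"
    proof -
      have l: "length u = D" "length v = D" using that by (auto simp: tuples_def)
      have l': "length u = 3 * Q" "length v = 3 * Q" using l by (auto simp: D_def)
      note E = put_env[OF l, of w k]
      have a: "2 < 3 + D + D" "3 + 3 * Q \<le> 3 + D + D" "3 + D + 3 * Q \<le> 3 + D + D" by (simp_all add: D_def)
      show ?thesis unfolding b_def R_def bval_derived bval.simps(3,4) bval_eqf[OF E(4,5) l]
        bval_conff[OF E(1-3) E(4) l'(1) E(5) l'(2) a] bval_conff[OF E(1-3) E(4) l'(1) E(4) l'(1) a(1,2,2)]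
        bval_conff[OF E(1-3) E(5) l'(2) E(5) l'(2) a(1,3,3)] ..
    qed
    let ?N = "tuples {..<tval (env0 w k) tB} D"
    have N: "?N = nodes w k" by (simp add: nodes_tB D_def)
    have ne: "?N \<noteq> {}" using tB(2)[of "env0 w k"] by (auto simp: tuples_def intro!: exI[of _ "replicate D 0"])
    have m: "models (lst ?N (R w k)) ((\<lambda>u. [u]) ` X) \<phi> \<longleftrightarrow> (\<forall>a\<in>X. \<forall>b\<in>X. \<not> R w k a b)" if X: "X \<subseteq> ?N" for X
    proof -
      have "models (lst ?N (R w k)) ((\<lambda>u. [u]) ` X) \<phi> \<longleftrightarrow> (\<forall>a\<in>?N. \<forall>b\<in>?N. \<not> (a \<in> X \<and> b \<in> X \<and> R w k a b))"
        unfolding models_def using sat ne by (auto simp: lst_def)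
      then show ?thesis using X by blast
    qed
    have c: "(\<forall>a\<in>X. \<forall>b\<in>X. \<not> R w k a b) \<longleftrightarrow> (\<forall>a\<in>X. \<forall>b\<in>X. \<not> conf w k a b)" if X: "(k + 2) ^ Q \<le> card X" for X
    proof
      assume h: "\<forall>a\<in>X. \<forall>b\<in>X. \<not> R w k a b"
      have "\<exists>b\<in>X. b \<noteq> a" if "a \<in> X" for a
      proof (rule ccontr)
        assume "\<not> (\<exists>b\<in>X. b \<noteq> a)"
        then have "X = {a}" using that by blast
        then show False using X K2[of k] by simp
      qed
      then show "\<forall>a\<in>X. \<forall>b\<in>X. \<not> conf w k a b" using h unfolding R_def by metis
    qed (auto simp: R_def)
    have lg: "\<not> (A \<and> B) \<Longrightarrow> (A \<and> B \<and> P) = (A \<and> B \<and> P')" for A B P P' by blast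
    have eq: "(X \<subseteq> ?N \<and> (k + 2) ^ Q \<le> card X \<and> (\<forall>a\<in>X. \<forall>b\<in>X. \<not> conf w k a b)) \<longleftrightarrow>
       (X \<subseteq> ?N \<and> (k + 2) ^ Q \<le> card X \<and> models (lst ?N (R w k)) ((\<lambda>u. [u]) ` X) \<phi>)" for X
    proof (cases "X \<subseteq> ?N \<and> (k + 2) ^ Q \<le> card X")
      case True
      show ?thesis unfolding m[OF conjunct1[OF True]] c[OF conjunct2[OF True]] ..
    qed (rule lg)
    show "(w, k) \<in> wd_problem \<tau> s (foldr Forall zs \<psi>) \<longleftrightarrow> (\<exists>X \<subseteq> ?N. tval (env0 w k) tK \<le> card X \<and>
       models (lst ?N (R w k)) ((\<lambda>u. [u]) ` X) \<phi>)"
      unfolding wd_nodes tB(4) N[symmetric] eq ..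
  qed
qed

section \<open>The gadget graph as a program\<close>

definition gT :: "nat \<Rightarrow> nat list" where "gT t = replicate (3 * Q) 0 @ replicate (3 * Q) 0 @ [t]"
abbreviation gU :: "word \<Rightarrow> nat \<Rightarrow> nat list set" where "gU w k \<equiv> tuples {..<tval (env0 w k) tB} (6 * Q + 1)"

lemma gadget: "gadget (gU w k) (nodes w k) (conf w k) gV gE (gT 2) (gT 3)"
proof
  show "finite (gU w k)" by simp
  show "conf w k a b \<Longrightarrow> conf w k b a" for a b by (simp add: conf_sym)
  show "gT 2 \<in> gU w k" "gT 3 \<in> gU w k" by (auto simp: gT_def tuples_def tB)
  show "a \<in> nodes w k \<Longrightarrow> gV a \<in> gU w k" for a by (auto simp: gV_def nodes_tB tuples_def tB)
  show "a \<in> nodes w k \<Longrightarrow> b \<in> nodes w k \<Longrightarrow> gE a b \<in> gU w k" for a b by (auto simp: gE_def nodes_tB tuples_def tB)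
  show "a = b" if h: "gV a = gV b" for a b
  proof -
    have "length a = length b" using arg_cong[OF h, of length] by (simp add: gV_def)
    then show ?thesis using h by (simp add: gV_def)
  qed
  show "a = c \<and> b = d" if "a \<in> nodes w k" "b \<in> nodes w k" "c \<in> nodes w k" "d \<in> nodes w k" "gE a b = gE c d" for a b c d
    using that by (auto simp: gE_def nodes_def tuples_def)
  have l: "last (gT t) = t" "last (gV a) = 0" "last (gE a b) = 1" for t a b by (simp_all add: gT_def gV_def gE_def)
  show "gT 2 \<noteq> gT 3" by (simp add: gT_def)
  show "gT 2 \<noteq> gV a" "gT 3 \<noteq> gV a" for a using l(1)[of 2] l(1)[of 3] l(2)[of a] by auto
  show "gT 2 \<noteq> gE a b" "gT 3 \<noteq> gE a b" "gV c \<noteq> gE a b" for a b c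
    using l(1)[of 2] l(1)[of 3] l(2)[of c] l(3)[of a b] by auto
qed

definition gR :: "word \<Rightarrow> nat \<Rightarrow> nat list \<Rightarrow> nat list \<Rightarrow> bool" where
  "gR w k = gadget.R (nodes w k) (conf w k) gV gE (gT 2) (gT 3)"

definition isT :: "nat \<Rightarrow> nat \<Rightarrow> bx" where
  "isT t p = BAnd (BEqu (TV (p + 6 * Q)) (TC t)) (BAnd (zerof (3 * Q) p) (zerof (3 * Q) (p + 3 * Q)))"
definition isV :: "nat \<Rightarrow> bx" where
  "isV p = BAnd (BEqu (TV (p + 6 * Q)) (TC 0)) (eqf (3 * Q) p (p + 3 * Q))"
definition isC :: "nat \<Rightarrow> nat \<Rightarrow> bx" where
  "isC a p = BAnd (BEqu (TV (p + 6 * Q)) (TC 1)) (conff a p (p + 3 * Q))"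
definition R0f :: "nat \<Rightarrow> nat \<Rightarrow> nat \<Rightarrow> bx" where
  "R0f a p p' = BOr (BAnd (isT 2 p) (BAnd (BNot (isT 2 p')) (BNot (isC a p')))) (BOr (BAnd (isT 3 p) (isV p'))
     (BAnd (isC a p) (BAnd (isV p') (BOr (eqf (3 * Q) p p') (eqf (3 * Q) (p + 3 * Q) p')))))"

lemma gU_split:
  assumes "u \<in> gU w k"
  obtains x y t where "u = x @ y @ [t]" "x \<in> nodes w k" "y \<in> nodes w k"
proof -
  have l: "length u = 6 * Q + 1" "set u \<subseteq> {..<tval (env0 w k) tB}" using assms by (auto simp: tuples_def)
  then have "u \<noteq> []" by auto
  define x where "x = take (3 * Q) u"
  define y where "y = take (3 * Q) (drop (3 * Q) u)"
  have "drop (6 * Q) u = [u ! (6 * Q)]" using l Cons_nth_drop_Suc[of "6 * Q" u] by simp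
  then have "drop (3 * Q) (drop (3 * Q) u) = [u ! (6 * Q)]" by (simp add: add_mult_distrib[symmetric])
  then have "u = x @ y @ [u ! (6 * Q)]" unfolding x_def y_def by (metis append_take_drop_id)
  moreover have "x \<in> nodes w k" "y \<in> nodes w k"
    unfolding x_def y_def nodes_tB tuples_def using l set_take_subset[of "3 * Q" u] set_take_subset[of "3 * Q" "drop (3 * Q) u"] set_drop_subset[of "3 * Q" u]
    by auto
  ultimately show ?thesis by (rule that)
qed

lemma bval_R0f:
  assumes e: "e 0 = k" "e 1 = length w" "e 2 = lead w" and u: "holds_at e p u" "u \<in> gU w k" and v: "holds_at e p' v" "v \<in> gU w k"
    and a: "2 < a" "p + 6 * Q \<le> a" "p' + 6 * Q \<le> a"
  shows "bval w e (R0f a p p') \<longleftrightarrow> gadget.R0 (nodes w k) (conf w k) gV gE (gT 2) (gT 3) u v"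
proof -
  interpret gadget "gU w k" "nodes w k" "conf w k" gV gE "gT 2" "gT 3" by (rule gadget)
  obtain x y t where uu: "u = x @ y @ [t]" and xy: "x \<in> nodes w k" "y \<in> nodes w k" by (rule gU_split[OF u(2)])
  obtain x' y' t' where vv: "v = x' @ y' @ [t']" and xy': "x' \<in> nodes w k" "y' \<in> nodes w k" by (rule gU_split[OF v(2)])
  have len: "length x = 3 * Q" "length y = 3 * Q" "length x' = 3 * Q" "length y' = 3 * Q"
    using xy xy' by (auto simp: nodes_def tuples_def)
  have h: "holds_at e p x" "holds_at e (p + 3 * Q) y" "e (p + 6 * Q) = t"
    using u(1) len unfolding uu holds_at_append by (auto simp: holds_at_def add.assoc)
  have h': "holds_at e p' x'" "holds_at e (p' + 3 * Q) y'" "e (p' + 6 * Q) = t'"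
    using v(1) len unfolding vv holds_at_append by (auto simp: holds_at_def add.assoc)
  have eqT: "x @ y @ [t] = gT i \<longleftrightarrow> t = i \<and> x = replicate (3 * Q) 0 \<and> y = replicate (3 * Q) 0"
    if "length x = 3 * Q" "length y = 3 * Q" for x y t i using that by (auto simp: gT_def)
  have T: "bval w e (isT i p) \<longleftrightarrow> u = gT i" "bval w e (isT i p') \<longleftrightarrow> v = gT i" for i
    unfolding uu vv eqT[OF len(1,2)] eqT[OF len(3,4)]
    using h(3) h'(3) bval_zerof[OF h(1) len(1)] bval_zerof[OF h(2) len(2)] bval_zerof[OF h'(1) len(3)] bval_zerof[OF h'(2) len(4)]
    by (auto simp: isT_def)
  have ce: "x @ y @ [t] \<in> CE \<longleftrightarrow> t = 1 \<and> conf w k x y" if "x \<in> nodes w k" "y \<in> nodes w k" for x y t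
  proof -
    have "x @ y @ [t] = gE c d \<longleftrightarrow> t = 1 \<and> x = c \<and> y = d" if "c \<in> nodes w k" "d \<in> nodes w k" for c d
      using that \<open>x \<in> nodes w k\<close> \<open>y \<in> nodes w k\<close> by (auto simp: gE_def nodes_def tuples_def)
    then show ?thesis unfolding CE_def using that by blast
  qed
  have a6: "p + 3 * Q \<le> a" "p + 3 * Q + 3 * Q \<le> a" "p' + 3 * Q \<le> a" "p' + 3 * Q + 3 * Q \<le> a" using a by auto
  have C: "bval w e (isC a p) \<longleftrightarrow> t = 1 \<and> conf w k x y" "bval w e (isC a p') \<longleftrightarrow> v \<in> CE"
    unfolding vv ce[OF xy'] isC_def using h(3) h'(3) bval_conff[OF e h(1) len(1) h(2) len(2) a(1) a6(1,2)]
      bval_conff[OF e h'(1) len(3) h'(2) len(4) a(1) a6(3,4)] by auto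
  have V: "x' @ y' @ [t'] = gV d \<longleftrightarrow> t' = 0 \<and> x' = d \<and> y' = d" if "d \<in> nodes w k" for d
    using that xy' by (auto simp: gV_def nodes_def tuples_def)
  have iV: "bval w e (isV p') \<longleftrightarrow> t' = 0 \<and> x' = y'"
    using h'(3) bval_eqf[OF h'(1,2) len(3,4)] by (simp add: isV_def)
  have VN: "v \<in> gV ` nodes w k \<longleftrightarrow> t' = 0 \<and> x' = y'" unfolding vv image_iff using V xy' by auto
  have E: "u = gE c d \<longleftrightarrow> t = 1 \<and> x = c \<and> y = d" if "c \<in> nodes w k" "d \<in> nodes w k" for c d
    using that xy unfolding uu by (auto simp: gE_def nodes_def tuples_def)
  have third: "(\<exists>a\<in>nodes w k. \<exists>b\<in>nodes w k. conf w k a b \<and> u = gE a b \<and> (v = gV a \<or> v = gV b)) \<longleftrightarrow>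
     (t = 1 \<and> conf w k x y) \<and> (t' = 0 \<and> x' = y') \<and> (x = x' \<or> y = x')"
    using E V xy unfolding vv by (metis (no_types, lifting))
  show ?thesis unfolding R0f_def R0_def third bval_derived bval.simps(3,4) T C iV VN
      bval_eqf[OF h(1) h'(1) len(1,3)] bval_eqf[OF h(2) h'(1) len(2,3)] by blast
qed

theorem polyred_gadget:
  assumes \<phi>: "fo_over graph_vocabulary 1 \<phi>" "free_vars \<phi> = {}"
    and \<phi>0: "\<phi>0 = Exists 2 (Forall 0 (Exists 1 mtxf)) \<or> \<phi>0 = Forall 0 (Exists 1 (Exists 2 mtxf))"
    and sat: "\<forall>(A :: nat list struct) X v. struct.univ A \<noteq> {} \<longrightarrow> sat A X v \<phi> = sat A X v \<phi>0"
  shows "polyred (wd_problem \<tau> s (foldr Forall zs \<psi>)) (fd_problem \<phi>)"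
proof -
  define D where "D = 6 * Q + 1"
  define b where "b = BOr (R0f (3 + D + D) 3 (3 + D)) (R0f (3 + D + D) (3 + D) 3)"
  show ?thesis
  proof (rule graph_polyred[of tB \<phi> tK Q gR D b, OF tB(1,2) \<phi>])
    fix w k u v
    interpret gadget "gU w k" "nodes w k" "conf w k" gV gE "gT 2" "gT 3" by (rule gadget)
    have gR: "gR w k = R" by (simp add: gR_def)
    show "tval (env0 w k) tK \<le> (k + 2) ^ Q" by (simp add: tB)
    show "gR w k u v \<Longrightarrow> gR w k v u" "\<not> gR w k u u" unfolding gR by (rule R_sym, assumption) (rule R_irr)
    show "bval w (put (put (env0 w k) (3 + D) v) 3 u) b \<longleftrightarrow> gR w k u v"
      if uv: "u \<in> tuples {..<tval (env0 w k) tB} D" "v \<in> tuples {..<tval (env0 w k) tB} D"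
    proof -
      have l: "length u = D" "length v = D" using uv by (auto simp: tuples_def)
      note E = put_env[OF l, of w k]
      have a: "2 < 3 + D + D" "3 + 6 * Q \<le> 3 + D + D" "3 + D + 6 * Q \<le> 3 + D + D" by (simp_all add: D_def)
      note uv' = uv[unfolded D_def]
      show ?thesis unfolding b_def gR R_def bval_derived bval_R0f[OF E(1-3) E(4) uv'(1) E(5) uv'(2) a]
        bval_R0f[OF E(1-3) E(5) uv'(2) E(4) uv'(1) a(1,3,2)] ..
    qed
    have ne: "gU w k \<noteq> {}" using inU(1) by blast
    have m: "models (lst (gU w k) R) ((\<lambda>u. [u]) ` X) \<phi> \<longleftrightarrow> sat (lst (gU w k) R) ((\<lambda>u. [u]) ` X) (\<lambda>_. []) \<phi>0" for X
    proof -
      have "struct.univ (lst (gU w k) R) \<noteq> {}" using ne by (simp add: lst_def)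
      from sat[rule_format, OF this] show ?thesis using models_closed[OF \<phi>(2)] by blast
    qed
    have u: "struct.univ (lst (gU w k) R) = gU w k" by (simp add: lst_def)
    have s1: "sat (lst (gU w k) R) ((\<lambda>u. [u]) ` X) (\<lambda>_. []) (Exists 2 (Forall 0 (Exists 1 mtxf))) \<longleftrightarrow>
       (\<exists>z\<in>gU w k. \<forall>x\<in>gU w k. \<exists>y\<in>gU w k. mtx R X x y z)" for X
      unfolding sat.simps u by (intro bex_cong ball_cong refl) (simp add: sat_mtxf)
    have s2: "sat (lst (gU w k) R) ((\<lambda>u. [u]) ` X) (\<lambda>_. []) (Forall 0 (Exists 1 (Exists 2 mtxf))) \<longleftrightarrow>
       (\<forall>x\<in>gU w k. \<exists>y\<in>gU w k. \<exists>z\<in>gU w k. mtx R X x y z)" for X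
      unfolding sat.simps u by (intro bex_cong ball_cong refl) (simp add: sat_mtxf)
    have wd: "(w, k) \<in> wd_problem \<tau> s (foldr Forall zs \<psi>) \<longleftrightarrow> (\<exists>X. solution ((k + 2) ^ Q) X)"
      unfolding wd_nodes solution_def by blast
    have "(\<exists>X. solution ((k + 2) ^ Q) X) \<longleftrightarrow> (\<exists>X \<subseteq> gU w k. (k + 2) ^ Q \<le> card X \<and> sat (lst (gU w k) R) ((\<lambda>u. [u]) ` X) (\<lambda>_. []) \<phi>0)"
    proof
      assume "\<exists>X. solution ((k + 2) ^ Q) X"
      then obtain X where "solution ((k + 2) ^ Q) X" by (rule exE)
      from forward[OF this] obtain C where C: "C \<subseteq> gU w k" "(k + 2) ^ Q \<le> card C"
        "\<exists>z\<in>gU w k. \<forall>x\<in>gU w k. \<exists>y\<in>gU w k. mtx R C x y z" by (elim exE conjE)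
      then have "\<forall>x\<in>gU w k. \<exists>y\<in>gU w k. \<exists>z\<in>gU w k. mtx R C x y z" by blast
      then have "sat (lst (gU w k) R) ((\<lambda>u. [u]) ` C) (\<lambda>_. []) \<phi>0" using \<phi>0 s1[of C] s2[of C] C(3) by metis
      then show "\<exists>X \<subseteq> gU w k. (k + 2) ^ Q \<le> card X \<and> sat (lst (gU w k) R) ((\<lambda>u. [u]) ` X) (\<lambda>_. []) \<phi>0" using C by (intro exI[of _ C]) simp
    next
      assume "\<exists>X \<subseteq> gU w k. (k + 2) ^ Q \<le> card X \<and> sat (lst (gU w k) R) ((\<lambda>u. [u]) ` X) (\<lambda>_. []) \<phi>0"
      then obtain C where C: "C \<subseteq> gU w k" "(k + 2) ^ Q \<le> card C" "sat (lst (gU w k) R) ((\<lambda>u. [u]) ` C) (\<lambda>_. []) \<phi>0" by (elim exE conjE)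
      have "\<forall>x\<in>gU w k. \<exists>y\<in>gU w k. \<exists>z\<in>gU w k. mtx R C x y z"
        using \<phi>0
      proof
        assume "\<phi>0 = Exists 2 (Forall 0 (Exists 1 mtxf))"
        then have "\<exists>z\<in>gU w k. \<forall>x\<in>gU w k. \<exists>y\<in>gU w k. mtx R C x y z" using s1[of C] C(3) by simp
        then show ?thesis by blast
      next
        assume "\<phi>0 = Forall 0 (Exists 1 (Exists 2 mtxf))"
        then show ?thesis using s2[of C] C(3) by simp
      qed
      then show "\<exists>X. solution ((k + 2) ^ Q) X" by (rule backward[OF C(1,2) _ K2])
    qed
    then show "(w, k) \<in> wd_problem \<tau> s (foldr Forall zs \<psi>) \<longleftrightarrow> (\<exists>X \<subseteq> tuples {..<tval (env0 w k) tB} D. tval (env0 w k) tK \<le> card X \<and>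
       models (lst (tuples {..<tval (env0 w k) tB} D) (gR w k)) ((\<lambda>u. [u]) ` X) \<phi>)"
      unfolding wd D_def gR m tB(4) .
  qed
qed

end

text \<open>Membership in W[1] supplies an fpt-reduction to some weighted Fagin problem with a
  universal prefix, so a polynomial reduction from each of these is enough.\<close>

lemma hardI:
  assumes \<phi>: "fo_over graph_vocabulary 1 \<phi>" "free_vars \<phi> = {}" "prenex p \<phi>"
    and red: "\<And>\<tau> s zs \<psi>. wdp \<tau> s zs \<psi> \<Longrightarrow> polyred (wd_problem \<tau> s (foldr Forall zs \<psi>)) (fd_problem \<phi>)"
  shows "\<exists>Q \<in> p_FD_basic p. W1_hard Q"
proof (rule bexI)
  show "fd_problem \<phi> \<in> p_FD_basic p" using \<phi> by (auto simp: p_FD_basic_def)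
  show "W1_hard (fd_problem \<phi>)" unfolding W1_hard_def
  proof
    fix Q' assume "Q' \<in> W1"
    then obtain \<tau> s \<phi>' m where h: "fo_over \<tau> s \<phi>'" "free_vars \<phi>' = {}" "prenex (replicate m QA) \<phi>'"
      "fpt_reducible Q' (wd_problem \<tau> s \<phi>')" unfolding W1_def by blast
    from prenex_QA[OF h(3)] obtain zs \<psi> where z: "\<phi>' = foldr Forall zs \<psi>" "quantifier_free \<psi>" by (elim exE conjE)
    have "wdp \<tau> s zs \<psi>" using h(1,2) z by unfold_locales auto
    from red[OF this] h(4)[unfolded z(1)] show "fpt_reducible Q' (fd_problem \<phi>)" by (rule fpt_reducible_polyred[rotated])
  qed
qed

lemma hard_pattern:
  assumes "subseq [QA, QA] p \<or> subseq [QE, QA, QE] p \<or> subseq [QA, QE, QE] p"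
  shows "\<exists>Q \<in> p_FD_basic p. W1_hard Q"
proof -
  define \<phi>a where "\<phi>a = Forall 0 (Forall 1 (Neg (Conj (Mem [0]) (Conj (Mem [1]) (Rel 0 [0, 1])))))"
  define \<phi>e where "\<phi>e = Exists 2 (Forall 0 (Exists 1 mtxf))"
  define \<phi>f where "\<phi>f = Forall 0 (Exists 1 (Exists 2 mtxf))"
  note mf = mtxf_def
  obtain q \<phi>0 where q: "subseq q p" "prenex q \<phi>0" "fo_over graph_vocabulary 1 \<phi>0" "free_vars \<phi>0 = {}" "\<phi>0 \<in> {\<phi>a, \<phi>e, \<phi>f}"
  proof -
    have a: "prenex [QA, QA] \<phi>a" "fo_over graph_vocabulary 1 \<phi>a" "free_vars \<phi>a = {}" by (auto simp: \<phi>a_def)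
    have e: "prenex [QE, QA, QE] \<phi>e" "fo_over graph_vocabulary 1 \<phi>e" "free_vars \<phi>e = {}" by (auto simp: \<phi>e_def mf)
    have f: "prenex [QA, QE, QE] \<phi>f" "fo_over graph_vocabulary 1 \<phi>f" "free_vars \<phi>f = {}" by (auto simp: \<phi>f_def mf)
    show ?thesis using assms that[OF _ a] that[OF _ e] that[OF _ f] by blast
  qed
  \<comment> \<open>Elements are lists here because \<open>fd_lgr\<close> evaluates the sentence on
    the graph of lists, whose universe is nonempty in both constructions.\<close>
  from prenex_pad[OF q(1,2)] obtain \<phi> where \<phi>: "prenex p \<phi>" "free_vars \<phi> = free_vars \<phi>0"
    "\<forall>\<tau> s. fo_over \<tau> s \<phi> = fo_over \<tau> s \<phi>0"
    "\<forall>(A :: nat list struct) X v. struct.univ A \<noteq> {} \<longrightarrow> sat A X v \<phi> = sat A X v \<phi>0" by (elim exE conjE)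
  have fo: "fo_over graph_vocabulary 1 \<phi>" and fv: "free_vars \<phi> = {}" using \<phi>(2,3) q(3,4) by auto
  show ?thesis
  proof (rule hardI[OF fo fv \<phi>(1)])
    fix \<tau> s zs \<psi> assume w: "wdp \<tau> s zs \<psi>"
    show "polyred (wd_problem \<tau> s (foldr Forall zs \<psi>)) (fd_problem \<phi>)"
    proof (cases "\<phi>0 = \<phi>a")
      case True
      then show ?thesis using wdp.polyred_independent[OF w fo fv] \<phi>(4) unfolding \<phi>a_def by blast
    next
      case False
      then have "\<phi>0 = Exists 2 (Forall 0 (Exists 1 mtxf)) \<or> \<phi>0 = Forall 0 (Exists 1 (Exists 2 mtxf))"
        using q(5) by (auto simp: \<phi>e_def \<phi>f_def)
      then show ?thesis by (rule wdp.polyred_gadget[OF w fo fv _ \<phi>(4)])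
    qed
  qed
qed

theorem mainTheorem4:
  fixes p :: pattern
  shows "((\<exists>m. subseq p (replicate m QE @ [QA])) \<or> subseq p [QA, QE] \<longrightarrow>
            p_FD_basic p \<subseteq> para_AC0) \<and>
         (subseq [QA, QA] p \<or> subseq [QE, QA, QE] p \<or> subseq [QA, QE, QE] p \<longrightarrow>
            (\<exists>Q \<in> p_FD_basic p. W1_hard Q))"
  using ea_pattern ae_pattern hard_pattern by blast

end
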